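(* Let $F$ be a number field and let $K/F$ and $L/F$ be finite extensions (inside a fixed algebraic closure of $F$) with $[K:F]\le 5$ and $[L:F]\le 5$. If $K$ and $L$ are locally GCD equivalent over $F$, then $K$ and $L$ are $F$-isomorphic.
   Context: For a finite extension $M/F$ of number fields and a prime ideal $\mathfrak{p}\subset\mathcal{O}_F$ unramified in $M$, write $\mathfrak{p}\mathcal{O}_M=\mathfrak{q}_1\cdots\mathfrak{q}_t$ and let $f_{i,M}(\mathfrak{p})$ be the inertia degree of $\mathfrak{q}_i$ over $\mathfrak{p}$; the splitting type of $\mathfrak{p}$ in $M$ is the tuple $f_M(\mathfrak{p})=(f_{1,M}(\mathfrak{p}),\ldots,f_{t,M}(\mathfrak{p}))$ (sorted increasingly). Two finite extensions $K/F$, $L/F$ are locally GCD equivalent over $F$ if for every prime $\mathfrak{p}\subset\mathcal{O}_F$ unramified in both $K$ and $L$ one has $\gcd(f_{1,K}(\mathfrak{p}),\ldots,f_{t,K}(\mathfrak{p}))=\gcd(f_{1,L}(\mathfrak{p}),\ldots,f_{t',L}(\mathfrak{p}))$. *)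

theory Defs
  imports "HOL-Algebra.Algebra"
begin

text \<open>Everything lives inside one ambient field R of characteristic 0
  (playing the role of a fixed algebraic closure); subfields are subsets of carrier R.\<close>

definition char_zero_field :: "('a, 'b) ring_scheme \<Rightarrow> bool" where
  "char_zero_field R \<longleftrightarrow> field R \<and> (\<forall>n::nat. n > 0 \<longrightarrow> [n] \<cdot>\<^bsub>R\<^esub> \<one>\<^bsub>R\<^esub> \<noteq> \<zero>\<^bsub>R\<^esub>)"

definition int_img :: "('a, 'b) ring_scheme \<Rightarrow> 'a set" where
  "int_img R = {x. \<exists>k::int. x = [k] \<cdot>\<^bsub>R\<^esub> \<one>\<^bsub>R\<^esub>}"

definition rat_img :: "('a, 'b) ring_scheme \<Rightarrow> 'a set" where
  "rat_img R = {x \<in> carrier R. \<exists>(a::int) (b::int). b \<noteq> 0 \<and>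
       x \<otimes>\<^bsub>R\<^esub> ([b] \<cdot>\<^bsub>R\<^esub> \<one>\<^bsub>R\<^esub>) = [a] \<cdot>\<^bsub>R\<^esub> \<one>\<^bsub>R\<^esub>}"

definition ext_degree :: "('a, 'b) ring_scheme \<Rightarrow> 'a set \<Rightarrow> 'a set \<Rightarrow> nat" where
  "ext_degree R K E = (THE n. ring.dimension R n K E)"

definition finite_ext :: "('a, 'b) ring_scheme \<Rightarrow> 'a set \<Rightarrow> 'a set \<Rightarrow> bool" where
  "finite_ext R K E \<longleftrightarrow> subfield K R \<and> subfield E R \<and> K \<subseteq> E \<and> (\<exists>n. ring.dimension R n K E)"

definition number_field :: "('a, 'b) ring_scheme \<Rightarrow> 'a set \<Rightarrow> bool" where
  "number_field R F \<longleftrightarrow> finite_ext R (rat_img R) F"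

definition ring_of_integers :: "('a, 'b) ring_scheme \<Rightarrow> 'a set \<Rightarrow> 'a set" where
  "ring_of_integers R K = {x \<in> K. \<exists>p. p \<noteq> [] \<and> hd p = \<one>\<^bsub>R\<^esub> \<and> set p \<subseteq> int_img R
       \<and> ring.eval R p x = \<zero>\<^bsub>R\<^esub>}"

abbreviation OK :: "('a, 'b) ring_scheme \<Rightarrow> 'a set \<Rightarrow> ('a, 'b) ring_scheme" where
  "OK R K \<equiv> R\<lparr>carrier := ring_of_integers R K\<rparr>"

definition nz_prime :: "('a, 'b) ring_scheme \<Rightarrow> 'a set \<Rightarrow> 'a set \<Rightarrow> bool" where
  "nz_prime R F P \<longleftrightarrow> primeideal P (OK R F) \<and> P \<noteq> {\<zero>\<^bsub>R\<^esub>}"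

definition primes_above :: "('a, 'b) ring_scheme \<Rightarrow> 'a set \<Rightarrow> 'a set \<Rightarrow> 'a set \<Rightarrow> 'a set set" where
  "primes_above R F M P = {Q. primeideal Q (OK R M) \<and> Q \<inter> ring_of_integers R F = P}"

definition ext_ideal :: "('a, 'b) ring_scheme \<Rightarrow> 'a set \<Rightarrow> 'a set \<Rightarrow> 'a set" where
  "ext_ideal R M P = genideal (OK R M) P"

text \<open>p unramified in M: every ramification index is 1, i.e. p O_M is not contained in Q^2.\<close>
definition unramified :: "('a, 'b) ring_scheme \<Rightarrow> 'a set \<Rightarrow> 'a set \<Rightarrow> 'a set \<Rightarrow> bool" where
  "unramified R F M P \<longleftrightarrow> (\<forall>Q \<in> primes_above R F M P.
      \<not> ext_ideal R M P \<subseteq> ideal_prod (OK R M) Q Q)"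

text \<open>Inertia degree f(Q|p) = [O_M/Q : O_F/p], where O_F/p is identified with its image in O_M/Q.\<close>
definition inertia_degree :: "('a, 'b) ring_scheme \<Rightarrow> 'a set \<Rightarrow> 'a set \<Rightarrow> 'a set \<Rightarrow> nat" where
  "inertia_degree R F M Q =
     (THE f. ring.dimension (OK R M Quot Q) f
               ((\<lambda>a. Q +>\<^bsub>OK R M\<^esub> a) ` ring_of_integers R F)
               (carrier (OK R M Quot Q)))"

definition split_gcd :: "('a, 'b) ring_scheme \<Rightarrow> 'a set \<Rightarrow> 'a set \<Rightarrow> 'a set \<Rightarrow> nat" where
  "split_gcd R F M P = Gcd (inertia_degree R F M ` primes_above R F M P)"

definition locally_gcd_equivalent :: "('a, 'b) ring_scheme \<Rightarrow> 'a set \<Rightarrow> 'a set \<Rightarrow> 'a set \<Rightarrow> bool" where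
  "locally_gcd_equivalent R F K L \<longleftrightarrow>
     (\<forall>P. nz_prime R F P \<and> unramified R F K P \<and> unramified R F L P \<longrightarrow>
          split_gcd R F K P = split_gcd R F L P)"

definition F_isomorphic :: "('a, 'b) ring_scheme \<Rightarrow> 'a set \<Rightarrow> 'a set \<Rightarrow> 'a set \<Rightarrow> bool" where
  "F_isomorphic R F K L \<longleftrightarrow> (\<exists>\<phi>. \<phi> \<in> ring_iso (R\<lparr>carrier := K\<rparr>) (R\<lparr>carrier := L\<rparr>)
       \<and> (\<forall>x \<in> F. \<phi> x = x))"

end

theory Submission
  imports Defs "HOL-Computational_Algebra.Computational_Algebra"
begin

text \<open>
  Embed \<open>K\<close> and \<open>L\<close> over \<open>F\<close> into a normal number field \<open>N \<subseteq> \<complex>\<close>, let \<open>G\<close> be the group of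
  automorphisms of \<open>N\<close> over \<open>F\<close>, and write \<open>K = F(\<alpha>)\<close>, \<open>L = F(\<beta>)\<close>. If the Frobenius at a large
  prime is a power \<open>\<sigma>\<^sup>k\<close> of an element \<open>\<sigma> \<in> G\<close> of \<open>l\<close>-power order with \<open>l\<close> not dividing \<open>k\<close>, then the
  gcd of the splitting type in \<open>K\<close> is 1 if \<open>\<sigma>\<close> fixes a conjugate of \<open>\<alpha>\<close>, and divisible by \<open>l\<close> otherwise.
  Hence every \<open>l\<close>-element has a fixed point on \<open>G\<alpha>\<close> if and only if it has one on \<open>G\<beta>\<close>. For orbits of
  size at most 5 this forces a conjugate of \<open>\<alpha>\<close> to have the same stabilizer as \<open>\<beta>\<close>, and Galois theory
  gives the isomorphism.

  Such a prime exists by a weak form of Chebotarev's theorem with an elementary proof. Otherwise almost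
  all Frobenius elements that lie in \<open>\<langle>\<sigma>\<rangle>\<close>, up to conjugation, lie in \<open>\<langle>\<sigma>\<^sup>l\<rangle>\<close>, so every prime of degree one
  of the fixed field of \<open>\<sigma>\<close> lies below at least two primes of degree one of the fixed field of \<open>\<sigma>\<^sup>l\<close>.
  This contradicts the fact that in either field the sum of \<open>1/n\<close> over the norms \<open>n \<le> x\<close> of squarefree
  products of degree-one primes is of exact order \<open>log x\<close>: the upper bound is a pigeonhole argument on
  integer polynomials in a generator, the lower bound counts integer polynomials in a box whose norm
  has no large square factor.
\<close>

section \<open>Galois action on a ring of algebraic integers\<close>

text \<open>Elements of prime power order matter because inertia degrees at a Frobenius are orbit
  lengths: for an \<open>l\<close>-element they are all powers of \<open>l\<close>, so their gcd is
  1 exactly when there is a fixed point. The gcd forgets most of the splitting type but still sees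
  every such fixed point. The bound five matters because every number from 2 to 5 is a prime or 4,
  and on that many points an \<open>l\<close>-group whose elements all have fixed points has a
  common one. The Frobenius is taken at a rational prime although the extensions are over
  \<open>F\<close>: since \<open>\<sigma>\<close> fixes \<open>F\<close>, the prime of
  \<open>F\<close> below has \<open>p\<close> residue classes, absolute and relative degrees agree,
  and no relative theory arises. Only primes not dividing a fixed discriminant occur, and for them
  ideal factorization is replaced by multipliers outside a prime \<open>Q\<close> that turn elements
  of \<open>Q\<close> into multiples of \<open>p\<close>. The weak form of Chebotarev suffices
  because a power of \<open>\<sigma>\<close> with exponent prime to \<open>l\<close> has the same
  fixed points as \<open>\<sigma>\<close>; its proof compares a logarithm with the square of a
  logarithm, so crude constants do.\<close>

hide_const (open) Divisibility.prime

text \<open>If \<open>x\<close> is moved by all of \<open>T\<close> and \<open>y\<close> by the new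
  \<open>\<tau>\<close>, then each element of \<open>insert \<tau> T\<close> fixes
  \<open>x + of_nat n * y\<close> for at most one \<open>n\<close>: fixing it for two values would
  force it to fix \<open>y\<close> and then \<open>x\<close>. Hence some \<open>n\<close> serves all
  of them. Closure is asked only for such combinations, so that rings of integers, rings of
  invariants and fields are all covered.\<close>

lemma exists_moved_by_all:
  fixes V :: "complex set" and T :: "(complex \<Rightarrow> complex) set"
  assumes "finite T" and ne: "V \<noteq> {}"
    and cl: "\<And>x y n. x \<in> V \<Longrightarrow> y \<in> V \<Longrightarrow> x + of_nat n * y \<in> V"
    and add: "\<And>\<tau> x y n. \<tau> \<in> T \<Longrightarrow> x \<in> V \<Longrightarrow> y \<in> V \<Longrightarrow> \<tau> (x + of_nat n * y) = \<tau> x + of_nat n * \<tau> y"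
    and mv: "\<And>\<tau>. \<tau> \<in> T \<Longrightarrow> \<exists>v\<in>V. \<tau> v \<noteq> v"
  shows "\<exists>v\<in>V. \<forall>\<tau>\<in>T. \<tau> v \<noteq> v"
  using assms(1) add mv
proof (induction T rule: finite_induct)
  case empty
  then show ?case using ne by auto
next
  case (insert \<tau> T)
  have "\<exists>v\<in>V. \<forall>\<tau>\<in>T. \<tau> v \<noteq> v"
    using insert.prems by (intro insert.IH) auto
  then obtain x where x: "x \<in> V" "\<And>\<tau>'. \<tau>' \<in> T \<Longrightarrow> \<tau>' x \<noteq> x" by auto
  obtain y where y: "y \<in> V" "\<tau> y \<noteq> y" using insert.prems(2)[of \<tau>] by auto
  have fin: "finite {n::nat. \<tau>' (x + of_nat n * y) = x + of_nat n * y}" if t: "\<tau>' \<in> insert \<tau> T" for \<tau>'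
  proof -
    have ne: "\<tau>' x \<noteq> x \<or> \<tau>' y \<noteq> y" using x(2) y(2) t by auto
    have eq: "m = n" if "\<tau>' (x + of_nat n * y) = x + of_nat n * y" "\<tau>' (x + of_nat m * y) = x + of_nat m * y" for m n :: nat
    proof -
      have 1: "\<tau>' x + of_nat n * \<tau>' y = x + of_nat n * y" "\<tau>' x + of_nat m * \<tau>' y = x + of_nat m * y"
        using that insert.prems(1)[OF t x(1) y(1)] by auto
      have "(of_nat n - of_nat m :: complex) * (\<tau>' y - y) = 0"
      proof -
        have "(of_nat n - of_nat m :: complex) * (\<tau>' y - y) =
          (\<tau>' x + of_nat n * \<tau>' y - (x + of_nat n * y)) - (\<tau>' x + of_nat m * \<tau>' y - (x + of_nat m * y))"
          by (simp add: algebra_simps)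
        then show ?thesis using 1 by simp
      qed
      moreover have "\<tau>' y \<noteq> y" using ne 1 by auto
      ultimately show ?thesis by auto
    qed
    show ?thesis
    proof (cases "{n::nat. \<tau>' (x + of_nat n * y) = x + of_nat n * y} = {}")
      case False
      then obtain n where "\<tau>' (x + of_nat n * y) = x + of_nat n * y" by auto
      then have "{n::nat. \<tau>' (x + of_nat n * y) = x + of_nat n * y} \<subseteq> {n}" using eq by auto
      then show ?thesis by (rule finite_subset) auto
    next
      case True
      then show ?thesis by (metis finite.emptyI)
    qed
  qed
  have "finite (\<Union>\<tau>'\<in>insert \<tau> T. {n::nat. \<tau>' (x + of_nat n * y) = x + of_nat n * y})"
    using fin insert.hyps by (intro finite_UN_I) auto
  then obtain n where "n \<notin> (\<Union>\<tau>'\<in>insert \<tau> T. {n::nat. \<tau>' (x + of_nat n * y) = x + of_nat n * y})"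
    using ex_new_if_finite infinite_UNIV_nat by blast
  then show ?case using cl[OF x(1) y(1), of n] by auto
qed

text \<open>Models the integers of a Galois number field with its group over the rationals; the
  field itself does not appear. The Galois theory enters through \<open>Gal_fixed\<close>: invariant
  elements are rational integers. Automorphisms are functions on all complex numbers, and
  \<open>Gal_faithful\<close> makes their equality plain equality of functions.\<close>

locale galois_ring =
  fixes Ob :: "complex set" and Gal :: "(complex \<Rightarrow> complex) set"
  assumes one_mem: "1 \<in> Ob"
    and diff_mem: "x \<in> Ob \<Longrightarrow> y \<in> Ob \<Longrightarrow> x - y \<in> Ob"
    and mult_mem: "x \<in> Ob \<Longrightarrow> y \<in> Ob \<Longrightarrow> x * y \<in> Ob"
    and finite_Gal: "finite Gal"
    and id_Gal: "id \<in> Gal"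
    and comp_Gal: "g \<in> Gal \<Longrightarrow> h \<in> Gal \<Longrightarrow> g \<circ> h \<in> Gal"
    and inv_Gal: "g \<in> Gal \<Longrightarrow> \<exists>h\<in>Gal. h \<circ> g = id \<and> g \<circ> h = id"
    and Gal_mem: "g \<in> Gal \<Longrightarrow> x \<in> Ob \<Longrightarrow> g x \<in> Ob"
    and Gal_diff: "g \<in> Gal \<Longrightarrow> x \<in> Ob \<Longrightarrow> y \<in> Ob \<Longrightarrow> g (x - y) = g x - g y"
    and Gal_mult: "g \<in> Gal \<Longrightarrow> x \<in> Ob \<Longrightarrow> y \<in> Ob \<Longrightarrow> g (x * y) = g x * g y"
    and Gal_one: "g \<in> Gal \<Longrightarrow> g 1 = 1"
    and Gal_faithful: "g \<in> Gal \<Longrightarrow> (\<And>x. x \<in> Ob \<Longrightarrow> g x = x) \<Longrightarrow> g = id"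
    and Gal_fixed: "x \<in> Ob \<Longrightarrow> (\<And>g. g \<in> Gal \<Longrightarrow> g x = x) \<Longrightarrow> x \<in> \<int>"
begin

lemma zero_mem: "0 \<in> Ob" using diff_mem[OF one_mem one_mem] by simp
lemma minus_mem: "x \<in> Ob \<Longrightarrow> - x \<in> Ob" using diff_mem[OF zero_mem] by force
lemma add_mem: "x \<in> Ob \<Longrightarrow> y \<in> Ob \<Longrightarrow> x + y \<in> Ob" using diff_mem[OF _ minus_mem] by force
lemma sum_mem: "(\<And>i. i \<in> I \<Longrightarrow> f i \<in> Ob) \<Longrightarrow> sum f I \<in> Ob"
  by (induction I rule: infinite_finite_induct) (auto simp: zero_mem add_mem)
lemma prod_mem: "(\<And>i. i \<in> I \<Longrightarrow> f i \<in> Ob) \<Longrightarrow> prod f I \<in> Ob"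
  by (induction I rule: infinite_finite_induct) (auto simp: one_mem mult_mem)
lemma power_mem: "x \<in> Ob \<Longrightarrow> x ^ n \<in> Ob"
  by (induction n) (auto simp: one_mem mult_mem)
lemma nat_mem: "of_nat n \<in> Ob"
  by (induction n) (auto simp: zero_mem one_mem add_mem)
lemma int_mem: "of_int n \<in> Ob"
  by (cases n) (auto simp: nat_mem minus_mem diff_mem one_mem simp del: of_nat_Suc)

lemmas mem = zero_mem one_mem diff_mem minus_mem add_mem mult_mem sum_mem prod_mem power_mem nat_mem int_mem

lemma Gal_zero: "g \<in> Gal \<Longrightarrow> g 0 = 0" using Gal_diff[OF _ one_mem one_mem] by simp
lemma Gal_minus: "g \<in> Gal \<Longrightarrow> x \<in> Ob \<Longrightarrow> g (- x) = - g x" using Gal_diff[OF _ zero_mem, of g x] Gal_zero by simp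
lemma Gal_add: "g \<in> Gal \<Longrightarrow> x \<in> Ob \<Longrightarrow> y \<in> Ob \<Longrightarrow> g (x + y) = g x + g y"
  using Gal_diff[OF _ _ minus_mem, of g x y] Gal_minus[of g y] by simp
lemma Gal_sum: "g \<in> Gal \<Longrightarrow> (\<And>i. i \<in> I \<Longrightarrow> f i \<in> Ob) \<Longrightarrow> g (sum f I) = (\<Sum>i\<in>I. g (f i))"
  by (induction I rule: infinite_finite_induct) (auto simp: Gal_zero Gal_add mem)
lemma Gal_prod: "g \<in> Gal \<Longrightarrow> (\<And>i. i \<in> I \<Longrightarrow> f i \<in> Ob) \<Longrightarrow> g (prod f I) = (\<Prod>i\<in>I. g (f i))"
  by (induction I rule: infinite_finite_induct) (auto simp: Gal_one Gal_mult mem)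
lemma Gal_power: "g \<in> Gal \<Longrightarrow> x \<in> Ob \<Longrightarrow> g (x ^ n) = g x ^ n"
  by (induction n) (auto simp: Gal_one Gal_mult mem)
lemma Gal_nat: "g \<in> Gal \<Longrightarrow> g (of_nat n) = of_nat n"
  by (induction n) (auto simp: Gal_zero Gal_one Gal_add mem)
lemma Gal_int: "g \<in> Gal \<Longrightarrow> g (of_int n) = of_int n"
  by (cases n) (auto simp: Gal_nat Gal_minus Gal_diff mem Gal_one simp del: of_nat_Suc)

lemma Gal_inv:
  assumes "g \<in> Gal"
  obtains h where "h \<in> Gal" "\<And>x. h (g x) = x" "\<And>x. g (h x) = x"
proof -
  obtain h where "h \<in> Gal" "h \<circ> g = id" "g \<circ> h = id" using inv_Gal[OF assms] by auto
  then show ?thesis using that by (metis comp_apply id_apply)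
qed

lemma Gal_inj: "g \<in> Gal \<Longrightarrow> g x = g y \<Longrightarrow> x = y"
  by (metis Gal_inv)

lemma Gal_bij_betw_comp: "g \<in> Gal \<Longrightarrow> bij_betw (\<lambda>h. g \<circ> h) Gal Gal"
proof -
  assume g: "g \<in> Gal"
  obtain k where k: "k \<in> Gal" "k \<circ> g = id" "g \<circ> k = id" using inv_Gal[OF g] by auto
  show ?thesis
    by (rule bij_betw_byWitness[where f' = "\<lambda>h. k \<circ> h"])
       (use g k in \<open>auto simp: comp_Gal comp_assoc[symmetric]\<close>)
qed

lemma Gal_funpow: "g \<in> Gal \<Longrightarrow> g ^^ n \<in> Gal"
  by (induction n) (auto simp: id_Gal comp_Gal simp flip: id_def)

lemma Gal_comp_eqD: "g \<in> Gal \<Longrightarrow> g \<circ> h = g \<circ> k \<Longrightarrow> h = k"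
  by (metis Gal_inj comp_apply ext)

text \<open>An integral primitive element: its stabilizer is trivial, so its conjugates are pairwise
  distinct and label the elements of the group.\<close>

definition gam :: complex where
  "gam = (SOME x. x \<in> Ob \<and> (\<forall>g\<in>Gal - {id}. g x \<noteq> x))"

lemma gam: "gam \<in> Ob" "g \<in> Gal \<Longrightarrow> g gam = gam \<Longrightarrow> g = id"
proof -
  have "\<exists>v\<in>Ob. \<forall>\<tau>\<in>Gal - {id}. \<tau> v \<noteq> v"
  proof (rule exists_moved_by_all)
    show "finite (Gal - {id})" using finite_Gal by auto
    show "Ob \<noteq> {}" using zero_mem by auto
  qed (use Gal_faithful in \<open>auto simp: mem Gal_add Gal_mult Gal_nat\<close>)
  then have ex: "\<exists>x. x \<in> Ob \<and> (\<forall>g\<in>Gal - {id}. g x \<noteq> x)" by blast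
  have "gam \<in> Ob \<and> (\<forall>g\<in>Gal - {id}. g gam \<noteq> gam)"
    unfolding gam_def using someI_ex[OF ex] .
  then show "gam \<in> Ob" "g \<in> Gal \<Longrightarrow> g gam = gam \<Longrightarrow> g = id" by auto
qed

lemma gam_mem: "g \<in> Gal \<Longrightarrow> g gam \<in> Ob" using Gal_mem gam(1) by simp

lemma gam_inj: "g \<in> Gal \<Longrightarrow> h \<in> Gal \<Longrightarrow> g gam = h gam \<Longrightarrow> g = h"
proof -
  assume a: "g \<in> Gal" "h \<in> Gal" "g gam = h gam"
  obtain k where k: "k \<in> Gal" "k \<circ> h = id" "h \<circ> k = id" using inv_Gal[OF a(2)] by auto
  have "(k \<circ> g) gam = gam" using a k by (metis comp_apply id_apply)
  then have "k \<circ> g = id" using gam(2) comp_Gal k a by blast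
  then show "g = h" using k by (metis comp_assoc comp_id id_comp)
qed

definition Opoly :: "complex poly \<Rightarrow> bool" where
  "Opoly q \<longleftrightarrow> (\<forall>i. Polynomial.coeff q i \<in> Ob)"

lemma Opoly_add: "Opoly p \<Longrightarrow> Opoly q \<Longrightarrow> Opoly (p + q)"
  and Opoly_diff: "Opoly p \<Longrightarrow> Opoly q \<Longrightarrow> Opoly (p - q)"
  and Opoly_mult: "Opoly p \<Longrightarrow> Opoly q \<Longrightarrow> Opoly (p * q)"
  and Opoly_smult: "c \<in> Ob \<Longrightarrow> Opoly p \<Longrightarrow> Opoly (Polynomial.smult c p)"
  and Opoly_0: "Opoly 0" and Opoly_1: "Opoly 1"
  and Opoly_lin: "c \<in> Ob \<Longrightarrow> Opoly [:- c, 1:]"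
  by (auto simp: Opoly_def mem coeff_mult coeff_pCons split: nat.splits)

lemma Opoly_prod: "(\<And>i. i \<in> I \<Longrightarrow> Opoly (f i)) \<Longrightarrow> Opoly (prod f I)"
  by (induction I rule: infinite_finite_induct) (auto simp: Opoly_1 Opoly_mult)
lemma Opoly_sum: "(\<And>i. i \<in> I \<Longrightarrow> Opoly (f i)) \<Longrightarrow> Opoly (sum f I)"
  by (induction I rule: infinite_finite_induct) (auto simp: Opoly_0 Opoly_add)

lemma map_poly_Gal_mult: "g \<in> Gal \<Longrightarrow> Opoly p \<Longrightarrow> Opoly q \<Longrightarrow> map_poly g (p * q) = map_poly g p * map_poly g q"
  by (rule poly_eqI) (auto simp: coeff_map_poly Gal_zero coeff_mult Gal_sum Gal_mult mem Opoly_def)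
lemma map_poly_Gal_add: "g \<in> Gal \<Longrightarrow> Opoly p \<Longrightarrow> Opoly q \<Longrightarrow> map_poly g (p + q) = map_poly g p + map_poly g q"
  by (rule poly_eqI) (auto simp: coeff_map_poly Gal_zero Gal_add mem Opoly_def)
lemma map_poly_Gal_smult: "g \<in> Gal \<Longrightarrow> c \<in> Ob \<Longrightarrow> Opoly p \<Longrightarrow> map_poly g (Polynomial.smult c p) = Polynomial.smult (g c) (map_poly g p)"
  by (rule poly_eqI) (auto simp: coeff_map_poly Gal_zero Gal_mult mem Opoly_def)
lemma map_poly_Gal_1: "g \<in> Gal \<Longrightarrow> map_poly g 1 = 1"
  by (simp add: map_poly_1' Gal_one)
lemma map_poly_Gal_lin: "g \<in> Gal \<Longrightarrow> c \<in> Ob \<Longrightarrow> map_poly g [:- c, 1:] = [:- g c, 1:]"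
  by (rule poly_eqI) (auto simp: coeff_map_poly Gal_zero Gal_minus Gal_one coeff_pCons split: nat.splits)
lemma map_poly_Gal_prod: "g \<in> Gal \<Longrightarrow> (\<And>i. i \<in> I \<Longrightarrow> Opoly (f i)) \<Longrightarrow> map_poly g (prod f I) = (\<Prod>i\<in>I. map_poly g (f i))"
  by (induction I rule: infinite_finite_induct) (auto simp: map_poly_Gal_1 map_poly_Gal_mult Opoly_prod)
lemma map_poly_Gal_sum: "g \<in> Gal \<Longrightarrow> (\<And>i. i \<in> I \<Longrightarrow> Opoly (f i)) \<Longrightarrow> map_poly g (sum f I) = (\<Sum>i\<in>I. map_poly g (f i))"
  by (induction I rule: infinite_finite_induct) (auto simp: map_poly_Gal_add Opoly_sum)

lemma Opoly_fixed_Ints: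
  assumes "Opoly q" "\<And>g. g \<in> Gal \<Longrightarrow> map_poly g q = q"
  shows "Polynomial.coeff q i \<in> \<int>"
proof (rule Gal_fixed)
  show "Polynomial.coeff q i \<in> Ob" using assms by (auto simp: Opoly_def)
  fix g assume "g \<in> Gal"
  then show "g (Polynomial.coeff q i) = Polynomial.coeff q i"
    using assms(2)[of g] coeff_map_poly[of g q i] Gal_zero by simp
qed

lemma Gal_poly: "g \<in> Gal \<Longrightarrow> Opoly q \<Longrightarrow> y \<in> Ob \<Longrightarrow> g (poly q y) = poly (map_poly g q) (g y)"
proof (induction q)
  case 0
  then show ?case by (simp add: Gal_zero)
next
  case (pCons a q)
  have c: "Polynomial.coeff (pCons a q) i \<in> Ob" for i using pCons.prems(2) by (simp add: Opoly_def)
  have q: "Opoly q" "a \<in> Ob" using c[of "Suc _"] c[of 0] by (auto simp: Opoly_def)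
  have "poly q y \<in> Ob" using q pCons.prems by (auto simp: poly_altdef Opoly_def intro!: mem)
  moreover have "map_poly g (pCons a q) = pCons (g a) (map_poly g q)"
    by (rule poly_eqI) (use pCons.prems in \<open>auto simp: coeff_map_poly Gal_zero coeff_pCons split: nat.splits\<close>)
  ultimately show ?case using pCons q by (simp add: Gal_add Gal_mult mem)
qed

lemma poly_mem: "Opoly q \<Longrightarrow> y \<in> Ob \<Longrightarrow> poly q y \<in> Ob"
  by (auto simp: poly_altdef Opoly_def intro!: mem)

text \<open>Up to the factor \<open>del\<close>, the polynomial \<open>W x\<close> interpolates \<open>g gam \<mapsto> g x\<close>. Its coefficients are
  integers, so it writes \<open>x\<close> as an integer polynomial in \<open>gam\<close> away from the primes dividing \<open>Disc\<close>.\<close>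

definition lag :: "(complex \<Rightarrow> complex) \<Rightarrow> complex poly" where
  "lag g = (\<Prod>h\<in>Gal - {g}. [:- h gam, 1:])"

definition W :: "complex \<Rightarrow> complex poly" where
  "W x = (\<Sum>g\<in>Gal. Polynomial.smult (g x) (lag g))"

text \<open>The derivative at \<open>gam\<close> of its minimal polynomial, equal to
  \<open>poly (lag id) gam\<close>; it is the common denominator of the interpolation.\<close>

definition del :: complex where "del = (\<Prod>h\<in>Gal - {id}. gam - h gam)"

lemma Opoly_lag: "Opoly (lag g)"
  unfolding lag_def by (rule Opoly_prod, rule Opoly_lin, rule gam_mem) auto

lemma Opoly_W: "x \<in> Ob \<Longrightarrow> Opoly (W x)"
  unfolding W_def by (rule Opoly_sum, rule Opoly_smult, rule Gal_mem, auto simp: Opoly_lag)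

lemma map_lag: "g \<in> Gal \<Longrightarrow> h \<in> Gal \<Longrightarrow> map_poly g (lag h) = lag (g \<circ> h)"
proof -
  assume g: "g \<in> Gal" and h: "h \<in> Gal"
  have "map_poly g (lag h) = (\<Prod>k\<in>Gal - {h}. [:- (g \<circ> k) gam, 1:])"
    unfolding lag_def using g gam by (subst map_poly_Gal_prod) (auto intro!: prod.cong Opoly_lin simp: map_poly_Gal_lin Gal_mem)
  also have "\<dots> = lag (g \<circ> h)" unfolding lag_def
  proof (rule prod.reindex_bij_betw[of "\<lambda>k. g \<circ> k"])
    have b: "bij_betw (\<lambda>k. g \<circ> k) Gal Gal" by (rule Gal_bij_betw_comp[OF g])
    show "bij_betw ((\<circ>) g) (Gal - {h}) (Gal - {g \<circ> h})"
      by (rule bij_betw_DiffI[OF b]) (use g h in \<open>auto simp: bij_betw_def comp_Gal\<close>)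
  qed
  finally show ?thesis .
qed

lemma map_W: "g \<in> Gal \<Longrightarrow> x \<in> Ob \<Longrightarrow> map_poly g (W x) = W x"
proof -
  assume g: "g \<in> Gal" and x: "x \<in> Ob"
  have "map_poly g (W x) = (\<Sum>h\<in>Gal. Polynomial.smult ((g \<circ> h) x) (lag (g \<circ> h)))"
    unfolding W_def using g x by (subst map_poly_Gal_sum) (auto intro!: sum.cong Opoly_smult Opoly_lag simp: map_poly_Gal_smult map_lag Opoly_lag Gal_mem)
  also have "\<dots> = W x" unfolding W_def
    by (rule sum.reindex_bij_betw[OF Gal_bij_betw_comp[OF g], of "\<lambda>h. Polynomial.smult (h x) (lag h)"])
  finally show ?thesis .
qed

lemma W_Ints: "x \<in> Ob \<Longrightarrow> Polynomial.coeff (W x) i \<in> \<int>"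
  by (intro Opoly_fixed_Ints Opoly_W map_W)

lemma del_mem: "del \<in> Ob" unfolding del_def using gam by (auto intro!: prod_mem diff_mem simp: Gal_mem)
lemma del_nz: "del \<noteq> 0" unfolding del_def using finite_Gal gam(2) by (auto dest: sym)

lemma W_gam: assumes x: "x \<in> Ob" and g: "g \<in> Gal" shows "poly (W x) (g gam) = g (x * del)"
proof -
  have "poly (W x) gam = (\<Sum>h\<in>Gal. if h = id then x * del else 0)"
    unfolding W_def poly_sum
  proof (rule sum.cong[OF refl])
    fix h assume h: "h \<in> Gal"
    show "poly (Polynomial.smult (h x) (lag h)) gam = (if h = id then x * del else 0)"
    proof (cases "h = id")
      case True
      then show ?thesis by (simp add: lag_def poly_prod del_def)
    next
      case False
      have "(\<Prod>k\<in>Gal - {h}. gam - k gam) = 0" using finite_Gal id_Gal False by (intro prod_zero) (auto intro!: bexI[of _ id])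
      then show ?thesis using False by (simp add: lag_def poly_prod)
    qed
  qed
  also have "\<dots> = x * del" using finite_Gal id_Gal by (simp add: sum.delta)
  finally have 1: "poly (W x) gam = x * del" .
  show ?thesis using Gal_poly[OF g Opoly_W[OF x] gam(1)] 1 map_W[OF g x] by simp
qed

text \<open>The norm of \<open>del\<close>, up to sign the discriminant of \<open>gam\<close>. A
  prime not dividing it is unramified, and \<open>del\<close> is invertible modulo it.\<close>

definition Disc :: int where "Disc = (THE n. of_int n = (\<Prod>g\<in>Gal. g del))"

lemma norm_Ints: assumes x: "x \<in> Ob" shows "(\<Prod>g\<in>Gal. g x) \<in> \<int>"
proof (rule Gal_fixed)
  show "(\<Prod>g\<in>Gal. g x) \<in> Ob" using x by (intro prod_mem) (simp add: Gal_mem)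
  fix g assume g: "g \<in> Gal"
  have "g (\<Prod>g\<in>Gal. g x) = (\<Prod>h\<in>Gal. (g \<circ> h) x)" using g x by (simp add: Gal_prod Gal_mem)
  also have "\<dots> = (\<Prod>g\<in>Gal. g x)" by (rule prod.reindex_bij_betw[OF Gal_bij_betw_comp[OF g]])
  finally show "g (\<Prod>g\<in>Gal. g x) = (\<Prod>g\<in>Gal. g x)" .
qed

lemma Disc: "of_int Disc = (\<Prod>g\<in>Gal. g del)"
proof -
  obtain n where n: "(\<Prod>g\<in>Gal. g del) = of_int n" using norm_Ints[OF del_mem] by (auto elim: Ints_cases)
  have "of_int Disc = (\<Prod>g\<in>Gal. g del)" unfolding Disc_def n by (rule theI[of _ n]) auto
  then show ?thesis .
qed

lemma Disc_nz: "Disc \<noteq> 0"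
proof
  assume "Disc = 0"
  then have "(\<Prod>g\<in>Gal. g del) = 0" using Disc by simp
  then obtain g where "g \<in> Gal" "g del = 0" using finite_Gal by auto
  then have "del = 0" using Gal_inj[of g del 0] Gal_zero by auto
  then show False using del_nz by simp
qed

lemma Disc_eq_del_mult: obtains e where "e \<in> Ob" "of_int Disc = del * e"
proof -
  have "(\<Prod>g\<in>Gal. g del) = id del * (\<Prod>g\<in>Gal-{id}. g del)"
    by (rule prod.remove[OF finite_Gal id_Gal])
  moreover have "(\<Prod>g\<in>Gal-{id}. g del) \<in> Ob" using del_mem by (intro prod_mem) (simp add: Gal_mem)
  ultimately show ?thesis using that[of "\<Prod>g\<in>Gal-{id}. g del"] Disc by simp
qed

section \<open>Congruences modulo ideals and modulo a rational prime\<close>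

definition pO :: "nat \<Rightarrow> complex set" where "pO n = (\<lambda>x. of_nat n * x) ` Ob"

definition idl :: "complex set \<Rightarrow> bool" where
  "idl I \<longleftrightarrow> I \<subseteq> Ob \<and> 0 \<in> I \<and> (\<forall>x\<in>I. \<forall>y\<in>I. x + y \<in> I) \<and> (\<forall>x\<in>Ob. \<forall>y\<in>I. x * y \<in> I)"

lemma idlD:
  assumes "idl I"
  shows "x \<in> I \<Longrightarrow> x \<in> Ob" "0 \<in> I" "x \<in> I \<Longrightarrow> y \<in> I \<Longrightarrow> x + y \<in> I"
    "x \<in> Ob \<Longrightarrow> y \<in> I \<Longrightarrow> x * y \<in> I" "x \<in> I \<Longrightarrow> y \<in> Ob \<Longrightarrow> x * y \<in> I"
  using assms by (auto simp: idl_def mult.commute)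

lemma idl_minus: "idl I \<Longrightarrow> x \<in> I \<Longrightarrow> - x \<in> I"
  using idlD(4)[of I "-1" x] mem by auto
lemma idl_diff: "idl I \<Longrightarrow> x \<in> I \<Longrightarrow> y \<in> I \<Longrightarrow> x - y \<in> I"
  using idlD(3)[of I x "-y"] idl_minus by auto
lemma idl_sum: "idl I \<Longrightarrow> (\<And>i. i \<in> A \<Longrightarrow> f i \<in> I) \<Longrightarrow> sum f A \<in> I"
  by (induction A rule: infinite_finite_induct) (auto simp: idlD)

lemma idl_cong_trans: "idl I \<Longrightarrow> x - y \<in> I \<Longrightarrow> y - z \<in> I \<Longrightarrow> x - z \<in> I"
  using idlD(3)[of I "x - y" "y - z"] by simp
lemma idl_cong_sym: "idl I \<Longrightarrow> x - y \<in> I \<Longrightarrow> y - x \<in> I"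
  using idl_minus[of I "x - y"] by simp
lemma idl_cong_mem: "idl I \<Longrightarrow> x - y \<in> I \<Longrightarrow> x \<in> I \<longleftrightarrow> y \<in> I"
  using idl_cong_trans[of I x y 0] idl_cong_trans[of I y x 0] idl_cong_sym by auto

lemma idl_cong_mult:
  assumes "idl I" "x - x' \<in> I" "y - y' \<in> I" "x \<in> Ob" "y' \<in> Ob"
  shows "x * y - x' * y' \<in> I"
proof -
  have "x * y - x' * y' = x * (y - y') + (x - x') * y'" by (simp add: algebra_simps)
  then show ?thesis using assms idlD by simp
qed

lemma idl_cong_power:
  assumes "idl I" "x - y \<in> I" "x \<in> Ob" "y \<in> Ob" shows "x ^ n - y ^ n \<in> I"
  using assms by (induction n) (auto simp: idlD intro!: idl_cong_mult mem)

lemma idl_cong_sum: "idl I \<Longrightarrow> (\<And>i. i \<in> A \<Longrightarrow> f i - g i \<in> I) \<Longrightarrow> sum f A - sum g A \<in> I"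
  using idl_sum[of I A "\<lambda>i. f i - g i"] by (simp add: sum_subtractf)

lemma idl_power: "idl I \<Longrightarrow> x \<in> I \<Longrightarrow> n > 0 \<Longrightarrow> x ^ n \<in> I"
  using idl_cong_power[of I x 0 n] idlD(1)[of I x] by (simp add: mem power_0_left)

lemma idl_poly: "idl I \<Longrightarrow> (\<And>i. Polynomial.coeff q i \<in> I) \<Longrightarrow> y \<in> Ob \<Longrightarrow> poly q y \<in> I"
  unfolding poly_altdef by (intro idl_sum) (auto simp: idlD mem)

lemma idl_cong_poly: "idl I \<Longrightarrow> Opoly q \<Longrightarrow> x \<in> Ob \<Longrightarrow> y \<in> Ob \<Longrightarrow> x - y \<in> I \<Longrightarrow> poly q x - poly q y \<in> I"
  unfolding poly_altdef
  by (intro idl_cong_sum idl_cong_mult idl_cong_power) (auto simp: Opoly_def mem idlD)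

lemma idl_pO: "idl (pO n)"
proof -
  have "x + y \<in> pO n" if xy: "x \<in> pO n" "y \<in> pO n" for x y
  proof -
    obtain a b where "x = of_nat n * a" "y = of_nat n * b" "a \<in> Ob" "b \<in> Ob" using xy by (auto simp: pO_def)
    then show ?thesis unfolding pO_def by (intro image_eqI[of _ _ "a + b"]) (auto simp: mem algebra_simps)
  qed
  moreover have "x * y \<in> pO n" if xy: "x \<in> Ob" "y \<in> pO n" for x y
  proof -
    obtain b where "y = of_nat n * b" "b \<in> Ob" using xy by (auto simp: pO_def)
    then show ?thesis unfolding pO_def using xy by (intro image_eqI[of _ _ "x * b"]) (auto simp: mem algebra_simps)
  qed
  moreover have "0 \<in> pO n" unfolding pO_def by (intro image_eqI[of _ _ 0]) (auto simp: mem)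
  ultimately show ?thesis unfolding idl_def by (auto simp: pO_def mem)
qed

lemma pO_I: "x \<in> Ob \<Longrightarrow> of_nat n * x \<in> pO n" by (auto simp: pO_def)

lemma pO_int_I: "int n dvd m \<Longrightarrow> of_int m \<in> pO n"
proof -
  assume "int n dvd m"
  then obtain k where "m = int n * k" by auto
  then show ?thesis using pO_I[OF int_mem[of k], of n] by simp
qed

lemma Gal_pO: "g \<in> Gal \<Longrightarrow> x \<in> pO n \<Longrightarrow> g x \<in> pO n"
proof -
  assume g: "g \<in> Gal" and "x \<in> pO n"
  then obtain a where a: "x = of_nat n * a" "a \<in> Ob" by (auto simp: pO_def)
  have "g x = of_nat n * g a" using a g by (simp add: Gal_mult Gal_nat mem)
  then show ?thesis using Gal_mem[OF g a(2)] by (simp add: pO_I)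
qed

text \<open>The quotient \<open>z\<close> of two rational integers is fixed by \<open>Gal\<close>,
  hence itself a rational integer.\<close>

lemma pO_int_D: assumes "n > 0" "of_int m \<in> pO n" shows "int n dvd m"
proof -
  obtain z where z: "of_int m = of_nat n * z" "z \<in> Ob" using assms by (auto simp: pO_def)
  have "z \<in> \<int>"
  proof (rule Gal_fixed[OF z(2)])
    fix g assume g: "g \<in> Gal"
    have "of_nat n * g z = of_nat n * z" using g z Gal_int[OF g, of m] by (simp add: Gal_mult Gal_nat mem)
    then show "g z = z" using assms by simp
  qed
  then obtain k where "z = of_int k" by (auto elim: Ints_cases)
  then have "(of_int m :: complex) = of_int (int n * k)" using z by simp
  then show ?thesis unfolding of_int_eq_iff by simp
qed

lemma one_not_pO: "prime p \<Longrightarrow> 1 \<notin> pO p"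
  using pO_int_D[of p 1] prime_gt_1_nat[of p] by auto

lemma frob_add:
  assumes p: "prime (p::nat)" and x: "x \<in> Ob" "y \<in> Ob"
  shows "(x + y) ^ p - (x ^ p + y ^ p) \<in> pO p"
proof -
  have p0: "p > 0" using p prime_gt_0_nat by blast
  have "(x + y) ^ p = (\<Sum>k\<le>p. of_nat (p choose k) * x ^ k * y ^ (p - k))" by (rule binomial_ring)
  also have "\<dots> = (\<Sum>k\<in>{0,p} \<union> {1..<p}. of_nat (p choose k) * x ^ k * y ^ (p - k))"
    by (intro sum.cong) auto
  also have "\<dots> = (x ^ p + y ^ p) + (\<Sum>k\<in>{1..<p}. of_nat (p choose k) * x ^ k * y ^ (p - k))"
    using p0 by (subst sum.union_disjoint) auto
  finally have "(x + y) ^ p - (x ^ p + y ^ p) = (\<Sum>k\<in>{1..<p}. of_nat (p choose k) * x ^ k * y ^ (p - k))" by simp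
  moreover have "\<dots> \<in> pO p"
  proof (rule idl_sum[OF idl_pO])
    fix k assume "k \<in> {1..<p}"
    then have "p dvd (p choose k)" using p by (intro dvd_choose_prime) auto
    then have "of_int (int (p choose k)) \<in> pO p" by (intro pO_int_I) simp
    then show "of_nat (p choose k) * x ^ k * y ^ (p - k) \<in> pO p"
      using x by (auto intro!: idlD(5)[OF idl_pO] mem)
  qed
  ultimately show ?thesis by simp
qed

lemma frob_sum:
  assumes p: "prime (p::nat)" and "\<And>i. i \<in> A \<Longrightarrow> f i \<in> Ob"
  shows "(sum f A) ^ p - (\<Sum>i\<in>A. f i ^ p) \<in> pO p"
  using assms(2)
proof (induction A rule: infinite_finite_induct)
  case (insert a A)
  have 1: "(f a + sum f A) ^ p - (f a ^ p + sum f A ^ p) \<in> pO p"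
    using insert by (intro frob_add p mem) auto
  have 2: "(f a ^ p + sum f A ^ p) - (f a ^ p + (\<Sum>i\<in>A. f i ^ p)) \<in> pO p"
    using insert by simp
  show ?case using idl_cong_trans[OF idl_pO 1 2] insert by simp
qed (use prime_gt_0_nat[OF p] in \<open>auto simp: idlD[OF idl_pO] power_0_left\<close>)

lemma frob_sum_iter:
  assumes p: "prime (p::nat)" and "\<And>i. i \<in> A \<Longrightarrow> f i \<in> Ob"
  shows "(sum f A) ^ (p ^ t) - (\<Sum>i\<in>A. f i ^ (p ^ t)) \<in> pO p"
proof (induction t)
  case 0
  then show ?case by (simp add: idlD[OF idl_pO])
next
  case (Suc t)
  have 1: "((sum f A) ^ (p ^ t)) ^ p - (\<Sum>i\<in>A. f i ^ (p ^ t)) ^ p \<in> pO p"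
    by (intro idl_cong_power[OF idl_pO Suc]) (auto intro!: mem assms(2))
  have 2: "(\<Sum>i\<in>A. f i ^ (p ^ t)) ^ p - (\<Sum>i\<in>A. (f i ^ (p ^ t)) ^ p) \<in> pO p"
    by (intro frob_sum p mem assms(2))
  have e: "x ^ p ^ Suc t = (x ^ (p ^ t)) ^ p" for x :: complex by (simp add: power_mult[symmetric] mult.commute)
  show ?case unfolding e by (rule idl_cong_trans[OF idl_pO 1 2])
qed

lemma frob_int: assumes p: "prime (p::nat)" shows "of_int n ^ p - of_int n \<in> pO p"
proof -
  have p0: "p > 0" using p prime_gt_0_nat by blast
  have nat: "of_nat m ^ p - of_nat m \<in> pO p" for m
  proof (induction m)
    case 0
    then show ?case using p0 idlD[OF idl_pO] by (simp add: power_0_left)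
  next
    case (Suc m)
    have 1: "(1 + of_nat m) ^ p - (1 ^ p + of_nat m ^ p) \<in> pO p" by (intro frob_add p mem)
    have 2: "(1 ^ p + of_nat m ^ p) - (1 + of_nat m) \<in> pO p" using Suc by simp
    show ?case using idl_cong_trans[OF idl_pO 1 2] by simp
  qed
  define m where "m = nat (n mod int p)"
  have m: "of_int n - of_nat m \<in> pO p"
  proof -
    have "int p dvd n - int m" unfolding m_def using p0 by (simp add: mod_eq_dvd_iff[symmetric])
    then have "of_int (n - int m) \<in> pO p" by (rule pO_int_I)
    then show ?thesis by simp
  qed
  have 1: "of_int n ^ p - of_nat m ^ p \<in> pO p" by (intro idl_cong_power[OF idl_pO m] mem)
  show ?thesis
    by (rule idl_cong_trans[OF idl_pO 1]) (rule idl_cong_trans[OF idl_pO nat idl_cong_sym[OF idl_pO m]])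
qed

lemma frob_poly:
  assumes p: "prime (p::nat)" and q: "\<And>i. Polynomial.coeff q i \<in> \<int>" and y: "y \<in> Ob"
  shows "poly q y ^ p - poly q (y ^ p) \<in> pO p"
proof -
  let ?c = "Polynomial.coeff q"
  have c: "?c i \<in> Ob" for i using q[of i] int_mem by (auto elim: Ints_cases)
  have 1: "poly q y ^ p - (\<Sum>i\<le>Polynomial.degree q. (?c i * y ^ i) ^ p) \<in> pO p"
    unfolding poly_altdef by (intro frob_sum p mem c y)
  have 2: "(\<Sum>i\<le>Polynomial.degree q. (?c i * y ^ i) ^ p) - poly q (y ^ p) \<in> pO p"
    unfolding poly_altdef
  proof (rule idl_cong_sum[OF idl_pO])
    fix i
    obtain n where n: "?c i = of_int n" using q[of i] by (auto elim: Ints_cases)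
    have "(?c i * y ^ i) ^ p - ?c i * (y ^ p) ^ i = (of_int n ^ p - of_int n) * (y ^ p) ^ i"
      by (simp add: n algebra_simps power_mult_distrib) (simp add: power_mult[symmetric] mult.commute)
    then show "(?c i * y ^ i) ^ p - ?c i * (y ^ p) ^ i \<in> pO p"
      using frob_int[OF p] y by (simp add: idlD(5)[OF idl_pO] mem)
  qed
  show ?thesis by (rule idl_cong_trans[OF idl_pO 1 2])
qed

section \<open>Prime ideals and unramified primes\<close>

definition primeO :: "complex set \<Rightarrow> bool" where
  "primeO Q \<longleftrightarrow> idl Q \<and> 1 \<notin> Q \<and> (\<forall>x\<in>Ob. \<forall>y\<in>Ob. x * y \<in> Q \<longrightarrow> x \<in> Q \<or> y \<in> Q)"

lemma primeO_idl: "primeO Q \<Longrightarrow> idl Q" by (simp add: primeO_def)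

lemma primeO_prod: "primeO Q \<Longrightarrow> (\<And>i. i \<in> I \<Longrightarrow> f i \<in> Ob) \<Longrightarrow> prod f I \<in> Q \<Longrightarrow> \<exists>i\<in>I. f i \<in> Q"
proof (induction I rule: infinite_finite_induct)
  case (insert a I)
  have "f a * prod f I \<in> Q" using insert by simp
  then have "f a \<in> Q \<or> prod f I \<in> Q" using insert.prems unfolding primeO_def by (meson insertCI prod_mem)
  then show ?case using insert by auto
qed (auto simp: primeO_def)

lemma primeO_power: "primeO Q \<Longrightarrow> x \<in> Ob \<Longrightarrow> x ^ n \<in> Q \<Longrightarrow> x \<in> Q"
  using primeO_prod[of Q "{..<n}" "\<lambda>_. x"] by auto

text \<open>Zorn's lemma gives an ideal \<open>M\<close> maximal among those that contain
  \<open>I\<close> and avoid 1. By \<open>key\<close> every element outside \<open>M\<close> is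
  invertible modulo \<open>M\<close>, so \<open>M\<close> is prime.\<close>

lemma exists_primeO:
  assumes I: "idl I" "1 \<notin> I"
  shows "\<exists>Q. primeO Q \<and> I \<subseteq> Q"
proof -
  define A where "A = {J. idl J \<and> 1 \<notin> J \<and> I \<subseteq> J}"
  have "\<exists>M\<in>A. \<forall>U\<in>A. (M \<subseteq> U \<longrightarrow> U = M)"
  proof (rule subset_Zorn_nonempty)
    show "A \<noteq> {}" using I by (auto simp: A_def)
  next
    fix C assume C: "C \<noteq> {}" "subset.chain A C"
    have CA: "J \<in> C \<Longrightarrow> idl J \<and> 1 \<notin> J \<and> I \<subseteq> J" for J using C(2) by (auto simp: subset.chain_def A_def)
    have "x + y \<in> \<Union>C" if xy: "x \<in> \<Union>C" "y \<in> \<Union>C" for x y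
    proof -
      obtain U Y where "U \<in> C" "Y \<in> C" "x \<in> U" "y \<in> Y" using xy by auto
      moreover then have "U \<subseteq> Y \<or> Y \<subseteq> U" using C(2) by (auto simp: subset.chain_def)
      ultimately obtain Z where "Z \<in> C" "x \<in> Z" "y \<in> Z" by auto
      then show ?thesis using CA idlD(3) by blast
    qed
    moreover have "\<Union>C \<subseteq> Ob" using CA idlD(1) by blast
    moreover have "0 \<in> \<Union>C" using CA C(1) idlD(2) by blast
    moreover have "x * y \<in> \<Union>C" if "x \<in> Ob" "y \<in> \<Union>C" for x y
      using that CA idlD(4) by (meson UnionE UnionI)
    ultimately have "idl (\<Union>C)" by (simp add: idl_def)
    then show "\<Union>C \<in> A" using CA C(1) by (auto simp: A_def)
  qed
  then obtain M where M: "idl M" "1 \<notin> M" "I \<subseteq> M" "\<And>U. idl U \<Longrightarrow> 1 \<notin> U \<Longrightarrow> M \<subseteq> U \<Longrightarrow> U = M" unfolding A_def by auto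
  have key: "\<exists>a\<in>Ob. 1 - a * x \<in> M" if x: "x \<in> Ob" "x \<notin> M" for x
  proof -
    let ?T = "{m + a * x | m a. m \<in> M \<and> a \<in> Ob}"
    have "u + v \<in> ?T" if uv: "u \<in> ?T" "v \<in> ?T" for u v
    proof -
      obtain m a n b where "u = m + a * x" "v = n + b * x" "m \<in> M" "n \<in> M" "a \<in> Ob" "b \<in> Ob" using uv by auto
      then have "u + v = (m + n) + (a + b) * x" "m + n \<in> M" "a + b \<in> Ob" using idlD[OF M(1)] by (auto simp: mem algebra_simps)
      then show ?thesis by blast
    qed
    moreover have "c * u \<in> ?T" if cu: "c \<in> Ob" "u \<in> ?T" for c u
    proof -
      obtain m a where "u = m + a * x" "m \<in> M" "a \<in> Ob" using cu by auto
      then have "c * u = c * m + (c * a) * x" "c * m \<in> M" "c * a \<in> Ob" using idlD[OF M(1)] cu by (auto simp: mem algebra_simps)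
      then show ?thesis by blast
    qed
    moreover have MX: "M \<subseteq> ?T" using zero_mem by (force intro: exI[of _ 0])
    moreover have "0 \<in> ?T" using MX idlD(2)[OF M(1)] by blast
    moreover have "?T \<subseteq> Ob" using x idlD(1)[OF M(1)] by (auto simp: mem)
    ultimately have "idl ?T" by (simp add: idl_def)
    moreover have "x \<in> ?T" using idlD(2)[OF M(1)] one_mem by (force intro: exI[of _ 0] exI[of _ 1])
    ultimately have "1 \<in> ?T" using M(4)[of ?T] MX x(2) by blast
    then obtain m a where "1 = m + a * x" "m \<in> M" "a \<in> Ob" by blast
    then have "1 - a * x = m" by (simp add: algebra_simps)
    then show ?thesis using \<open>m \<in> M\<close> \<open>a \<in> Ob\<close> by auto
  qed
  have "x \<in> M \<or> y \<in> M" if xy: "x \<in> Ob" "y \<in> Ob" "x * y \<in> M" for x y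
  proof (rule ccontr)
    assume "\<not> (x \<in> M \<or> y \<in> M)"
    then obtain a where a: "a \<in> Ob" "1 - a * x \<in> M" using key xy by blast
    have "y * (1 - a * x) + a * (x * y) \<in> M" using idlD(3)[OF M(1) idlD(4)[OF M(1) xy(2) a(2)] idlD(4)[OF M(1) a(1) xy(3)]] .
    then have "y \<in> M" by (simp add: algebra_simps)
    then show False using \<open>\<not> (x \<in> M \<or> y \<in> M)\<close> by simp
  qed
  then have "primeO M" using M unfolding primeO_def by blast
  then show ?thesis using M by blast
qed

lemma exists_primeO_over: "prime p \<Longrightarrow> \<exists>Q. primeO Q \<and> of_nat p \<in> Q"
  using exists_primeO[OF idl_pO one_not_pO, of p] pO_I[OF one_mem, of p] by auto

lemma pO_sub: "primeO Q \<Longrightarrow> of_nat p \<in> Q \<Longrightarrow> pO p \<subseteq> Q"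
  using idlD(5)[of Q] by (auto simp: primeO_def pO_def)

lemma primeO_int_iff:
  assumes "primeO Q" "of_nat p \<in> Q" "prime p"
  shows "of_int n \<in> Q \<longleftrightarrow> int p dvd n"
proof
  assume n: "of_int n \<in> Q"
  show "int p dvd n"
  proof (rule ccontr)
    assume "\<not> int p dvd n"
    then have "coprime (int p) n" using assms(3) by (simp add: prime_imp_coprime)
    then obtain u v where "u * int p + v * n = 1" by (metis bezout_int coprime_iff_gcd_eq_1)
    then have "of_int u * of_nat p + of_int v * of_int n = (1::complex)" by (metis of_int_1 of_int_add of_int_mult of_int_of_nat_eq)
    moreover have "of_int u * of_nat p + of_int v * of_int n \<in> Q" using n assms primeO_idl by (intro idlD(3,4)) (auto simp: mem)
    ultimately show False using assms(1) by (simp add: primeO_def)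
  qed
next
  assume "int p dvd n"
  then show "of_int n \<in> Q" using pO_int_I pO_sub assms by blast
qed

lemma del_not_Q:
  assumes "primeO Q" "of_nat p \<in> Q" "prime p" "\<not> int p dvd Disc" "g \<in> Gal"
  shows "g del \<notin> Q"
proof
  assume d: "g del \<in> Q"
  obtain e where e: "e \<in> Ob" "of_int Disc = del * e" by (rule Disc_eq_del_mult)
  have "of_int Disc = g del * g e" using Gal_int[OF assms(5), of Disc] e Gal_mult[OF assms(5) del_mem e(1)] by simp
  then have "of_int Disc \<in> Q" using d e idlD(5)[OF primeO_idl[OF assms(1)]] Gal_mem[OF assms(5)] by simp
  then show False using primeO_int_iff[OF assms(1-3)] assms(4) by simp
qed

lemma del_cancel:
  assumes "prime p" "\<not> int p dvd Disc" "z \<in> Ob" "z * del \<in> pO p"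
  shows "z \<in> pO p"
proof -
  obtain e where e: "e \<in> Ob" "of_int Disc = del * e" by (rule Disc_eq_del_mult)
  have D: "z * of_int Disc \<in> pO p" using idlD(5)[OF idl_pO assms(4) e(1)] e(2) by (simp add: mult.assoc)
  have "coprime (int p) Disc" using assms by (simp add: prime_imp_coprime)
  then obtain u v where "u * int p + v * Disc = 1" by (metis bezout_int coprime_iff_gcd_eq_1)
  then have "of_int u * of_nat p + of_int v * of_int Disc = (1::complex)" by (metis of_int_1 of_int_add of_int_mult of_int_of_nat_eq)
  then have "z = z * (of_int u * of_nat p + of_int v * of_int Disc)" by simp
  also have "\<dots> = of_nat p * (z * of_int u) + of_int v * (z * of_int Disc)" by (simp add: algebra_simps)
  finally have z: "z = of_nat p * (z * of_int u) + of_int v * (z * of_int Disc)" .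
  have "of_nat p * (z * of_int u) + of_int v * (z * of_int Disc) \<in> pO p"
    by (intro idlD(3)[OF idl_pO] idlD(4)[OF idl_pO] D pO_I mem assms)
  then show ?thesis using z by simp
qed

text \<open>Exhibits the coefficients of \<open>W x\<close> as traces, since \<open>lag g\<close> is
  \<open>lag id\<close> with \<open>g\<close> applied to its coefficients. Modulo \<open>p\<close>,
  Frobenius powers pass through such sums.\<close>

lemma W_coeff: "x \<in> Ob \<Longrightarrow> Polynomial.coeff (W x) i = (\<Sum>g\<in>Gal. g (x * Polynomial.coeff (lag id) i))"
proof -
  assume x: "x \<in> Ob"
  have "Polynomial.coeff (W x) i = (\<Sum>g\<in>Gal. g x * Polynomial.coeff (lag g) i)"
    by (simp add: W_def coeff_sum)
  also have "\<dots> = (\<Sum>g\<in>Gal. g (x * Polynomial.coeff (lag id) i))"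
  proof (rule sum.cong[OF refl])
    fix g assume g: "g \<in> Gal"
    have "lag g = map_poly g (lag id)" using map_lag[OF g id_Gal] by simp
    then have "Polynomial.coeff (lag g) i = g (Polynomial.coeff (lag id) i)" by (simp add: coeff_map_poly Gal_zero[OF g])
    then show "g x * Polynomial.coeff (lag g) i = g (x * Polynomial.coeff (lag id) i)"
      using Gal_mult[OF g x] Opoly_lag[of id] by (simp add: Opoly_def)
  qed
  finally show ?thesis .
qed

lemma W_all_pO_imp:
  assumes "prime p" "\<not> int p dvd Disc" "z \<in> Ob" "\<And>i. Polynomial.coeff (W z) i \<in> pO p"
  shows "z \<in> pO p"
proof -
  have "poly (W z) gam \<in> pO p" using assms gam by (intro idl_poly[OF idl_pO]) auto
  then show ?thesis using W_gam[OF assms(3) id_Gal] assms by (auto intro: del_cancel)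
qed

text \<open>The residue ring modulo such a \<open>p\<close> has no nilpotents. A coefficient of
  \<open>W z\<close> is a trace; raised to the power \<open>p ^ n\<close> it becomes, modulo
  \<open>p\<close>, the trace of a multiple of \<open>z ^ (p ^ n)\<close>, which vanishes. Being a
  rational integer, the coefficient is itself divisible by \<open>p\<close>, and the coefficients of
  \<open>W z\<close> detect \<open>z\<close> modulo \<open>p\<close>.\<close>

lemma reduced:
  assumes p: "prime p" "\<not> int p dvd Disc" and z: "z \<in> Ob" and n: "z ^ n \<in> pO p"
  shows "z \<in> pO p"
proof -
  have np: "n < p ^ n" using prime_gt_1_nat[OF p(1)] power_gt_expt[of p n] by simp
  then have zp: "z ^ (p ^ n) \<in> pO p" using idlD(5)[OF idl_pO n, of "z ^ (p ^ n - n)"] z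
    by (simp add: power_add[symmetric] mem)
  show ?thesis
  proof (rule W_all_pO_imp[OF p z])
    fix i
    let ?e = "Polynomial.coeff (lag id) i" and ?c = "Polynomial.coeff (W z) i"
    have e: "?e \<in> Ob" using Opoly_lag by (simp add: Opoly_def)
    have 1: "?c ^ (p ^ n) - (\<Sum>g\<in>Gal. (g (z * ?e)) ^ (p ^ n)) \<in> pO p"
      unfolding W_coeff[OF z] using e z by (intro frob_sum_iter[OF p(1)]) (simp add: Gal_mem mult_mem)
    have 2: "(\<Sum>g\<in>Gal. (g (z * ?e)) ^ (p ^ n)) \<in> pO p"
    proof (rule idl_sum[OF idl_pO])
      fix g assume g: "g \<in> Gal"
      have "(g (z * ?e)) ^ (p ^ n) = g (z ^ (p ^ n) * ?e ^ (p ^ n))"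
        using Gal_power[OF g mult_mem[OF z e], of "p ^ n"] by (simp add: power_mult_distrib)
      then show "(g (z * ?e)) ^ (p ^ n) \<in> pO p"
        using Gal_pO[OF g idlD(5)[OF idl_pO zp power_mem[OF e]]] by simp
    qed
    have 3: "?c ^ (p ^ n) \<in> pO p" using idl_cong_mem[OF idl_pO 1] 2 by simp
    obtain m where m: "?c = of_int m" using W_Ints[OF z, of i] by (auto elim: Ints_cases)
    have "of_int (m ^ (p ^ n)) \<in> pO p" using 3 m by simp
    then have "int p dvd m ^ (p ^ n)" using p prime_gt_0_nat by (intro pO_int_D) auto
    then have "int p dvd m" using p by (meson prime_dvd_power prime_nat_int_transfer)
    then show "?c \<in> pO p" using m pO_int_I by simp
  qed
qed

definition cls :: "nat \<Rightarrow> complex \<Rightarrow> complex set" where "cls p x = {y \<in> Ob. y - x \<in> pO p}"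

lemma cls_eq_imp: "x \<in> Ob \<Longrightarrow> cls p x = cls p y \<Longrightarrow> x - y \<in> pO p"
  using idlD(2)[OF idl_pO] by (auto simp: cls_def set_eq_iff dest: spec[of _ x])

text \<open>The map \<open>\<kappa>\<close> records the coefficients of \<open>W x\<close> modulo
  \<open>p\<close>. It separates residue classes by \<open>W_all_pO_imp\<close>, and it takes
  finitely many values because the degree of \<open>W x\<close> is at most
  \<open>card Gal\<close>.\<close>

lemma finite_quotient:
  assumes p: "prime p" "\<not> int p dvd Disc"
  shows "finite (cls p ` Ob)"
proof -
  define D where "D = Suc (card Gal)"
  define \<kappa> where "\<kappa> x = map (\<lambda>i. \<lfloor>Re (Polynomial.coeff (W x) i)\<rfloor> mod int p) [0..<D]" for x
  have p0: "p > 0" using p prime_gt_0_nat by blast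
  have deg: "Polynomial.degree (W x) < D" for x
  proof -
    have "Polynomial.degree (lag g) \<le> card Gal" for g
    proof -
      have "Polynomial.degree (lag g) \<le> (\<Sum>h\<in>Gal - {g}. Polynomial.degree [:- h gam, 1:])"
        unfolding lag_def by (rule degree_prod_sum_le[unfolded comp_def]) (use finite_Gal in auto)
      also have "\<dots> = card (Gal - {g})" by simp
      also have "\<dots> \<le> card Gal" using finite_Gal by (intro card_mono) auto
      finally show ?thesis .
    qed
    then have "Polynomial.degree (W x) \<le> card Gal"
      unfolding W_def by (intro degree_sum_le finite_Gal order.trans[OF degree_smult_le])
    then show ?thesis by (simp add: D_def)
  qed
  have "\<kappa> ` Ob \<subseteq> {xs. set xs \<subseteq> {0..<int p} \<and> length xs = D}"
    using p0 by (auto simp: \<kappa>_def)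
  then have fin: "finite (\<kappa> ` Ob)" by (rule finite_subset) (intro finite_lists_length_eq, auto)
  have key: "x - y \<in> pO p" if xy: "x \<in> Ob" "y \<in> Ob" "\<kappa> x = \<kappa> y" for x y
  proof (rule W_all_pO_imp[OF p])
    show "x - y \<in> Ob" using xy mem by auto
    fix i
    have W: "Polynomial.coeff (W (x - y)) i = Polynomial.coeff (W x) i - Polynomial.coeff (W y) i"
      using xy by (auto simp: W_def coeff_sum Gal_diff algebra_simps sum_subtractf intro!: sum.cong)
    obtain m n where mn: "Polynomial.coeff (W x) i = of_int m" "Polynomial.coeff (W y) i = of_int n"
      using W_Ints[OF xy(1), of i] W_Ints[OF xy(2), of i] by (auto elim!: Ints_cases)
    show "Polynomial.coeff (W (x - y)) i \<in> pO p"
    proof (cases "i < D")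
      case True
      then have "\<kappa> x ! i = \<kappa> y ! i" "m mod int p = n mod int p" using xy mn by (auto simp: \<kappa>_def list_eq_iff_nth_eq)
      then have "int p dvd m - n" by (simp add: mod_eq_dvd_iff)
      then have "of_int (m - n) \<in> pO p" by (rule pO_int_I)
      then show ?thesis using W mn by simp
    next
      case False
      then have "Polynomial.coeff (W (x - y)) i = 0" using deg by (intro coeff_eq_0) (metis leI le_less_trans not_less)
      then show ?thesis using idlD(2)[OF idl_pO] by simp
    qed
  qed
  have "cls p x = cls p y" if xy: "x \<in> Ob" "y \<in> Ob" "\<kappa> x = \<kappa> y" for x y
    using key[OF xy] idl_cong_trans[OF idl_pO] idl_cong_sym[OF idl_pO] unfolding cls_def by blast
  then have "cls p ` Ob \<subseteq> (\<lambda>k. cls p (SOME x. x \<in> Ob \<and> \<kappa> x = k)) ` (\<kappa> ` Ob)"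
  proof -
    assume a: "\<And>x y. x \<in> Ob \<Longrightarrow> y \<in> Ob \<Longrightarrow> \<kappa> x = \<kappa> y \<Longrightarrow> cls p x = cls p y"
    show ?thesis
    proof
      fix c assume "c \<in> cls p ` Ob"
      then obtain x where x: "x \<in> Ob" "c = cls p x" by auto
      have s: "(SOME y. y \<in> Ob \<and> \<kappa> y = \<kappa> x) \<in> Ob \<and> \<kappa> (SOME y. y \<in> Ob \<and> \<kappa> y = \<kappa> x) = \<kappa> x"
        by (rule someI[of _ x]) (use x in auto)
      have "c = cls p (SOME y. y \<in> Ob \<and> \<kappa> y = \<kappa> x)" unfolding x(2) using s x by (intro a) auto
      then show "c \<in> (\<lambda>k. cls p (SOME x. x \<in> Ob \<and> \<kappa> x = k)) ` (\<kappa> ` Ob)" using x by blast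
    qed
  qed
  then show ?thesis by (rule finite_subset) (use fin in auto)
qed

text \<open>Finiteness makes two powers of \<open>x\<close> congruent, so
  \<open>x * (x ^ n - 1)\<close> is nilpotent modulo \<open>p\<close>, hence zero by
  \<open>reduced\<close>. For \<open>x\<close> in a prime \<open>Q\<close> above \<open>p\<close>
  the factor \<open>x ^ n - 1\<close> lies outside \<open>Q\<close>: this is how \<open>p\<close>
  acts as a uniformizer at \<open>Q\<close> without any localization.\<close>

lemma local_annihilator:
  assumes p: "prime p" "\<not> int p dvd Disc" and x: "x \<in> Ob"
  shows "\<exists>n>0. x * (x ^ n - 1) \<in> pO p"
proof -
  have "\<not> inj (\<lambda>i. cls p (x ^ i))"
  proof
    assume "inj (\<lambda>i. cls p (x ^ i))"
    moreover have "range (\<lambda>i. cls p (x ^ i)) \<subseteq> cls p ` Ob" using x mem by auto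
    ultimately have "finite (UNIV :: nat set)" using finite_quotient[OF p] by (meson finite_subset finite_imageD)
    then show False by simp
  qed
  then obtain i j where ij: "i < j" "cls p (x ^ i) = cls p (x ^ j)"
    unfolding inj_def by (metis linorder_neqE_nat)
  define n where "n = j - i"
  have n: "n > 0" "j = i + n" using ij by (auto simp: n_def)
  have 1: "x ^ j - x ^ i \<in> pO p" using cls_eq_imp[of "x ^ j" p "x ^ i"] ij x mem by auto
  have 2: "(x * (x ^ n - 1)) ^ Suc i = (x ^ j - x ^ i) * (x * (x ^ n - 1) ^ i)"
  proof -
    have "x ^ j - x ^ i = x ^ i * (x ^ n - 1)" by (simp add: n power_add algebra_simps)
    then show ?thesis by (simp only: power_mult_distrib power_Suc mult.assoc mult.commute mult.left_commute)
  qed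
  have "(x * (x ^ n - 1)) ^ Suc i \<in> pO p" unfolding 2 using x by (intro idlD(5)[OF idl_pO 1] mem)
  then have "x * (x ^ n - 1) \<in> pO p"
    using reduced[OF p mult_mem[OF x diff_mem[OF power_mem[OF x] one_mem]]] by blast
  then show ?thesis using n by blast
qed

lemma local_unif:
  assumes p: "prime p" "\<not> int p dvd Disc" and Q: "primeO Q" "of_nat p \<in> Q" and x: "x \<in> Q"
  shows "\<exists>s\<in>Ob - Q. s * x \<in> pO p"
proof -
  have xO: "x \<in> Ob" using x idlD(1)[OF primeO_idl[OF Q(1)]] by simp
  obtain n where n: "n > 0" "x * (x ^ n - 1) \<in> pO p" using local_annihilator[OF p xO] by blast
  have "x ^ n \<in> Q" using idl_power[OF primeO_idl[OF Q(1)] x n(1)] .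
  then have "x ^ n - 1 \<notin> Q" using idl_cong_mem[of Q "x ^ n" 1] Q(1) by (auto simp: primeO_def)
  then show ?thesis using n xO by (intro bexI[of _ "x ^ n - 1"]) (auto simp: mem mult.commute)
qed

text \<open>The elements of \<open>Q\<close>-adic valuation at least \<open>k\<close>, where \<open>p\<close> is unramified.\<close>

definition vQ :: "complex set \<Rightarrow> nat \<Rightarrow> nat \<Rightarrow> complex set" where
  "vQ Q p k = {x \<in> Ob. \<exists>s\<in>Ob - Q. s * x \<in> pO (p ^ k)}"

text \<open>Factors \<open>p\<close> are stripped one at a time: if \<open>n = p ^ j * m\<close>
  with \<open>j < k\<close>, cancelling \<open>p ^ j\<close> shows that \<open>s * m\<close> lies in
  \<open>Q\<close>; since \<open>s\<close> does not, \<open>p\<close> divides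
  \<open>m\<close>.\<close>

lemma vQ_int:
  assumes p: "prime p" and Q: "primeO Q" "of_nat p \<in> Q" and x: "of_int n \<in> vQ Q p k"
  shows "int p ^ k dvd n"
proof -
  have p0: "p > 0" using p prime_gt_0_nat by blast
  obtain s where s: "s \<in> Ob" "s \<notin> Q" "s * of_int n \<in> pO (p ^ k)" using x by (auto simp: vQ_def)
  have "int p ^ j dvd n" if "j \<le> k" for j using that
  proof (induction j)
    case (Suc j)
    then obtain m where m: "n = int p ^ j * m" by auto
    obtain z where z: "s * of_int n = of_nat (p ^ k) * z" "z \<in> Ob" using s by (auto simp: pO_def)
    have "p ^ k = p ^ j * p * p ^ (k - Suc j)" using Suc.prems by (simp flip: power_Suc power_add add: mult.commute[of _ p])
    then have "of_nat p ^ j * (s * of_int m) = of_nat p ^ j * (of_nat p * (of_nat (p ^ (k - Suc j)) * z))"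
      using z m by (simp add: algebra_simps)
    then have e: "s * of_int m = of_nat p * (of_nat (p ^ (k - Suc j)) * z)" using p0 by simp
    have "of_nat p * (of_nat (p ^ (k - Suc j)) * z) \<in> Q" using z Q(2) by (intro idlD(5)[OF primeO_idl[OF Q(1)]] mem)
    then have "of_int m \<in> Q" using e s Q(1) mem(11)[of m] unfolding primeO_def by metis
    then have "int p dvd m" using primeO_int_iff[OF Q p] by simp
    then show ?case using m by (simp add: mult_dvd_mono)
  qed auto
  then show ?thesis by simp
qed

lemma primeO_mult_not: "primeO Q \<Longrightarrow> x \<in> Ob - Q \<Longrightarrow> y \<in> Ob - Q \<Longrightarrow> x * y \<in> Ob - Q"
  by (auto simp: primeO_def mem)

text \<open>Valuations add up: \<open>local_unif\<close> gives for each factor in \<open>Q\<close> a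
  multiplier outside \<open>Q\<close> that turns it into a multiple of \<open>p\<close>, and the
  product of the multipliers stays outside \<open>Q\<close>.\<close>

lemma vQ_prod:
  assumes p: "prime p" "\<not> int p dvd Disc" and Q: "primeO Q" "of_nat p \<in> Q"
    and I: "finite I" "\<And>i. i \<in> I \<Longrightarrow> f i \<in> Ob" "J \<subseteq> I" "\<And>i. i \<in> J \<Longrightarrow> f i \<in> Q"
  shows "prod f I \<in> vQ Q p (card J)"
proof -
  have fJ: "finite J" using I finite_subset by blast
  have "\<exists>s\<in>Ob - Q. s * prod f J \<in> pO (p ^ card J)"
    using fJ I(4) I(3)
  proof (induction J rule: finite_induct)
    case empty
    show ?case using Q(1) one_mem pO_I[OF one_mem, of 1] by (intro bexI[of _ 1]) (auto simp: primeO_def)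
  next
    case (insert a J)
    obtain s where s: "s \<in> Ob - Q" "s * prod f J \<in> pO (p ^ card J)" using insert by auto
    obtain t where t: "t \<in> Ob - Q" "t * f a \<in> pO p" using local_unif[OF p Q, of "f a"] insert by auto
    obtain u where u: "s * prod f J = of_nat (p ^ card J) * u" "u \<in> Ob" using s by (auto simp: pO_def)
    obtain v where v: "t * f a = of_nat p * v" "v \<in> Ob" using t by (auto simp: pO_def)
    have "(s * t) * prod f (insert a J) = (t * f a) * (s * prod f J)" using insert by (simp add: algebra_simps)
    also have "\<dots> = of_nat (p ^ card (insert a J)) * (u * v)" unfolding u v using insert by (simp add: algebra_simps)
    finally have "(s * t) * prod f (insert a J) \<in> pO (p ^ card (insert a J))" using u v by (simp add: pO_I mem del: of_nat_power)
    then show ?case using primeO_mult_not[OF Q(1) s(1) t(1)] by blast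
  qed
  then obtain s where s: "s \<in> Ob - Q" "s * prod f J \<in> pO (p ^ card J)" by blast
  have "s * prod f I = (s * prod f J) * prod f (I - J)" using prod.subset_diff[OF I(3,1), of f] by (simp add: algebra_simps)
  moreover have "(s * prod f J) * prod f (I - J) \<in> pO (p ^ card J)" using s I(2) by (intro idlD(5)[OF idl_pO s(2)] prod_mem) auto
  ultimately have "s * prod f I \<in> pO (p ^ card J)" by (simp only:)
  then show ?thesis using s I by (auto simp: vQ_def mem)
qed

section \<open>Frobenius elements and residues\<close>

text \<open>The minimal polynomial \<open>m\<close> of \<open>gam\<close> has integer coefficients,
  so its value at \<open>gam ^ p\<close> is congruent to the \<open>p\<close>-th power of its value
  at \<open>gam\<close>, which is 0. Hence one linear factor of that value lies in \<open>Q\<close>,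
  and this singles out \<open>\<phi>\<close>. The congruence spreads from \<open>gam\<close> to
  \<open>x * del\<close> through the integral polynomial \<open>W x\<close>, and \<open>del\<close>
  is then cancelled because it is not in \<open>Q\<close>.\<close>

lemma exists_Frobenius:
  assumes p: "prime p" "\<not> int p dvd Disc" and Q: "primeO Q" "of_nat p \<in> Q"
  shows "\<exists>\<phi>\<in>Gal. \<forall>x\<in>Ob. x ^ p - \<phi> x \<in> Q"
proof -
  have QI: "idl Q" by (rule primeO_idl[OF Q(1)])
  define m where "m = (\<Prod>g\<in>Gal. [:- g gam, 1:])"
  have Om: "Opoly m" unfolding m_def by (rule Opoly_prod, rule Opoly_lin, rule gam_mem)
  have "map_poly g m = m" if g: "g \<in> Gal" for g
  proof -
    have "map_poly g m = (\<Prod>h\<in>Gal. [:- (g \<circ> h) gam, 1:])" unfolding m_def using g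
      by (subst map_poly_Gal_prod) (auto intro!: prod.cong Opoly_lin simp: map_poly_Gal_lin gam_mem)
    also have "\<dots> = m" unfolding m_def by (rule prod.reindex_bij_betw[OF Gal_bij_betw_comp[OF g], of "\<lambda>h. [:- h gam, 1:]"])
    finally show ?thesis .
  qed
  then have mI: "Polynomial.coeff m i \<in> \<int>" for i using Om by (intro Opoly_fixed_Ints)
  have "poly m gam = 0" unfolding m_def poly_prod using finite_Gal id_Gal by (intro prod_zero) (auto intro!: bexI[of _ id])
  then have "- poly m (gam ^ p) \<in> Q" using frob_poly[OF p(1) mI gam(1)] pO_sub[OF Q] prime_gt_0_nat[OF p(1)] by (auto simp: power_0_left)
  then have "poly m (gam ^ p) \<in> Q" using idl_minus[OF QI, of "- poly m (gam ^ p)"] by simp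
  then have "(\<Prod>g\<in>Gal. gam ^ p - g gam) \<in> Q" by (simp add: m_def poly_prod)
  then obtain \<phi> where \<phi>: "\<phi> \<in> Gal" "gam ^ p - \<phi> gam \<in> Q"
    using primeO_prod[OF Q(1), of Gal "\<lambda>g. gam ^ p - g gam"] gam gam_mem by (auto simp: mem)
  have key: "(x * del) ^ p - \<phi> (x * del) \<in> Q" if x: "x \<in> Ob" for x
  proof -
    have 1: "poly (W x) gam ^ p - poly (W x) (gam ^ p) \<in> Q" using frob_poly[OF p(1) W_Ints[OF x] gam(1)] pO_sub[OF Q] by auto
    have 2: "poly (W x) (gam ^ p) - poly (W x) (\<phi> gam) \<in> Q"
      by (rule idl_cong_poly[OF QI Opoly_W[OF x] _ _ \<phi>(2)]) (use gam gam_mem \<phi> in \<open>auto simp: mem\<close>)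
    show ?thesis using idl_cong_trans[OF QI 1 2] W_gam[OF x id_Gal] W_gam[OF x \<phi>(1)] by simp
  qed
  have d: "del ^ p - \<phi> del \<in> Q" using key[OF one_mem] by simp
  have dn: "del ^ p \<notin> Q" using primeO_power[OF Q(1) del_mem] del_not_Q[OF Q p id_Gal] by auto
  have "x ^ p - \<phi> x \<in> Q" if x: "x \<in> Ob" for x
  proof -
    have px: "\<phi> x \<in> Ob" "\<phi> del \<in> Ob" using Gal_mem[OF \<phi>(1)] x del_mem by auto
    have 1: "x ^ p * del ^ p - \<phi> x * \<phi> del \<in> Q" using key[OF x] Gal_mult[OF \<phi>(1) x del_mem] by (simp add: power_mult_distrib)
    have 2: "\<phi> x * \<phi> del - \<phi> x * del ^ p \<in> Q" using idl_cong_mult[OF QI _ idl_cong_sym[OF QI d], of "\<phi> x" "\<phi> x"] idlD(2)[OF QI] px del_mem by (simp add: mem)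
    have "(x ^ p - \<phi> x) * del ^ p \<in> Q" using idl_cong_trans[OF QI 1 2] by (simp add: algebra_simps)
    then show ?thesis using dn Q(1) x px del_mem unfolding primeO_def by (meson mem)
  qed
  then show ?thesis using \<phi> by blast
qed

lemma Opoly_synthetic_div: "Opoly q \<Longrightarrow> c \<in> Ob \<Longrightarrow> Opoly (synthetic_div q c)"
proof (induction q)
  case (pCons a q)
  have c: "Polynomial.coeff (pCons a q) i \<in> Ob" for i using pCons.prems(1) by (simp add: Opoly_def)
  have q: "Opoly q" using c[of "Suc _"] by (auto simp: Opoly_def)
  then show ?case using pCons poly_mem[OF q] by (auto simp: Opoly_def coeff_pCons split: nat.splits)
qed (simp add: Opoly_0)

text \<open>Modulo a prime \<open>Q\<close> above \<open>p\<close> the polynomial \<open>X\<^sup>p - X\<close> splits into the factors \<open>X - r\<close> with \<open>0 \<le> r < p\<close>.\<close>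

lemma exists_residue:
  assumes p: "prime p" and Q: "primeO Q" "of_nat p \<in> Q" and y: "y \<in> Ob" "y ^ p - y \<in> Q"
  shows "\<exists>r<p. y - of_nat r \<in> Q"
proof -
  have QI: "idl Q" by (rule primeO_idl[OF Q(1)])
  have p1: "p > 1" using p prime_gt_1_nat by blast
  \<comment> \<open>The quotient after dividing off the first \<open>n\<close> linear factors. The
    remainder at \<open>n\<close> lies in \<open>Q\<close> because \<open>n\<close> is a root of
    \<open>X ^ p - X\<close> modulo \<open>Q\<close> while the earlier factors do not vanish there.
    Keeping the quotient monic of degree \<open>p - n\<close> makes it 1 at the end.\<close>
  have main: "\<exists>q. Opoly q \<and> Polynomial.degree q = p - n \<and> Polynomial.coeff q (p - n) = 1 \<and>
      (\<forall>y\<in>Ob. (y ^ p - y) - (\<Prod>r<n. y - of_nat r) * poly q y \<in> Q)" if "n \<le> p" for n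
    using that
  proof (induction n)
    case 0
    have d: "Polynomial.degree (Polynomial.monom 1 p - [:0, 1::complex:]) = p"
      using p1 by (subst diff_conv_add_uminus, subst degree_add_eq_left) (auto simp: degree_monom_eq)
    have "Opoly (Polynomial.monom 1 p - [:0, 1:])"
      by (rule Opoly_diff) (auto simp: Opoly_def mem coeff_pCons split: nat.splits)
    moreover have "Polynomial.coeff (Polynomial.monom 1 p - [:0, 1::complex:]) (p - 0) = 1"
      using p1 by (simp add: coeff_pCons split: nat.splits)
    moreover have "\<forall>y\<in>Ob. (y ^ p - y) - (\<Prod>r<0::nat. y - of_nat r) * poly (Polynomial.monom 1 p - [:0, 1:]) y \<in> Q"
      using idlD(2)[OF QI] by (simp add: poly_monom)
    ultimately show ?case using d by (intro exI[of _ "Polynomial.monom 1 p - [:0, 1:]"]) simp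
  next
    case (Suc n)
    then obtain q where q: "Opoly q" "Polynomial.degree q = p - n" "Polynomial.coeff q (p - n) = 1"
      "\<And>y. y \<in> Ob \<Longrightarrow> (y ^ p - y) - (\<Prod>r<n. y - of_nat r) * poly q y \<in> Q" by auto
    let ?s = "synthetic_div q (of_nat n)"
    have e: "q = [:- of_nat n, 1:] * ?s + [:poly q (of_nat n):]" by (rule synthetic_div_correct'[symmetric])
    have "of_nat n ^ p - of_nat n \<in> Q" using frob_int[OF p, of "int n"] pO_sub[OF Q] by auto
    then have "(\<Prod>r<n. of_nat n - of_nat r) * poly q (of_nat n) \<in> Q"
      using idl_cong_mem[OF QI q(4)[OF nat_mem[of n]]] by simp
    moreover have "(\<Prod>r<n. of_nat n - of_nat r :: complex) \<notin> Q"
    proof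
      assume "(\<Prod>r<n. of_nat n - of_nat r :: complex) \<in> Q"
      then obtain r where r: "r < n" "of_nat n - of_nat r \<in> Q" using primeO_prod[OF Q(1), of "{..<n}" "\<lambda>r. of_nat n - of_nat r"] by (auto simp: mem)
      then have "of_int (int (n - r)) \<in> Q" by (simp add: of_nat_diff)
      then have "int p dvd int (n - r)" using primeO_int_iff[OF Q p] by blast
      then have "p dvd n - r" by (simp only: int_dvd_int_iff)
      then show False using r Suc.prems by (auto dest: dvd_imp_le)
    qed
    ultimately have qn: "poly q (of_nat n) \<in> Q" using Q(1) q(1) poly_mem[OF q(1) nat_mem] unfolding primeO_def by (meson mem)
    have ds: "Polynomial.degree ?s = p - Suc n" using q by (simp add: degree_synthetic_div)
    have pn: "p - n = Suc (p - Suc n)" using Suc.prems by simp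
    have "Polynomial.coeff q (p - n) = Polynomial.coeff ([:- of_nat n, 1:] * ?s) (p - n)"
      by (subst e) (simp add: pn)
    also have "\<dots> = Polynomial.coeff ?s (p - Suc n) - of_nat n * Polynomial.coeff ?s (p - n)" by (simp add: pn)
    also have "Polynomial.coeff ?s (p - n) = 0" using ds pn by (intro coeff_eq_0) simp
    finally have lc: "Polynomial.coeff ?s (p - Suc n) = 1" using q by simp
    have "(y ^ p - y) - (\<Prod>r<Suc n. y - of_nat r) * poly ?s y \<in> Q" if y: "y \<in> Ob" for y
    proof -
      have py: "poly q y = (y - of_nat n) * poly ?s y + poly q (of_nat n)" by (subst e) (simp add: algebra_simps)
      have "(y ^ p - y) - (\<Prod>r<Suc n. y - of_nat r) * poly ?s y =
        ((y ^ p - y) - (\<Prod>r<n. y - of_nat r) * poly q y) + (\<Prod>r<n. y - of_nat r) * poly q (of_nat n)"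
        unfolding py by (simp add: algebra_simps)
      also have "\<dots> \<in> Q" using q(4)[OF y] qn y by (intro idlD(3)[OF QI] idlD(4)[OF QI]) (auto intro!: mem)
      finally show ?thesis .
    qed
    then show ?case using ds lc Opoly_synthetic_div[OF q(1) nat_mem] by blast
  qed
  from main[of p] obtain q where q: "Polynomial.degree q = 0" "Polynomial.coeff q 0 = 1"
    "\<And>y. y \<in> Ob \<Longrightarrow> (y ^ p - y) - (\<Prod>r<p. y - of_nat r) * poly q y \<in> Q" by auto
  have "q = 1" using q(1,2) by (metis degree_0_id one_pCons)
  then have "(\<Prod>r<p. y - of_nat r) \<in> Q" using idl_cong_mem[OF QI q(3)[OF y(1)]] y(2) by simp
  then show ?thesis using primeO_prod[OF Q(1), of "{..<p}" "\<lambda>r. y - of_nat r"] y by (auto simp: mem)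
qed

text \<open>One prime above each \<open>p\<close> is fixed, together with its Frobenius. Other
  primes of the big field do not enter the counting: instead of moving the prime by an automorphism,
  the element is moved to a conjugate.\<close>

definition QQ :: "nat \<Rightarrow> complex set" where "QQ p = (SOME Q. primeO Q \<and> of_nat p \<in> Q)"
definition frob :: "nat \<Rightarrow> complex \<Rightarrow> complex" where
  "frob p = (SOME \<phi>. \<phi> \<in> Gal \<and> (\<forall>x\<in>Ob. x ^ p - \<phi> x \<in> QQ p))"

lemma QQ: assumes "prime p" shows "primeO (QQ p)" "of_nat p \<in> QQ p" "idl (QQ p)"
  using someI_ex[OF exists_primeO_over[OF assms]] unfolding QQ_def by (auto intro: primeO_idl)

lemma frob:
  assumes "prime p" "\<not> int p dvd Disc"
  shows "frob p \<in> Gal" "x \<in> Ob \<Longrightarrow> x ^ p - frob p x \<in> QQ p"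
proof -
  have "\<exists>\<phi>. \<phi> \<in> Gal \<and> (\<forall>x\<in>Ob. x ^ p - \<phi> x \<in> QQ p)"
    using exists_Frobenius[OF assms QQ(1,2)[OF assms(1)]] by blast
  from someI_ex[OF this] show "frob p \<in> Gal" "x \<in> Ob \<Longrightarrow> x ^ p - frob p x \<in> QQ p"
    unfolding frob_def by auto
qed

lemma not_dvd_Disc: "nat \<bar>Disc\<bar> < p \<Longrightarrow> \<not> int p dvd Disc"
  using Disc_nz dvd_imp_le_int[of Disc "int p"] by auto

end

lemma prod_prime_powers_dvd:
  fixes n :: int and k :: "nat \<Rightarrow> nat"
  assumes "finite P" "\<And>p. p \<in> P \<Longrightarrow> prime p" "\<And>p. p \<in> P \<Longrightarrow> int p ^ k p dvd n"
  shows "(\<Prod>p\<in>P. int p ^ k p) dvd n"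
  using assms
proof (induction P rule: finite_induct)
  case (insert q P)
  have "coprime (int q ^ k q) (\<Prod>p\<in>P. int p ^ k p)"
  proof (rule prod_coprime_right)
    fix p assume p: "p \<in> P"
    then have "coprime q p" using insert by (intro primes_coprime) auto
    then show "coprime (int q ^ k q) (int p ^ k p)" by simp
  qed
  then show ?case using insert by (auto intro: divides_mult)
qed auto

section \<open>Counting products of degree-one primes\<close>

locale orbit_element = galois_ring +
  fixes eta :: complex
  assumes eta: "eta \<in> Ob"
begin

definition Xi :: "complex set" where "Xi = (\<lambda>g. g eta) ` Gal"
definition dg :: nat where "dg = card Xi"
text \<open>A vector \<open>b\<close> is an integer polynomial of degree below \<open>dg\<close>, so
  \<open>ev b eta\<close> runs through the order generated by \<open>eta\<close>, and
  \<open>Nz\<close> is its norm form in \<open>dg\<close> variables.\<close>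

definition ev :: "(nat \<Rightarrow> int) \<Rightarrow> complex \<Rightarrow> complex" where "ev b \<xi> = (\<Sum>i<dg. of_int (b i) * \<xi> ^ i)"
definition Nz :: "(nat \<Rightarrow> int) \<Rightarrow> int" where "Nz b = (THE n. of_int n = (\<Prod>\<xi>\<in>Xi. ev b \<xi>))"

lemma finite_Xi: "finite Xi" unfolding Xi_def using finite_Gal by simp
lemma eta_Xi: "eta \<in> Xi" unfolding Xi_def by (rule image_eqI[of _ _ id]) (auto simp: id_Gal)
lemma dg_pos: "dg > 0" unfolding dg_def using finite_Xi eta_Xi card_gt_0_iff by blast
lemma Xi_mem: "\<xi> \<in> Xi \<Longrightarrow> \<xi> \<in> Ob" unfolding Xi_def using eta Gal_mem by auto
lemma Gal_Xi: "g \<in> Gal \<Longrightarrow> \<xi> \<in> Xi \<Longrightarrow> g \<xi> \<in> Xi"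
proof -
  assume g: "g \<in> Gal" and "\<xi> \<in> Xi"
  then obtain h where h: "h \<in> Gal" "\<xi> = h eta" by (auto simp: Xi_def)
  have "g \<xi> = (g \<circ> h) eta" using h by simp
  then show ?thesis unfolding Xi_def using comp_Gal[OF g h(1)] by blast
qed
lemma Gal_Xi_bij: "g \<in> Gal \<Longrightarrow> bij_betw g Xi Xi"
proof -
  assume g: "g \<in> Gal"
  obtain h where h: "h \<in> Gal" "\<And>x. h (g x) = x" "\<And>x. g (h x) = x" using Gal_inv[OF g] by metis
  show ?thesis by (rule bij_betw_byWitness[of _ h]) (use g h Gal_Xi in auto)
qed
lemma Gal_Xi_trans: "\<xi> \<in> Xi \<Longrightarrow> \<xi>' \<in> Xi \<Longrightarrow> \<exists>g\<in>Gal. g \<xi> = \<xi>'"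
proof -
  assume "\<xi> \<in> Xi" "\<xi>' \<in> Xi"
  then obtain g h where gh: "g \<in> Gal" "h \<in> Gal" "\<xi> = g eta" "\<xi>' = h eta" by (auto simp: Xi_def)
  obtain k where k: "k \<in> Gal" "\<And>x. k (g x) = x" using Gal_inv[OF gh(1)] by metis
  have "(h \<circ> k) \<xi> = \<xi>'" using gh k by simp
  then show ?thesis using comp_Gal[OF gh(2) k(1)] by blast
qed

lemma ev_mem: "\<xi> \<in> Xi \<Longrightarrow> ev b \<xi> \<in> Ob"
  unfolding ev_def by (intro sum_mem mult_mem int_mem power_mem Xi_mem)

lemma Gal_ev: "g \<in> Gal \<Longrightarrow> \<xi> \<in> Xi \<Longrightarrow> g (ev b \<xi>) = ev b (g \<xi>)"
proof -
  assume g: "g \<in> Gal" and x: "\<xi> \<in> Xi"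
  have xO: "\<xi> \<in> Ob" by (rule Xi_mem[OF x])
  have "g (ev b \<xi>) = (\<Sum>i<dg. g (of_int (b i) * \<xi> ^ i))" unfolding ev_def
    by (rule Gal_sum[OF g]) (intro mem xO)
  also have "\<dots> = ev b (g \<xi>)" unfolding ev_def
    by (rule sum.cong[OF refl]) (simp add: Gal_mult[OF g] Gal_int[OF g] Gal_power[OF g xO] mem xO)
  finally show ?thesis .
qed

lemma ev_diff: "ev (\<lambda>i. b i - c i) \<xi> = ev b \<xi> - ev c \<xi>"
  by (simp add: ev_def algebra_simps sum_subtractf)
lemma ev_cong: "(\<And>i. i < dg \<Longrightarrow> b i = c i) \<Longrightarrow> ev b \<xi> = ev c \<xi>"
  by (auto simp: ev_def)

lemma Nz: "of_int (Nz b) = (\<Prod>\<xi>\<in>Xi. ev b \<xi>)"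
proof -
  have "(\<Prod>\<xi>\<in>Xi. ev b \<xi>) \<in> \<int>"
  proof (rule Gal_fixed)
    show "(\<Prod>\<xi>\<in>Xi. ev b \<xi>) \<in> Ob" by (intro prod_mem ev_mem)
    fix g assume g: "g \<in> Gal"
    have "g (\<Prod>\<xi>\<in>Xi. ev b \<xi>) = (\<Prod>\<xi>\<in>Xi. ev b (g \<xi>))" using g by (simp add: Gal_prod ev_mem Gal_ev)
    also have "\<dots> = (\<Prod>\<xi>\<in>Xi. ev b \<xi>)" by (rule prod.reindex_bij_betw[OF Gal_Xi_bij[OF g]])
    finally show "g (\<Prod>\<xi>\<in>Xi. ev b \<xi>) = (\<Prod>\<xi>\<in>Xi. ev b \<xi>)" .
  qed
  then obtain n where n: "(\<Prod>\<xi>\<in>Xi. ev b \<xi>) = of_int n" by (auto elim: Ints_cases)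
  show ?thesis unfolding Nz_def n by (rule theI[of _ n]) auto
qed

lemma Nz_abs: "real_of_int \<bar>Nz b\<bar> = (\<Prod>\<xi>\<in>Xi. norm (ev b \<xi>))"
proof -
  have "real_of_int \<bar>Nz b\<bar> = norm (of_int (Nz b) :: complex)" by simp
  also have "\<dots> = (\<Prod>\<xi>\<in>Xi. norm (ev b \<xi>))" unfolding Nz by (simp add: prod_norm)
  finally show ?thesis .
qed

text \<open>A vanishing norm kills one conjugate and, by transitivity, all \<open>dg\<close> of
  them; a nonzero polynomial of degree below \<open>dg\<close> has fewer roots.\<close>

lemma Nz_nz: assumes "i < dg" "b i \<noteq> 0" shows "Nz b \<noteq> 0"
proof
  assume "Nz b = 0"
  then have "(\<Prod>\<xi>\<in>Xi. ev b \<xi>) = 0" using Nz[of b] by simp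
  then obtain \<xi> where x: "\<xi> \<in> Xi" "ev b \<xi> = 0" using finite_Xi by auto
  have all: "ev b \<xi>' = 0" if "\<xi>' \<in> Xi" for \<xi>'
  proof -
    obtain g where "g \<in> Gal" "g \<xi> = \<xi>'" using Gal_Xi_trans[OF x(1) \<open>\<xi>' \<in> Xi\<close>] by auto
    then show ?thesis using Gal_ev[of g \<xi> b] x Gal_zero[of g] by auto
  qed
  define q where "q = (\<Sum>i<dg. Polynomial.monom (complex_of_int (b i)) i)"
  have pq: "poly q y = ev b y" for y by (simp add: q_def ev_def poly_sum poly_monom)
  have cq: "Polynomial.coeff q i = of_int (b i)" using assms by (simp add: q_def coeff_sum)
  then have q0: "q \<noteq> 0" using assms by auto
  have "Polynomial.degree q < dg" unfolding q_def
    using dg_pos by (intro degree_sum_less) (auto intro: le_less_trans[OF degree_monom_le])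
  moreover have "dg \<le> card {x. poly q x = 0}" unfolding dg_def
    using q0 all pq by (intro card_mono poly_roots_finite) auto
  ultimately show False using card_poly_roots_bound[OF q0] by simp
qed

text \<open>\<open>AA\<close> bounds all conjugates of polynomials with coefficients at most 1 in
  absolute value, and \<open>CC\<close> bounds the norm form there; by homogeneity a box of size
  \<open>t\<close> costs a further factor \<open>t ^ dg\<close>.\<close>

definition AA :: nat where "AA = nat \<lceil>1 + (\<Sum>\<xi>\<in>Xi. \<Sum>i<dg. norm \<xi> ^ i)\<rceil>"
definition CC :: nat where "CC = AA ^ dg"

lemma AA: "\<xi> \<in> Xi \<Longrightarrow> (\<Sum>i<dg. norm \<xi> ^ i) \<le> real AA" "AA > 0"
proof -
  have nn: "(\<Sum>\<xi>\<in>Xi. \<Sum>i<dg. norm \<xi> ^ i) \<ge> 0" by (intro sum_nonneg) auto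
  then have 1: "real AA \<ge> 1 + (\<Sum>\<xi>\<in>Xi. \<Sum>i<dg. norm \<xi> ^ i)" unfolding AA_def by linarith
  then show "AA > 0" using nn by (metis add_nonneg_pos add.commute le_less_trans not_less of_nat_0_less_iff zero_less_one less_le_trans)
  assume "\<xi> \<in> Xi"
  then have "(\<Sum>i<dg. norm \<xi> ^ i) \<le> (\<Sum>\<xi>\<in>Xi. \<Sum>i<dg. norm \<xi> ^ i)"
    using finite_Xi by (intro member_le_sum) (auto intro!: sum_nonneg)
  then show "(\<Sum>i<dg. norm \<xi> ^ i) \<le> real AA" using 1 by simp
qed

lemma CC_pos: "CC > 0" using AA(2) by (simp add: CC_def)

lemma ev_bound:
  assumes "\<xi> \<in> Xi" "\<And>i. i < dg \<Longrightarrow> \<bar>b i\<bar> \<le> int t"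
  shows "norm (ev b \<xi>) \<le> real t * real AA"
proof -
  have "norm (ev b \<xi>) \<le> (\<Sum>i<dg. norm (of_int (b i) * \<xi> ^ i))" unfolding ev_def by (rule norm_sum)
  also have "\<dots> \<le> (\<Sum>i<dg. real t * norm \<xi> ^ i)"
  proof (rule sum_mono)
    fix i assume "i \<in> {..<dg}"
    then have "\<bar>b i\<bar> \<le> int t" using assms by auto
    then have "real_of_int \<bar>b i\<bar> \<le> real t" by linarith
    then have "norm (of_int (b i) :: complex) \<le> real t" by simp
    then show "norm (of_int (b i) * \<xi> ^ i) \<le> real t * norm \<xi> ^ i" by (simp only: norm_mult norm_power) (intro mult_right_mono, auto)
  qed
  also have "\<dots> = real t * (\<Sum>i<dg. norm \<xi> ^ i)" by (simp add: sum_distrib_left)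
  also have "\<dots> \<le> real t * real AA" using AA(1)[OF assms(1)] by (intro mult_left_mono) auto
  finally show ?thesis .
qed

lemma Nz_bound:
  assumes "\<And>i. i < dg \<Longrightarrow> \<bar>b i\<bar> \<le> int t"
  shows "nat \<bar>Nz b\<bar> \<le> CC * t ^ dg"
proof -
  have "real_of_int \<bar>Nz b\<bar> \<le> (\<Prod>\<xi>\<in>Xi. real t * real AA)" unfolding Nz_abs
    using assms by (intro prod_mono conjI ev_bound) auto
  also have "\<dots> = real (CC * t ^ dg)" by (simp add: CC_def dg_def[symmetric] power_mult_distrib mult.commute)
  finally have "real_of_int \<bar>Nz b\<bar> \<le> real_of_int (int (CC * t ^ dg))" by simp
  then show ?thesis unfolding of_int_le_iff by linarith
qed

text \<open>A pair \<open>(p, \<xi>)\<close> in \<open>PP p0\<close> stands for the degree-one prime above \<open>p\<close> of the field generated by \<open>eta\<close>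
  that is the preimage of \<open>QQ p\<close> under \<open>eta \<mapsto> \<xi>\<close>; finite sets of pairs stand for squarefree ideals,
  with norm \<open>NA\<close>, and \<open>TT p0 b\<close> is the part of the factorization of \<open>ev b eta\<close> that is visible to \<open>PP p0\<close>.\<close>

definition PP :: "nat \<Rightarrow> (nat \<times> complex) set" where
  "PP p0 = {(p, \<xi>). prime p \<and> p0 < p \<and> \<xi> \<in> Xi \<and> frob p \<xi> = \<xi>}"

definition NA :: "(nat \<times> complex) set \<Rightarrow> nat" where "NA A = prod fst A"

definition TT :: "nat \<Rightarrow> (nat \<Rightarrow> int) \<Rightarrow> (nat \<times> complex) set" where
  "TT p0 b = {(p, \<xi>) \<in> PP p0. ev b \<xi> \<in> QQ p}"

definition FA :: "nat \<Rightarrow> nat \<Rightarrow> (nat \<times> complex) set set" where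
  "FA p0 x = {A. finite A \<and> A \<subseteq> PP p0 \<and> NA A \<le> x}"

lemma NA_pos: "A \<subseteq> PP p0 \<Longrightarrow> NA A > 0"
  unfolding NA_def by (intro prod_pos) (auto simp: PP_def prime_gt_0_nat)

text \<open>For fixed \<open>p\<close> the \<open>k p\<close> pairs of \<open>A\<close> above it
  give \<open>k p\<close> different conjugates in \<open>QQ p\<close>, so by \<open>vQ_prod\<close>
  the norm has valuation at least \<open>k p\<close>; powers of different primes are then combined.
  The bound on \<open>p0\<close> keeps all these primes away from \<open>Disc\<close>.\<close>

lemma NA_dvd:
  assumes p0: "nat \<bar>Disc\<bar> \<le> p0" and A: "finite A" "A \<subseteq> TT p0 b"
  shows "int (NA A) dvd Nz b"
proof -
  define k where "k p = card {\<xi>. (p, \<xi>) \<in> A}" for p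
  have AP: "A \<subseteq> PP p0" using A by (auto simp: TT_def)
  have ASig: "A = (SIGMA p:fst ` A. {\<xi>. (p, \<xi>) \<in> A})" by force
  have fin: "finite {\<xi>. (p, \<xi>) \<in> A}" for p
    by (rule finite_subset[of _ "snd ` A"]) (use A in force)+
  have "NA A = (\<Prod>(p,\<xi>)\<in>(SIGMA p:fst ` A. {\<xi>. (p, \<xi>) \<in> A}). p)"
    unfolding NA_def by (subst ASig) (auto intro: prod.cong)
  also have "\<dots> = (\<Prod>p\<in>fst ` A. \<Prod>\<xi>\<in>{\<xi>. (p, \<xi>) \<in> A}. p)"
    using A fin by (subst prod.Sigma) auto
  also have "\<dots> = (\<Prod>p\<in>fst ` A. p ^ k p)" by (simp add: k_def)
  finally have NA: "int (NA A) = (\<Prod>p\<in>fst ` A. int p ^ k p)" by simp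
  have "int p ^ k p dvd Nz b" if p: "p \<in> fst ` A" for p
  proof -
    have pp: "prime p" "p0 < p" using p AP by (auto simp: PP_def)
    have nd: "\<not> int p dvd Disc" using pp p0 by (intro not_dvd_Disc) auto
    have "(\<Prod>\<xi>\<in>Xi. ev b \<xi>) \<in> vQ (QQ p) p (card {\<xi>. (p, \<xi>) \<in> A})"
      by (rule vQ_prod[OF pp(1) nd QQ(1,2)[OF pp(1)] finite_Xi ev_mem])
         (use A in \<open>auto simp: TT_def PP_def\<close>)
    then have "of_int (Nz b) \<in> vQ (QQ p) p (k p)" by (simp add: Nz k_def)
    then show ?thesis by (rule vQ_int[OF pp(1) QQ(1,2)[OF pp(1)]])
  qed
  then show ?thesis unfolding NA using A AP
    by (intro prod_prime_powers_dvd) (auto simp: PP_def)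
qed

lemma finite_TT:
  assumes p0: "nat \<bar>Disc\<bar> \<le> p0" and b: "Nz b \<noteq> 0"
  shows "finite (TT p0 b)"
proof -
  have "TT p0 b \<subseteq> {..nat \<bar>Nz b\<bar>} \<times> Xi"
  proof
    fix a assume a: "a \<in> TT p0 b"
    obtain p \<xi> where p: "a = (p, \<xi>)" by (cases a)
    have "int (NA {a}) dvd Nz b" using a by (intro NA_dvd[OF p0]) auto
    then have "int p dvd Nz b" by (simp add: NA_def p)
    then have "int p \<le> \<bar>Nz b\<bar>" using b by (metis abs_dvd_iff abs_ge_zero dvd_abs_iff dvd_imp_le_int abs_of_nat)
    then show "a \<in> {..nat \<bar>Nz b\<bar>} \<times> Xi" using a p by (auto simp: TT_def PP_def)
  qed
  then show ?thesis by (rule finite_subset) (use finite_Xi in auto)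
qed

text \<open>Pigeonhole: a conjugate fixed by \<open>frob p\<close> makes \<open>ev b \<xi>\<close>
  congruent to some residue \<open>r < p\<close>, so at most \<open>NA A\<close> residue vectors
  face \<open>(s + 1) ^ dg\<close> polynomials with coefficients from 0 to \<open>s\<close>. The
  difference of two that collide is nonzero and lies in all primes of \<open>A\<close>.\<close>

lemma exists_small_multiple:
  assumes p0: "nat \<bar>Disc\<bar> \<le> p0" and A: "finite A" "A \<subseteq> PP p0" and s: "NA A < (s + 1) ^ dg"
  shows "\<exists>b\<in>{..<dg} \<rightarrow>\<^sub>E {- int s..int s}. Nz b \<noteq> 0 \<and> A \<subseteq> TT p0 b"
proof -
  define Bx where "Bx = ({..<dg} \<rightarrow>\<^sub>E {0..int s})"
  define res where "res b = (\<lambda>a\<in>A. SOME r. r < fst a \<and> ev b (snd a) - of_nat r \<in> QQ (fst a))" for b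
  have res: "res b a < fst a" "ev b (snd a) - of_nat (res b a) \<in> QQ (fst a)" if a: "a \<in> A" for b a
  proof -
    obtain p \<xi> where p: "a = (p, \<xi>)" by (cases a)
    have pp: "prime p" "p0 < p" "\<xi> \<in> Xi" "frob p \<xi> = \<xi>" using a A p by (auto simp: PP_def)
    have nd: "\<not> int p dvd Disc" using pp p0 by (intro not_dvd_Disc) auto
    have "ev b \<xi> ^ p - frob p (ev b \<xi>) \<in> QQ p" by (rule frob(2)[OF pp(1) nd ev_mem[OF pp(3)]])
    then have "ev b \<xi> ^ p - ev b \<xi> \<in> QQ p" using Gal_ev[OF frob(1)[OF pp(1) nd] pp(3)] pp(4) by simp
    then have "\<exists>r<p. ev b \<xi> - of_nat r \<in> QQ p"
      by (rule exists_residue[OF pp(1) QQ(1,2)[OF pp(1)] ev_mem[OF pp(3)]])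
    then have ex: "\<exists>r. r < fst a \<and> ev b (snd a) - of_nat r \<in> QQ (fst a)" using p by auto
    from someI_ex[OF ex] show "res b a < fst a" "ev b (snd a) - of_nat (res b a) \<in> QQ (fst a)"
      unfolding res_def using a by auto
  qed
  have "res ` Bx \<subseteq> (\<Pi>\<^sub>E a\<in>A. {..<fst a})" using res(1) by (auto simp: res_def)
  moreover have cPi: "card (\<Pi>\<^sub>E a\<in>A. {..<fst a}) = NA A" using A by (simp add: card_PiE NA_def)
  moreover have "finite (\<Pi>\<^sub>E a\<in>A. {..<fst a})" using A by (intro finite_PiE) auto
  ultimately have "card (res ` Bx) \<le> NA A" by (metis card_mono)
  moreover have "card Bx = (s + 1) ^ dg" unfolding Bx_def by (simp add: card_PiE nat_add_distrib)
  ultimately have "\<not> inj_on res Bx" using s by (metis card_image not_less)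
  then obtain b b' where bb: "b \<in> Bx" "b' \<in> Bx" "res b = res b'" "b \<noteq> b'" by (auto simp: inj_on_def)
  define c where "c = (\<lambda>i\<in>{..<dg}. b i - b' i)"
  have bnd: "0 \<le> b i \<and> b i \<le> int s \<and> 0 \<le> b' i \<and> b' i \<le> int s" if "i < dg" for i
    using bb(1,2) that unfolding Bx_def by (auto simp: PiE_iff)
  have cB: "c \<in> {..<dg} \<rightarrow>\<^sub>E {- int s..int s}"
  proof -
    have "- int s \<le> b i - b' i \<and> b i - b' i \<le> int s" if "i < dg" for i using bnd[OF that] by linarith
    then show ?thesis unfolding c_def by auto
  qed
  have "\<exists>i<dg. b i \<noteq> b' i" using bb unfolding Bx_def by (metis PiE_ext lessThan_iff)
  then obtain i where i: "i < dg" "b i \<noteq> b' i" by auto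
  have N: "Nz c \<noteq> 0" using i by (intro Nz_nz[of i]) (auto simp: c_def)
  have evc: "ev c \<xi> = ev b \<xi> - ev b' \<xi>" for \<xi>
    unfolding ev_diff[symmetric] by (rule ev_cong) (simp add: c_def)
  have "A \<subseteq> TT p0 c"
  proof
    fix a assume a: "a \<in> A"
    obtain p \<xi> where p: "a = (p, \<xi>)" by (cases a)
    have pp: "prime p" "(p, \<xi>) \<in> PP p0" using a A p by (auto simp: PP_def)
    have 1: "ev b \<xi> - of_nat (res b a) \<in> QQ p" "ev b' \<xi> - of_nat (res b a) \<in> QQ p"
      using res(2)[OF a, of b] res(2)[OF a, of b'] bb(3) p by auto
    have "ev c \<xi> \<in> QQ p" unfolding evc using idl_diff[OF QQ(3)[OF pp(1)] 1] by simp
    then show "a \<in> TT p0 c" using pp p by (auto simp: TT_def)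
  qed
  then show ?thesis using cB N by blast
qed

text \<open>With \<open>s\<close> the integer \<open>dg\<close>-th root of the norm, the small
  multiple \<open>b\<close> has norm at most \<open>CC * NA A\<close>. A further prime in
  \<open>TT p0 b\<close> would contribute a factor above \<open>p0\<close>, hence above
  \<open>CC\<close>. So \<open>A\<close> is recovered from \<open>b\<close>, and counting ideals
  reduces to counting coefficient vectors.\<close>

lemma FA_subset_TT:
  assumes p0: "nat \<bar>Disc\<bar> \<le> p0" "CC \<le> p0" and x: "x > 0"
  shows "FA p0 x \<subseteq> TT p0 ` ({..<dg} \<rightarrow>\<^sub>E {- int (nth_root_nat dg x)..int (nth_root_nat dg x)})"
proof
  fix A assume "A \<in> FA p0 x"
  then have A: "finite A" "A \<subseteq> PP p0" "NA A \<le> x" by (auto simp: FA_def)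
  define s where "s = nth_root_nat dg (NA A)"
  have s: "NA A < (s + 1) ^ dg" "s ^ dg \<le> NA A"
    using nth_root_nat_ge[OF dg_pos, of "s + 1" "NA A"] nth_root_nat_power_le[OF dg_pos]
    by (auto simp: s_def not_le[symmetric])
  obtain b where b: "b \<in> {..<dg} \<rightarrow>\<^sub>E {- int s..int s}" "Nz b \<noteq> 0" "A \<subseteq> TT p0 b"
    using exists_small_multiple[OF p0(1) A(1,2) s(1)] by blast
  have fT: "finite (TT p0 b)" by (rule finite_TT[OF p0(1) b(2)])
  have "int (NA (TT p0 b)) dvd Nz b" by (rule NA_dvd[OF p0(1) fT]) auto
  then have "NA (TT p0 b) dvd nat \<bar>Nz b\<bar>" by (simp add: dvd_nat_abs_iff)
  then have "NA (TT p0 b) \<le> nat \<bar>Nz b\<bar>" using b(2) by (intro dvd_imp_le) auto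
  also have "\<dots> \<le> CC * s ^ dg"
  proof (rule Nz_bound)
    fix i assume "i < dg"
    then have "b i \<in> {- int s..int s}" using b(1) by (auto simp: PiE_iff)
    then show "\<bar>b i\<bar> \<le> int s" by auto
  qed
  also have "\<dots> \<le> CC * NA A" using s by simp
  finally have le: "NA (TT p0 b) \<le> CC * NA A" .
  have "TT p0 b = A"
  proof (rule ccontr)
    assume "TT p0 b \<noteq> A"
    then obtain a where a: "a \<in> TT p0 b - A" using b(3) by blast
    have sp: "NA (TT p0 b) = NA (TT p0 b - A) * NA A" unfolding NA_def using prod.subset_diff[OF b(3) fT] .
    have "fst a dvd NA (TT p0 b - A)" unfolding NA_def using a fT by (intro dvd_prodI) auto
    moreover have "NA (TT p0 b - A) > 0" by (rule NA_pos[of _ p0]) (auto simp: TT_def)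
    ultimately have "fst a \<le> NA (TT p0 b - A)" by (rule dvd_imp_le)
    moreover have "p0 < fst a" using a by (auto simp: TT_def PP_def)
    ultimately have "CC < NA (TT p0 b - A)" using p0 by simp
    then have "CC * NA A < NA (TT p0 b)" unfolding sp using NA_pos[OF A(2)] by simp
    then show False using le by simp
  qed
  moreover have "b \<in> {..<dg} \<rightarrow>\<^sub>E {- int (nth_root_nat dg x)..int (nth_root_nat dg x)}"
  proof -
    have "s \<le> nth_root_nat dg x" unfolding s_def using A(3) by (intro nth_root_nat_mono)
    then have "{- int s..int s} \<subseteq> {- int (nth_root_nat dg x)..int (nth_root_nat dg x)}" by auto
    then show ?thesis using b(1) PiE_mono[of "{..<dg}" "\<lambda>_. {- int s..int s}"] by blast
  qed
  ultimately show "A \<in> TT p0 ` ({..<dg} \<rightarrow>\<^sub>E {- int (nth_root_nat dg x)..int (nth_root_nat dg x)})" by blast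
qed

lemma card_FA:
  assumes p0: "nat \<bar>Disc\<bar> \<le> p0" "CC \<le> p0" and x: "x > 0"
  shows "finite (FA p0 x)" "card (FA p0 x) \<le> 3 ^ dg * x"
proof -
  let ?s = "nth_root_nat dg x"
  have fin: "finite ({..<dg} \<rightarrow>\<^sub>E {- int ?s..int ?s})" by (intro finite_PiE) auto
  show "finite (FA p0 x)" using FA_subset_TT[OF assms] fin finite_subset by blast
  have s1: "?s \<ge> 1" using nth_root_nat_mono[of 1 x dg] x nth_root_nat_1[OF dg_pos] by simp
  have "card (FA p0 x) \<le> card ({..<dg} \<rightarrow>\<^sub>E {- int ?s..int ?s})"
    using FA_subset_TT[OF assms] fin by (meson card_image_le card_mono finite_imageI order_trans)
  also have "\<dots> = (2 * ?s + 1) ^ dg"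
  proof -
    have "nat (2 * int ?s + 1) = 2 * ?s + 1" by linarith
    then show ?thesis by (simp add: card_PiE)
  qed
  also have "\<dots> \<le> (3 * ?s) ^ dg" using s1 by (intro power_mono) auto
  also have "\<dots> = 3 ^ dg * ?s ^ dg" by (simp add: power_mult_distrib)
  also have "\<dots> \<le> 3 ^ dg * x" using nth_root_nat_power_le[OF dg_pos, of x] by simp
  finally show "card (FA p0 x) \<le> 3 ^ dg * x" .
qed

text \<open>Dyadic summation: there are at most \<open>3 ^ dg * 2 ^ Suc m\<close> ideals of norm up
  to \<open>2 ^ Suc m\<close>, and the new ones have norm at least \<open>2 ^ m\<close>, so each
  doubling adds at most \<open>2 * 3 ^ dg\<close>.\<close>

lemma sum_FA_upper:
  assumes p0: "nat \<bar>Disc\<bar> \<le> p0" "CC \<le> p0"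
  shows "(\<Sum>A\<in>FA p0 (2 ^ m). 1 / real (NA A)) \<le> 3 ^ dg * (2 * real m + 1)"
proof (induction m)
  case 0
  have "(\<Sum>A\<in>FA p0 1. 1 / real (NA A)) \<le> (\<Sum>A\<in>FA p0 1. 1)"
    by (rule sum_mono) (use NA_pos in \<open>auto simp: FA_def divide_simps\<close>)
  also have "\<dots> \<le> 3 ^ dg" using card_FA(2)[OF p0, of 1] by simp
  finally show ?case by simp
next
  case (Suc m)
  have fin: "finite (FA p0 (2 ^ Suc m))" by (rule card_FA(1)[OF p0]) auto
  have sub: "FA p0 (2 ^ m) \<subseteq> FA p0 (2 ^ Suc m)" by (auto simp: FA_def)
  have "(\<Sum>A\<in>FA p0 (2 ^ Suc m). 1 / real (NA A)) =
    (\<Sum>A\<in>FA p0 (2 ^ Suc m) - FA p0 (2 ^ m). 1 / real (NA A)) + (\<Sum>A\<in>FA p0 (2 ^ m). 1 / real (NA A))"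
    by (rule sum.subset_diff[OF sub fin])
  also have "(\<Sum>A\<in>FA p0 (2 ^ Suc m) - FA p0 (2 ^ m). 1 / real (NA A)) \<le> (\<Sum>A\<in>FA p0 (2 ^ Suc m) - FA p0 (2 ^ m). 1 / 2 ^ m)"
  proof (rule sum_mono)
    fix A assume "A \<in> FA p0 (2 ^ Suc m) - FA p0 (2 ^ m)"
    then have "2 ^ m \<le> NA A" by (auto simp: FA_def)
    then have "real (2 ^ m) \<le> real (NA A)" unfolding of_nat_le_iff .
    then have le: "2 ^ m \<le> real (NA A)" by simp
    moreover have "(0::real) < 2 ^ m" by simp
    ultimately have "real (NA A) > 0" by linarith
    then show "1 / real (NA A) \<le> 1 / 2 ^ m" using le by (intro divide_left_mono) auto
  qed
  also have "\<dots> \<le> real (card (FA p0 (2 ^ Suc m))) / 2 ^ m"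
    using fin by (simp add: divide_right_mono card_mono)
  also have "\<dots> \<le> real (3 ^ dg * 2 ^ Suc m) / 2 ^ m"
    using card_FA(2)[OF p0, of "2 ^ Suc m"] by (intro divide_right_mono) (auto simp del: of_nat_mult of_nat_power power_Suc)
  also have "\<dots> = 2 * 3 ^ dg" by simp
  finally show ?case using Suc by (simp add: algebra_simps)
qed

end

section \<open>Lower bound: lattice points and square divisors of the norm\<close>

text \<open>Cubes of side \<open>t\<close> cover the box, and each of them holds at most one point
  of \<open>L\<close>.\<close>

lemma card_separated_box:
  fixes L :: "(nat \<Rightarrow> int) set"
  assumes L: "L \<subseteq> {..<d} \<rightarrow>\<^sub>E {0..<int Y}" and t: "t > 0"
    and sep: "\<And>c c'. c \<in> L \<Longrightarrow> c' \<in> L \<Longrightarrow> (\<And>i. i < d \<Longrightarrow> \<bar>c i - c' i\<bar> \<le> int (t - 1)) \<Longrightarrow> c = c'"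
  shows "card L \<le> (Y div t + 1) ^ d"
proof -
  define \<kappa> where "\<kappa> c = (\<lambda>i\<in>{..<d}. c i div int t)" for c :: "nat \<Rightarrow> int"
  have "inj_on \<kappa> L"
  proof (rule inj_onI)
    fix c c' assume c: "c \<in> L" "c' \<in> L" "\<kappa> c = \<kappa> c'"
    show "c = c'"
    proof (rule sep[OF c(1,2)])
      fix i assume i: "i < d"
      have e: "c i div int t = c' i div int t" using fun_cong[OF c(3), of i] i by (simp add: \<kappa>_def)
      have "c i = int t * (c i div int t) + c i mod int t" "c' i = int t * (c' i div int t) + c' i mod int t" by simp_all
      moreover have "0 \<le> c i mod int t" "c i mod int t < int t" "0 \<le> c' i mod int t" "c' i mod int t < int t" using t by auto
      ultimately have "\<bar>c i - c' i\<bar> < int t" unfolding e by linarith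
      then show "\<bar>c i - c' i\<bar> \<le> int (t - 1)" using t by (simp add: of_nat_diff)
    qed
  qed
  moreover have "\<kappa> ` L \<subseteq> {..<d} \<rightarrow>\<^sub>E {0..int (Y div t)}"
  proof
    fix k assume "k \<in> \<kappa> ` L"
    then obtain c where c: "c \<in> L" "k = \<kappa> c" by auto
    have "0 \<le> c i div int t \<and> c i div int t \<le> int (Y div t)" if i: "i < d" for i
    proof -
      have "c i \<in> {0..<int Y}" using L c(1) i by (auto simp: PiE_iff subset_iff)
      then show ?thesis using t by (simp add: zdiv_int pos_imp_zdiv_nonneg_iff zdiv_mono1)
    qed
    then show "k \<in> {..<d} \<rightarrow>\<^sub>E {0..int (Y div t)}" unfolding c(2) \<kappa>_def by auto
  qed
  moreover have "card ({..<d} \<rightarrow>\<^sub>E {0..int (Y div t)}) = (Y div t + 1) ^ d"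
    by (simp add: card_PiE nat_add_distrib del: of_nat_div zdiv_int)
  moreover have "finite ({..<d} \<rightarrow>\<^sub>E {0..int (Y div t)})" by (intro finite_PiE) auto
  ultimately show ?thesis by (metis card_inj_on_le)
qed

lemma sum_inverse_squares: "p0 > 0 \<Longrightarrow> (\<Sum>p\<in>{p0<..z}. 1 / (real p)\<^sup>2) \<le> 1 / real p0"
proof -
  assume p0: "p0 > 0"
  have "(\<Sum>p\<in>{p0<..z}. 1 / (real p)\<^sup>2) \<le> 1 / real p0 - 1 / real z" if "p0 \<le> z"
    using that
  proof (induction z rule: dec_induct)
    case (step n)
    have e: "{p0<..Suc n} = insert (Suc n) {p0<..n}" using step by auto
    have n: "n > 0" using step p0 by simp
    have "1 / (real (Suc n))\<^sup>2 \<le> 1 / real n - 1 / real (Suc n)"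
    proof -
      have "1 / real n - 1 / real (Suc n) = 1 / (real n * real (Suc n))" using n by (simp add: field_simps)
      moreover have "1 / (real (Suc n))\<^sup>2 \<le> 1 / (real n * real (Suc n))"
        using n unfolding power2_eq_square by (intro divide_left_mono mult_right_mono mult_pos_pos) auto
      ultimately show ?thesis by simp
    qed
    then show ?case unfolding e using step by simp
  qed (use p0 in auto)
  moreover have "(\<Sum>p\<in>{p0<..z}. 1 / (real p)\<^sup>2) = 0" if "z < p0" using that by simp
  ultimately show ?thesis
    by (cases "p0 \<le> z") (auto simp: le_diff_eq intro: order_trans[of _ "1 / real p0 - 1 / real z"])
qed

context galois_ring
begin

lemma idl_prod_cong_one:
  "idl I \<Longrightarrow> (\<And>i. i \<in> J \<Longrightarrow> f i \<in> Ob \<and> f i - 1 \<in> I) \<Longrightarrow> prod f J - 1 \<in> I"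
proof (induction J rule: infinite_finite_induct)
  case (insert a J)
  have "f a * prod f J - 1 * 1 \<in> I" using insert by (intro idl_cong_mult) (auto simp: one_mem)
  then show ?case using insert by simp
qed (auto simp: idlD)

lemma vQ_diff:
  assumes Q: "primeO Q" and "x \<in> vQ Q p k" "y \<in> vQ Q p k" shows "x - y \<in> vQ Q p k"
proof -
  obtain s t where st: "s \<in> Ob - Q" "s * x \<in> pO (p ^ k)" "t \<in> Ob - Q" "t * y \<in> pO (p ^ k)" "x \<in> Ob" "y \<in> Ob"
    using assms by (auto simp: vQ_def)
  have "t * (s * x) - s * (t * y) \<in> pO (p ^ k)" 
    using idl_diff[OF idl_pO idlD(4)[OF idl_pO _ st(2)] idlD(4)[OF idl_pO _ st(4)]] st by blast
  then have "(s * t) * (x - y) \<in> pO (p ^ k)" by (simp add: algebra_simps)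
  then show ?thesis using primeO_mult_not[OF Q st(1,3)] st by (auto simp: vQ_def mem)
qed

end

context orbit_element
begin

text \<open>If \<open>p\<^sup>2\<close> divides the norm of \<open>ev b eta\<close>, then \<open>b\<close> lies in one of the \<open>dg\<^sup>2\<close> lattices \<open>Lam p \<xi> \<xi>'\<close>.\<close>

definition Lam :: "nat \<Rightarrow> complex \<Rightarrow> complex \<Rightarrow> (nat \<Rightarrow> int) \<Rightarrow> bool" where
  "Lam p \<xi> \<xi>' b \<longleftrightarrow> (if \<xi> \<noteq> \<xi>' then ev b \<xi> \<in> QQ p \<and> ev b \<xi>' \<in> QQ p else ev b \<xi> \<in> vQ (QQ p) p 2)"

lemma Lam_dvd:
  assumes p: "prime p" "\<not> int p dvd Disc" and x: "\<xi> \<in> Xi" "\<xi>' \<in> Xi" and L: "Lam p \<xi> \<xi>' b"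
  shows "int p ^ 2 dvd Nz b"
proof -
  have "(\<Prod>\<xi>\<in>Xi. ev b \<xi>) \<in> vQ (QQ p) p 2"
  proof (cases "\<xi> = \<xi>'")
    case True
    then have "ev b \<xi> \<in> vQ (QQ p) p 2" using L by (simp add: Lam_def)
    then obtain s where s: "s \<in> Ob - QQ p" "s * ev b \<xi> \<in> pO (p ^ 2)" by (auto simp: vQ_def)
    have e: "(\<Prod>\<xi>\<in>Xi. ev b \<xi>) = ev b \<xi> * (\<Prod>\<xi>\<in>Xi - {\<xi>}. ev b \<xi>)" by (rule prod.remove[OF finite_Xi x(1)])
    have "(s * ev b \<xi>) * (\<Prod>\<xi>\<in>Xi - {\<xi>}. ev b \<xi>) \<in> pO (p ^ 2)"
      by (rule idlD(5)[OF idl_pO s(2)]) (auto intro!: prod_mem ev_mem)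
    then have "s * (\<Prod>\<xi>\<in>Xi. ev b \<xi>) \<in> pO (p ^ 2)" unfolding e by (simp add: mult.assoc)
    then show ?thesis using s by (auto simp: vQ_def intro!: prod_mem ev_mem)
  next
    case False
    then have "(\<Prod>\<xi>\<in>Xi. ev b \<xi>) \<in> vQ (QQ p) p (card {\<xi>, \<xi>'})"
      using L x by (intro vQ_prod[OF p QQ(1,2)[OF p(1)] finite_Xi ev_mem]) (auto simp: Lam_def)
    moreover have "card {\<xi>, \<xi>'} = 2" using False by simp
    ultimately show ?thesis by (simp only:)
  qed
  then have "of_int (Nz b) \<in> vQ (QQ p) p 2" by (simp add: Nz)
  then show ?thesis by (rule vQ_int[OF p(1) QQ(1,2)[OF p(1)]])
qed

lemma prime_dvd_Nz:
  assumes p: "prime p" and d: "int p dvd Nz b"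
  shows "\<exists>\<xi>\<in>Xi. ev b \<xi> \<in> QQ p"
proof -
  have "of_int (Nz b) \<in> QQ p" using primeO_int_iff[OF QQ(1,2)[OF p] p] d by simp
  then have "prod (ev b) Xi \<in> QQ p" by (simp add: Nz)
  then show ?thesis using primeO_prod[OF QQ(1)[OF p], of Xi "ev b"] ev_mem by blast
qed

text \<open>If only one conjugate lies in \<open>QQ p\<close>, the product \<open>s\<close> of the
  others is a multiplier outside \<open>QQ p\<close>, so this conjugate alone absorbs the whole
  square.\<close>

lemma Lam_cover:
  assumes p: "prime p" and d: "int p ^ 2 dvd Nz b"
  shows "\<exists>\<xi>\<in>Xi. \<exists>\<xi>'\<in>Xi. Lam p \<xi> \<xi>' b"
proof -
  have "int p dvd Nz b" using d by (metis dvd_trans dvd_triv_left power2_eq_square)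
  then obtain \<xi> where x: "\<xi> \<in> Xi" "ev b \<xi> \<in> QQ p" using prime_dvd_Nz[OF p] by blast
  show ?thesis
  proof (cases "\<exists>\<xi>'\<in>Xi - {\<xi>}. ev b \<xi>' \<in> QQ p")
    case True
    then obtain \<xi>' where "\<xi>' \<in> Xi" "\<xi>' \<noteq> \<xi>" "ev b \<xi>' \<in> QQ p" by auto
    then have "Lam p \<xi> \<xi>' b" using x by (auto simp: Lam_def)
    then show ?thesis using x \<open>\<xi>' \<in> Xi\<close> by blast
  next
    case False
    define s where "s = (\<Prod>\<xi>\<in>Xi - {\<xi>}. ev b \<xi>)"
    have s: "s \<in> Ob - QQ p" unfolding s_def
      using False primeO_prod[OF QQ(1)[OF p], of "Xi - {\<xi>}" "ev b"] by (auto intro!: prod_mem ev_mem simp: ev_mem)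
    have "(\<Prod>\<xi>\<in>Xi. ev b \<xi>) = ev b \<xi> * s" unfolding s_def by (rule prod.remove[OF finite_Xi x(1)])
    then have "s * ev b \<xi> = of_int (Nz b)" by (simp add: Nz mult.commute)
    moreover have "of_int (Nz b) \<in> pO (p ^ 2)" using d by (intro pO_int_I) simp
    ultimately have "s * ev b \<xi> \<in> pO (p ^ 2)" by (simp only:)
    then have "ev b \<xi> \<in> vQ (QQ p) p 2" using s ev_mem[OF x(1), of b] unfolding vQ_def by blast
    then have "Lam p \<xi> \<xi> b" by (simp add: Lam_def)
    then show ?thesis using x by blast
  qed
qed

lemma Lam_diff: "prime p \<Longrightarrow> Lam p \<xi> \<xi>' b \<Longrightarrow> Lam p \<xi> \<xi>' c \<Longrightarrow> Lam p \<xi> \<xi>' (\<lambda>i. b i - c i)"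
  using QQ by (auto simp: Lam_def ev_diff intro!: idl_diff vQ_diff split: if_splits)

lemma ev_scale: "ev (\<lambda>i. k * b i) \<xi> = of_int k * ev b \<xi>"
  by (simp add: ev_def sum_distrib_left mult.assoc)

lemma Lam_scale:
  assumes p: "prime p" "\<not> int p dvd k" and x: "\<xi> \<in> Xi" "\<xi>' \<in> Xi" and L: "Lam p \<xi> \<xi>' (\<lambda>i. k * b i)"
  shows "Lam p \<xi> \<xi>' b"
proof -
  have k: "of_int k \<notin> QQ p" using primeO_int_iff[OF QQ(1,2)[OF p(1)] p(1)] p by simp
  have 1: "y \<in> QQ p" if "of_int k * y \<in> QQ p" "y \<in> Ob" for y
    using that k QQ(1)[OF p(1)] int_mem[of k] unfolding primeO_def by blast
  have 2: "y \<in> vQ (QQ p) p 2" if y: "of_int k * y \<in> vQ (QQ p) p 2" "y \<in> Ob" for y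
  proof -
    obtain s where s: "s \<in> Ob - QQ p" "s * (of_int k * y) \<in> pO (p ^ 2)" using y unfolding vQ_def by blast
    have "s * of_int k \<in> Ob - QQ p" using s k int_mem by (intro primeO_mult_not[OF QQ(1)[OF p(1)]]) auto
    moreover have "(s * of_int k) * y \<in> pO (p ^ 2)" using s by (simp add: mult.assoc)
    ultimately show ?thesis using y unfolding vQ_def by blast
  qed
  show ?thesis using L 1 2 ev_mem[OF x(1)] ev_mem[OF x(2)] by (auto simp: Lam_def ev_scale split: if_splits)
qed

text \<open>The shift by \<open>BB p0 * MM * Y\<close> makes the constant term dominate, which bounds the norm from both sides;
  \<open>BB p0 = fact p0\<close> makes the norm congruent to 1 modulo all primes up to \<open>p0\<close>.\<close>

definition MM :: nat where "MM = AA + 1"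
definition C0 :: nat where "C0 = (1 + 2 * MM) ^ dg"
definition BB :: "nat \<Rightarrow> nat" where "BB p0 = fact p0"
definition Box :: "nat \<Rightarrow> (nat \<Rightarrow> int) set" where "Box Y = {..<dg} \<rightarrow>\<^sub>E {0..<int Y}"
definition aa :: "nat \<Rightarrow> nat \<Rightarrow> (nat \<Rightarrow> int) \<Rightarrow> nat \<Rightarrow> int" where
  "aa p0 Y c i = (if i = 0 then 1 + int (BB p0 * MM * Y) else 0) + int (BB p0) * c i"

lemma BB_pos: "BB p0 > 0" by (simp add: BB_def)
lemma C0_pos: "C0 > 0" by (simp add: C0_def)

lemma Box: "finite (Box Y)" "card (Box Y) = Y ^ dg" "c \<in> Box Y \<Longrightarrow> i < dg \<Longrightarrow> 0 \<le> c i \<and> c i < int Y"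
  unfolding Box_def by (auto intro!: finite_PiE simp: card_PiE PiE_iff)

lemma ev_aa: "ev (aa p0 Y c) \<xi> = of_nat (1 + BB p0 * MM * Y) + of_nat (BB p0) * ev c \<xi>"
proof -
  have "ev (aa p0 Y c) \<xi> = (\<Sum>i<dg. (if i = 0 then of_nat (1 + BB p0 * MM * Y) else 0) + of_nat (BB p0) * (of_int (c i) * \<xi> ^ i))"
    unfolding ev_def by (rule sum.cong) (auto simp: aa_def algebra_simps)
  also have "\<dots> = of_nat (1 + BB p0 * MM * Y) + of_nat (BB p0) * ev c \<xi>"
    using dg_pos by (simp add: sum.distrib sum_distrib_left[symmetric] ev_def)
  finally show ?thesis .
qed

text \<open>\<open>MM\<close> exceeds \<open>AA\<close> by one: the polynomial part of a conjugate
  has size at most \<open>BB p0 * AA * Y\<close>, so at least \<open>BB p0 * Y\<close> of the shift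
  survives. As this holds for each conjugate separately, the norm has exact order
  \<open>(BB p0 * Y) ^ dg\<close>.\<close>

lemma Nz_aa_bounds:
  assumes c: "c \<in> Box Y" and Y: "Y > 0"
  shows "(BB p0 * Y) ^ dg \<le> nat \<bar>Nz (aa p0 Y c)\<bar>" "nat \<bar>Nz (aa p0 Y c)\<bar> \<le> C0 * (BB p0 * Y) ^ dg"
proof -
  let ?B = "real (BB p0)"
  have ec: "norm (ev c \<xi>) \<le> real Y * real AA" if "\<xi> \<in> Xi" for \<xi>
    using Box(3)[OF c] by (intro ev_bound[OF that]) force
  have B1: "?B * real Y \<ge> 1" using BB_pos[of p0] Y by (metis One_nat_def Suc_leI mult_pos_pos of_nat_1 of_nat_le_iff of_nat_mult)
  have lo: "?B * real Y \<le> norm (ev (aa p0 Y c) \<xi>)" if x: "\<xi> \<in> Xi" for \<xi>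
  proof -
    have "norm (of_nat (1 + BB p0 * MM * Y) :: complex) - norm (- (of_nat (BB p0) * ev c \<xi>)) \<le> norm (ev (aa p0 Y c) \<xi>)"
      unfolding ev_aa using norm_triangle_ineq2[of "of_nat (1 + BB p0 * MM * Y) :: complex" "- (of_nat (BB p0) * ev c \<xi>)"] by simp
    moreover have "norm (of_nat (1 + BB p0 * MM * Y) :: complex) = 1 + ?B * real MM * real Y" by (simp only: norm_of_nat) simp
    moreover have "norm (- (of_nat (BB p0) * ev c \<xi>)) \<le> ?B * (real Y * real AA)"
      using ec[OF x] by (simp add: norm_mult mult_left_mono)
    moreover have "1 + ?B * real MM * real Y - ?B * (real Y * real AA) \<ge> ?B * real Y" by (simp add: MM_def algebra_simps)
    ultimately show ?thesis by linarith
  qed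
  have hi: "norm (ev (aa p0 Y c) \<xi>) \<le> real (1 + 2 * MM) * (?B * real Y)" if x: "\<xi> \<in> Xi" for \<xi>
  proof -
    have "norm (ev (aa p0 Y c) \<xi>) \<le> norm (of_nat (1 + BB p0 * MM * Y) :: complex) + norm (of_nat (BB p0) * ev c \<xi>)"
      unfolding ev_aa by (rule norm_triangle_ineq)
    moreover have "norm (of_nat (1 + BB p0 * MM * Y) :: complex) = 1 + ?B * real MM * real Y" by (simp only: norm_of_nat) simp
    moreover have "norm (of_nat (BB p0) * ev c \<xi>) \<le> ?B * (real Y * real AA)"
      using ec[OF x] by (simp add: norm_mult mult_left_mono)
    moreover have "?B * (real Y * real AA) \<le> ?B * (real Y * real MM)" by (intro mult_left_mono) (auto simp: MM_def)
    moreover have "real (1 + 2 * MM) * (?B * real Y) = ?B * real Y + ?B * real MM * real Y + ?B * (real Y * real MM)" by (simp add: algebra_simps)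
    ultimately show ?thesis using B1 by linarith
  qed
  have "(?B * real Y) ^ dg \<le> real_of_int \<bar>Nz (aa p0 Y c)\<bar>"
  proof -
    have "(?B * real Y) ^ dg = (\<Prod>\<xi>\<in>Xi. ?B * real Y)" by (simp add: dg_def)
    also have "\<dots> \<le> real_of_int \<bar>Nz (aa p0 Y c)\<bar>" unfolding Nz_abs using lo by (intro prod_mono) auto
    finally show ?thesis .
  qed
  then have "real ((BB p0 * Y) ^ dg) \<le> real (nat \<bar>Nz (aa p0 Y c)\<bar>)" by simp
  then show "(BB p0 * Y) ^ dg \<le> nat \<bar>Nz (aa p0 Y c)\<bar>" unfolding of_nat_le_iff .
  have "real_of_int \<bar>Nz (aa p0 Y c)\<bar> \<le> (real (1 + 2 * MM) * (?B * real Y)) ^ dg"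
  proof -
    have "real_of_int \<bar>Nz (aa p0 Y c)\<bar> \<le> (\<Prod>\<xi>\<in>Xi. real (1 + 2 * MM) * (?B * real Y))" unfolding Nz_abs using hi by (intro prod_mono) auto
    also have "\<dots> = (real (1 + 2 * MM) * (?B * real Y)) ^ dg" by (simp add: dg_def)
    finally show ?thesis .
  qed
  then have "real (nat \<bar>Nz (aa p0 Y c)\<bar>) \<le> real (C0 * (BB p0 * Y) ^ dg)" by (simp add: C0_def power_mult_distrib)
  then show "nat \<bar>Nz (aa p0 Y c)\<bar> \<le> C0 * (BB p0 * Y) ^ dg" unfolding of_nat_le_iff .
qed

lemma prime_not_dvd_BB: "prime p \<Longrightarrow> p0 < p \<Longrightarrow> \<not> int p dvd int (BB p0)"
  unfolding BB_def int_dvd_int_iff by (simp add: prime_dvd_fact_iff)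

text \<open>Two points of the lattice in the same small cube have a difference whose norm is
  divisible by \<open>p ^ 2\<close> and yet smaller, so they agree and
  \<open>card_separated_box\<close> applies. The common factor \<open>BB p0\<close> of the
  differences can be removed inside the lattice because \<open>p > p0\<close>.\<close>

lemma card_Lam:
  assumes p: "prime p" "p0 < p" and p0: "nat \<bar>Disc\<bar> \<le> p0" and x: "\<xi> \<in> Xi" "\<xi>' \<in> Xi"
  shows "real (card {c \<in> Box Y. Lam p \<xi> \<xi>' (aa p0 Y c)}) \<le> 2 ^ dg * (real CC * real Y ^ dg * (1 / (real p)\<^sup>2) + 1)"
proof -
  let ?L = "{c \<in> Box Y. Lam p \<xi> \<xi>' (aa p0 Y c)}"
  have nd: "\<not> int p dvd Disc" using p p0 by (intro not_dvd_Disc) auto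
  \<comment> \<open>The least such \<open>t\<close> serves twice: the inequality itself gives a
    density of order \<open>1 / p ^ 2\<close>, and its failure at \<open>t - 1\<close> makes the
    norm of a difference within a cube less than \<open>p ^ 2\<close>.\<close>
  define t where "t = (LEAST t. p\<^sup>2 \<le> CC * t ^ dg)"
  have "p\<^sup>2 \<le> CC * (p\<^sup>2) ^ dg"
  proof -
    have "p\<^sup>2 \<le> (p\<^sup>2) ^ dg" using dg_pos prime_gt_0_nat[OF p(1)] by (intro self_le_power) auto
    also have "\<dots> \<le> CC * (p\<^sup>2) ^ dg" using CC_pos by simp
    finally show ?thesis .
  qed
  then have t: "p\<^sup>2 \<le> CC * t ^ dg" unfolding t_def by (rule LeastI)
  have t0: "t > 0"
  proof (rule ccontr)
    assume "\<not> t > 0"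
    then show False using t dg_pos prime_gt_0_nat[OF p(1)] by (simp add: power_0_left)
  qed
  have t1: "CC * (t - 1) ^ dg < p\<^sup>2" using t0 not_less_Least[of "t - 1" "\<lambda>t. p\<^sup>2 \<le> CC * t ^ dg"] by (simp add: t_def[symmetric] not_le)
  have "card ?L \<le> (Y div t + 1) ^ dg"
  proof (rule card_separated_box[OF _ t0])
    show "?L \<subseteq> {..<dg} \<rightarrow>\<^sub>E {0..<int Y}" by (auto simp: Box_def)
    fix c c' assume c: "c \<in> ?L" "c' \<in> ?L" and close: "\<And>i. i < dg \<Longrightarrow> \<bar>c i - c' i\<bar> \<le> int (t - 1)"
    have "Lam p \<xi> \<xi>' (\<lambda>i. aa p0 Y c i - aa p0 Y c' i)" using c by (intro Lam_diff[OF p(1)]) auto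
    moreover have "(\<lambda>i. aa p0 Y c i - aa p0 Y c' i) = (\<lambda>i. int (BB p0) * (c i - c' i))"
      by (auto simp: aa_def algebra_simps)
    ultimately have "Lam p \<xi> \<xi>' (\<lambda>i. c i - c' i)"
      using Lam_scale[OF p(1) prime_not_dvd_BB[OF p] x, of "\<lambda>i. c i - c' i"] by simp
    then have dv: "int p ^ 2 dvd Nz (\<lambda>i. c i - c' i)" by (rule Lam_dvd[OF p(1) nd x])
    have "nat \<bar>Nz (\<lambda>i. c i - c' i)\<bar> \<le> CC * (t - 1) ^ dg" by (rule Nz_bound[OF close])
    then have small: "nat \<bar>Nz (\<lambda>i. c i - c' i)\<bar> < p\<^sup>2" using t1 by simp
    have z: "Nz (\<lambda>i. c i - c' i) = 0"
    proof (rule ccontr)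
      assume n: "Nz (\<lambda>i. c i - c' i) \<noteq> 0"
      then have "int p ^ 2 \<le> \<bar>Nz (\<lambda>i. c i - c' i)\<bar>" using dvd_imp_le_int[OF n dv] by simp
      then have "int (p\<^sup>2) \<le> \<bar>Nz (\<lambda>i. c i - c' i)\<bar>" by simp
      then show False using small by linarith
    qed
    show "c = c'"
    proof (rule PiE_ext)
      show "c \<in> {..<dg} \<rightarrow>\<^sub>E {0..<int Y}" "c' \<in> {..<dg} \<rightarrow>\<^sub>E {0..<int Y}" using c by (auto simp: Box_def)
      fix i assume "i \<in> {..<dg}"
      then show "c i = c' i" using Nz_nz[of i "\<lambda>i. c i - c' i"] z by auto
    qed
  qed
  moreover have "real ((Y div t + 1) ^ dg) \<le> 2 ^ dg * (real CC * real Y ^ dg * (1 / (real p)\<^sup>2) + 1)"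
  proof -
    let ?u = "Y div t"
    have "(?u + 1) ^ dg \<le> 2 ^ dg * (?u ^ dg + 1)"
    proof (cases "?u = 0")
      case False
      then have "(?u + 1) ^ dg \<le> (2 * ?u) ^ dg" by (intro power_mono) auto
      also have "\<dots> = 2 ^ dg * ?u ^ dg" by (rule power_mult_distrib)
      finally show ?thesis by simp
    next
      case True
      have "(1::nat) \<le> 2 ^ dg" by simp
      then show ?thesis unfolding True by (simp add: trans_le_add1)
    qed
    then have 1: "real ((?u + 1) ^ dg) \<le> real (2 ^ dg * (?u ^ dg + 1))" unfolding of_nat_le_iff .
    have "?u ^ dg * p\<^sup>2 \<le> ?u ^ dg * (CC * t ^ dg)" using t by simp
    also have "\<dots> = CC * (?u * t) ^ dg" by (simp add: power_mult_distrib)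
    also have "\<dots> \<le> CC * Y ^ dg" by (intro mult_left_mono power_mono) auto
    finally have "real (?u ^ dg * p\<^sup>2) \<le> real (CC * Y ^ dg)" unfolding of_nat_le_iff .
    then have "real (?u ^ dg) \<le> real CC * real Y ^ dg * (1 / (real p)\<^sup>2)"
      using prime_gt_0_nat[OF p(1)] by (simp add: field_simps)
    then have "2 ^ dg * (real (?u ^ dg) + 1) \<le> 2 ^ dg * (real CC * real Y ^ dg * (1 / (real p)\<^sup>2) + 1)"
      by (intro mult_left_mono add_right_mono) auto
    moreover have "real (2 ^ dg * (?u ^ dg + 1)) = 2 ^ dg * (real (?u ^ dg) + 1)" by (simp add: algebra_simps)
    ultimately have "real (2 ^ dg * (?u ^ dg + 1)) \<le> 2 ^ dg * (real CC * real Y ^ dg * (1 / (real p)\<^sup>2) + 1)"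
      by (simp only:)
    then show ?thesis using 1 by linarith
  qed
  ultimately show ?thesis by (meson of_nat_le_iff order_trans)
qed

definition bad :: "nat \<Rightarrow> nat \<Rightarrow> (nat \<Rightarrow> int) set" where
  "bad p0 Y = {c \<in> Box Y. \<exists>p. prime p \<and> p0 < p \<and> int p ^ 2 dvd Nz (aa p0 Y c)}"

lemma Nz_aa_nz: "c \<in> Box Y \<Longrightarrow> Y > 0 \<Longrightarrow> Nz (aa p0 Y c) \<noteq> 0"
  using Nz_aa_bounds(1)[of c Y p0] BB_pos[of p0] by auto

text \<open>The norms are below \<open>(z + 1) ^ 2\<close>, so only primes up to \<open>z\<close>
  can contribute a square. In the sum of \<open>card_Lam\<close> over these primes and the
  \<open>dg ^ 2\<close> pairs of conjugates, the density terms add up to at most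
  \<open>1 / p0\<close> and the error terms to at most \<open>z\<close>.\<close>

lemma card_bad:
  assumes p0: "nat \<bar>Disc\<bar> \<le> p0" "p0 > 0" and Y: "Y > 0" and z: "C0 * (BB p0 * Y) ^ dg < (z + 1)\<^sup>2"
  shows "real (card (bad p0 Y)) \<le> real dg ^ 2 * 2 ^ dg * (real CC * real Y ^ dg / real p0 + real z)"
proof -
  define P where "P = {p. prime p \<and> p0 < p \<and> p \<le> z}"
  have fP: "finite P" unfolding P_def by (rule finite_subset[of _ "{..z}"]) auto
  let ?L = "\<lambda>p \<xi> \<xi>'. {c \<in> Box Y. Lam p \<xi> \<xi>' (aa p0 Y c)}"
  have fL: "finite (?L p \<xi> \<xi>')" for p \<xi> \<xi>' using Box(1)[of Y] by auto
  have sub: "bad p0 Y \<subseteq> (\<Union>p\<in>P. \<Union>\<xi>\<in>Xi. \<Union>\<xi>'\<in>Xi. ?L p \<xi> \<xi>')"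
  proof
    fix c assume "c \<in> bad p0 Y"
    then obtain p where p: "c \<in> Box Y" "prime p" "p0 < p" "int p ^ 2 dvd Nz (aa p0 Y c)" by (auto simp: bad_def)
    have "int p ^ 2 \<le> \<bar>Nz (aa p0 Y c)\<bar>" using dvd_imp_le_int[OF Nz_aa_nz[OF p(1) Y] p(4)] by simp
    then have "int (p\<^sup>2) \<le> \<bar>Nz (aa p0 Y c)\<bar>" by simp
    then have "p\<^sup>2 \<le> nat \<bar>Nz (aa p0 Y c)\<bar>" by (simp add: le_nat_iff)
    then have "p\<^sup>2 < (z + 1)\<^sup>2" using Nz_aa_bounds(2)[OF p(1) Y, of p0] z by (meson le_less_trans)
    then have "p < z + 1" by (rule power_less_imp_less_base) auto
    then have "p \<in> P" using p by (auto simp: P_def)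
    then show "c \<in> (\<Union>p\<in>P. \<Union>\<xi>\<in>Xi. \<Union>\<xi>'\<in>Xi. ?L p \<xi> \<xi>')" using Lam_cover[OF p(2,4)] p(1) by blast
  qed
  have "card (bad p0 Y) \<le> card (\<Union>p\<in>P. \<Union>\<xi>\<in>Xi. \<Union>\<xi>'\<in>Xi. ?L p \<xi> \<xi>')"
    using sub fP finite_Xi fL by (intro card_mono) auto
  also have "\<dots> \<le> (\<Sum>p\<in>P. card (\<Union>\<xi>\<in>Xi. \<Union>\<xi>'\<in>Xi. ?L p \<xi> \<xi>'))" by (rule card_UN_le[OF fP])
  also have "\<dots> \<le> (\<Sum>p\<in>P. \<Sum>\<xi>\<in>Xi. \<Sum>\<xi>'\<in>Xi. card (?L p \<xi> \<xi>'))"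
    by (intro sum_mono order_trans[OF card_UN_le[OF finite_Xi]] card_UN_le[OF finite_Xi])
  finally have "real (card (bad p0 Y)) \<le> real (\<Sum>p\<in>P. \<Sum>\<xi>\<in>Xi. \<Sum>\<xi>'\<in>Xi. card (?L p \<xi> \<xi>'))" by (simp only: of_nat_le_iff)
  also have "\<dots> = (\<Sum>p\<in>P. \<Sum>\<xi>\<in>Xi. \<Sum>\<xi>'\<in>Xi. real (card (?L p \<xi> \<xi>')))" by simp
  also have "\<dots> \<le> (\<Sum>p\<in>P. \<Sum>\<xi>\<in>Xi. \<Sum>\<xi>'\<in>Xi. 2 ^ dg * (real CC * real Y ^ dg * (1 / (real p)\<^sup>2) + 1))"
    using p0 by (intro sum_mono card_Lam) (auto simp: P_def)
  also have "\<dots> = (\<Sum>p\<in>P. real dg ^ 2 * 2 ^ dg * (real CC * real Y ^ dg * (1 / (real p)\<^sup>2) + 1))"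
    by (simp add: dg_def[symmetric] power2_eq_square mult.assoc)
  also have "\<dots> = real dg ^ 2 * 2 ^ dg * (real CC * real Y ^ dg * (\<Sum>p\<in>P. 1 / (real p)\<^sup>2) + real (card P))"
    unfolding sum_distrib_left[symmetric] sum.distrib by simp
  also have "\<dots> \<le> real dg ^ 2 * 2 ^ dg * (real CC * real Y ^ dg * (1 / real p0) + real z)"
  proof -
    have "(\<Sum>p\<in>P. 1 / (real p)\<^sup>2) \<le> (\<Sum>p\<in>{p0<..z}. 1 / (real p)\<^sup>2)"
      by (rule sum_mono2) (auto simp: P_def)
    then have "(\<Sum>p\<in>P. 1 / (real p)\<^sup>2) \<le> 1 / real p0" using sum_inverse_squares[OF p0(2), of z] by linarith
    moreover have "card P \<le> card {1..z}" using p0 by (intro card_mono) (auto simp: P_def)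
    ultimately show ?thesis by (intro mult_left_mono add_mono) auto
  qed
  finally show ?thesis by simp
qed

text \<open>The two hypotheses share the allowance: the bound on \<open>p0\<close> makes the density
  part of \<open>card_bad\<close> at most a quarter of the box, and the bound on \<open>Y\<close>
  does the same for the error \<open>z\<close>, which grows only like the square root of the number
  of points in the box.\<close>

lemma card_good:
  assumes p0: "nat \<bar>Disc\<bar> \<le> p0" "4 * dg ^ 2 * 2 ^ dg * CC \<le> p0"
    and Y: "(4 * dg ^ 2 * 2 ^ dg) ^ 2 * (C0 * BB p0 ^ dg) \<le> Y"
  shows "real (card (Box Y - bad p0 Y)) \<ge> real Y ^ dg / 2"
proof -
  let ?k = "dg ^ 2 * 2 ^ dg"
  have k: "?k > 0" using dg_pos by simp
  have "(4 * dg ^ 2 * 2 ^ dg) ^ 2 * (C0 * BB p0 ^ dg) > 0" using dg_pos C0_pos BB_pos by simp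
  then have Y0: "Y > 0" using Y by linarith
  have "4 * dg ^ 2 * 2 ^ dg * CC > 0" using dg_pos CC_pos by simp
  then have p00: "p0 > 0" using p0 by linarith
  define n where "n = C0 * (BB p0 * Y) ^ dg"
  define z where "z = nth_root_nat 2 n"
  have z: "n < (z + 1)\<^sup>2" "z\<^sup>2 \<le> n"
    using nth_root_nat_ge[of 2 "z + 1" n] nth_root_nat_power_le[of 2 n] by (auto simp: z_def not_le[symmetric])
  have "4 * ?k * z \<le> Y ^ dg"
  proof -
    have "(4 * ?k * z)\<^sup>2 = (4 * ?k)\<^sup>2 * z\<^sup>2" by (simp add: power_mult_distrib)
    also have "\<dots> \<le> (4 * ?k)\<^sup>2 * n" using z by simp
    also have "\<dots> = ((4 * ?k)\<^sup>2 * (C0 * BB p0 ^ dg)) * Y ^ dg" by (simp add: n_def power_mult_distrib)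
    also have "\<dots> \<le> Y ^ dg * Y ^ dg"
    proof -
      have "Y \<le> Y ^ dg" using Y0 dg_pos by (intro self_le_power) auto
      then have "(4 * ?k)\<^sup>2 * (C0 * BB p0 ^ dg) \<le> Y ^ dg" using Y by (simp add: mult.assoc)
      then show ?thesis by (rule mult_right_mono) simp
    qed
    also have "\<dots> = (Y ^ dg)\<^sup>2" by (simp add: power2_eq_square)
    finally show ?thesis by (rule power2_le_imp_le) simp
  qed
  then have 1: "real (4 * ?k * z) \<le> real (Y ^ dg)" unfolding of_nat_le_iff .
  have "real (4 * ?k * CC) \<le> real p0" unfolding of_nat_le_iff using p0(2) by (simp add: mult.assoc)
  then have "real (4 * ?k * CC) * (real Y ^ dg / real p0) \<le> real p0 * (real Y ^ dg / real p0)" by (rule mult_right_mono) simp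
  then have 2: "real (4 * ?k * CC) * (real Y ^ dg / real p0) \<le> real Y ^ dg" using p00 by simp
  have "real (card (bad p0 Y)) \<le> real ?k * (real CC * real Y ^ dg / real p0 + real z)"
    using card_bad[OF p0(1) p00 Y0, of z] z(1) by (simp add: n_def)
  also have "\<dots> = (real (4 * ?k * CC) * (real Y ^ dg / real p0)) / 4 + real (4 * ?k * z) / 4"
    by (simp add: distrib_left)
  also have "\<dots> \<le> real Y ^ dg / 2" using 1 2 by simp
  finally have 3: "real (card (bad p0 Y)) \<le> real Y ^ dg / 2" .
  have "card (Box Y - bad p0 Y) = card (Box Y) - card (bad p0 Y)"
    using Box(1)[of Y] by (intro card_Diff_subset finite_subset[of "bad p0 Y" "Box Y"]) (auto simp: bad_def)
  then have "real (card (Box Y - bad p0 Y)) \<ge> real (card (Box Y)) - real (card (bad p0 Y))" by linarith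
  then show ?thesis using 3 Box(2)[of Y] by simp
qed

text \<open>Suppose a prime \<open>p\<close> divides the cofactor \<open>k\<close>. The norm is 1
  modulo \<open>BB p0\<close>, so \<open>p > p0\<close>, and by goodness \<open>p ^ 2\<close> does
  not divide the norm. Then the conjugate \<open>\<xi>\<close> with value in \<open>QQ p\<close> is
  fixed by \<open>frob p\<close>, since otherwise \<open>frob p \<xi>\<close> would be a second one.
  So \<open>(p, \<xi>)\<close> already contributes \<open>p\<close> to \<open>NA\<close>, and
  together with \<open>k\<close> this makes \<open>p ^ 2\<close> a divisor after all.\<close>

lemma NA_TT_good:
  assumes p0: "nat \<bar>Disc\<bar> \<le> p0" and Y: "Y > 0" and c: "c \<in> Box Y - bad p0 Y"
  shows "finite (TT p0 (aa p0 Y c))" "NA (TT p0 (aa p0 Y c)) = nat \<bar>Nz (aa p0 Y c)\<bar>"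
proof -
  let ?a = "aa p0 Y c"
  have nz: "Nz ?a \<noteq> 0" using c Y by (intro Nz_aa_nz) auto
  show fT: "finite (TT p0 ?a)" by (rule finite_TT[OF p0 nz])
  have "int (NA (TT p0 ?a)) dvd Nz ?a" by (rule NA_dvd[OF p0 fT]) auto
  then have "NA (TT p0 ?a) dvd nat \<bar>Nz ?a\<bar>" by (simp add: dvd_nat_abs_iff)
  then obtain k where k: "nat \<bar>Nz ?a\<bar> = NA (TT p0 ?a) * k" by (rule dvdE)
  have "k = 1"
  proof (rule ccontr)
    assume "k \<noteq> 1"
    then obtain p where p: "prime p" "p dvd k" using prime_factor_nat by blast
    have pd: "int p dvd Nz ?a" using p k by (metis dvd_mult dvd_nat_abs_iff int_dvd_int_iff)
    have "p0 < p"
    proof (rule ccontr)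
      assume "\<not> p0 < p"
      then have "p dvd BB p0" using p by (simp add: BB_def prime_dvd_fact_iff)
      have "(\<Prod>\<xi>\<in>Xi. ev ?a \<xi>) - 1 \<in> pO (BB p0)"
      proof (rule idl_prod_cong_one[OF idl_pO])
        fix \<xi> assume x: "\<xi> \<in> Xi"
        have "ev ?a \<xi> - 1 = of_nat (BB p0) * (of_nat (MM * Y) + ev c \<xi>)" by (simp add: ev_aa algebra_simps)
        then show "ev ?a \<xi> \<in> Ob \<and> ev ?a \<xi> - 1 \<in> pO (BB p0)" using ev_mem[OF x] by (simp add: pO_I mem del: of_nat_mult)
      qed
      then have "of_int (Nz ?a - 1) \<in> pO (BB p0)" by (simp add: Nz)
      then have "int (BB p0) dvd Nz ?a - 1" by (rule pO_int_D[OF BB_pos])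
      then have "int p dvd Nz ?a - 1" using \<open>p dvd BB p0\<close> by (meson dvd_trans int_dvd_int_iff)
      then have "int p dvd 1" using pd by (metis dvd_diff diff_diff_eq2 add.commute diff_add_cancel dvd_diffD1)
      then show False using p by (metis int_dvd_int_iff not_prime_unit of_nat_1)
    qed
    have nd: "\<not> int p dvd Disc" using \<open>p0 < p\<close> p0 by (intro not_dvd_Disc) auto
    have sq: "\<not> int p ^ 2 dvd Nz ?a" using c p \<open>p0 < p\<close> by (auto simp: bad_def)
    obtain \<xi> where x: "\<xi> \<in> Xi" "ev ?a \<xi> \<in> QQ p" using prime_dvd_Nz[OF p(1) pd] by blast
    have fr: "frob p \<in> Gal" by (rule frob(1)[OF p(1) nd])
    have "ev ?a \<xi> ^ p - frob p (ev ?a \<xi>) \<in> QQ p" by (rule frob(2)[OF p(1) nd ev_mem[OF x(1)]])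
    then have "ev ?a (frob p \<xi>) \<in> QQ p" unfolding Gal_ev[OF fr x(1)]
      using idl_cong_mem[OF QQ(3)[OF p(1)]] idl_power[OF QQ(3)[OF p(1)] x(2) prime_gt_0_nat[OF p(1)]] by blast
    then have "Lam p \<xi> (frob p \<xi>) ?a" if "\<xi> \<noteq> frob p \<xi>" using that x(2) by (simp add: Lam_def)
    then have "frob p \<xi> = \<xi>" using Lam_dvd[OF p(1) nd x(1) Gal_Xi[OF fr x(1)], of ?a] sq by metis
    then have "(p, \<xi>) \<in> TT p0 ?a" using x p \<open>p0 < p\<close> by (auto simp: TT_def PP_def)
    then have "p dvd NA (TT p0 ?a)" unfolding NA_def using fT by (metis dvd_prodI fst_conv)
    then have "p * p dvd nat \<bar>Nz ?a\<bar>" unfolding k using p by (intro mult_dvd_mono)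
    then have "int (p * p) dvd Nz ?a" by (metis dvd_nat_abs_iff)
    then show False using sq by (simp add: power2_eq_square)
  qed
  then show "NA (TT p0 ?a) = nat \<bar>Nz ?a\<bar>" using k by simp
qed

text \<open>If two box points give the same ideal, their difference lies in it, the factor
  \<open>BB p0\<close> being prime to it. That difference has norm at most
  \<open>CC * Y ^ dg\<close>, less than the norm of the ideal, which is at least
  \<open>(BB p0 * Y) ^ dg\<close>.\<close>

lemma inj_TT_good:
  assumes p0: "nat \<bar>Disc\<bar> \<le> p0" "CC < p0" and Y: "Y > 0"
  shows "inj_on (\<lambda>c. TT p0 (aa p0 Y c)) (Box Y - bad p0 Y)"
proof (rule inj_onI, rule ccontr)
  fix c c' assume c: "c \<in> Box Y - bad p0 Y" "c' \<in> Box Y - bad p0 Y"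
    and eq: "TT p0 (aa p0 Y c) = TT p0 (aa p0 Y c')" and ne: "c \<noteq> c'"
  let ?A = "TT p0 (aa p0 Y c)" and ?e = "\<lambda>i. c i - c' i"
  have "\<exists>i<dg. c i \<noteq> c' i" using c ne unfolding Box_def by (metis DiffD1 PiE_ext lessThan_iff)
  then have nz: "Nz ?e \<noteq> 0" using Nz_nz[of _ ?e] by auto
  have "?A \<subseteq> TT p0 ?e"
  proof
    fix a assume a: "a \<in> ?A"
    obtain p \<xi> where p: "a = (p, \<xi>)" by (cases a)
    have pp: "prime p" "p0 < p" "\<xi> \<in> Xi" "(p, \<xi>) \<in> PP p0" "ev (aa p0 Y c) \<xi> \<in> QQ p" using a p by (auto simp: TT_def PP_def)
    have "ev (aa p0 Y c') \<xi> \<in> QQ p" using a eq p by (auto simp: TT_def)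
    then have "ev (aa p0 Y c) \<xi> - ev (aa p0 Y c') \<xi> \<in> QQ p" using pp idl_diff[OF QQ(3)[OF pp(1)]] by simp
    then have "of_int (int (BB p0)) * ev ?e \<xi> \<in> QQ p" by (simp add: ev_aa ev_diff algebra_simps)
    moreover have "of_int (int (BB p0)) \<notin> QQ p"
      using primeO_int_iff[OF QQ(1,2)[OF pp(1)] pp(1)] prime_not_dvd_BB[OF pp(1,2)] by blast
    ultimately have "ev ?e \<xi> \<in> QQ p" using QQ(1)[OF pp(1)] int_mem ev_mem[OF pp(3)] unfolding primeO_def by blast
    then show "a \<in> TT p0 ?e" using pp p by (auto simp: TT_def)
  qed
  then have "int (NA ?A) dvd Nz ?e" using NA_TT_good(1)[OF p0(1) Y c(1)] by (intro NA_dvd[OF p0(1)])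
  then have "NA ?A dvd nat \<bar>Nz ?e\<bar>" by (simp add: dvd_nat_abs_iff)
  then have "NA ?A \<le> nat \<bar>Nz ?e\<bar>" using nz by (intro dvd_imp_le) auto
  also have "\<dots> \<le> CC * Y ^ dg"
  proof (rule Nz_bound)
    fix i assume "i < dg"
    then show "\<bar>c i - c' i\<bar> \<le> int Y" using Box(3)[of c Y i] Box(3)[of c' Y i] c by auto
  qed
  also have "\<dots> < (BB p0 * Y) ^ dg"
  proof -
    have "CC < BB p0" using p0(2) fact_ge_self[of p0] by (simp add: BB_def)
    also have "\<dots> \<le> BB p0 ^ dg" using BB_pos[of p0] dg_pos by (intro self_le_power) auto
    finally show ?thesis using Y by (simp add: power_mult_distrib)
  qed
  also have "\<dots> \<le> nat \<bar>Nz (aa p0 Y c)\<bar>" using c by (intro Nz_aa_bounds Y) auto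
  finally show False using NA_TT_good(2)[OF p0(1) Y c(1)] by simp
qed

text \<open>The good box points give at least \<open>Y ^ dg / 2\<close> distinct ideals, each of
  norm between \<open>x\<close> and \<open>C0 * x\<close>. As \<open>x\<close> is a constant times
  \<open>Y ^ dg\<close>, the bound does not depend on \<open>Y\<close>.\<close>

lemma sum_dyadic_lower:
  assumes p0: "nat \<bar>Disc\<bar> \<le> p0" "4 * dg ^ 2 * 2 ^ dg * CC \<le> p0"
    and Y: "(4 * dg ^ 2 * 2 ^ dg) ^ 2 * (C0 * BB p0 ^ dg) \<le> Y"
  defines "x \<equiv> (BB p0 * Y) ^ dg"
  shows "(\<Sum>A\<in>{A\<in>FA p0 (C0 * x). x \<le> NA A}. 1 / real (NA A)) \<ge> 1 / (2 * real (C0 * BB p0 ^ dg))"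
proof -
  have "(4 * dg ^ 2 * 2 ^ dg) ^ 2 * (C0 * BB p0 ^ dg) > 0" using dg_pos C0_pos BB_pos by simp
  then have Y0: "Y > 0" using Y by linarith
  have "2 \<le> 4 * dg ^ 2 * 2 ^ dg" using dg_pos by (simp add: Suc_le_eq)
  then have "2 * CC \<le> 4 * dg ^ 2 * 2 ^ dg * CC" by (rule mult_right_mono) simp
  then have CCp: "CC < p0" "CC \<le> p0" using CC_pos p0(2) by linarith+
  have x0: "C0 * x > 0" using Y0 BB_pos C0_pos by (simp add: x_def)
  let ?S = "{A\<in>FA p0 (C0 * x). x \<le> NA A}"
  have fS: "finite ?S" using card_FA(1)[OF p0(1) CCp(2) x0] by simp
  have "(\<lambda>c. TT p0 (aa p0 Y c)) ` (Box Y - bad p0 Y) \<subseteq> ?S"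
  proof
    fix A assume "A \<in> (\<lambda>c. TT p0 (aa p0 Y c)) ` (Box Y - bad p0 Y)"
    then obtain c where c: "c \<in> Box Y - bad p0 Y" "A = TT p0 (aa p0 Y c)" by auto
    have cB: "c \<in> Box Y" using c by simp
    have "TT p0 (aa p0 Y c) \<subseteq> PP p0" by (auto simp: TT_def)
    then show "A \<in> ?S" unfolding c(2) FA_def x_def
      using NA_TT_good[OF p0(1) Y0 c(1)] Nz_aa_bounds[OF cB Y0, of p0] by simp
  qed
  then have "card (Box Y - bad p0 Y) \<le> card ?S"
    by (rule card_inj_on_le[OF inj_TT_good[OF p0(1) CCp(1) Y0] _ fS])
  then have "real Y ^ dg / 2 \<le> real (card ?S)" using card_good[OF assms(1-3)] by linarith
  then have "real Y ^ dg / 2 * (1 / real (C0 * x)) \<le> real (card ?S) * (1 / real (C0 * x))" by (rule mult_right_mono) simp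
  also have "\<dots> = (\<Sum>A\<in>?S. 1 / real (C0 * x))" by simp
  also have "\<dots> \<le> (\<Sum>A\<in>?S. 1 / real (NA A))"
  proof (rule sum_mono)
    fix A assume A: "A \<in> ?S"
    then have "NA A > 0" "NA A \<le> C0 * x" using NA_pos[of A p0] by (auto simp: FA_def)
    then show "1 / real (C0 * x) \<le> 1 / real (NA A)"
      using x0 by (intro divide_left_mono mult_pos_pos) (auto simp del: of_nat_mult)
  qed
  finally have "real Y ^ dg / 2 * (1 / real (C0 * x)) \<le> (\<Sum>A\<in>?S. 1 / real (NA A))" .
  moreover have "real Y ^ dg / 2 * (1 / real (C0 * x)) = 1 / (2 * real (C0 * BB p0 ^ dg))"
    using Y0 by (simp add: x_def power_mult_distrib)
  ultimately show ?thesis by simp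
qed

text \<open>Scaling \<open>Y\<close> by \<open>K\<close> at each step, with
  \<open>K ^ dg > C0\<close>, makes the norm ranges from \<open>x j\<close> to
  \<open>C0 * x j\<close> disjoint, so each scale adds the same constant \<open>c\<close>. The
  scales grow geometrically, which gives logarithmic growth of the sum.\<close>

lemma sum_FA_lower:
  assumes p0: "nat \<bar>Disc\<bar> \<le> p0" "4 * dg ^ 2 * 2 ^ dg * CC \<le> p0"
  shows "\<exists>e c. c > 0 \<and> (\<forall>j. (\<Sum>A\<in>FA p0 (2 ^ (e * (j + 1))). 1 / real (NA A)) \<ge> c * real (j + 1))"
proof -
  define Y0 where "Y0 = (4 * dg ^ 2 * 2 ^ dg) ^ 2 * (C0 * BB p0 ^ dg)"
  have Y00: "Y0 > 0" unfolding Y0_def using dg_pos C0_pos BB_pos by simp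
  define K where "K = C0 + 1"
  define x where "x j = (BB p0 * (Y0 * K ^ j)) ^ dg" for j
  define c where "c = 1 / (2 * real (C0 * BB p0 ^ dg))"
  have c0: "c > 0" unfolding c_def using C0_pos BB_pos by simp
  have "2 \<le> 4 * dg ^ 2 * 2 ^ dg" using dg_pos by (simp add: Suc_le_eq)
  then have "2 * CC \<le> 4 * dg ^ 2 * 2 ^ dg * CC" by (rule mult_right_mono) simp
  then have CCp: "CC \<le> p0" using p0(2) by linarith
  have xpos: "x j > 0" for j unfolding x_def K_def using Y00 BB_pos by simp
  have xs: "x (Suc j) = K ^ dg * x j" for j unfolding x_def by (simp add: power_mult_distrib mult_ac)
  have K: "C0 < K ^ dg" using self_le_power[of K dg] dg_pos by (simp add: K_def)
  have step: "C0 * x j < x (Suc j)" for j unfolding xs using K xpos[of j] by simp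
  have main: "(\<Sum>A\<in>FA p0 (C0 * x j). 1 / real (NA A)) \<ge> c * real (j + 1)" for j
  proof (induction j)
    case 0
    have fin: "finite (FA p0 (C0 * x 0))" using xpos[of 0] C0_pos by (intro card_FA(1)[OF p0(1) CCp]) simp
    have "c \<le> (\<Sum>A\<in>{A\<in>FA p0 (C0 * x 0). x 0 \<le> NA A}. 1 / real (NA A))"
      using sum_dyadic_lower[OF p0, of Y0] by (simp add: c_def x_def Y0_def)
    also have "\<dots> \<le> (\<Sum>A\<in>FA p0 (C0 * x 0). 1 / real (NA A))" using fin by (intro sum_mono2) auto
    finally show ?case by simp
  next
    case (Suc j)
    let ?S = "{A\<in>FA p0 (C0 * x (Suc j)). x (Suc j) \<le> NA A}"
    have fin: "finite (FA p0 (C0 * x i))" for i using xpos[of i] C0_pos by (intro card_FA(1)[OF p0(1) CCp]) simp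
    have "Y0 * 1 \<le> Y0 * K ^ Suc j" by (intro mult_left_mono) (auto simp: K_def simp del: power_Suc)
    then have "c \<le> (\<Sum>A\<in>?S. 1 / real (NA A))"
      using sum_dyadic_lower[OF p0, of "Y0 * K ^ Suc j"] unfolding c_def x_def Y0_def by simp
    moreover have "(\<Sum>A\<in>FA p0 (C0 * x j). 1 / real (NA A)) + (\<Sum>A\<in>?S. 1 / real (NA A)) =
        (\<Sum>A\<in>FA p0 (C0 * x j) \<union> ?S. 1 / real (NA A))"
    proof (rule sum.union_disjoint[symmetric])
      show "finite (FA p0 (C0 * x j))" "finite ?S" using fin[of j] fin[of "Suc j"] by auto
      have "A \<notin> ?S" if "A \<in> FA p0 (C0 * x j)" for A
        using that step[of j] unfolding FA_def by (simp add: not_le)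
      then show "FA p0 (C0 * x j) \<inter> ?S = {}" by blast
    qed
    moreover have "\<dots> \<le> (\<Sum>A\<in>FA p0 (C0 * x (Suc j)). 1 / real (NA A))"
    proof (rule sum_mono2[OF fin])
      have "1 * x j \<le> C0 * x j" using C0_pos by (intro mult_right_mono) auto
      then have "x j \<le> x (Suc j)" using step[of j] by linarith
      then have "C0 * x j \<le> C0 * x (Suc j)" by (rule mult_left_mono) simp
      then have "FA p0 (C0 * x j) \<subseteq> FA p0 (C0 * x (Suc j))" unfolding FA_def by (auto intro: le_trans simp del: mult_le_cancel1)
      then show "FA p0 (C0 * x j) \<union> ?S \<subseteq> FA p0 (C0 * x (Suc j))" by blast
    qed auto
    ultimately have "(\<Sum>A\<in>FA p0 (C0 * x (Suc j)). 1 / real (NA A)) \<ge> c * real (j + 1) + c" using Suc by linarith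
    then show ?case by (simp add: algebra_simps)
  qed
  \<comment> \<open>Any \<open>e\<close> with both \<open>C0 * x 0\<close> and \<open>K ^ dg\<close>
    at most \<open>2 ^ e\<close> would do; it matches the scales with the powers of 2 of the upper
    bound.\<close>
  define e where "e = C0 * x 0 + K ^ dg"
  have xe: "C0 * x j \<le> 2 ^ (e * (j + 1))" for j
  proof (induction j)
    case 0
    have "C0 * x 0 \<le> e" by (simp add: e_def)
    also have "e \<le> 2 ^ e" using less_exp[of e] by simp
    finally show ?case by simp
  next
    case (Suc j)
    have "C0 * x (Suc j) = K ^ dg * (C0 * x j)" by (simp add: xs)
    also have "\<dots> \<le> 2 ^ e * 2 ^ (e * (j + 1))"
    proof (rule mult_mono[OF _ Suc])
      have "K ^ dg \<le> e" by (simp add: e_def)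
      also have "e \<le> 2 ^ e" using less_exp[of e] by simp
      finally show "K ^ dg \<le> 2 ^ e" .
    qed auto
    also have "\<dots> = 2 ^ (e * (Suc j + 1))" by (simp add: power_add[symmetric] algebra_simps)
    finally show ?case .
  qed
  have "(\<Sum>A\<in>FA p0 (2 ^ (e * (j + 1))). 1 / real (NA A)) \<ge> c * real (j + 1)" for j
  proof -
    have "(\<Sum>A\<in>FA p0 (C0 * x j). 1 / real (NA A)) \<le> (\<Sum>A\<in>FA p0 (2 ^ (e * (j + 1))). 1 / real (NA A))"
      using xe[of j] by (intro sum_mono2 card_FA(1)[OF p0(1) CCp]) (auto simp: FA_def)
    then show ?thesis using main[of j] by linarith
  qed
  then show ?thesis using c0 by blast
qed

end

section \<open>The weak form of Chebotarev's theorem\<close>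

context galois_ring
begin

text \<open>Formal Euler products: a set of norm-\<open>n\<close> ideals of the first field and a set of norm-\<open>m\<close> ideals
  are combined, through the two disjoint embeddings, into a norm-\<open>mn\<close> ideal of the second field.
  So the sum of inverse norms up to \<open>x\<^sup>2\<close> in the second field is at least the square of the sum up to \<open>x\<close>
  in the first, but both are of order \<open>log x\<close>.\<close>

lemma no_double_cover:
  fixes \<iota> :: "bool \<Rightarrow> nat \<Rightarrow> complex \<Rightarrow> complex"
  assumes eta: "eta \<in> Ob" "eta' \<in> Ob"
    and io: "\<And>p i \<xi>. prime p \<Longrightarrow> B < p \<Longrightarrow> \<xi> \<in> (\<lambda>g. g eta) ` Gal \<Longrightarrow> frob p \<xi> = \<xi> \<Longrightarrow>
        \<iota> i p \<xi> \<in> (\<lambda>g. g eta') ` Gal \<and> frob p (\<iota> i p \<xi>) = \<iota> i p \<xi>"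
    and inj: "\<And>p i j \<xi> \<zeta>. prime p \<Longrightarrow> B < p \<Longrightarrow> \<xi> \<in> (\<lambda>g. g eta) ` Gal \<Longrightarrow> frob p \<xi> = \<xi> \<Longrightarrow>
        \<zeta> \<in> (\<lambda>g. g eta) ` Gal \<Longrightarrow> frob p \<zeta> = \<zeta> \<Longrightarrow> \<iota> i p \<xi> = \<iota> j p \<zeta> \<Longrightarrow> i = j \<and> \<xi> = \<zeta>"
  shows False
proof -
  interpret E: orbit_element Ob Gal eta by unfold_locales (rule eta)
  interpret E': orbit_element Ob Gal eta' by unfold_locales (rule eta)
  \<comment> \<open>One cutoff above every threshold: \<open>B\<close> for the two embeddings,
    \<open>Disc\<close> for ramification, and the constants of both counting arguments.\<close>
  define p0 where "p0 = B + nat \<bar>Disc\<bar> + 4 * E.dg ^ 2 * 2 ^ E.dg * E.CC + E'.CC + E.CC"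
  have p0: "nat \<bar>Disc\<bar> \<le> p0" "4 * E.dg ^ 2 * 2 ^ E.dg * E.CC \<le> p0" "E'.CC \<le> p0" "E.CC \<le> p0" "B \<le> p0"
    by (simp_all add: p0_def)
  obtain e c where c: "c > 0" and low: "\<And>j. (\<Sum>A\<in>E.FA p0 (2 ^ (e * (j + 1))). 1 / real (E.NA A)) \<ge> c * real (j + 1)"
    using E.sum_FA_lower[OF p0(1,2)] by blast
  define f where "f i a = (fst a, \<iota> i (fst a) (snd a))" for i and a :: "nat \<times> complex"
  have PPD: "prime (fst a) \<and> B < fst a \<and> snd a \<in> (\<lambda>g. g eta) ` Gal \<and> frob (fst a) (snd a) = snd a" if "a \<in> E.PP p0" for a
    using that p0(5) by (auto simp: E.PP_def E.Xi_def)
  have f_in: "f i a \<in> E'.PP p0" if a: "a \<in> E.PP p0" for i a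
    using io[of "fst a" "snd a" i] PPD[OF a] a by (auto simp: f_def E'.PP_def E'.Xi_def E.PP_def)
  have f_inj: "i = j \<and> a = b" if "a \<in> E.PP p0" "b \<in> E.PP p0" "f i a = f j b" for i j a b
    using inj[of "fst a" "snd a" "snd b" i j] PPD[OF that(1)] PPD[OF that(2)] that(3) by (auto simp: f_def prod_eq_iff)
  define h where "h = (\<lambda>(A, A'). f True ` A \<union> f False ` A')"
  have sq: "(\<Sum>A\<in>E.FA p0 x. 1 / real (E.NA A))\<^sup>2 \<le> (\<Sum>A\<in>E'.FA p0 (x * x). 1 / real (E'.NA A))" if x: "x > 0" for x
  proof -
    have finE': "finite (E'.FA p0 (x * x))" using x by (intro E'.card_FA(1)[OF p0(1,3)]) simp
    have NA: "E'.NA (h (A, A')) = E.NA A * E.NA A'" if A: "A \<in> E.FA p0 x" "A' \<in> E.FA p0 x" for A A'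
    proof -
      have sub: "A \<subseteq> E.PP p0" "A' \<subseteq> E.PP p0" "finite A" "finite A'" using A by (auto simp: E.FA_def)
      have disj: "f True ` A \<inter> f False ` A' = {}"
      proof (rule ccontr)
        assume "f True ` A \<inter> f False ` A' \<noteq> {}"
        then obtain y where "y \<in> f True ` A" "y \<in> f False ` A'" by blast
        then obtain a b where "a \<in> A" "b \<in> A'" "f True a = f False b" by (metis imageE)
        then show False using f_inj[of a b True False] sub by blast
      qed
      have i1: "inj_on (f True) A" by (rule inj_onI) (use f_inj sub in blast)
      have i2: "inj_on (f False) A'" by (rule inj_onI) (use f_inj sub in blast)
      have "E'.NA (h (A, A')) = prod fst (f True ` A) * prod fst (f False ` A')"
        unfolding E'.NA_def h_def using sub disj by (simp add: prod.union_disjoint)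
      also have "prod fst (f True ` A) = prod fst A" by (subst prod.reindex[OF i1]) (simp add: f_def comp_def)
      also have "prod fst (f False ` A') = prod fst A'" by (subst prod.reindex[OF i2]) (simp add: f_def comp_def)
      finally show ?thesis by (simp add: E.NA_def)
    qed
    have h_in: "h ` (E.FA p0 x \<times> E.FA p0 x) \<subseteq> E'.FA p0 (x * x)"
    proof
      fix y assume "y \<in> h ` (E.FA p0 x \<times> E.FA p0 x)"
      then obtain A A' where y: "y = h (A, A')" "A \<in> E.FA p0 x" "A' \<in> E.FA p0 x" by auto
      have "finite y" "y \<subseteq> E'.PP p0" using y f_in by (auto simp: h_def E.FA_def)
      moreover have "E'.NA y \<le> x * x" unfolding y(1) NA[OF y(2,3)] using y by (auto simp: E.FA_def intro: mult_le_mono)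
      ultimately show "y \<in> E'.FA p0 (x * x)" by (simp add: E'.FA_def)
    qed
    have h_inj: "inj_on h (E.FA p0 x \<times> E.FA p0 x)"
    proof (rule inj_onI)
      fix u v assume u: "u \<in> E.FA p0 x \<times> E.FA p0 x" and v: "v \<in> E.FA p0 x \<times> E.FA p0 x" and eq: "h u = h v"
      obtain A A' C C' where uv: "u = (A, A')" "v = (C, C')" by (cases u, cases v)
      have sub: "A \<subseteq> E.PP p0" "A' \<subseteq> E.PP p0" "C \<subseteq> E.PP p0" "C' \<subseteq> E.PP p0" using u v uv by (auto simp: E.FA_def)
      \<comment> \<open>Since \<open>f\<close> is injective jointly in its index and argument, both
        components can be read off from the union; this makes \<open>h\<close> injective.\<close>
      have rec1: "D = {a \<in> E.PP p0. f True a \<in> h (D, D')}" if "D \<subseteq> E.PP p0" "D' \<subseteq> E.PP p0" for D D'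
        using that f_inj by (auto simp: h_def) blast+
      have rec2: "D' = {a \<in> E.PP p0. f False a \<in> h (D, D')}" if "D \<subseteq> E.PP p0" "D' \<subseteq> E.PP p0" for D D'
        using that f_inj by (auto simp: h_def) blast+
      have "A = C" using rec1[OF sub(1,2)] rec1[OF sub(3,4)] eq uv by simp
      moreover have "A' = C'" using rec2[OF sub(1,2)] rec2[OF sub(3,4)] eq uv by simp
      ultimately show "u = v" using uv by simp
    qed
    have "(\<Sum>A\<in>E.FA p0 x. 1 / real (E.NA A))\<^sup>2 = (\<Sum>(A, A')\<in>E.FA p0 x \<times> E.FA p0 x. 1 / real (E.NA A) * (1 / real (E.NA A')))"
      unfolding power2_eq_square sum_product sum.cartesian_product ..
    also have "\<dots> = (\<Sum>u\<in>E.FA p0 x \<times> E.FA p0 x. 1 / real (E'.NA (h u)))"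
      by (rule sum.cong) (auto simp: NA)
    also have "\<dots> = (\<Sum>y\<in>h ` (E.FA p0 x \<times> E.FA p0 x). 1 / real (E'.NA y))"
      by (simp add: sum.reindex[OF h_inj])
    also have "\<dots> \<le> (\<Sum>A\<in>E'.FA p0 (x * x). 1 / real (E'.NA A))"
      using h_in finE' by (intro sum_mono2) auto
    finally show ?thesis .
  qed
  \<comment> \<open>The squared lower bound is \<open>c ^ 2 * (j + 1) ^ 2\<close>, while the upper
    bound at exponent \<open>2 * (e * (j + 1))\<close> is at most \<open>K * (j + 1)\<close>; large
    \<open>j\<close> gives the contradiction.\<close>
  define K where "K = (3::real) ^ E'.dg * (4 * real e + 1)"
  have bound: "c\<^sup>2 * real (j + 1) \<le> K" for j
  proof -
    let ?x = "2 ^ (e * (j + 1)) :: nat"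
    have "(c * real (j + 1))\<^sup>2 \<le> (\<Sum>A\<in>E.FA p0 ?x. 1 / real (E.NA A))\<^sup>2"
      using low[of j] c by (intro power_mono) auto
    also have "\<dots> \<le> (\<Sum>A\<in>E'.FA p0 (?x * ?x). 1 / real (E'.NA A))" by (rule sq) simp
    also have "?x * ?x = 2 ^ (2 * (e * (j + 1)))" by (simp add: power_add[symmetric] mult_2 del: mult_Suc_right)
    also have "(\<Sum>A\<in>E'.FA p0 (2 ^ (2 * (e * (j + 1)))). 1 / real (E'.NA A)) \<le> 3 ^ E'.dg * (2 * real (2 * (e * (j + 1))) + 1)"
      by (rule E'.sum_FA_upper[OF p0(1,3)])
    also have "\<dots> \<le> 3 ^ E'.dg * ((4 * real e + 1) * real (j + 1))"
      by (intro mult_left_mono) (auto simp: algebra_simps)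
    finally have "c\<^sup>2 * real (j + 1) * real (j + 1) \<le> K * real (j + 1)"
      by (simp only: K_def power_mult_distrib power2_eq_square mult_ac)
    then show ?thesis by (rule mult_right_le_imp_le) simp
  qed
  obtain n where "K / c\<^sup>2 < real n" using reals_Archimedean2 by blast
  then have "K < c\<^sup>2 * real n" using c by (simp add: field_simps)
  also have "\<dots> \<le> c\<^sup>2 * real (n + 1)" by (intro mult_left_mono) auto
  finally show False using bound[of n] by linarith
qed

text \<open>A \<open>\<tau>\<close> that fixes every invariant of \<open>C\<close> fixes the
  coefficients of \<open>P\<close>, hence maps its root \<open>gam\<close> to some root
  \<open>c gam\<close> and equals \<open>c\<close>. So each \<open>\<tau>\<close> outside
  \<open>C\<close> moves some invariant, and \<open>exists_moved_by_all\<close> finds one moved by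
  all of them.\<close>

lemma exists_stabilizer:
  assumes C: "C \<subseteq> Gal" "id \<in> C" "\<And>g h. g \<in> C \<Longrightarrow> h \<in> C \<Longrightarrow> g \<circ> h \<in> C"
  shows "\<exists>eta\<in>Ob. \<forall>g\<in>Gal. g eta = eta \<longleftrightarrow> g \<in> C"
proof -
  have fC: "finite C" using C finite_Gal finite_subset by blast
  define V where "V = {x \<in> Ob. \<forall>c\<in>C. c x = x}"
  define P where "P = (\<Prod>c\<in>C. [:- c gam, 1:])"
  have OP: "Opoly P" unfolding P_def by (rule Opoly_prod, rule Opoly_lin, rule gam_mem) (use C in auto)
  have "\<exists>v\<in>V. \<forall>\<tau>\<in>Gal - C. \<tau> v \<noteq> v"
  proof (rule exists_moved_by_all)
    show "finite (Gal - C)" using finite_Gal by simp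
    have "0 \<in> V" unfolding V_def using C Gal_zero zero_mem by auto
    then show "V \<noteq> {}" by auto
    show "x + of_nat n * y \<in> V" if "x \<in> V" "y \<in> V" for x y n
      using that C(1) unfolding V_def by (auto simp: mem Gal_add Gal_mult Gal_nat subset_iff)
    show "\<tau> (x + of_nat n * y) = \<tau> x + of_nat n * \<tau> y" if "\<tau> \<in> Gal - C" "x \<in> V" "y \<in> V" for \<tau> x y n
      using that unfolding V_def by (auto simp: mem Gal_add Gal_mult Gal_nat)
    fix \<tau> assume t: "\<tau> \<in> Gal - C"
    have mapP: "map_poly g P = P" if g: "g \<in> C" for g
    proof -
      have gG: "g \<in> Gal" using g C by auto
      have "bij_betw (\<lambda>h. g \<circ> h) C C"
        unfolding bij_betw_def
      proof
        show i: "inj_on (\<lambda>h. g \<circ> h) C" by (rule inj_onI) (rule Gal_comp_eqD[OF gG])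
        show "(\<lambda>h. g \<circ> h) ` C = C" by (rule endo_inj_surj[OF fC _ i]) (use C g in auto)
      qed
      have "map_poly g P = (\<Prod>c\<in>C. [:- (g \<circ> c) gam, 1:])" unfolding P_def using gG C(1)
        by (subst map_poly_Gal_prod) (auto intro!: prod.cong Opoly_lin simp: map_poly_Gal_lin gam_mem subset_iff)
      also have "\<dots> = P" unfolding P_def by (rule prod.reindex_bij_betw[OF \<open>bij_betw (\<lambda>h. g \<circ> h) C C\<close>, of "\<lambda>h. [:- h gam, 1:]"])
      finally show ?thesis .
    qed
    have cV: "Polynomial.coeff P i \<in> V" for i
    proof -
      have "g (Polynomial.coeff P i) = Polynomial.coeff P i" if g: "g \<in> C" for g
        using arg_cong[OF mapP[OF g], of "\<lambda>q. Polynomial.coeff q i"] Gal_zero[of g] g C(1) by (auto simp: coeff_map_poly)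
      then show ?thesis using OP unfolding V_def Opoly_def by auto
    qed
    show "\<exists>v\<in>V. \<tau> v \<noteq> v"
    proof (rule ccontr)
      assume "\<not> (\<exists>v\<in>V. \<tau> v \<noteq> v)"
      then have "\<tau> (Polynomial.coeff P i) = Polynomial.coeff P i" for i using cV by blast
      then have "map_poly \<tau> P = P" using t Gal_zero[of \<tau>] by (intro poly_eqI) (simp add: coeff_map_poly)
      moreover have "poly P gam = 0" unfolding P_def poly_prod using fC C(2) by (intro prod_zero) (auto intro!: bexI[of _ id])
      ultimately have "poly P (\<tau> gam) = 0" using Gal_poly[of \<tau> P gam] t OP gam(1) Gal_zero[of \<tau>] by simp
      then obtain c where c: "c \<in> C" "\<tau> gam = c gam" unfolding P_def poly_prod using fC by auto
      then have "\<tau> = c" using gam_inj[of \<tau> c] t C by auto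
      then show False using c t by auto
    qed
  qed
  then show ?thesis unfolding V_def by blast
qed

text \<open>Let \<open>eta\<close> and \<open>eta'\<close> have as stabilizers the groups generated
  by \<open>\<sigma>\<close> and by \<open>\<sigma> ^^ l\<close>. At a degree-one prime
  \<open>(p, \<xi>)\<close> the automorphism \<open>\<tau> \<xi>\<close> conjugates the Frobenius
  into a power of \<open>\<sigma>\<close>. Were its exponent always divisible by \<open>l\<close>,
  this power would fix \<open>eta'\<close> and also \<open>\<sigma> eta'\<close>, two different
  elements because a nontrivial \<open>\<sigma>\<close> of \<open>l\<close>-power order is not a
  power of \<open>\<sigma> ^^ l\<close>. Their images under \<open>\<tau> \<xi>\<close> supply the
  double cover.\<close>

theorem Frobenius_generates:
  assumes s: "\<sigma> \<in> Gal" "\<sigma> \<noteq> id" and l: "prime l" "\<sigma> ^^ (l ^ a) = id"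
  shows "\<exists>p Q k. B < p \<and> prime p \<and> primeO Q \<and> of_nat p \<in> Q \<and> \<not> l dvd k \<and> (\<forall>x\<in>Ob. x ^ p - (\<sigma> ^^ k) x \<in> Q)"
proof (rule ccontr)
  assume neg: "\<not> ?thesis"
  define C where "C = range (\<lambda>k. \<sigma> ^^ k)"
  define C' where "C' = range (\<lambda>k. \<sigma> ^^ (l * k))"
  have fp: "\<sigma> ^^ m \<circ> \<sigma> ^^ n = \<sigma> ^^ (m + n)" for m n by (simp add: funpow_add)
  have CG: "C \<subseteq> Gal" "C' \<subseteq> Gal" "C' \<subseteq> C" using Gal_funpow[OF s(1)] by (auto simp: C_def C'_def)
  have idC: "id \<in> C" "id \<in> C'" unfolding C_def C'_def by (auto intro!: image_eqI[of _ _ 0] simp flip: id_def)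
  have cC: "g \<circ> h \<in> C" if gh: "g \<in> C" "h \<in> C" for g h
  proof -
    obtain m n where "g = \<sigma> ^^ m" "h = \<sigma> ^^ n" using gh by (auto simp: C_def)
    then show ?thesis unfolding C_def using fp by blast
  qed
  have cC': "g \<circ> h \<in> C'" if gh: "g \<in> C'" "h \<in> C'" for g h
  proof -
    obtain m n where "g = \<sigma> ^^ (l * m)" "h = \<sigma> ^^ (l * n)" using gh by (auto simp: C'_def)
    then have "g \<circ> h = \<sigma> ^^ (l * (m + n))" using fp by (simp add: distrib_left)
    then show ?thesis unfolding C'_def by blast
  qed
  obtain eta where eta: "eta \<in> Ob" "\<And>g. g \<in> Gal \<Longrightarrow> g eta = eta \<longleftrightarrow> g \<in> C"
    using exists_stabilizer[OF CG(1) idC(1) cC] by blast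
  obtain eta' where eta': "eta' \<in> Ob" "\<And>g. g \<in> Gal \<Longrightarrow> g eta' = eta' \<longleftrightarrow> g \<in> C'"
    using exists_stabilizer[OF CG(2) idC(2) cC'] by blast
  have sC': "\<sigma> \<notin> C'"
  proof
    assume "\<sigma> \<in> C'"
    then obtain k where k: "\<sigma> = \<sigma> ^^ (l * k)" by (auto simp: C'_def)
    \<comment> \<open>Iterating \<open>\<sigma> = \<sigma> ^^ (l * k)\<close> allows every power of
      \<open>l * k\<close> as exponent, and the \<open>a\<close>-th one is a multiple of
      \<open>l ^ a\<close>.\<close>
    have "\<sigma> = \<sigma> ^^ ((l * k) ^ n)" for n
    proof (induction n)
      case (Suc n)
      have "\<sigma> ^^ ((l * k) ^ Suc n) = (\<sigma> ^^ (l * k)) ^^ ((l * k) ^ n)" by (simp add: funpow_mult mult.commute)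
      also have "\<dots> = \<sigma>" using k Suc by simp
      finally show ?case by simp
    qed auto
    from this[of a] have "\<sigma> = (\<sigma> ^^ (l ^ a)) ^^ (k ^ a)" by (simp add: funpow_mult power_mult_distrib mult.commute)
    then have "\<sigma> = id" unfolding l(2) by (simp add: id_funpow)
    then show False using s by simp
  qed
  have sC: "\<sigma> \<in> C" unfolding C_def by (auto intro!: image_eqI[of _ _ 1])
  \<comment> \<open>The stabilizer of \<open>eta'\<close> lies in that of \<open>eta\<close>, so a
    conjugate of \<open>eta'\<close> determines the conjugate of \<open>eta\<close> below
    it.\<close>
  have cancel: "u eta = v eta" if uv: "u \<in> Gal" "v \<in> Gal" "u eta' = v eta'" for u v
  proof -
    obtain w where w: "w \<in> Gal" "\<And>x. w (v x) = x" "\<And>x. v (w x) = x" using Gal_inv[OF uv(2)] by metis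
    have "(w \<circ> u) eta' = eta'" using uv w by simp
    then have "w \<circ> u \<in> C" using eta'(2)[OF comp_Gal[OF w(1) uv(1)]] CG by blast
    then have "(w \<circ> u) eta = eta" using eta(2)[OF comp_Gal[OF w(1) uv(1)]] by blast
    then show ?thesis using w(3) by (metis comp_apply)
  qed
  define \<tau> where "\<tau> \<xi> = (SOME g. g \<in> Gal \<and> g eta = \<xi>)" for \<xi>
  have tau: "\<tau> \<xi> \<in> Gal" "\<tau> \<xi> eta = \<xi>" if x: "\<xi> \<in> (\<lambda>g. g eta) ` Gal" for \<xi>
  proof -
    have "\<exists>g. g \<in> Gal \<and> g eta = \<xi>" using x by auto
    from someI_ex[OF this] show "\<tau> \<xi> \<in> Gal" "\<tau> \<xi> eta = \<xi>" by (auto simp: \<tau>_def)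
  qed
  define \<iota> where "\<iota> i p \<xi> = \<tau> \<xi> (if i then eta' else \<sigma> eta')" for i and p :: nat and \<xi>
  show False
  proof (rule no_double_cover[OF eta(1) eta'(1), of "B + nat \<bar>Disc\<bar>" \<iota>])
    fix p i \<xi> assume p: "prime p" "B + nat \<bar>Disc\<bar> < p" and x: "\<xi> \<in> (\<lambda>g. g eta) ` Gal" "frob p \<xi> = \<xi>"
    have nd: "\<not> int p dvd Disc" using p by (intro not_dvd_Disc) auto
    let ?t = "\<tau> \<xi>" and ?f = "frob p"
    have t: "?t \<in> Gal" "?t eta = \<xi>" by (rule tau[OF x(1)])+
    have f: "?f \<in> Gal" by (rule frob(1)[OF p(1) nd])
    obtain w where w: "w \<in> Gal" "\<And>x. w (?t x) = x" "\<And>x. ?t (w x) = x" using Gal_inv[OF t(1)] by metis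
    define \<psi> where "\<psi> = w \<circ> ?f \<circ> ?t"
    have psG: "\<psi> \<in> Gal" unfolding \<psi>_def by (intro comp_Gal w t f)
    have tpsi: "?t (\<psi> y) = ?f (?t y)" for y by (simp add: \<psi>_def w)
    have "\<psi> eta = eta" using t x w by (simp add: \<psi>_def) (metis w(2) t(2))
    then have "\<psi> \<in> C" using eta(2)[OF psG] by simp
    then obtain k where k: "\<psi> = \<sigma> ^^ k" by (auto simp: C_def)
    have "l dvd k"
    proof (rule ccontr)
      assume lk: "\<not> l dvd k"
      \<comment> \<open>The prime conjugate to \<open>QQ p\<close> under the inverse of
        \<open>\<tau> \<xi>\<close>; its Frobenius is \<open>\<psi>\<close>, so an exponent not
        divisible by \<open>l\<close> is what \<open>neg\<close> excludes.\<close>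
      define Q where "Q = {x \<in> Ob. ?t x \<in> QQ p}"
      have Qp: "idl (QQ p)" by (rule QQ(3)[OF p(1)])
      have "idl Q" unfolding idl_def Q_def
        using t(1) by (auto simp: mem Gal_zero Gal_add Gal_mult idlD[OF Qp] Gal_mem)
      moreover have "1 \<notin> Q" unfolding Q_def using QQ(1)[OF p(1)] Gal_one[OF t(1)] by (simp add: primeO_def)
      moreover have "x \<in> Q \<or> y \<in> Q" if xy: "x \<in> Ob" "y \<in> Ob" "x * y \<in> Q" for x y
      proof -
        have "?t x * ?t y \<in> QQ p" using xy Gal_mult[OF t(1)] by (simp add: Q_def)
        then have "?t x \<in> QQ p \<or> ?t y \<in> QQ p" using QQ(1)[OF p(1)] Gal_mem[OF t(1)] xy unfolding primeO_def by blast
        then show ?thesis using xy by (simp add: Q_def)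
      qed
      ultimately have Q: "primeO Q" unfolding primeO_def by blast
      have pQ: "of_nat p \<in> Q" unfolding Q_def using QQ(2)[OF p(1)] Gal_nat[OF t(1)] by (simp add: mem)
      have "y ^ p - (\<sigma> ^^ k) y \<in> Q" if y: "y \<in> Ob" for y
      proof -
        have py: "\<psi> y \<in> Ob" "?t y \<in> Ob" using Gal_mem[OF psG y] Gal_mem[OF t(1) y] by auto
        have "?t (y ^ p - \<psi> y) = ?t y ^ p - ?f (?t y)"
          using py y by (simp add: Gal_diff[OF t(1)] Gal_power[OF t(1)] mem tpsi)
        then have "?t (y ^ p - \<psi> y) \<in> QQ p" using frob(2)[OF p(1) nd py(2)] by simp
        then show ?thesis using y py by (simp add: Q_def k mem)
      qed
      then have "\<exists>p Q k. B < p \<and> prime p \<and> primeO Q \<and> of_nat p \<in> Q \<and> \<not> l dvd k \<and> (\<forall>x\<in>Ob. x ^ p - (\<sigma> ^^ k) x \<in> Q)"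
        using p Q pQ lk by (intro exI[of _ p] exI[of _ Q] exI[of _ k]) auto
      then show False using neg by blast
    qed
    then have "\<psi> \<in> C'" using k by (auto simp: C'_def)
    then have ps': "\<psi> eta' = eta'" using eta'(2)[OF psG] by simp
    have "\<psi> (\<sigma> eta') = \<sigma> (\<psi> eta')" unfolding k by (simp add: funpow_swap1)
    then have ps2: "\<psi> (\<sigma> eta') = \<sigma> eta'" using ps' by simp
    show "\<iota> i p \<xi> \<in> (\<lambda>g. g eta') ` Gal \<and> frob p (\<iota> i p \<xi>) = \<iota> i p \<xi>"
    proof
      show "\<iota> i p \<xi> \<in> (\<lambda>g. g eta') ` Gal"
      proof (cases i)
        case True
        then show ?thesis using t(1) by (auto simp: \<iota>_def)
      next
        case False
        then have "\<iota> i p \<xi> = (?t \<circ> \<sigma>) eta'" by (simp add: \<iota>_def)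
        then show ?thesis using comp_Gal[OF t(1) s(1)] by blast
      qed
      show "frob p (\<iota> i p \<xi>) = \<iota> i p \<xi>" unfolding \<iota>_def tpsi[symmetric] using ps' ps2 by simp
    qed
  next
    fix p i j \<xi> \<zeta> assume x: "\<xi> \<in> (\<lambda>g. g eta) ` Gal" "\<zeta> \<in> (\<lambda>g. g eta) ` Gal" and eq: "\<iota> i p \<xi> = \<iota> j p \<zeta>"
    define u where "u i \<xi> = (if i then \<tau> \<xi> else \<tau> \<xi> \<circ> \<sigma>)" for i :: bool and \<xi>
    have uG: "u i \<xi> \<in> Gal" if "\<xi> \<in> (\<lambda>g. g eta) ` Gal" for i \<xi> using tau(1)[OF that] s(1) by (simp add: u_def comp_Gal)
    have ue: "u i \<xi> eta' = \<iota> i p \<xi>" for i \<xi> by (simp add: u_def \<iota>_def)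
    have "\<sigma> eta = eta" using eta(2)[OF s(1)] sC by simp
    then have ueta: "u i \<xi> eta = \<xi>" if "\<xi> \<in> (\<lambda>g. g eta) ` Gal" for i \<xi> using tau(2)[OF that] by (simp add: u_def)
    have "\<xi> = \<zeta>" using cancel[OF uG[OF x(1)] uG[OF x(2)], of i j] ue eq ueta x by simp
    moreover have "i = j"
    proof (rule ccontr)
      assume "i \<noteq> j"
      then have "\<tau> \<xi> eta' = \<tau> \<xi> (\<sigma> eta')" using eq \<open>\<xi> = \<zeta>\<close> by (auto simp: \<iota>_def split: if_splits)
      then have "eta' = \<sigma> eta'" using Gal_inj[OF tau(1)[OF x(1)]] by blast
      then show False using eta'(2)[OF s(1)] sC' by simp
    qed
    ultimately show "i = j \<and> \<xi> = \<zeta>" by simp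
  qed
qed

end

section \<open>Stabilizers in transitive actions of degree at most five\<close>

text \<open>Groups are bare sets of functions, so that subgroups act on the same points without an
  action map. Group records are entered through \<open>grp_rec\<close>, for Lagrange, Sylow and the
  orders of elements.\<close>

definition perm_grp :: "('a \<Rightarrow> 'a) set \<Rightarrow> bool" where
  "perm_grp G \<longleftrightarrow> finite G \<and> id \<in> G \<and> (\<forall>g\<in>G. \<forall>h\<in>G. g \<circ> h \<in> G) \<and> (\<forall>g\<in>G. \<exists>h\<in>G. h \<circ> g = id \<and> g \<circ> h = id)"

definition stb :: "('a \<Rightarrow> 'a) set \<Rightarrow> 'a \<Rightarrow> ('a \<Rightarrow> 'a) set" where "stb G x = {g \<in> G. g x = x}"
definition orbt :: "('a \<Rightarrow> 'a) set \<Rightarrow> 'a \<Rightarrow> 'a set" where "orbt G x = (\<lambda>g. g x) ` G"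

lemma perm_grpD:
  assumes "perm_grp G"
  shows "finite G" "id \<in> G" "g \<in> G \<Longrightarrow> h \<in> G \<Longrightarrow> g \<circ> h \<in> G"
  using assms by (auto simp: perm_grp_def)

lemma perm_grp_inv:
  assumes "perm_grp G" "g \<in> G"
  obtains h where "h \<in> G" "\<And>x. h (g x) = x" "\<And>x. g (h x) = x" "h \<circ> g = id" "g \<circ> h = id"
proof -
  obtain h where h: "h \<in> G" "h \<circ> g = id" "g \<circ> h = id" using assms by (auto simp: perm_grp_def)
  have "h (g x) = x" "g (h x) = x" for x using fun_cong[OF h(2), of x] fun_cong[OF h(3), of x] by auto
  then show ?thesis using h that by blast
qed

lemma perm_grp_inj: "perm_grp G \<Longrightarrow> g \<in> G \<Longrightarrow> g x = g y \<Longrightarrow> x = y"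
  by (metis perm_grp_inv)

lemma perm_grp_card_pos: "perm_grp G \<Longrightarrow> card G > 0"
  using perm_grpD(1,2) card_gt_0_iff by blast

lemma perm_grp_stb: assumes "perm_grp G" shows "perm_grp (stb G x)"
proof -
  have "\<exists>h\<in>stb G x. h \<circ> g = id \<and> g \<circ> h = id" if g: "g \<in> stb G x" for g
  proof -
    have gG: "g \<in> G" "g x = x" using g by (auto simp: stb_def)
    obtain h where h: "h \<in> G" "\<And>x. h (g x) = x" "h \<circ> g = id" "g \<circ> h = id" using perm_grp_inv[OF assms gG(1)] by metis
    have "h x = x" using h(2)[of x] gG by simp
    then show ?thesis using h by (auto simp: stb_def)
  qed
  then show ?thesis using perm_grpD[OF assms] unfolding perm_grp_def by (auto simp: stb_def)
qed

lemma stb_sub: "stb G x \<subseteq> G" by (auto simp: stb_def)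
lemma finite_orbt: "perm_grp G \<Longrightarrow> finite (orbt G x)" by (auto simp: orbt_def perm_grp_def)
lemma orbt_self: "perm_grp G \<Longrightarrow> x \<in> orbt G x"
  unfolding orbt_def by (rule image_eqI[of _ _ id]) (auto dest: perm_grpD(2))
lemma orbt_closed: "perm_grp G \<Longrightarrow> g \<in> G \<Longrightarrow> y \<in> orbt G x \<Longrightarrow> g y \<in> orbt G x"
proof -
  assume G: "perm_grp G" and g: "g \<in> G" and "y \<in> orbt G x"
  then obtain h where h: "h \<in> G" "y = h x" by (auto simp: orbt_def)
  have "g y = (g \<circ> h) x" using h by simp
  then show ?thesis unfolding orbt_def using perm_grpD(3)[OF G g h(1)] by blast
qed
lemma orbt_trans: "perm_grp G \<Longrightarrow> y \<in> orbt G x \<Longrightarrow> z \<in> orbt G x \<Longrightarrow> \<exists>g\<in>G. g y = z"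
proof -
  assume G: "perm_grp G" and "y \<in> orbt G x" "z \<in> orbt G x"
  then obtain g h where gh: "g \<in> G" "h \<in> G" "y = g x" "z = h x" by (auto simp: orbt_def)
  obtain k where k: "k \<in> G" "\<And>x. k (g x) = x" using perm_grp_inv[OF G gh(1)] by metis
  have "(h \<circ> k) y = z" using gh k by simp
  then show ?thesis using perm_grpD(3)[OF G gh(2) k(1)] by blast
qed
lemma orbt_eq: "perm_grp G \<Longrightarrow> y \<in> orbt G x \<Longrightarrow> orbt G y = orbt G x"
proof -
  assume G: "perm_grp G" and y: "y \<in> orbt G x"
  have "z \<in> orbt G y" if z: "z \<in> orbt G x" for z using orbt_trans[OF G y z] by (auto simp: orbt_def)
  moreover have "z \<in> orbt G x" if z: "z \<in> orbt G y" for z using z orbt_closed[OF G _ y] by (auto simp: orbt_def)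
  ultimately show ?thesis by blast
qed
lemma orbt_mono: "S \<subseteq> G \<Longrightarrow> orbt S x \<subseteq> orbt G x" by (auto simp: orbt_def)

lemma orbit_stabilizer:
  assumes G: "perm_grp G"
  shows "card (orbt G x) * card (stb G x) = card G"
proof -
  have fib: "card {g \<in> G. g x = y} = card (stb G x)" if y: "y \<in> orbt G x" for y
  proof -
    obtain h where h: "h \<in> G" "y = h x" using y by (auto simp: orbt_def)
    obtain k where k: "k \<in> G" "\<And>x. k (h x) = x" "\<And>x. h (k x) = x" "k \<circ> h = id" "h \<circ> k = id" using perm_grp_inv[OF G h(1)] by metis
    have "bij_betw (\<lambda>g. h \<circ> g) (stb G x) {g \<in> G. g x = y}"
      by (rule bij_betw_byWitness[of _ "\<lambda>g. k \<circ> g"])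
         (use h k perm_grpD(3)[OF G] in \<open>auto simp: stb_def comp_assoc[symmetric]\<close>)
    then show ?thesis by (simp add: bij_betw_same_card)
  qed
  have "card G = card (\<Union>y\<in>orbt G x. {g \<in> G. g x = y})" by (rule arg_cong[of _ _ card]) (auto simp: orbt_def)
  also have "\<dots> = (\<Sum>y\<in>orbt G x. card {g \<in> G. g x = y})"
    using finite_orbt[OF G] perm_grpD(1)[OF G] by (intro card_UN_disjoint) auto
  also have "\<dots> = card (orbt G x) * card (stb G x)" using fib by simp
  finally show ?thesis by simp
qed

definition grp_rec :: "('a \<Rightarrow> 'a) set \<Rightarrow> ('a \<Rightarrow> 'a) monoid" where
  "grp_rec G = \<lparr>carrier = G, monoid.mult = (\<circ>), one = id\<rparr>"

lemma grp_rec_group: assumes "perm_grp G" shows "group (grp_rec G)"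
proof (rule groupI)
  fix x assume "x \<in> carrier (grp_rec G)"
  then show "\<exists>y\<in>carrier (grp_rec G). y \<otimes>\<^bsub>grp_rec G\<^esub> x = \<one>\<^bsub>grp_rec G\<^esub>"
    using assms by (auto simp: grp_rec_def perm_grp_def)
qed (use assms in \<open>auto simp: grp_rec_def perm_grp_def comp_assoc\<close>)

lemma subgroup_perm_grp:
  assumes G: "perm_grp G" and S: "subgroup S (grp_rec G)"
  shows "perm_grp S" "S \<subseteq> G"
proof -
  interpret group "grp_rec G" by (rule grp_rec_group[OF G])
  show SG: "S \<subseteq> G" using subgroup.subset[OF S] by (simp add: grp_rec_def)
  have "\<exists>h\<in>S. h \<circ> g = id \<and> g \<circ> h = id" if g: "g \<in> S" for g
  proof -
    have gc: "g \<in> carrier (grp_rec G)" using g SG by (auto simp: grp_rec_def)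
    show ?thesis using subgroup.m_inv_closed[OF S g] l_inv[OF gc] r_inv[OF gc] by (auto simp: grp_rec_def intro!: bexI)
  qed
  moreover have "g \<circ> h \<in> S" if "g \<in> S" "h \<in> S" for g h using subgroup.m_closed[OF S that] by (simp add: grp_rec_def)
  moreover have "id \<in> S" using subgroup.one_closed[OF S] by (simp add: grp_rec_def)
  ultimately show "perm_grp S" using SG perm_grpD(1)[OF G] finite_subset unfolding perm_grp_def by blast
qed

lemma perm_grp_subgroup:
  assumes "perm_grp G" "perm_grp S" "S \<subseteq> G" shows "subgroup S (grp_rec G)"
proof -
  interpret group "grp_rec G" by (rule grp_rec_group[OF assms(1)])
  show ?thesis
  proof (rule subgroupI)
    show "S \<subseteq> carrier (grp_rec G)" using assms by (simp add: grp_rec_def)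
    show "S \<noteq> {}" using perm_grpD(2)[OF assms(2)] by auto
    fix g assume g: "g \<in> S"
    obtain h where h: "h \<in> S" "h \<circ> g = id" using perm_grp_inv[OF assms(2) g] by metis
    have "inv\<^bsub>grp_rec G\<^esub> g = h" using h g assms by (intro inv_equality) (auto simp: grp_rec_def)
    then show "inv\<^bsub>grp_rec G\<^esub> g \<in> S" using h by simp
    fix k assume "k \<in> S"
    then show "g \<otimes>\<^bsub>grp_rec G\<^esub> k \<in> S" using g perm_grpD(3)[OF assms(2)] by (simp add: grp_rec_def)
  qed
qed

lemma perm_grp_lagrange:
  assumes "perm_grp G" "perm_grp S" "S \<subseteq> G" shows "card S dvd card G"
proof -
  interpret group "grp_rec G" by (rule grp_rec_group[OF assms(1)])
  have "card (rcosets\<^bsub>grp_rec G\<^esub> S) * card S = Coset.order (grp_rec G)"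
    using lagrange[OF perm_grp_subgroup[OF assms]] .
  then show ?thesis by (metis Coset.order_def dvd_triv_right grp_rec_def partial_object.select_convs(1))
qed

lemma exists_sylow:
  assumes G: "perm_grp G" and l: "prime l" and c: "card G = l ^ v * m"
  shows "\<exists>S. perm_grp S \<and> S \<subseteq> G \<and> card S = l ^ v"
proof -
  have "\<exists>H. subgroup H (grp_rec G) \<and> card H = l ^ v"
    by (rule sylow_thm[OF _ grp_rec_group[OF G], of l v m])
       (use l c perm_grpD(1)[OF G] in \<open>auto simp: Coset.order_def grp_rec_def\<close>)
  then show ?thesis using subgroup_perm_grp[OF G] by blast
qed

lemma funpow_card_id:
  assumes G: "perm_grp G" and g: "g \<in> G" shows "g ^^ card G = id"
proof -
  interpret group "grp_rec G" by (rule grp_rec_group[OF G])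
  have pw: "g [^]\<^bsub>grp_rec G\<^esub> n = g ^^ n" for n :: nat
    by (induction n) (auto simp: grp_rec_def nat_pow_def funpow_Suc_right simp del: funpow.simps(2) simp flip: id_def)
  have "g [^]\<^bsub>grp_rec G\<^esub> Coset.order (grp_rec G) = \<one>\<^bsub>grp_rec G\<^esub>"
    using g by (intro pow_order_eq_1) (simp add: grp_rec_def)
  then show ?thesis using pw by (simp add: Coset.order_def grp_rec_def)
qed

section \<open>Fixed points of groups of prime power order\<close>

text \<open>Jordan's theorem by orbit counting: on a transitive orbit the elements have one fixed
  point on average, and the identity has more than one, so some element has none.\<close>

lemma exists_derangement:
  assumes T: "perm_grp T" and n: "card (orbt T z) > 1"
  shows "\<exists>t\<in>T. \<forall>x\<in>orbt T z. t x \<noteq> x"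
proof (rule ccontr)
  assume neg: "\<not> ?thesis"
  let ?Z = "orbt T z"
  have fT: "finite T" "finite ?Z" using perm_grpD(1)[OF T] finite_orbt[OF T] by auto
  have eq: "(\<Sum>t\<in>T. card {x\<in>?Z. t x = x}) = (\<Sum>x\<in>?Z. card (stb T x))"
  proof -
    have "(\<Sum>t\<in>T. card {x\<in>?Z. t x = x}) = (\<Sum>t\<in>T. \<Sum>x\<in>?Z. if t x = x then 1 else 0)"
      using fT by (simp add: sum.inter_filter[symmetric])
    also have "\<dots> = (\<Sum>x\<in>?Z. \<Sum>t\<in>T. if t x = x then 1 else 0)" by (rule sum.swap)
    also have "\<dots> = (\<Sum>x\<in>?Z. card (stb T x))"
      using fT by (simp add: sum.inter_filter[symmetric] stb_def)
    finally show ?thesis .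
  qed
  have "(\<Sum>x\<in>?Z. card (stb T x)) = (\<Sum>x\<in>?Z. card (stb T z))"
  proof (rule sum.cong[OF refl])
    fix x assume "x \<in> ?Z"
    then have "card ?Z * card (stb T x) = card ?Z * card (stb T z)"
      using orbit_stabilizer[OF T, of x] orbit_stabilizer[OF T, of z] orbt_eq[OF T] by simp
    then show "card (stb T x) = card (stb T z)" using n by simp
  qed
  also have "\<dots> = card T" using orbit_stabilizer[OF T, of z] by simp
  finally have tot: "(\<Sum>t\<in>T. card {x\<in>?Z. t x = x}) = card T" using eq by simp
  have ge: "card {x\<in>?Z. t x = x} \<ge> 1" if t: "t \<in> T" for t
  proof -
    have "{x\<in>?Z. t x = x} \<noteq> {}" using neg t by auto
    then show ?thesis using fT by (simp add: Suc_le_eq card_gt_0_iff)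
  qed
  have "(\<Sum>t\<in>T. 1) < (\<Sum>t\<in>T. card {x\<in>?Z. t x = x})"
  proof (rule sum_strict_mono_ex1[OF fT(1)])
    show "\<forall>t\<in>T. 1 \<le> card {x\<in>?Z. t x = x}" using ge by blast
    show "\<exists>t\<in>T. 1 < card {x\<in>?Z. t x = x}" using n perm_grpD(2)[OF T] by (intro bexI[of _ id]) auto
  qed
  then show False using tot by simp
qed

lemma card_orbt_prime_power:
  assumes T: "perm_grp T" and c: "card T = l ^ b" and l: "prime l"
  shows "\<exists>i. card (orbt T z) = l ^ i"
proof -
  have "card (orbt T z) dvd l ^ b" using orbit_stabilizer[OF T, of z] c by (metis dvd_triv_left)
  then show ?thesis using divides_primepow_nat[OF l] by blast
qed

text \<open>No orbit is all of \<open>Z\<close>, since a transitive one admits a derangement. Orbit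
  lengths are powers of \<open>l\<close>, so without a common fixed point only \<open>l = 2\<close>
  with two orbits of length 2 remains. There take \<open>t\<close> without fixed points on the first
  orbit and \<open>u\<close> without fixed points on the second: each must fix the other orbit
  pointwise, and \<open>t \<circ> u\<close> has no fixed point at all.\<close>

lemma common_fixpoint:
  assumes T: "perm_grp T" and c: "card T = l ^ b" and l: "prime l"
    and Z: "finite Z" "Z \<noteq> {}" "\<And>t z. t \<in> T \<Longrightarrow> z \<in> Z \<Longrightarrow> t z \<in> Z" "card Z = l \<or> l = 2 \<and> card Z = 4"
    and fx: "\<And>t. t \<in> T \<Longrightarrow> \<exists>z\<in>Z. t z = z"
  shows "\<exists>z\<in>Z. \<forall>t\<in>T. t z = z"
proof (rule ccontr)
  assume neg: "\<not> ?thesis"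
  have l2: "l \<ge> 2" using l prime_ge_2_nat by blast
  have sub: "orbt T z \<subseteq> Z" if "z \<in> Z" for z using Z(3) that by (auto simp: orbt_def)
  have big: "\<exists>i>0. card (orbt T z) = l ^ i" if z: "z \<in> Z" for z
  proof -
    obtain i where i: "card (orbt T z) = l ^ i" using card_orbt_prime_power[OF T c l] by blast
    have "i \<noteq> 0"
    proof
      assume "i = 0"
      then obtain y where y: "orbt T z = {y}" using i by (auto simp: card_1_singleton_iff)
      then have "\<forall>t\<in>T. t z = z" using orbt_self[OF T, of z] by (auto simp: orbt_def)
      then show False using neg z by blast
    qed
    then show ?thesis using i by auto
  qed
  have noZ: "orbt T z \<noteq> Z" if z: "z \<in> Z" for z
  proof
    assume e: "orbt T z = Z"
    have "card Z > 1" using Z(4) l2 by auto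
    then obtain t where "t \<in> T" "\<forall>x\<in>Z. t x \<noteq> x" using exists_derangement[OF T, of z] e by auto
    then show False using fx by blast
  qed
  obtain a where a: "a \<in> Z" using Z(2) by auto
  obtain i where i: "i > 0" "card (orbt T a) = l ^ i" using big[OF a] by blast
  have lt: "card (orbt T a) < card Z" using noZ[OF a] sub[OF a] Z(1) by (meson psubsetI psubset_card_mono)
  have "l ^ 1 \<le> l ^ i" using i l2 by (intro power_increasing) auto
  then have l4: "l = 2" "card Z = 4" using lt i Z(4) by auto
  have pw: "k = 2" if "k = 2 ^ j" "j > 0" "k < 4" for k j :: nat
  proof -
    have "j < 2"
    proof (rule ccontr)
      assume "\<not> j < 2"
      then have "(2::nat) ^ 2 \<le> 2 ^ j" by (intro power_increasing) auto
      then show False using that by simp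
    qed
    then show ?thesis using that by (cases j) auto
  qed
  have ca: "card (orbt T a) = 2" using pw[of _ i] i lt l4 by auto
  obtain w where w: "w \<in> Z" "w \<notin> orbt T a" using lt by (metis card_mono finite_orbt[OF T] not_le subsetI)
  obtain i' where i': "i' > 0" "card (orbt T w) = l ^ i'" using big[OF w(1)] by blast
  have ltw: "card (orbt T w) < card Z" using noZ[OF w(1)] sub[OF w(1)] Z(1) by (meson psubsetI psubset_card_mono)
  have cw: "card (orbt T w) = 2" using pw[of _ i'] i' ltw l4 by auto
  have disj: "orbt T a \<inter> orbt T w = {}" using w(2) orbt_eq[OF T] orbt_self[OF T] by blast
  have ZU: "Z = orbt T a \<union> orbt T w"
    by (rule card_subset_eq[symmetric]) (use Z sub[OF a] sub[OF w(1)] ca cw disj l4 finite_orbt[OF T] in \<open>auto simp: card_Un_disjoint\<close>)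
  have swap: "\<exists>t\<in>T. \<forall>x\<in>orbt T y. t x \<noteq> x" if "card (orbt T y) = 2" for y
    using exists_derangement[OF T, of y] that by simp
  obtain t where t: "t \<in> T" "\<forall>x\<in>orbt T a. t x \<noteq> x" using swap[OF ca] by blast
  obtain u where u: "u \<in> T" "\<forall>x\<in>orbt T w. u x \<noteq> x" using swap[OF cw] by blast
  have all: "\<forall>x\<in>orbt T y. s x = x" if s: "s \<in> T" and y: "card (orbt T y) = 2" and z: "z \<in> orbt T y" "s z = z" for s y z
  proof
    fix x assume x: "x \<in> orbt T y"
    show "s x = x"
    proof (rule ccontr)
      assume "s x \<noteq> x"
      then have "x \<noteq> z" using z by auto
      then have "orbt T y = {x, z}" using y x z
        by (metis card_2_iff insert_iff doubleton_eq_iff empty_iff)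
      then have "s x \<in> {x, z}" using orbt_closed[OF T s x] by simp
      then have "s x = s z" using \<open>s x \<noteq> x\<close> z by auto
      then show False using perm_grp_inj[OF T s] \<open>x \<noteq> z\<close> by blast
    qed
  qed
  obtain z where z: "z \<in> Z" "t z = z" using fx[OF t(1)] by blast
  then have "z \<in> orbt T w" using t(2) ZU by auto
  then have tw: "\<forall>x\<in>orbt T w. t x = x" using all[OF t(1) cw _ z(2)] by blast
  obtain z' where z': "z' \<in> Z" "u z' = z'" using fx[OF u(1)] by blast
  then have "z' \<in> orbt T a" using u(2) ZU by auto
  then have ua: "\<forall>x\<in>orbt T a. u x = x" using all[OF u(1) ca _ z'(2)] by blast
  obtain x where x: "x \<in> Z" "(t \<circ> u) x = x" using fx[OF perm_grpD(3)[OF T t(1) u(1)]] by blast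
  show False
  proof (cases "x \<in> orbt T a")
    case True
    then show False using x ua t by auto
  next
    case False
    then have "x \<in> orbt T w" using x ZU by auto
    then have "u x \<in> orbt T w" by (rule orbt_closed[OF T u(1)])
    then show False using tw x u \<open>x \<in> orbt T w\<close> by auto
  qed
qed

lemma sylow_part:
  assumes G: "perm_grp G" and l: "prime l"
  obtains v m S where "card G = l ^ v * m" "\<not> l dvd m" "perm_grp S" "S \<subseteq> G" "card S = l ^ v"
proof -
  have "card G \<noteq> 0" "\<not> is_unit l" using perm_grp_card_pos[OF G] l by auto
  then obtain m where m: "card G = l ^ multiplicity l (card G) * m" "\<not> l dvd m"
    by (rule multiplicity_decompose')
  then show ?thesis using exists_sylow[OF G l m(1)] that by blast
qed

text \<open>The stabilizer \<open>T\<close> of \<open>\<beta>\<close> in a Sylow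
  \<open>l\<close>-subgroup \<open>S\<close> has a common fixed point \<open>x\<close> on the orbit
  of \<open>\<alpha>\<close>. The length \<open>n\<close> of that orbit is a power of
  \<open>l\<close>, so comparing powers of \<open>l\<close> in
  \<open>card G = n * card (stb G x)\<close> gives \<open>n * card T \<le> card S\<close>; hence the
  \<open>S\<close>-orbit of \<open>\<beta>\<close> has at least \<open>n\<close> points. In the case
  of equality \<open>T\<close> is a Sylow subgroup of \<open>stb G \<beta>\<close> and fixes
  \<open>x\<close>, so the orbit of \<open>x\<close> under that stabilizer has length prime to
  \<open>l\<close>.\<close>

lemma sylow_fixpoint:
  assumes G: "perm_grp G" and l: "prime l" and n: "card (orbt G \<alpha>) = l \<or> l = 2 \<and> card (orbt G \<alpha>) = 4"
    and hyp: "\<And>a \<sigma>. \<sigma> \<in> G \<Longrightarrow> \<sigma> ^^ (l ^ a) = id \<Longrightarrow> \<sigma> \<beta> = \<beta> \<Longrightarrow> \<exists>x\<in>orbt G \<alpha>. \<sigma> x = x"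
  shows "card (orbt G \<alpha>) \<le> card (orbt G \<beta>)"
    and "card (orbt G \<alpha>) = card (orbt G \<beta>) \<Longrightarrow> \<exists>x\<in>orbt G \<alpha>. \<not> l dvd card (orbt (stb G \<beta>) x)"
proof -
  obtain v m S where S: "card G = l ^ v * m" "\<not> l dvd m" "perm_grp S" "S \<subseteq> G" "card S = l ^ v"
    by (rule sylow_part[OF G l])
  have l0: "l > 0" using l prime_gt_0_nat by blast
  let ?n = "card (orbt G \<alpha>)"
  obtain k where k: "?n = l ^ k" using n by (metis power_one_right power2_eq_square numeral_Bit0 mult_2 numeral_times_numeral semiring_norm(13) semiring_norm(12))
  let ?T = "stb S \<beta>"
  have T: "perm_grp ?T" "?T \<subseteq> S" by (rule perm_grp_stb[OF S(3)], rule stb_sub)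
  have cT: "\<exists>b. card U = l ^ b" if U: "perm_grp U" "U \<subseteq> S" for U
    using perm_grp_lagrange[OF S(3) U] S(5) divides_primepow_nat[OF l] by auto
  obtain b where b: "card ?T = l ^ b" using cT[OF T] by blast
  have "\<exists>x\<in>orbt G \<alpha>. \<forall>t\<in>?T. t x = x"
  proof (rule common_fixpoint[OF T(1) b l finite_orbt[OF G] _ _ n])
    show "orbt G \<alpha> \<noteq> {}" using orbt_self[OF G] by blast
    show "t z \<in> orbt G \<alpha>" if "t \<in> ?T" "z \<in> orbt G \<alpha>" for t z using that T S orbt_closed[OF G] by blast
    fix t assume t: "t \<in> ?T"
    then have "t \<in> S" "t \<beta> = \<beta>" by (auto simp: stb_def)
    then show "\<exists>x\<in>orbt G \<alpha>. t x = x" using hyp[of t v] funpow_card_id[OF S(3)] S by auto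
  qed
  then obtain x where x: "x \<in> orbt G \<alpha>" "\<And>t. t \<in> ?T \<Longrightarrow> t x = x" by blast
  have Tx: "?T \<subseteq> stb S x" using x(2) by (auto simp: stb_def)
  obtain i where i: "card (stb S x) = l ^ i" using cT[OF perm_grp_stb[OF S(3)] stb_sub] by blast
  have "stb S x \<subseteq> stb G x" using S(4) by (auto simp: stb_def)
  then have "card (stb S x) dvd card (stb G x)" by (intro perm_grp_lagrange perm_grp_stb G S)
  moreover have "?n * card (stb G x) = card G" using orbit_stabilizer[OF G, of x] orbt_eq[OF G x(1)] by simp
  ultimately have "?n * card (stb S x) dvd card G" by (metis mult_dvd_mono dvd_refl)
  then have dv: "l ^ (k + i) dvd l ^ v * m" using S(1) k i by (simp add: power_add)
  have "k + i \<le> v"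
  proof (rule ccontr)
    assume "\<not> k + i \<le> v"
    then have "l ^ Suc v dvd l ^ v * m" using dv le_imp_power_dvd[of "Suc v" "k + i" l] by (meson dvd_trans not_less_eq_eq)
    then show False using S(2) l0 by (simp add: mult.commute)
  qed
  then have "l ^ (k + i) \<le> l ^ v" using l0 by (intro power_increasing) auto
  then have nSx: "?n * card (stb S x) \<le> card S" using k i S(5) by (simp add: power_add)
  have os: "card (orbt S \<beta>) * card ?T = card S" by (rule orbit_stabilizer[OF S(3)])
  have "card ?T \<le> card (stb S x)" using Tx perm_grpD(1)[OF perm_grp_stb[OF S(3)]] by (rule card_mono[rotated])
  then have "?n * card ?T \<le> card (orbt S \<beta>) * card ?T" using nSx os by (metis le_trans mult_le_mono2)
  then have nS: "?n \<le> card (orbt S \<beta>)" using perm_grp_card_pos[OF T(1)] by simp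
  have sG: "card (orbt S \<beta>) \<le> card (orbt G \<beta>)" using orbt_mono[OF S(4)] finite_orbt[OF G] by (intro card_mono)
  show "?n \<le> card (orbt G \<beta>)" using nS sG by simp
  assume eq: "?n = card (orbt G \<beta>)"
  then have nT: "?n * card ?T = l ^ v" using nS sG os S(5) by simp
  let ?H = "stb G \<beta>"
  have H: "perm_grp ?H" by (rule perm_grp_stb[OF G])
  have "\<not> l dvd card (orbt ?H x)"
  proof
    assume "l dvd card (orbt ?H x)"
    moreover have "?T \<subseteq> stb ?H x" using x(2) S(4) by (auto simp: stb_def)
    then have "card ?T dvd card (stb ?H x)" by (intro perm_grp_lagrange perm_grp_stb H T)
    ultimately have "l * card ?T dvd card ?H" using orbit_stabilizer[OF H, of x] by (metis mult_dvd_mono)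
    then have "?n * (l * card ?T) dvd ?n * card ?H" by (intro mult_dvd_mono) auto
    then have "l * l ^ v dvd l ^ v * m" using nT orbit_stabilizer[OF G, of \<beta>] eq S(1) by (simp add: mult_ac)
    then show False using S(2) l0 by (simp add: mult.commute)
  qed
  then show "\<exists>x\<in>orbt G \<alpha>. \<not> l dvd card (orbt (stb G \<beta>) x)" using x(1) by blast
qed

text \<open>The pairs \<open>g`{a, b}\<close>, with \<open>{a, b}\<close> the two-element orbit of the stabilizer, would be the edges
  of a 2-regular graph on five vertices, but an element of order 3 makes the degree of \<open>a\<close> at least 3.\<close>

lemma no_two_three_split:
  assumes G: "perm_grp G" and c5: "card (orbt G \<alpha>) = 5" "card (orbt G \<beta>) = 5"
    and a: "a \<in> orbt G \<alpha>" "card (orbt (stb G \<beta>) a) = 2"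
    and z0: "z0 \<in> orbt G \<alpha>" "card (orbt (stb G \<beta>) z0) = 3"
    and Z: "orbt G \<alpha> = orbt (stb G \<beta>) a \<union> orbt (stb G \<beta>) z0"
  shows False
proof -
  let ?H = "stb G \<beta>" and ?Z = "orbt G \<alpha>"
  have H: "perm_grp ?H" by (rule perm_grp_stb[OF G])
  let ?A = "orbt ?H a" and ?C = "orbt ?H z0"
  have fZ: "finite ?Z" by (rule finite_orbt[OF G])
  have fG: "finite G" by (rule perm_grpD(1)[OF G])
  define E where "E = (\<lambda>g. g ` ?A) ` G"
  have fE: "finite E" unfolding E_def using fG by simp
  have HA: "h ` ?A = ?A" if h: "h \<in> ?H" for h
  proof (rule card_subset_eq[OF finite_orbt[OF H]])
    show "h ` ?A \<subseteq> ?A" using orbt_closed[OF H h] by blast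
    show "card (h ` ?A) = card ?A"
      by (intro card_image inj_onI) (use perm_grp_inj[OF H h] in blast)
  qed
  \<comment> \<open>The stabilizer of \<open>\<beta>\<close> preserves the two-point orbit, so an
    edge depends only on the point to which \<open>\<beta>\<close> is moved; this bounds the number
    of edges by 5.\<close>
  have "E \<subseteq> (\<lambda>y. (SOME g. g \<in> G \<and> g \<beta> = y) ` ?A) ` orbt G \<beta>"
  proof
    fix e assume "e \<in> E"
    then obtain g where g: "g \<in> G" "e = g ` ?A" by (auto simp: E_def)
    define g' where "g' = (SOME k. k \<in> G \<and> k \<beta> = g \<beta>)"
    have g': "g' \<in> G \<and> g' \<beta> = g \<beta>" unfolding g'_def by (rule someI[of _ g]) (use g in simp)
    obtain k where k: "k \<in> G" "\<And>x. k (g x) = x" "\<And>x. g (k x) = x" using perm_grp_inv[OF G g(1)] by metis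
    have "k \<circ> g' \<in> ?H" using k g' perm_grpD(3)[OF G] by (simp add: stb_def)
    then have "(k \<circ> g') ` ?A = ?A" by (rule HA)
    then have "g ` (k ` (g' ` ?A)) = g ` ?A" by (simp add: image_comp comp_assoc)
    then have "g' ` ?A = e" using k(3) g(2) by (simp add: image_image)
    then show "e \<in> (\<lambda>y. (SOME g. g \<in> G \<and> g \<beta> = y) ` ?A) ` orbt G \<beta>"
      using g(1) unfolding g'_def orbt_def by blast
  qed
  then have "card E \<le> card (orbt G \<beta>)"
    using finite_orbt[OF G] by (meson card_image_le card_mono finite_imageI le_trans)
  then have E5: "card E \<le> 5" using c5 by simp
  have eE: "e \<subseteq> ?Z" "card e = 2" if e: "e \<in> E" for e
  proof -
    obtain g where g: "g \<in> G" "e = g ` ?A" using e by (auto simp: E_def)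
    show "e \<subseteq> ?Z" using g Z orbt_closed[OF G g(1)] by blast
    have "card e = card ?A" unfolding g(2) by (intro card_image inj_onI) (use perm_grp_inj[OF G g(1)] in blast)
    then show "card e = 2" using a(2) by simp
  qed
  have gE: "g ` e \<in> E" if g: "g \<in> G" and e: "e \<in> E" for g e
  proof -
    obtain h where h: "h \<in> G" "e = h ` ?A" using e by (auto simp: E_def)
    have "g ` e = (g \<circ> h) ` ?A" using h by (simp add: image_comp)
    then show ?thesis unfolding E_def using perm_grpD(3)[OF G g h(1)] by blast
  qed
  define D where "D z = {e \<in> E. z \<in> e}" for z
  have fD: "finite (D z)" for z unfolding D_def using fE by simp
  have Dle: "card (D z) \<le> card (D z')" if z: "z \<in> ?Z" "z' \<in> ?Z" for z z'
  proof -
    obtain g where g: "g \<in> G" "g z = z'" using orbt_trans[OF G z] by blast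
    have "inj g" by (rule injI) (rule perm_grp_inj[OF G g(1)])
    then have "inj_on (\<lambda>e. g ` e) (D z)" by (auto simp: inj_on_def inj_image_eq_iff)
    moreover have "(\<lambda>e. g ` e) ` D z \<subseteq> D z'" using gE[OF g(1)] g(2) by (auto simp: D_def)
    ultimately show ?thesis using fD by (metis card_inj_on_le)
  qed
  have Deq: "card (D z) = card (D a)" if "z \<in> ?Z" for z using Dle[OF that a(1)] Dle[OF a(1) that] by simp
  have "(\<Sum>z\<in>?Z. card (D z)) = (\<Sum>e\<in>E. card e)"
  proof -
    have "(\<Sum>z\<in>?Z. card (D z)) = (\<Sum>z\<in>?Z. \<Sum>e\<in>E. if z \<in> e then 1 else 0)"
      using fE by (simp add: D_def sum.inter_filter[symmetric])
    also have "\<dots> = (\<Sum>e\<in>E. \<Sum>z\<in>?Z. if z \<in> e then 1 else 0)" by (rule sum.swap)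
    also have "\<dots> = (\<Sum>e\<in>E. card {z\<in>?Z. z \<in> e})" using fZ by (simp add: sum.inter_filter[symmetric])
    also have "\<dots> = (\<Sum>e\<in>E. card e)"
    proof (rule sum.cong[OF refl])
      fix e assume "e \<in> E"
      then have "{z\<in>?Z. z \<in> e} = e" using eE by blast
      then show "card {z\<in>?Z. z \<in> e} = card e" by simp
    qed
    finally show ?thesis .
  qed
  moreover have "(\<Sum>z\<in>?Z. card (D z)) = 5 * card (D a)" using Deq c5 by simp
  moreover have "(\<Sum>e\<in>E. card e) = card E * 2" using eE by simp
  ultimately have cnt: "5 * card (D a) = card E * 2" by simp
  have "?A \<in> E" unfolding E_def by (rule image_eqI[of _ _ id]) (simp_all add: perm_grpD(2)[OF G])
  then have AD: "?A \<in> D a" using orbt_self[OF H] by (simp add: D_def)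
  \<comment> \<open>Five times the degree is twice the number of edges, which is at most 5, so the
    degree is even and at most 2; the orbit of \<open>a\<close> is itself an edge at
    \<open>a\<close>.\<close>
  have "card (D a) = 2"
  proof -
    have "card (D a) \<noteq> 0" using AD fD by auto
    then show ?thesis using cnt E5 by presburger
  qed
  then obtain e where e: "e \<in> D a" "e \<noteq> ?A" using AD by (metis card_2_iff insert_iff)
  have ae: "a \<in> e" "e \<in> E" using e by (auto simp: D_def)
  obtain z where z: "e = {a, z}" "z \<noteq> a" using eE(2)[OF ae(2)] ae(1) by (auto simp: card_2_iff)
  have "z \<in> ?Z" using eE(1)[OF ae(2)] z by auto
  moreover have "z \<notin> ?A"
  proof
    assume "z \<in> ?A"
    then have "e \<subseteq> ?A" using z orbt_self[OF H, of a] by auto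
    then have "e = ?A" using eE(2)[OF ae(2)] a(2) finite_orbt[OF H] by (metis card_subset_eq)
    then show False using e by simp
  qed
  ultimately have zC: "z \<in> ?C" using Z by auto
  \<comment> \<open>A Sylow 3-subgroup of the stabilizer fixes \<open>a\<close>, whose orbit has
    only two points, and is transitive on the three-point orbit; so it moves the second edge at
    \<open>a\<close> to three different edges at \<open>a\<close>.\<close>
  obtain v m S where S: "card ?H = 3 ^ v * m" "\<not> 3 dvd m" "perm_grp S" "S \<subseteq> ?H" "card S = 3 ^ v"
    using sylow_part[OF H, of 3] by auto
  have Sa: "s a = a" if s: "s \<in> S" for s
  proof -
    obtain i where i: "card (orbt S a) = 3 ^ i" using card_orbt_prime_power[OF S(3,5)] by auto
    have "card (orbt S a) \<le> 2" using card_mono[OF finite_orbt[OF H] orbt_mono[OF S(4), of a]] a(2) by simp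
    have "i = 0"
    proof (rule ccontr)
      assume "i \<noteq> 0"
      then have "(3::nat) ^ 1 \<le> 3 ^ i" by (intro power_increasing) auto
      then show False using i \<open>card (orbt S a) \<le> 2\<close> by simp
    qed
    then obtain y where "orbt S a = {y}" using i by (auto simp: card_1_singleton_iff)
    then show ?thesis using orbt_self[OF S(3), of a] s by (auto simp: orbt_def)
  qed
  have SC: "orbt S z = ?C"
  proof (rule card_subset_eq[OF finite_orbt[OF H]])
    show "orbt S z \<subseteq> ?C" using orbt_mono[OF S(4), of z] orbt_eq[OF H zC] by simp
    then have le: "card (orbt S z) \<le> 3" using card_mono[OF finite_orbt[OF H]] z0(2) by metis
    obtain i where i: "card (orbt S z) = 3 ^ i" using card_orbt_prime_power[OF S(3,5)] by auto
    have "i \<noteq> 0"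
    proof
      assume "i = 0"
      then obtain y where "orbt S z = {y}" using i by (auto simp: card_1_singleton_iff)
      then have "S \<subseteq> stb ?H z" using orbt_self[OF S(3), of z] S(4) by (auto simp: orbt_def stb_def)
      then have "card S dvd card (stb ?H z)" by (intro perm_grp_lagrange perm_grp_stb H S)
      then have "3 * 3 ^ v dvd 3 * card (stb ?H z)" using S(5) by (intro mult_dvd_mono) auto
      also have "3 * card (stb ?H z) = card ?H" using orbit_stabilizer[OF H, of z] orbt_eq[OF H zC] z0(2) by simp
      finally have "3 * 3 ^ v dvd 3 ^ v * m" using S(1) by simp
      then show False using S(2) by (simp add: mult.commute)
    qed
    then have "(3::nat) ^ 1 \<le> 3 ^ i" by (intro power_increasing) auto
    then show "card (orbt S z) = card ?C" using le i z0(2) by simp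
  qed
  have "(\<lambda>y. {a, y}) ` ?C \<subseteq> D a"
  proof
    fix w assume "w \<in> (\<lambda>y. {a, y}) ` ?C"
    then obtain y where y: "y \<in> orbt S z" "w = {a, y}" using SC by auto
    then obtain s where s: "s \<in> S" "s z = y" by (auto simp: orbt_def)
    have "s \<in> G" by (rule subsetD[OF stb_sub subsetD[OF S(4) s(1)]])
    then have "s ` e \<in> E" using gE ae(2) by blast
    moreover have "s ` e = w" using s(2) Sa[OF s(1)] y(2) z(1) by simp
    ultimately show "w \<in> D a" using y(2) by (simp add: D_def)
  qed
  then have "card ((\<lambda>y. {a, y}) ` ?C) \<le> card (D a)" by (rule card_mono[OF fD])
  moreover have "inj_on (\<lambda>y. {a, y}) ?C" by (auto simp: inj_on_def doubleton_eq_iff)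
  ultimately show False using \<open>card (D a) = 2\<close> z0(2) by (simp add: card_image)
qed

text \<open>\<open>sylow_fixpoint\<close> in both directions makes the orbits equally long, so it
  suffices that \<open>stb G \<beta>\<close> fixes some \<open>x\<close> in the orbit of
  \<open>\<alpha>\<close>: nested stabilizers of equal order are equal. If it fixes none, all its
  orbits there have length at least 2, and one has length prime to \<open>l\<close>, hence is not
  everything. On at most five points this leaves 2 + 2 with \<open>l = 2\<close>, which is absurd,
  and 2 + 3, which \<open>no_two_three_split\<close> excludes.\<close>

theorem exists_equal_stabilizers:
  assumes G: "perm_grp G" and c5: "card (orbt G \<alpha>) \<le> 5" "card (orbt G \<beta>) \<le> 5"
    and hyp: "\<And>l a \<sigma>. prime l \<Longrightarrow> \<sigma> \<in> G \<Longrightarrow> \<sigma> ^^ (l ^ a) = id \<Longrightarrow>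
      (\<exists>x\<in>orbt G \<alpha>. \<sigma> x = x) \<longleftrightarrow> (\<exists>y\<in>orbt G \<beta>. \<sigma> y = y)"
  shows "\<exists>x\<in>orbt G \<alpha>. stb G x = stb G \<beta>"
proof -
  \<comment> \<open>The degree bound enters here, through the admissible orbit lengths of
    \<open>common_fixpoint\<close>.\<close>
  have lex: "\<exists>l. prime l \<and> (n = l \<or> l = 2 \<and> n = 4)" if "n > 1" "n \<le> 5" for n :: nat
  proof -
    have "n = 2 \<or> n = 3 \<or> n = 4 \<or> n = 5" using that by linarith
    moreover have "prime (2::nat)" "prime (3::nat)" "prime (5::nat)" by simp_all
    ultimately show ?thesis by blast
  qed
  let ?n = "card (orbt G \<alpha>)" and ?m = "card (orbt G \<beta>)"
  have pos: "?n > 0" "?m > 0" using orbt_self[OF G] finite_orbt[OF G] by (auto simp: card_gt_0_iff)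
  have le1: "?n \<le> ?m" if n: "?n > 1"
  proof -
    obtain l where l: "prime l" "?n = l \<or> l = 2 \<and> ?n = 4" using lex[OF n c5(1)] by blast
    show ?thesis by (rule sylow_fixpoint(1)[OF G l]) (use hyp[OF l(1)] orbt_self[OF G, of \<beta>] in blast)
  qed
  have le2: "?m \<le> ?n" if m: "?m > 1"
  proof -
    obtain l where l: "prime l" "?m = l \<or> l = 2 \<and> ?m = 4" using lex[OF m c5(2)] by blast
    show ?thesis by (rule sylow_fixpoint(1)[OF G l]) (use hyp[OF l(1)] orbt_self[OF G, of \<alpha>] in blast)
  qed
  have nm: "?n = ?m" using le1 le2 pos by linarith
  let ?H = "stb G \<beta>" and ?Z = "orbt G \<alpha>"
  have H: "perm_grp ?H" by (rule perm_grp_stb[OF G])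
  have fZ: "finite ?Z" by (rule finite_orbt[OF G])
  have sub: "orbt ?H z \<subseteq> ?Z" if "z \<in> ?Z" for z
    using that orbt_closed[OF G] stb_sub[of G \<beta>] by (auto simp: orbt_def)
  have "\<exists>x\<in>?Z. card (orbt ?H x) = 1"
  proof (cases "?n > 1")
    case False
    then have n1: "?n = 1" using pos by linarith
    have "card (orbt ?H \<alpha>) \<le> 1" using card_mono[OF fZ sub[OF orbt_self[OF G]]] n1 by simp
    moreover have "card (orbt ?H \<alpha>) > 0" using orbt_self[OF H] finite_orbt[OF H] by (auto simp: card_gt_0_iff)
    ultimately show ?thesis using orbt_self[OF G, of \<alpha>] by (intro bexI[of _ \<alpha>]) linarith
  next
    case True
    show ?thesis
    proof (rule ccontr)
      assume neg: "\<not> ?thesis"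
      have ge2: "card (orbt ?H z) \<ge> 2" if "z \<in> ?Z" for z
      proof -
        have "card (orbt ?H z) > 0" using orbt_self[OF H] finite_orbt[OF H] by (auto simp: card_gt_0_iff)
        moreover have "card (orbt ?H z) \<noteq> 1" using neg that by blast
        ultimately show ?thesis by linarith
      qed
      obtain l where l: "prime l" "?n = l \<or> l = 2 \<and> ?n = 4" using lex[OF True c5(1)] by blast
      have "\<exists>x\<in>?Z. \<not> l dvd card (orbt ?H x)"
        by (rule sylow_fixpoint(2)[OF G l _ nm]) (use hyp[OF l(1)] orbt_self[OF G, of \<beta>] in blast)
      then obtain x where x: "x \<in> ?Z" "\<not> l dvd card (orbt ?H x)" by blast
      let ?O = "orbt ?H x"
      have "l dvd ?n" using l by auto
      then have "?O \<noteq> ?Z" using x by auto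
      then obtain z where z: "z \<in> ?Z" "z \<notin> ?O" using sub[OF x(1)] by blast
      let ?P = "orbt ?H z"
      have disj: "?O \<inter> ?P = {}" using z(2) orbt_eq[OF H] orbt_self[OF H] by blast
      have cU: "card (?O \<union> ?P) = card ?O + card ?P" using disj finite_orbt[OF H] by (intro card_Un_disjoint)
      have le: "card ?O + card ?P \<le> ?n" using card_mono[OF fZ, of "?O \<union> ?P"] sub[OF x(1)] sub[OF z(1)] cU by simp
      have g: "card ?O \<ge> 2" "card ?P \<ge> 2" using ge2 x z by auto
      have n5: "?n = 5"
      proof (rule ccontr)
        assume "?n \<noteq> 5"
        then have "?n = 4" "card ?O = 2" using le g c5(1) by linarith+
        moreover have "\<not> prime (4::nat)" by simp
        then have "l = 2" using l \<open>?n = 4\<close> by auto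
        ultimately show False using x(2) by simp
      qed
      have U: "?Z = ?O \<union> ?P"
      proof (rule ccontr)
        assume "?Z \<noteq> ?O \<union> ?P"
        then obtain w where w: "w \<in> ?Z" "w \<notin> ?O" "w \<notin> ?P" using sub[OF x(1)] sub[OF z(1)] by blast
        let ?R = "orbt ?H w"
        have "(?O \<union> ?P) \<inter> ?R = {}" using w orbt_eq[OF H] orbt_self[OF H] by blast
        then have "card (?O \<union> ?P \<union> ?R) = card ?O + card ?P + card ?R" using cU finite_orbt[OF H] by (simp add: card_Un_disjoint)
        moreover have "card (?O \<union> ?P \<union> ?R) \<le> ?n" using sub x z w by (intro card_mono[OF fZ]) blast
        ultimately show False using g ge2[OF w(1)] n5 by linarith
      qed
      then have s5: "card ?O + card ?P = 5" using cU n5 by simp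
      consider "card ?O = 2" "card ?P = 3" | "card ?O = 3" "card ?P = 2" using s5 g by linarith
      then show False
      proof cases
        case 1
        then show False using no_two_three_split[OF G n5 _ x(1) _ z(1) _ U] nm n5 by simp
      next
        case 2
        then show False using no_two_three_split[OF G n5 _ z(1) _ x(1) _ U[unfolded Un_commute[of ?O]]] nm n5 by simp
      qed
    qed
  qed
  then obtain x where x: "x \<in> ?Z" "card (orbt ?H x) = 1" by blast
  then obtain y where "orbt ?H x = {y}" by (auto simp: card_1_singleton_iff)
  then have hx: "h x = x" if "h \<in> ?H" for h using orbt_self[OF H, of x] that by (auto simp: orbt_def)
  have "?H \<subseteq> stb G x" using hx by (auto simp: stb_def)
  moreover have "card ?H = card (stb G x)"
  proof -
    have "?n * card (stb G x) = ?n * card ?H" using orbit_stabilizer[OF G, of x] orbit_stabilizer[OF G, of \<beta>] orbt_eq[OF G x(1)] nm by simp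
    then show ?thesis using pos by simp
  qed
  ultimately have "?H = stb G x" using perm_grpD(1)[OF perm_grp_stb[OF G]] by (intro card_subset_eq) auto
  then show ?thesis using x by blast
qed

section \<open>Embeddings of number fields into the complex numbers\<close>

text \<open>The complex numbers as a ring record, so that the theory of simple and finite extensions
  inside a record applies to them.\<close>

definition CR :: "complex ring" where
  "CR = \<lparr>carrier = UNIV, monoid.mult = (*), one = 1, ring.zero = 0, add = (+)\<rparr>"

lemma CR_simps [simp]:
  "carrier CR = UNIV" "x \<otimes>\<^bsub>CR\<^esub> y = x * y" "\<one>\<^bsub>CR\<^esub> = 1" "\<zero>\<^bsub>CR\<^esub> = 0" "x \<oplus>\<^bsub>CR\<^esub> y = x + y"
  by (simp_all add: CR_def)

lemma CR_field: "field CR"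
proof -
  have g: "abelian_group CR"
  proof (rule abelian_groupI)
    fix x assume "x \<in> carrier CR"
    show "\<exists>y\<in>carrier CR. y \<oplus>\<^bsub>CR\<^esub> x = \<zero>\<^bsub>CR\<^esub>" by (auto intro: exI[of _ "-x"])
  qed auto
  have c: "cring CR" by (rule cringI[OF g]) (auto intro!: monoid.monoid_comm_monoidI monoidI simp: algebra_simps)
  then show ?thesis
  proof (rule cring.cring_fieldI2)
    fix a assume "a \<in> carrier CR" "a \<noteq> \<zero>\<^bsub>CR\<^esub>"
    then show "\<exists>b\<in>carrier CR. a \<otimes>\<^bsub>CR\<^esub> b = \<one>\<^bsub>CR\<^esub>" by (auto intro: exI[of _ "inverse a"])
  qed simp
qed

lemma CR_cring: "cring CR" using CR_field by (simp add: field_def domain_def)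
lemma CR_domain: "domain CR" using CR_field by (simp add: field_def)

interpretation CRf: cring CR by (rule CR_cring)

lemma CR_minus [simp]: "\<ominus>\<^bsub>CR\<^esub> x = - x"
  by (rule CRf.minus_equality) auto
lemma CR_diff [simp]: "x \<ominus>\<^bsub>CR\<^esub> y = x - y" by (simp add: a_minus_def)
lemma CR_inv [simp]: "x \<noteq> 0 \<Longrightarrow> inv\<^bsub>CR\<^esub> x = inverse x"
  by (rule CRf.inv_unique'[symmetric]) auto
lemma CR_pow [simp]: "x [^]\<^bsub>CR\<^esub> (n::nat) = x ^ n"
  by (induction n) auto

text \<open>Coefficient lists on the left start with the leading coefficient, while
  \<open>Poly\<close> expects the constant term in front; hence the \<open>rev\<close>.\<close>

lemma CR_eval: "CRf.eval p z = poly (Poly (rev p)) z"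
  by (induction p) (auto simp: Poly_append poly_monom)

text \<open>A total function of which only the values on \<open>S\<close> and at 1 matter.
  Injectivity on a subfield follows, since inverses force nonzero elements to have nonzero
  images.\<close>

definition emb :: "('a, 'b) ring_scheme \<Rightarrow> 'a set \<Rightarrow> ('a \<Rightarrow> complex) \<Rightarrow> bool" where
  "emb R S j \<longleftrightarrow> j \<one>\<^bsub>R\<^esub> = 1 \<and> (\<forall>x\<in>S. \<forall>y\<in>S. j (x \<oplus>\<^bsub>R\<^esub> y) = j x + j y \<and> j (x \<otimes>\<^bsub>R\<^esub> y) = j x * j y)"

lemma embD:
  assumes "emb R S j"
  shows "j \<one>\<^bsub>R\<^esub> = 1" "x \<in> S \<Longrightarrow> y \<in> S \<Longrightarrow> j (x \<oplus>\<^bsub>R\<^esub> y) = j x + j y"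
    "x \<in> S \<Longrightarrow> y \<in> S \<Longrightarrow> j (x \<otimes>\<^bsub>R\<^esub> y) = j x * j y"
  using assms by (auto simp: emb_def)

lemma emb_mono: "emb R S j \<Longrightarrow> T \<subseteq> S \<Longrightarrow> emb R T j"
  by (auto simp: emb_def subset_iff)

context field
begin

lemma emb_hom:
  assumes "subfield S R" "emb R S j" shows "ring_hom_ring (R\<lparr>carrier := S\<rparr>) CR j"
proof (rule ring_hom_ringI2)
  show "ring (R\<lparr>carrier := S\<rparr>)" using subring_is_ring[OF subfieldE(1)[OF assms(1)]] .
  show "ring CR" by (rule CRf.ring_axioms)
  show "j \<in> ring_hom (R\<lparr>carrier := S\<rparr>) CR" using embD[OF assms(2)] by (intro ring_hom_memI) auto
qed

lemma emb_zero: assumes "subfield S R" "emb R S j" shows "j \<zero> = 0"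
proof -
  have "\<zero> \<in> S" by (rule subringE(2)[OF subfieldE(1)[OF assms(1)]])
  then have "j (\<zero> \<oplus> \<zero>) = j \<zero> + j \<zero>" by (intro embD(2)[OF assms(2)])
  then show ?thesis by simp
qed

lemma emb_minus: assumes "subfield S R" "emb R S j" "x \<in> S" shows "j (\<ominus> x) = - j x"
proof -
  have z: "x \<in> carrier R" "\<ominus> x \<in> S"
    using subsetD[OF subfieldE(3)[OF assms(1)] assms(3)] subringE(5)[OF subfieldE(1)[OF assms(1)] assms(3)] by auto
  have "j (x \<oplus> \<ominus> x) = j x + j (\<ominus> x)" using embD(2)[OF assms(2)] assms z by auto
  then show ?thesis using z emb_zero[OF assms(1,2)] by (simp add: r_neg eq_neg_iff_add_eq_0 add.commute)
qed

lemma emb_diff: assumes "subfield S R" "emb R S j" "x \<in> S" "y \<in> S" shows "j (x \<ominus> y) = j x - j y"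
proof -
  have "\<ominus> y \<in> S" using subringE(5)[OF subfieldE(1)[OF assms(1)]] assms by auto
  then show ?thesis using embD(2)[OF assms(2) assms(3), of "\<ominus> y"] emb_minus[OF assms(1,2,4)] by (simp add: a_minus_def)
qed

lemma emb_nz: assumes "subfield S R" "emb R S j" "x \<in> S" "x \<noteq> \<zero>" shows "j x \<noteq> 0"
proof
  assume "j x = 0"
  have "inv x \<in> S" "x \<otimes> inv x = \<one>" using subfield_m_inv[OF assms(1), of x] assms by auto
  then have "j \<one> = j x * j (inv x)" using embD(3)[OF assms(2,3)] by metis
  then show False using embD(1)[OF assms(2)] \<open>j x = 0\<close> by simp
qed

lemma emb_inj: assumes "subfield S R" "emb R S j" "x \<in> S" "y \<in> S" "j x = j y" shows "x = y"
proof (rule ccontr)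
  assume "x \<noteq> y"
  have c: "x \<in> carrier R" "y \<in> carrier R"
    using subsetD[OF subfieldE(3)[OF assms(1)] assms(3)] subsetD[OF subfieldE(3)[OF assms(1)] assms(4)] by auto
  have "x \<ominus> y \<in> S" using subringE(5,7)[OF subfieldE(1)[OF assms(1)]] assms by (auto simp: a_minus_def)
  moreover have "x \<ominus> y \<noteq> \<zero>" using c \<open>x \<noteq> y\<close> by simp
  ultimately show False using emb_nz[OF assms(1,2)] emb_diff[OF assms(1-4)] assms(5) by simp
qed

lemma emb_eval:
  assumes "subfield S R" "emb R S j" "x \<in> S" "set p \<subseteq> S"
  shows "j (eval p x) = CRf.eval (map j p) (j x)"
  using ring_hom_ring.eval_hom'[OF emb_hom[OF assms(1,2)], of x p] assms
    eval_consistent[OF subfieldE(1)[OF assms(1)]] by simp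

lemma emb_pow: "subfield S R \<Longrightarrow> emb R S j \<Longrightarrow> x \<in> S \<Longrightarrow> j (x [^] (n::nat)) = j x ^ n"
proof (induction n)
  case 0
  then show ?case using embD(1) by simp
next
  case (Suc n)
  have "x [^] n \<in> S" using subringE(3,6)[OF subfieldE(1)[OF Suc.prems(1)]] Suc.prems(3) by (induction n) auto
  then show ?case using Suc embD(3)[OF Suc.prems(2)] by simp
qed

lemma ev_add:
  assumes "subfield S R" "emb R S j" "set p \<subseteq> S" "set q \<subseteq> S"
  shows "CRf.eval (map j (poly_add p q)) z = CRf.eval (map j p) z + CRf.eval (map j q) z"
proof -
  interpret h: ring_hom_ring "R\<lparr>carrier := S\<rparr>" CR j by (rule emb_hom[OF assms(1,2)])
  have 1: "CRf.normalize (map j (poly_add p q)) = CRf.poly_add (map j p) (map j q)"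
    using h.poly_add_hom'[of p q] assms poly_add_consistent[OF subfieldE(1)[OF assms(1)]] by simp
  have "CRf.eval (map j (poly_add p q)) z = CRf.eval (CRf.normalize (map j (poly_add p q))) z"
    by (rule CRf.eval_normalize[symmetric]) auto
  also have "\<dots> = CRf.eval (map j p) z + CRf.eval (map j q) z" unfolding 1 by (subst CRf.eval_poly_add) auto
  finally show ?thesis .
qed

lemma ev_mult:
  assumes "subfield S R" "emb R S j" "set p \<subseteq> S" "set q \<subseteq> S"
  shows "CRf.eval (map j (poly_mult p q)) z = CRf.eval (map j p) z * CRf.eval (map j q) z"
proof -
  interpret h: ring_hom_ring "R\<lparr>carrier := S\<rparr>" CR j by (rule emb_hom[OF assms(1,2)])
  have 1: "CRf.normalize (map j (poly_mult p q)) = CRf.poly_mult (map j p) (map j q)"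
    using h.poly_mult_hom'[of p q] assms poly_mult_consistent[OF subfieldE(1)[OF assms(1)]] by simp
  have "CRf.eval (map j (poly_mult p q)) z = CRf.eval (CRf.normalize (map j (poly_mult p q))) z"
    by (rule CRf.eval_normalize[symmetric]) auto
  also have "\<dots> = CRf.eval (map j p) z * CRf.eval (map j q) z" unfolding 1 by (subst CRf.eval_poly_mult) auto
  finally show ?thesis .
qed

text \<open>Sends \<open>eval p x\<close> to the value at \<open>z\<close> of \<open>p\<close> with
  \<open>j\<close> applied to its coefficients. This is well defined because two polynomials with
  the same value at \<open>x\<close> differ by a multiple of \<open>Irr S x\<close>, and
  \<open>z\<close> is a root of its image under \<open>j\<close>.\<close>

lemma extend_emb:
  assumes S: "subfield S R" and x: "x \<in> carrier R" "(algebraic over S) x" and j: "emb R S j"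
    and z: "CRf.eval (map j (Irr S x)) z = 0"
  shows "\<exists>j'. emb R (simple_extension S x) j' \<and> (\<forall>y\<in>S. j' y = j y) \<and> j' x = z"
proof -
  let ?P = "univ_poly R S"
  have Sr: "subring S R" by (rule subfieldE(1)[OF S])
  interpret UP: domain ?P by (rule univ_poly_is_domain[OF Sr])
  have Pset: "set p \<subseteq> S" if "p \<in> carrier ?P" for p
    using that polynomial_incl[of S p] by (simp add: univ_poly_carrier[symmetric])
  define ev where "ev p = CRf.eval (map j p) z" for p
  have eva: "ev (p \<oplus>\<^bsub>?P\<^esub> q) = ev p + ev q" "ev (p \<otimes>\<^bsub>?P\<^esub> q) = ev p * ev q"
    if "p \<in> carrier ?P" "q \<in> carrier ?P" for p q
    unfolding ev_def univ_poly_add univ_poly_mult by (rule ev_add[OF S j Pset Pset], use that in blast, use that in blast, rule ev_mult[OF S j Pset Pset], use that in blast, use that in blast)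
  have hom: "(\<lambda>p. eval p x) \<in> ring_hom ?P R" by (rule eval_is_hom[OF Sr x(1)])
  have evm: "ev p = ev q" if pq: "p \<in> carrier ?P" "q \<in> carrier ?P" "eval p x = eval q x" for p q
  proof -
    let ?r = "p \<ominus>\<^bsub>?P\<^esub> q"
    have r: "?r \<in> carrier ?P" using pq by simp
    have pr: "p = ?r \<oplus>\<^bsub>?P\<^esub> q" using pq by (simp add: a_minus_def UP.a_assoc UP.l_neg)
    have c: "eval p x \<in> carrier R" "eval ?r x \<in> carrier R" "eval q x \<in> carrier R" using ring_hom_memE(1)[OF hom] pq r by auto
    have "eval p x = eval ?r x \<oplus> eval q x" using pr ring_hom_memE(3)[OF hom r pq(2)] by simp
    then have "eval ?r x = \<zero>" using pq(3) c by (metis add.r_cancel_one')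
    then have "Irr S x pdivides ?r" by (rule Irr_minimal[OF S x r])
    then have "Irr S x divides\<^bsub>?P\<^esub> ?r" using pdivides_iff_shell[OF S IrrE(1)[OF S x] r] by simp
    then obtain s where s: "s \<in> carrier ?P" "?r = Irr S x \<otimes>\<^bsub>?P\<^esub> s" by (auto simp: factor_def)
    have "ev ?r = 0" unfolding s(2) eva(2)[OF IrrE(1)[OF S x] s(1)] using z by (simp add: ev_def)
    then show ?thesis using pr eva(1)[OF r pq(2)] by simp
  qed
  define j' where "j' u = ev (SOME p. p \<in> carrier ?P \<and> eval p x = u)" for u
  have j': "j' (eval p x) = ev p" if p: "p \<in> carrier ?P" for p
  proof -
    have s: "(SOME q. q \<in> carrier ?P \<and> eval q x = eval p x) \<in> carrier ?P \<and> eval (SOME q. q \<in> carrier ?P \<and> eval q x = eval p x) x = eval p x"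
      by (rule someI[of _ p]) (use p in simp)
    then show ?thesis unfolding j'_def using evm p by blast
  qed
  have img: "\<exists>p\<in>carrier ?P. u = eval p x" if "u \<in> simple_extension S x" for u
    using that simple_extension_as_eval_img[OF subfieldE(3)[OF S] x(1)] by auto
  have yS: "j' y = j y" if y: "y \<in> S" for y
  proof -
    have yc: "y \<in> carrier R" using y subfieldE(3)[OF S] by auto
    have p: "normalize [y] \<in> carrier ?P" using normalize_gives_polynomial[of "[y]" S] y by (simp add: univ_poly_carrier)
    have "eval (normalize [y]) x = y" using yc x by simp
    moreover have "ev (normalize [y]) = j y" using emb_zero[OF S j] by (simp add: ev_def)
    ultimately show ?thesis using j'[OF p] by simp
  qed
  have "j' x = z"
  proof -
    have p: "[\<one>, \<zero>] \<in> carrier ?P" using subringE(2,3)[OF Sr] by (simp add: univ_poly_carrier[symmetric] polynomial_def)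
    have "eval [\<one>, \<zero>] x = x" using x by simp
    moreover have "ev [\<one>, \<zero>] = z" using emb_zero[OF S j] embD(1)[OF j] by (simp add: ev_def)
    ultimately show ?thesis using j'[OF p] by simp
  qed
  moreover have "emb R (simple_extension S x) j'"
    unfolding emb_def
  proof (intro conjI ballI)
    show "j' \<one> = 1" using yS[OF subringE(3)[OF Sr]] embD(1)[OF j] by simp
    fix u v assume "u \<in> simple_extension S x" "v \<in> simple_extension S x"
    then obtain p q where pq: "p \<in> carrier ?P" "u = eval p x" "q \<in> carrier ?P" "v = eval q x" using img by metis
    have "u \<oplus> v = eval (p \<oplus>\<^bsub>?P\<^esub> q) x" "u \<otimes> v = eval (p \<otimes>\<^bsub>?P\<^esub> q) x"
      using ring_hom_memE(2,3)[OF hom] pq by auto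
    then show "j' (u \<oplus> v) = j' u + j' v" "j' (u \<otimes> v) = j' u * j' v" using j' eva pq by auto
  qed
  ultimately show ?thesis using yS by blast
qed

lemma Irr_length: assumes "subfield S R" "x \<in> carrier R" "(algebraic over S) x" shows "length (Irr S x) \<ge> 2"
proof -
  have "Irr S x \<noteq> []" using pirreducibleE(1)[OF subfieldE(1)[OF assms(1)] IrrE(1,2)[OF assms]] .
  moreover have "length (Irr S x) \<noteq> 1"
  proof
    assume "length (Irr S x) = 1"
    then have "Irr S x = [\<one>]" using IrrE(3)[OF assms] by (cases "Irr S x") auto
    then show False using IrrE(4)[OF assms] assms(2) by simp
  qed
  ultimately show ?thesis by (cases "Irr S x"; cases "tl (Irr S x)") auto
qed

text \<open>Generators are adjoined one at a time. The image of the irreducible polynomial is monic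
  of positive degree, so the fundamental theorem of algebra supplies the root that
  \<open>extend_emb\<close> asks for.\<close>

lemma extend_emb_list:
  assumes S: "subfield S R" and xs: "set xs \<subseteq> carrier R" "\<And>x. x \<in> set xs \<Longrightarrow> (algebraic over S) x" and j: "emb R S j"
  shows "\<exists>j'. emb R (finite_extension S xs) j' \<and> (\<forall>y\<in>S. j' y = j y)"
  using xs
proof (induction xs)
  case Nil
  then show ?case using j by auto
next
  case (Cons x xs)
  let ?T = "finite_extension S xs"
  obtain j1 where j1: "emb R ?T j1" "\<And>y. y \<in> S \<Longrightarrow> j1 y = j y" using Cons by force
  have T: "subfield ?T R" using Cons.prems by (intro finite_extension_is_subfield[OF S]) auto
  have ST: "S \<subseteq> ?T" using Cons.prems subfieldE(3)[OF S] by (intro finite_extension_incl) auto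
  have x: "x \<in> carrier R" "(algebraic over ?T) x" using Cons.prems algebraic_mono[OF ST, of x] by auto
  let ?q = "map j1 (Irr ?T x)"
  obtain c cs where ir: "Irr ?T x = c # cs" "cs \<noteq> []" using Irr_length[OF T x] by (cases "Irr ?T x") (auto simp: Suc_le_eq)
  have c: "c = \<one>" using IrrE(3)[OF T x] ir by simp
  have "Poly (rev ?q) = Poly (rev (map j1 cs)) + Polynomial.monom 1 (length cs)"
    using ir c embD(1)[OF j1(1)] by (simp add: Poly_append)
  then have co: "Polynomial.coeff (Poly (rev ?q)) (length cs) = 1"
    by (simp add: coeff_Poly_eq nth_default_def)
  have "length cs \<le> Polynomial.degree (Poly (rev ?q))" by (rule le_degree) (use co in simp)
  moreover have "length cs > 0" using ir(2) by simp
  ultimately have "Polynomial.degree (Poly (rev ?q)) \<noteq> 0" by linarith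
  then have "\<not> constant (poly (Poly (rev ?q)))" unfolding constant_degree .
  then obtain z where "poly (Poly (rev ?q)) z = 0" using fundamental_theorem_of_algebra by blast
  then have "CRf.eval ?q z = 0" by (simp add: CR_eval)
  from extend_emb[OF T x j1(1) this] obtain j' where j': "emb R (simple_extension ?T x) j'" "\<forall>y\<in>?T. j' y = j1 y" by blast
  then show ?case using j1(2) ST by (intro exI[of _ j']) auto
qed

lemma finite_dim_eq_finite_extension:
  assumes S: "subfield S R" "subfield K R" "S \<subseteq> K" and d: "finite_dimension S K"
  obtains us where "set us \<subseteq> K" "finite_extension S us = K" "\<And>x. x \<in> K \<Longrightarrow> (algebraic over S) x"
proof -
  obtain n where n: "dimension n S K" using d by auto
  obtain us where us: "set us \<subseteq> carrier R" "Span S us = K" using exists_base[OF S(1) n] by auto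
  have alg: "(algebraic over S) x" if "x \<in> K" for x
    using finite_dimension_imp_algebraic[OF S(1) subfieldE(1)[OF S(2)] d that] .
  have usK: "set us \<subseteq> K" using Span_base_incl[OF S(1) us(1)] us(2) by simp
  have sub: "subring (finite_extension S us) R" by (rule finite_extension_is_subring[OF subfieldE(1)[OF S(1)] us(1)])
  have "subalgebra S (finite_extension S us) R"
  proof (rule subalgebra.intro)
    show "subgroup (finite_extension S us) (add_monoid R)" using sub by (simp add: subring_def)
    have inc: "S \<subseteq> finite_extension S us" using finite_extension_incl[OF subfieldE(3)[OF S(1)] us(1)] .
    show "subalgebra_axioms S (finite_extension S us) R"
      unfolding subalgebra_axioms_def using inc subringE(6)[OF sub] by blast
  qed
  then have "K \<subseteq> finite_extension S us"
    using subalgebra_Span_incl[OF S(1)] finite_extension_mem[OF subfieldE(1)[OF S(1)] us(1)] us(2) by blast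
  moreover have "finite_extension S us \<subseteq> K" by (rule finite_extension_subring_incl[OF subfieldE(1)[OF S(2)] S(3) usK])
  ultimately show ?thesis using that usK alg by blast
qed

end

section \<open>The embedding of the prime field\<close>

definition ratc :: "('a, 'b) ring_scheme \<Rightarrow> 'a \<Rightarrow> complex" where
  "ratc R x = (SOME c. \<exists>(a::int) (b::int). b \<noteq> 0 \<and> x \<otimes>\<^bsub>R\<^esub> ([b] \<cdot>\<^bsub>R\<^esub> \<one>\<^bsub>R\<^esub>) = [a] \<cdot>\<^bsub>R\<^esub> \<one>\<^bsub>R\<^esub> \<and> c = of_int a / of_int b)"

context field
begin

abbreviation ZZ :: "int \<Rightarrow> 'a" where "ZZ k \<equiv> [k] \<cdot> \<one>"

lemma ZZ_closed: "ZZ k \<in> carrier R" by simp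
lemma ZZ_add: "ZZ (a + b) = ZZ a \<oplus> ZZ b" by (simp add: add.int_pow_mult)
lemma ZZ_mult: "ZZ (a * b) = ZZ a \<otimes> ZZ b"
proof -
  have "ZZ a \<otimes> ZZ b = [a] \<cdot> (\<one> \<otimes> ZZ b)" by (rule add_pow_ldistr_int) auto
  also have "\<dots> = ZZ (a * b)" by (simp add: add.int_pow_pow mult.commute)
  finally show ?thesis by simp
qed

lemma ZZ_inj:
  assumes "\<forall>n::nat. n > 0 \<longrightarrow> [n] \<cdot> \<one> \<noteq> \<zero>" "ZZ a = ZZ b" shows "a = b"
proof (rule ccontr)
  assume ne: "a \<noteq> b"
  have key: "ZZ c \<noteq> \<zero>" if "c > 0" for c :: int
    using assms(1) that add_pow_int_ge[of c R \<one>] by simp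
  have "ZZ (a - b) \<oplus> ZZ b = ZZ b" "ZZ (b - a) \<oplus> ZZ a = ZZ a" using ZZ_add[of "a - b" b] ZZ_add[of "b - a" a] assms(2) by auto
  then have "ZZ (a - b) = \<zero>" "ZZ (b - a) = \<zero>" by (metis add.r_cancel_one ZZ_closed)+
  then show False using key[of "a - b"] key[of "b - a"] ne by (cases "a > b") auto
qed

lemma ratc_eq:
  assumes ch: "\<forall>n::nat. n > 0 \<longrightarrow> [n] \<cdot> \<one> \<noteq> \<zero>" and x: "x \<in> carrier R" "b \<noteq> 0" "x \<otimes> ZZ b = ZZ a"
  shows "ratc R x = of_int a / of_int b"
proof -
  have ex: "\<exists>c. \<exists>(a::int) (b::int). b \<noteq> 0 \<and> x \<otimes> ZZ b = ZZ a \<and> c = (of_int a / of_int b :: complex)" using x by blast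
  from someI_ex[OF ex] obtain a' b' where ab: "b' \<noteq> 0" "x \<otimes> ZZ b' = ZZ a'" "ratc R x = of_int a' / of_int b'"
    unfolding ratc_def by blast
  have "ZZ (a' * b) = (x \<otimes> ZZ b') \<otimes> ZZ b" by (simp add: ab ZZ_mult)
  also have "\<dots> = (x \<otimes> ZZ b) \<otimes> ZZ b'" by (metis m_assoc m_comm ZZ_closed x(1))
  also have "\<dots> = ZZ (a * b')" by (simp add: x ZZ_mult)
  finally have "a' * b = a * b'" by (rule ZZ_inj[OF ch])
  then have "(of_int a' * of_int b :: complex) = of_int a * of_int b'" by (metis of_int_mult)
  then show ?thesis unfolding ab(3) using ab(1) x(2) by (simp add: field_simps)
qed

lemma emb_ratc:
  assumes ch: "\<forall>n::nat. n > 0 \<longrightarrow> [n] \<cdot> \<one> \<noteq> \<zero>"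
  shows "emb R (rat_img R) (ratc R)"
  unfolding emb_def
proof (intro conjI ballI)
  show "ratc R \<one> = 1" using ratc_eq[OF ch, of \<one> 1 1] by simp
  fix x y assume "x \<in> rat_img R" "y \<in> rat_img R"
  then obtain a b c d where x: "x \<in> carrier R" "b \<noteq> 0" "x \<otimes> ZZ b = ZZ a" and y: "y \<in> carrier R" "d \<noteq> 0" "y \<otimes> ZZ d = ZZ c"
    unfolding rat_img_def by blast
  have e: "ratc R x = of_int a / of_int b" "ratc R y = of_int c / of_int d" using ratc_eq[OF ch] x y by auto
  have "(x \<oplus> y) \<otimes> ZZ (b * d) = (x \<otimes> ZZ b) \<otimes> ZZ d \<oplus> (y \<otimes> ZZ d) \<otimes> ZZ b"
    using x(1) y(1) ZZ_closed[of b] ZZ_closed[of d] by (simp add: ZZ_mult l_distr m_assoc m_comm[of "ZZ b"] m_lcomm)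
  also have "\<dots> = ZZ (a * d + c * b)" by (simp add: x y ZZ_mult ZZ_add)
  finally have "ratc R (x \<oplus> y) = of_int (a * d + c * b) / of_int (b * d)" using x y by (intro ratc_eq[OF ch]) auto
  then show "ratc R (x \<oplus> y) = ratc R x + ratc R y" unfolding e using x y by (simp add: field_simps)
  have "(x \<otimes> y) \<otimes> ZZ (b * d) = (x \<otimes> ZZ b) \<otimes> (y \<otimes> ZZ d)"
    using x(1) y(1) ZZ_closed[of b] ZZ_closed[of d] by (simp add: ZZ_mult m_assoc m_lcomm)
  also have "\<dots> = ZZ (a * c)" by (simp add: x y ZZ_mult)
  finally have "ratc R (x \<otimes> y) = of_int (a * c) / of_int (b * d)" using x y by (intro ratc_eq[OF ch]) auto
  then show "ratc R (x \<otimes> y) = ratc R x * ratc R y" unfolding e by simp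
qed

lemma emb_ZZ:
  assumes S: "subfield S R" and j: "emb R S j" shows "ZZ k \<in> S" "j (ZZ k) = of_int k"
proof -
  have Sr: "subring S R" by (rule subfieldE(1)[OF S])
  have nat: "[n] \<cdot> \<one> \<in> S \<and> j ([n] \<cdot> \<one>) = of_nat n" for n :: nat
  proof (induction n)
    case 0
    then show ?case using subringE(2)[OF Sr] emb_zero[OF S j] by simp
  next
    case (Suc n)
    have "[Suc n] \<cdot> \<one> = [n] \<cdot> \<one> \<oplus> \<one>" by (simp add: add.nat_pow_Suc)
    then show ?case using Suc subringE(3,7)[OF Sr] embD(1,2)[OF j] by simp
  qed
  have "ZZ k \<in> S \<and> j (ZZ k) = of_int k"
  proof (cases "k \<ge> 0")
    case True
    then show ?thesis using nat[of "nat k"] add_pow_int_ge[of k R \<one>] by simp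
  next
    case False
    then have "ZZ k = \<ominus> ([nat (- k)] \<cdot> \<one>)" using add_pow_int_lt[of k R \<one>] by simp
    then show ?thesis using nat[of "nat (- k)"] subringE(5)[OF Sr] emb_minus[OF S j] False by simp
  qed
  then show "ZZ k \<in> S" "j (ZZ k) = of_int k" by auto
qed

lemma emb_rat_img:
  assumes S: "subfield S R" and j: "emb R S j" and x: "x \<in> S" "x \<in> rat_img R" shows "j x \<in> \<rat>"
proof -
  obtain a b where ab: "b \<noteq> 0" "x \<otimes> ZZ b = ZZ a" using x(2) unfolding rat_img_def by blast
  have "j x * of_int b = of_int a" using embD(3)[OF j x(1) emb_ZZ(1)[OF S j, of b]] emb_ZZ(2)[OF S j] ab(2) by simp
  then have "j x = of_int a / of_int b" using ab(1) by (simp add: field_simps)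
  then show ?thesis by simp
qed

end

section \<open>Algebraic integers through finitely generated groups\<close>

text \<open>The additive group generated by \<open>A\<close>. Integrality is expressed by it:
  \<open>z\<close> is integral when some power of \<open>z\<close> lies in the group generated by
  the lower powers.\<close>

inductive_set zsp :: "complex set \<Rightarrow> complex set" for A where
  zsp_zero: "0 \<in> zsp A"
| zsp_diff: "x \<in> zsp A \<Longrightarrow> a \<in> A \<Longrightarrow> x - a \<in> zsp A"
| zsp_add: "x \<in> zsp A \<Longrightarrow> a \<in> A \<Longrightarrow> x + a \<in> zsp A"

lemma zsp_base: "a \<in> A \<Longrightarrow> a \<in> zsp A" using zsp_add[OF zsp_zero, of a A] by simp
lemma zsp_plus: "y \<in> zsp A \<Longrightarrow> x \<in> zsp A \<Longrightarrow> x + y \<in> zsp A"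
  by (induction rule: zsp.induct) (auto simp: add.assoc[symmetric] add_diff_eq intro: zsp.intros)
lemma zsp_minus: "y \<in> zsp A \<Longrightarrow> - y \<in> zsp A"
proof (induction rule: zsp.induct)
  case (zsp_diff x a)
  then show ?case using zsp.zsp_add[of "- x" A a] by (simp add: algebra_simps)
next
  case (zsp_add x a)
  moreover have "- (x + a) = - x - a" by simp
  ultimately show ?case using zsp.zsp_diff[of "- x" A a] by (simp only:)
qed (auto intro: zsp.intros)
lemma zsp_sub: "x \<in> zsp A \<Longrightarrow> y \<in> zsp A \<Longrightarrow> x - y \<in> zsp A"
  using zsp_plus[OF zsp_minus, of y A x] by simp
lemma zsp_nat: "x \<in> zsp A \<Longrightarrow> of_nat n * x \<in> zsp A"
  by (induction n) (auto simp: algebra_simps intro: zsp_zero zsp_plus)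
lemma zsp_int: "x \<in> zsp A \<Longrightarrow> of_int n * x \<in> zsp A"
  by (cases n) (auto simp del: of_nat_Suc intro: zsp_nat zsp_minus)
lemma zsp_lin:
  assumes "x \<in> zsp A" "\<And>a. a \<in> A \<Longrightarrow> c * a \<in> zsp B" shows "c * x \<in> zsp B"
  using assms(1)
proof (induction rule: zsp.induct)
  case (zsp_diff x a)
  then show ?case using zsp_sub assms(2) by (simp add: right_diff_distrib)
next
  case (zsp_add x a)
  then show ?case using zsp_plus assms(2) by (simp add: distrib_left)
qed (auto intro: zsp_zero)
lemma zsp_mono: "x \<in> zsp A \<Longrightarrow> A \<subseteq> zsp B \<Longrightarrow> x \<in> zsp B"
  using zsp_lin[of x A 1 B] by auto
lemma zsp_sum: "(\<And>i. i \<in> I \<Longrightarrow> f i \<in> zsp A) \<Longrightarrow> sum f I \<in> zsp A"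
  by (induction I rule: infinite_finite_induct) (auto intro: zsp_zero zsp_plus)

lemma zsp_insert: "x \<in> zsp (insert g A) \<Longrightarrow> \<exists>w\<in>zsp A. \<exists>n::int. x = w + of_int n * g"
proof (induction rule: zsp.induct)
  case zsp_zero
  show ?case by (rule bexI[of _ 0], rule exI[of _ 0]) (auto intro: zsp.zsp_zero)
next
  case (zsp_diff x a)
  then obtain w n where w: "w \<in> zsp A" "x = w + of_int n * g" by auto
  show ?case
  proof (cases "a = g")
    case True
    then show ?thesis using w by (intro bexI[of _ w] exI[of _ "n - 1"]) (auto simp: algebra_simps)
  next
    case False
    then show ?thesis using w zsp_diff zsp.zsp_diff[of w A a] by (intro bexI[of _ "w - a"] exI[of _ n]) (auto simp: algebra_simps)
  qed
next
  case (zsp_add x a)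
  then obtain w n where w: "w \<in> zsp A" "x = w + of_int n * g" by auto
  show ?case
  proof (cases "a = g")
    case True
    then show ?thesis using w by (intro bexI[of _ w] exI[of _ "n + 1"]) (auto simp: algebra_simps)
  next
    case False
    then show ?thesis using w zsp_add zsp.zsp_add[of w A a] by (intro bexI[of _ "w + a"] exI[of _ n]) (auto simp: algebra_simps)
  qed
qed

text \<open>The ascending chain condition for finitely generated abelian groups, stated for a
  sequence. Induction on the generators: let \<open>d\<close> be the least positive coefficient of
  \<open>g\<close> that occurs in the span of an initial segment, attained by \<open>s0\<close>.
  Division with remainder by \<open>d\<close> subtracts a multiple of \<open>s0\<close> from each
  \<open>v k\<close> such that the rest lies in \<open>zsp A\<close>, and the induction hypothesis
  applies to these rests from \<open>k0\<close> on.\<close>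

lemma zsp_noetherian:
  assumes "finite A" "\<And>k::nat. v k \<in> zsp A" shows "\<exists>k. v k \<in> zsp (v ` {..<k})"
  using assms
proof (induction A arbitrary: v rule: finite_induct)
  case empty
  have "zsp {} \<subseteq> {0}"
  proof
    fix x assume "x \<in> zsp {}"
    then show "x \<in> {0}" by (induction rule: zsp.induct) auto
  qed
  then have "v 0 = 0" using empty by blast
  then show ?case by (intro exI[of _ 0]) (simp add: zsp_zero)
next
  case (insert g A)
  define D where "D m \<longleftrightarrow> m > 0 \<and> (\<exists>k. \<exists>s\<in>zsp (v ` {..<k}). \<exists>w\<in>zsp A. s = w + of_nat m * g)" for m :: nat
  have vin: "v k \<in> zsp (v ` {..<Suc k})" for k by (rule zsp_base) auto
  show ?case
  proof (cases "\<exists>m. D m")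
    case False
    have "v k \<in> zsp A" for k
    proof -
      obtain w n where w: "w \<in> zsp A" "v k = w + of_int n * g" using zsp_insert[OF insert.prems] by blast
      have "n = 0"
      proof (rule ccontr)
        assume n: "n \<noteq> 0"
        have "D (nat \<bar>n\<bar>)"
        proof (cases "n > 0")
          case True
          then show ?thesis unfolding D_def using w vin[of k] by (intro conjI exI[of _ "Suc k"] bexI[of _ "v k"] bexI[of _ w]) auto
        next
          case neg: False
          have "- v k = - w + of_nat (nat \<bar>n\<bar>) * g" using w neg by simp
          then show ?thesis unfolding D_def using n zsp_minus[OF w(1)] zsp_minus[OF vin[of k]] by fastforce
        qed
        then show False using False by blast
      qed
      then show ?thesis using w by simp
    qed
    then show ?thesis using insert.IH by blast
  next
    case True
    define d where "d = (LEAST m. D m)"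
    have Dd: "D d" unfolding d_def using True by (rule LeastI_ex)
    then obtain k0 s0 w0 where d: "d > 0" "s0 \<in> zsp (v ` {..<k0})" "w0 \<in> zsp A" "s0 = w0 + of_nat d * g"
      unfolding D_def by blast
    have "\<exists>q::int. v k - of_int q * s0 \<in> zsp A" for k
    proof -
      obtain w n where w: "w \<in> zsp A" "v k = w + of_int n * g" using zsp_insert[OF insert.prems] by blast
      let ?q = "n div int d" and ?r = "nat (n mod int d)"
      have r: "n = ?q * int d + int ?r" using d(1) by simp
      have nc: "(of_int n :: complex) = of_int ?q * of_nat d + of_nat ?r"
        by (subst r) (simp only: of_int_add of_int_mult of_int_of_nat_eq)
      have eq: "v k - of_int ?q * s0 = (w - of_int ?q * w0) + of_nat ?r * g"
        unfolding w(2) d(4) nc by (simp add: algebra_simps)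
      have win: "w - of_int ?q * w0 \<in> zsp A" by (intro zsp_sub zsp_int w d)
      have "v k - of_int ?q * s0 \<in> zsp (v ` {..<k0 + Suc k})"
        by (intro zsp_sub zsp_int zsp_mono[OF d(2)] zsp_base) (auto intro: zsp_base)
      then have "?r > 0 \<Longrightarrow> D ?r" unfolding D_def using eq win by blast
      moreover have "?r < d" using d(1) by (simp add: nat_less_iff)
      ultimately have "?r = 0" using not_less_Least[of ?r D] unfolding d_def by blast
      then have "v k - of_int ?q * s0 = w - of_int ?q * w0" using eq by simp
      then show ?thesis using win by metis
    qed
    then obtain q where q: "\<And>k. v k - of_int (q k) * s0 \<in> zsp A" by metis
    obtain j where j: "v (k0 + j) - of_int (q (k0 + j)) * s0 \<in> zsp ((\<lambda>j. v (k0 + j) - of_int (q (k0 + j)) * s0) ` {..<j})"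
      using insert.IH[of "\<lambda>j. v (k0 + j) - of_int (q (k0 + j)) * s0"] q by blast
    have s0: "s0 \<in> zsp (v ` {..<k0 + j})" by (rule zsp_mono[OF d(2)]) (auto intro: zsp_base)
    have "v (k0 + j) - of_int (q (k0 + j)) * s0 \<in> zsp (v ` {..<k0 + j})"
      by (rule zsp_mono[OF j]) (auto intro!: zsp_sub zsp_int s0 intro: zsp_base)
    then have "v (k0 + j) - of_int (q (k0 + j)) * s0 + of_int (q (k0 + j)) * s0 \<in> zsp (v ` {..<k0 + j})"
      by (intro zsp_plus zsp_int s0)
    then show ?thesis by auto
  qed
qed

lemma zsp_powers_imp_algebraic_int:
  assumes "z ^ k \<in> zsp ((\<lambda>i. z ^ i) ` {..<k})" shows "algebraic_int z"
proof -
  have "\<exists>q. (\<forall>i. Polynomial.coeff q i \<in> \<int>) \<and> (\<forall>i\<ge>k. Polynomial.coeff q i = 0) \<and> poly q z = y"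
    if "y \<in> zsp ((\<lambda>i. z ^ i) ` {..<k})" for y
    using that
  proof (induction rule: zsp.induct)
    case zsp_zero
    show ?case by (rule exI[of _ 0]) auto
  next
    case (zsp_diff x a)
    then obtain q i where "\<forall>i. Polynomial.coeff q i \<in> \<int>" "\<forall>i\<ge>k. Polynomial.coeff q i = 0" "poly q z = x" "a = z ^ i" "i < k" by auto
    then show ?case by (intro exI[of _ "q - Polynomial.monom 1 i"]) (auto simp: poly_monom)
  next
    case (zsp_add x a)
    then obtain q i where "\<forall>i. Polynomial.coeff q i \<in> \<int>" "\<forall>i\<ge>k. Polynomial.coeff q i = 0" "poly q z = x" "a = z ^ i" "i < k" by auto
    then show ?case by (intro exI[of _ "q + Polynomial.monom 1 i"]) (auto simp: poly_monom)
  qed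
  from this[OF assms] obtain q where q: "\<And>i. Polynomial.coeff q i \<in> \<int>" "\<And>i. i \<ge> k \<Longrightarrow> Polynomial.coeff q i = 0" "poly q z = z ^ k" by auto
  let ?p = "Polynomial.monom 1 k - q"
  have ck: "Polynomial.coeff ?p k = 1" using q(2) by simp
  have "Polynomial.degree ?p \<le> k" by (rule degree_le) (use q(2) in auto)
  moreover have "k \<le> Polynomial.degree ?p" by (rule le_degree) (use ck in simp)
  ultimately have "Polynomial.degree ?p = k" by simp
  then show ?thesis using ck q by (intro algebraic_int.intros[of ?p]) (auto simp: poly_monom)
qed

lemma algebraic_int_imp_zsp:
  assumes "algebraic_int x" shows "\<exists>n>0. x ^ n \<in> zsp ((\<lambda>i. x ^ i) ` {..<n})"
proof -
  obtain p where p: "Polynomial.lead_coeff p = 1" "\<forall>i. Polynomial.coeff p i \<in> \<int>" "poly p x = 0"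
    using assms by (auto simp: algebraic_int.simps)
  let ?n = "Polynomial.degree p"
  have "?n > 0"
  proof (rule ccontr)
    assume "\<not> ?n > 0"
    then have "p = [:1:]" using p(1) by (metis degree_0_id neq0_conv)
    then show False using p(3) by simp
  qed
  have "poly p x = (\<Sum>i<?n. Polynomial.coeff p i * x ^ i) + x ^ ?n"
    using p(1) by (simp add: poly_altdef lessThan_Suc_atMost[symmetric])
  then have e: "x ^ ?n = - (\<Sum>i<?n. Polynomial.coeff p i * x ^ i)" using p(3) by (simp add: eq_neg_iff_add_eq_0 add.commute)
  have "x ^ ?n \<in> zsp ((\<lambda>i. x ^ i) ` {..<?n})" unfolding e
  proof (intro zsp_minus zsp_sum)
    fix i assume i: "i \<in> {..<?n}"
    obtain m where "Polynomial.coeff p i = of_int m" using p(2) by (meson Ints_cases)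
    then show "Polynomial.coeff p i * x ^ i \<in> zsp ((\<lambda>i. x ^ i) ` {..<?n})" using i by (auto intro!: zsp_int[OF zsp_base])
  qed
  then show ?thesis using \<open>?n > 0\<close> by blast
qed

text \<open>The group spanned by the monomials \<open>x ^ i * y ^ j\<close> with
  \<open>i < n\<close> and \<open>j < m\<close> is stable under multiplication by \<open>x\<close>
  and by \<open>y\<close>. So it contains all powers of the sum and of the product, and by
  \<open>zsp_noetherian\<close> one of these powers is an integral combination of lower
  ones.\<close>

lemma algebraic_int_closed:
  assumes x: "algebraic_int (x::complex)" and y: "algebraic_int y"
  shows "algebraic_int (x + y)" "algebraic_int (x * y)"
proof -
  obtain n where n: "n > 0" "x ^ n \<in> zsp ((\<lambda>i. x ^ i) ` {..<n})" using algebraic_int_imp_zsp[OF x] by blast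
  obtain m where m: "m > 0" "y ^ m \<in> zsp ((\<lambda>i. y ^ i) ` {..<m})" using algebraic_int_imp_zsp[OF y] by blast
  define A where "A = (\<lambda>(i, j). x ^ i * y ^ j) ` ({..<n} \<times> {..<m})"
  have fA: "finite A" by (simp add: A_def)
  have A: "x ^ i * y ^ j \<in> zsp A" if "i < n" "j < m" for i j
    using that by (intro zsp_base) (force simp: A_def)
  have mx: "x * s \<in> zsp A" if "s \<in> zsp A" for s
  proof (rule zsp_lin[OF that])
    fix a assume "a \<in> A"
    then obtain i j where a: "a = x ^ i * y ^ j" "i < n" "j < m" by (auto simp: A_def)
    show "x * a \<in> zsp A"
    proof (cases "Suc i < n")
      case True
      then show ?thesis using A[of "Suc i" j] a by (simp add: mult.assoc)
    next
      case False
      then have "Suc i = n" using a by simp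
      then have "x * a = y ^ j * x ^ n" using a by (metis mult.assoc mult.commute power_Suc)
      moreover have "y ^ j * x ^ n \<in> zsp A" by (rule zsp_lin[OF n(2)]) (use A a in \<open>auto simp: mult.commute\<close>)
      ultimately show ?thesis by simp
    qed
  qed
  have my: "y * s \<in> zsp A" if "s \<in> zsp A" for s
  proof (rule zsp_lin[OF that])
    fix a assume "a \<in> A"
    then obtain i j where a: "a = x ^ i * y ^ j" "i < n" "j < m" by (auto simp: A_def)
    show "y * a \<in> zsp A"
    proof (cases "Suc j < m")
      case True
      then show ?thesis using A[of i "Suc j"] a by (simp add: mult.left_commute)
    next
      case False
      then have "Suc j = m" using a by simp
      then have "y * a = x ^ i * y ^ m" using a by (metis mult.left_commute power_Suc)
      moreover have "x ^ i * y ^ m \<in> zsp A" by (rule zsp_lin[OF m(2)]) (use A a in auto)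
      ultimately show ?thesis by simp
    qed
  qed
  have one: "1 \<in> zsp A" using A[of 0 0] n(1) m(1) by simp
  have "algebraic_int z" if z: "\<And>s. s \<in> zsp A \<Longrightarrow> z * s \<in> zsp A" for z
  proof -
    have "z ^ k \<in> zsp A" for k by (induction k) (auto simp: one z)
    then obtain k where "z ^ k \<in> zsp ((\<lambda>i. z ^ i) ` {..<k})" using zsp_noetherian[OF fA, of "\<lambda>k. z ^ k"] by blast
    then show ?thesis by (rule zsp_powers_imp_algebraic_int)
  qed
  note * = this
  show "algebraic_int (x + y)" by (rule *) (simp add: distrib_right zsp_plus mx my)
  show "algebraic_int (x * y)" by (rule *) (simp add: mult.assoc mx my)
qed

text \<open>Multiplying the equation by a power of the leading coefficient \<open>c\<close> makes it
  monic in \<open>of_int c * x\<close>.\<close>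

lemma algebraic_imp_int_multiple:
  assumes "p \<noteq> 0" "\<And>i. Polynomial.coeff p i \<in> \<int>" "poly p (x::complex) = 0"
  shows "\<exists>n::int. n \<noteq> 0 \<and> algebraic_int (of_int n * x)"
proof -
  let ?n = "Polynomial.degree p"
  obtain c where c: "Polynomial.lead_coeff p = of_int c" using assms(2) by (meson Ints_cases)
  have c0: "c \<noteq> 0" using c assms(1) by auto
  let ?z = "of_int c * x"
  have "?n \<noteq> 0"
  proof
    assume "?n = 0"
    then obtain a where "p = [:a:]" by (metis degree_eq_zeroE)
    then show False using assms by simp
  qed
  have "poly p x = (\<Sum>i<?n. Polynomial.coeff p i * x ^ i) + of_int c * x ^ ?n"
    using c by (simp add: poly_altdef lessThan_Suc_atMost[symmetric])
  then have e: "of_int c * x ^ ?n = - (\<Sum>i<?n. Polynomial.coeff p i * x ^ i)" using assms(3) by (simp add: eq_neg_iff_add_eq_0 add.commute)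
  have "?z ^ ?n = of_int (c ^ (?n - 1)) * (of_int c * x ^ ?n)"
    using \<open>?n \<noteq> 0\<close> by (cases ?n) (auto simp: power_mult_distrib)
  also have "\<dots> = - (\<Sum>i<?n. of_int (c ^ (?n - 1)) * (Polynomial.coeff p i * x ^ i))" unfolding e by (simp add: sum_distrib_left)
  also have "(\<Sum>i<?n. of_int (c ^ (?n - 1)) * (Polynomial.coeff p i * x ^ i)) = (\<Sum>i<?n. of_int (c ^ (?n - 1 - i)) * (Polynomial.coeff p i * ?z ^ i))"
  proof (rule sum.cong[OF refl])
    fix i assume "i \<in> {..<?n}"
    then have "c ^ (?n - 1) = c ^ (?n - 1 - i) * c ^ i" by (simp flip: power_add)
    then show "of_int (c ^ (?n - 1)) * (Polynomial.coeff p i * x ^ i) = of_int (c ^ (?n - 1 - i)) * (Polynomial.coeff p i * ?z ^ i)"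
      by (simp add: power_mult_distrib)
  qed
  finally have e2: "?z ^ ?n = - (\<Sum>i<?n. of_int (c ^ (?n - 1 - i)) * (Polynomial.coeff p i * ?z ^ i))" .
  have "?z ^ ?n \<in> zsp ((\<lambda>i. ?z ^ i) ` {..<?n})" unfolding e2
  proof (intro zsp_minus zsp_sum zsp_int)
    fix i assume i: "i \<in> {..<?n}"
    obtain m where "Polynomial.coeff p i = of_int m" using assms(2) by (meson Ints_cases)
    then show "Polynomial.coeff p i * ?z ^ i \<in> zsp ((\<lambda>i. ?z ^ i) ` {..<?n})" using i by (auto intro!: zsp_int[OF zsp_base])
  qed
  then have "algebraic_int ?z" by (rule zsp_powers_imp_algebraic_int)
  then show ?thesis using c0 by blast
qed

text \<open>The second coefficient of a power of a linear polynomial reveals its root, since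
  \<open>Suc m\<close> is invertible in characteristic zero; \<open>exists_conjugate\<close> draws
  separability from this.\<close>

lemma coeff_linear_power: "Polynomial.coeff ([:- x, 1:] ^ Suc m) m = - (of_nat (Suc m) * (x::complex))"
proof (induction m)
  case (Suc m)
  have top: "Polynomial.coeff ([:- x, 1:] ^ n) n = 1" for n
    by (induction n) (auto simp: coeff_eq_0 degree_linear_power)
  have "Polynomial.coeff ([:- x, 1:] ^ Suc (Suc m)) (Suc m) =
      - x * Polynomial.coeff ([:- x, 1:] ^ Suc m) (Suc m) + Polynomial.coeff ([:- x, 1:] ^ Suc m) m"
    unfolding power_Suc[of _ "Suc m"] by (simp del: power_Suc)
  also have "\<dots> = - x * 1 - of_nat (Suc m) * x" unfolding Suc top by simp
  also have "\<dots> = - (of_nat (Suc (Suc m)) * x)" by (simp add: algebra_simps)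
  finally show ?case .
qed simp

lemma Rats_subfield: "subfield \<rat> CR"
proof (rule field.subfieldI'[OF CR_field])
  show "subring \<rat> CR" by (rule CRf.subringI) auto
  show "inv\<^bsub>CR\<^esub> k \<in> \<rat>" if "k \<in> \<rat> - {\<zero>\<^bsub>CR\<^esub>}" for k using that by auto
qed

lemma CR_subfieldD:
  assumes "subfield N CR"
  shows "0 \<in> N" "1 \<in> N" "x \<in> N \<Longrightarrow> y \<in> N \<Longrightarrow> x + y \<in> N" "x \<in> N \<Longrightarrow> y \<in> N \<Longrightarrow> x * y \<in> N"
    "x \<in> N \<Longrightarrow> - x \<in> N" "x \<in> N \<Longrightarrow> y \<in> N \<Longrightarrow> x - y \<in> N" "x \<in> N \<Longrightarrow> inverse x \<in> N"
proof -
  note s = subringE[OF subfieldE(1)[OF assms]]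
  show "0 \<in> N" "1 \<in> N" "x \<in> N \<Longrightarrow> y \<in> N \<Longrightarrow> x + y \<in> N" "x \<in> N \<Longrightarrow> y \<in> N \<Longrightarrow> x * y \<in> N" and m: "\<And>x. x \<in> N \<Longrightarrow> - x \<in> N"
    using s(2,3,5,6,7) by auto
  show "x \<in> N \<Longrightarrow> y \<in> N \<Longrightarrow> x - y \<in> N" using s(7)[of x "- y"] m[of y] by simp
  show "inverse x \<in> N" if "x \<in> N"
    using that CRf.subfield_m_inv(1)[OF assms, of x] s(2) by (cases "x = 0") auto
qed

lemma CR_ZZ: "[k] \<cdot>\<^bsub>CR\<^esub> \<one>\<^bsub>CR\<^esub> = of_int (k::int)"
  using field.emb_ZZ(2)[OF CR_field, of UNIV id k]
    field.carrier_is_subfield[OF CR_field] by (auto simp: emb_def)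

lemma CR_subfield_Rats: assumes "subfield N CR" shows "\<rat> \<subseteq> N"
proof
  fix x :: complex assume "x \<in> \<rat>"
  then obtain a b where x: "x = of_int a / of_int b" by (auto elim: Rats_cases')
  have "emb CR N id" by (simp add: emb_def)
  then have "of_int k \<in> N" for k using field.emb_ZZ(1)[OF CR_field assms, of id k] CR_ZZ by simp
  then show "x \<in> N" unfolding x divide_inverse by (intro CR_subfieldD[OF assms])
qed

lemma emb_CR_Rats:
  assumes N: "subfield N CR" and s: "emb CR N \<sigma>" and x: "x \<in> \<rat>" shows "\<sigma> x = x"
proof -
  obtain a b where ab: "b \<noteq> 0" "x = of_int a / of_int b" using x by (metis Rats_cases' less_irrefl)
  have i: "\<sigma> (of_int k) = of_int k" "of_int k \<in> N" for k using field.emb_ZZ[OF CR_field N s, of k] CR_ZZ by auto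
  have "x \<in> N" using CR_subfield_Rats[OF N] x by auto
  then have "\<sigma> (x * of_int b) = \<sigma> x * of_int b" using embD(3)[OF s, of x "of_int b"] i by simp
  moreover have "x * of_int b = of_int a" using ab by simp
  ultimately have "\<sigma> x * of_int b = x * of_int b" by (simp only: i)
  then show ?thesis using ab(1) by simp
qed

lemma emb_CR_poly:
  assumes N: "subfield N CR" and s: "emb CR N \<sigma>" and q: "\<And>i. Polynomial.coeff q i \<in> N \<and> \<sigma> (Polynomial.coeff q i) = Polynomial.coeff q i"
    and x: "x \<in> N"
  shows "poly q x \<in> N \<and> \<sigma> (poly q x) = poly q (\<sigma> x)"
  using q
proof (induction q)
  case 0
  then show ?case using field.emb_zero[OF CR_field N s] CR_subfieldD(1)[OF N] by simp
next
  case (pCons a q)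
  have "Polynomial.coeff q i \<in> N \<and> \<sigma> (Polynomial.coeff q i) = Polynomial.coeff q i" for i
    using pCons.prems[of "Suc i"] by simp
  then have IH: "poly q x \<in> N" "\<sigma> (poly q x) = poly q (\<sigma> x)" using pCons.IH by auto
  have a: "a \<in> N" "\<sigma> a = a" using pCons.prems[of 0] by auto
  have m: "x * poly q x \<in> N" using CR_subfieldD(4)[OF N x IH(1)] .
  have "\<sigma> (a + x * poly q x) = a + \<sigma> x * poly q (\<sigma> x)"
    using embD(2)[OF s a(1) m] embD(3)[OF s x IH(1)] a IH by simp
  then show ?case using CR_subfieldD(3)[OF N a(1) m] by simp
qed

section \<open>Normal subfields of the complex numbers\<close>

text \<open>\<open>N\<close> will be the splitting field of \<open>f\<close> over the rationals. In
  the application \<open>f\<close> is a product of several polynomials; the roots form a list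
  because \<open>finite_extension\<close> takes one.\<close>

locale normal_field =
  fixes f :: "complex poly" and xs :: "complex list"
  assumes f_nz: "f \<noteq> 0" and f_Rats: "\<And>i. Polynomial.coeff f i \<in> \<rat>" and xs: "set xs = {z. poly f z = 0}"
begin

definition N :: "complex set" where "N = CRf.finite_extension \<rat> xs"

lemma root_algebraic: "z \<in> set xs \<Longrightarrow> (CRf.algebraic over \<rat>) z"
proof (rule CRf.algebraicI)
  assume z: "z \<in> set xs"
  let ?p = "rev (coeffs f)"
  have ne: "coeffs f \<noteq> []" using f_nz by simp
  have "hd ?p \<noteq> 0" using f_nz ne by (simp add: hd_rev last_coeffs_eq_coeff_degree)
  moreover have "set ?p \<subseteq> \<rat>" using f_Rats by (auto simp: coeffs_def)
  ultimately show "?p \<in> carrier (univ_poly CR \<rat>)" by (simp add: univ_poly_carrier[symmetric] polynomial_def)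
  show "?p \<noteq> []" using ne by simp
  show "CRf.eval ?p z = \<zero>\<^bsub>CR\<^esub>" using z xs by (simp add: CR_eval)
qed

lemma N_subfield: "subfield N CR"
  unfolding N_def by (rule domain.finite_extension_is_subfield[OF CR_domain Rats_subfield]) (auto simp: root_algebraic)

lemmas ND = CR_subfieldD[OF N_subfield]

lemma N_Rats: "\<rat> \<subseteq> N" by (rule CR_subfield_Rats[OF N_subfield])

lemma xs_N: "set xs \<subseteq> N"
  unfolding N_def by (rule domain.finite_extension_mem[OF CR_domain subfieldE(1)[OF Rats_subfield]]) auto

lemma N_min: "subring T CR \<Longrightarrow> \<rat> \<subseteq> T \<Longrightarrow> set xs \<subseteq> T \<Longrightarrow> N \<subseteq> T"
  unfolding N_def by (rule CRf.finite_extension_subring_incl)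

lemma N_algebraic: "x \<in> N \<Longrightarrow> (CRf.algebraic over \<rat>) x"
  unfolding N_def
  by (rule domain.finite_extesion_mem_imp_algebraic[OF CR_domain Rats_subfield, of xs]) (auto simp: root_algebraic)

lemma N_int_multiple: assumes "x \<in> N" shows "\<exists>n::int. n \<noteq> 0 \<and> algebraic_int (of_int n * x)"
proof -
  obtain p where p: "p \<in> carrier (univ_poly CR \<rat>)" "p \<noteq> []" "CRf.eval p x = 0"
    using domain.algebraicE[OF CR_domain subfieldE(1)[OF Rats_subfield] _ N_algebraic[OF assms]] by auto
  let ?P = "Poly (rev p)"
  have pp: "set p \<subseteq> \<rat>" "hd p \<noteq> 0" using p(1,2) by (auto simp: univ_poly_carrier[symmetric] polynomial_def)
  have c: "Polynomial.coeff ?P (length p - 1) = hd p" using p(2) by (simp add: nth_default_def rev_nth hd_conv_nth)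
  have P0: "?P \<noteq> 0"
  proof
    assume "?P = 0"
    then show False using c pp(2) by (metis coeff_0)
  qed
  have PR: "Polynomial.coeff ?P i \<in> \<rat>" for i using pp(1) nth_mem[of i "rev p"] by (auto simp: nth_default_def)
  have "algebraic x" unfolding algebraic_altdef using P0 PR p(3) by (intro exI[of _ ?P]) (simp add: CR_eval)
  then obtain q where "\<forall>i. Polynomial.coeff q i \<in> \<int>" "q \<noteq> 0" "poly q x = 0" unfolding algebraic_def by blast
  then show ?thesis using algebraic_imp_int_multiple[of q x] by blast
qed

text \<open>Automorphisms are the identity outside \<open>N\<close>, so they compose as functions
  and are equal as functions once they agree on \<open>N\<close>.\<close>

definition Gal :: "(complex \<Rightarrow> complex) set" where
  "Gal = {\<sigma>. (\<forall>x. x \<notin> N \<longrightarrow> \<sigma> x = x) \<and> emb CR N \<sigma> \<and> \<sigma> ` N = N}"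

lemma GalD:
  assumes "\<sigma> \<in> Gal"
  shows "x \<notin> N \<Longrightarrow> \<sigma> x = x" "emb CR N \<sigma>" "\<sigma> ` N = N" "x \<in> N \<Longrightarrow> \<sigma> x \<in> N"
    "x \<in> N \<Longrightarrow> y \<in> N \<Longrightarrow> \<sigma> (x + y) = \<sigma> x + \<sigma> y" "x \<in> N \<Longrightarrow> y \<in> N \<Longrightarrow> \<sigma> (x * y) = \<sigma> x * \<sigma> y" "\<sigma> 1 = 1"
    "x \<in> N \<Longrightarrow> y \<in> N \<Longrightarrow> \<sigma> (x - y) = \<sigma> x - \<sigma> y" "x \<in> \<rat> \<Longrightarrow> \<sigma> x = x"
  using assms embD[of CR N \<sigma>] field.emb_diff[OF CR_field N_subfield, of \<sigma> x y] emb_CR_Rats[OF N_subfield, of \<sigma> x]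
  by (auto simp: Gal_def)

lemma Gal_poly_eq: "\<sigma> \<in> Gal \<Longrightarrow> x \<in> N \<Longrightarrow> (\<And>i. Polynomial.coeff q i \<in> \<rat>) \<Longrightarrow> \<sigma> (poly q x) = poly q (\<sigma> x)"
  using emb_CR_poly[OF N_subfield GalD(2), of \<sigma> q x] N_Rats GalD(9)[of \<sigma>] by blast

lemma equalizer_subring:
  assumes s: "emb CR N \<sigma>" and t: "emb CR N \<tau>" shows "subring {x \<in> N. \<sigma> x = \<tau> x} CR"
proof (rule CRf.subringI)
  show "\<one>\<^bsub>CR\<^esub> \<in> {x \<in> N. \<sigma> x = \<tau> x}" using embD(1)[OF s] embD(1)[OF t] ND(2) by simp
  fix h assume h: "h \<in> {x \<in> N. \<sigma> x = \<tau> x}"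
  then show "\<ominus>\<^bsub>CR\<^esub> h \<in> {x \<in> N. \<sigma> x = \<tau> x}"
    using field.emb_minus[OF CR_field N_subfield s, of h] field.emb_minus[OF CR_field N_subfield t, of h] ND(5) by auto
  fix k assume "k \<in> {x \<in> N. \<sigma> x = \<tau> x}"
  then show "h \<otimes>\<^bsub>CR\<^esub> k \<in> {x \<in> N. \<sigma> x = \<tau> x}" "h \<oplus>\<^bsub>CR\<^esub> k \<in> {x \<in> N. \<sigma> x = \<tau> x}"
    using h embD(2,3)[OF s, of h k] embD(2,3)[OF t, of h k] ND(3,4) by auto
qed auto

lemma Gal_finite: "finite Gal"
proof -
  let ?r = "\<lambda>\<sigma>. restrict \<sigma> (set xs)"
  have root: "\<sigma> z \<in> set xs" if s: "\<sigma> \<in> Gal" and z: "z \<in> set xs" for \<sigma> z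
  proof -
    have "poly f (\<sigma> z) = \<sigma> (poly f z)" using Gal_poly_eq[OF s _ f_Rats, of z] z xs_N by auto
    also have "\<dots> = 0" using z xs GalD(9)[OF s, of 0] by simp
    finally show ?thesis using xs by simp
  qed
  have "?r ` Gal \<subseteq> set xs \<rightarrow>\<^sub>E set xs" using root by auto
  then have "finite (?r ` Gal)" by (rule finite_subset) (intro finite_PiE, auto)
  moreover have "inj_on ?r Gal"
  proof (rule inj_onI)
    fix \<sigma> \<tau> assume st: "\<sigma> \<in> Gal" "\<tau> \<in> Gal" and eq: "?r \<sigma> = ?r \<tau>"
    have "\<sigma> z = \<tau> z" if "z \<in> set xs" for z using fun_cong[OF eq, of z] that by simp
    moreover have "\<sigma> r = \<tau> r" if "r \<in> \<rat>" for r using GalD(9)[OF st(1) that] GalD(9)[OF st(2) that] by simp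
    ultimately have "N \<subseteq> {x \<in> N. \<sigma> x = \<tau> x}"
      using st N_Rats xs_N by (intro N_min equalizer_subring GalD(2)) auto
    then have NN: "\<sigma> x = \<tau> x" if "x \<in> N" for x using that by blast
    show "\<sigma> = \<tau>"
    proof
      fix x show "\<sigma> x = \<tau> x" using NN GalD(1)[OF st(1), of x] GalD(1)[OF st(2), of x] by (cases "x \<in> N") simp_all
    qed
  qed
  ultimately show ?thesis using finite_imageD by blast
qed

text \<open>If \<open>x\<close> were the only root, its irreducible polynomial would be
  \<open>(X - x) ^ n\<close> over the complex numbers. The second coefficient \<open>- n * x\<close>
  lies in \<open>S\<close>, and dividing by \<open>n\<close> would put \<open>x\<close> into
  \<open>S\<close>.\<close>

lemma exists_conjugate:
  assumes S: "subfield S CR" and x: "(CRf.algebraic over S) x" "x \<notin> S"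
  shows "\<exists>z. z \<noteq> x \<and> CRf.eval (CRf.Irr S x) z = 0"
proof (rule ccontr)
  assume neg: "\<not> ?thesis"
  have xc: "x \<in> carrier CR" by simp
  let ?I = "CRf.Irr S x" and ?P = "Poly (rev (CRf.Irr S x))"
  note I = domain.IrrE[OF CR_domain S xc x(1)]
  have len: "length ?I \<ge> 2" by (rule field.Irr_length[OF CR_field S xc x(1)])
  have Iset: "set ?I \<subseteq> S" using I(1) by (auto simp: univ_poly_carrier[symmetric] polynomial_def)
  let ?n = "length ?I - 1"
  have "?I \<noteq> []" using len by auto
  then have "?I ! 0 = 1" "?n < length ?I" using I(3) len by (simp_all add: hd_conv_nth)
  then have lc: "Polynomial.coeff ?P ?n = 1" by (simp add: nth_default_def rev_nth)
  have "Polynomial.degree ?P \<le> ?n" by (rule degree_le) (use len in \<open>auto simp: nth_default_def\<close>)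
  moreover have "?n \<le> Polynomial.degree ?P" by (rule le_degree) (use lc in simp)
  ultimately have deg: "Polynomial.degree ?P = ?n" by simp
  obtain rt where rt: "Polynomial.smult (Polynomial.lead_coeff ?P) (\<Prod>i<Polynomial.degree ?P. [:- rt i, 1:]) = ?P"
    by (rule complex_poly_decompose')
  then have Pe: "?P = (\<Prod>i<?n. [:- rt i, 1:])" using deg lc by simp
  have "rt i = x" if i: "i < ?n" for i
  proof -
    have "poly ?P (rt i) = 0" by (subst Pe) (use i in \<open>auto simp: poly_prod\<close>)
    then show ?thesis using neg by (auto simp: CR_eval)
  qed
  then have "?P = [:- x, 1:] ^ ?n" by (subst Pe) simp
  moreover have "Suc (?n - 1) = ?n" using len by simp
  ultimately have "?P = [:- x, 1:] ^ Suc (?n - 1)" by (simp only:)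
  then have "Polynomial.coeff ?P (?n - 1) = - (of_nat (Suc (?n - 1)) * x)" using coeff_linear_power[of x "?n - 1"] by (simp only:)
  moreover have "Polynomial.coeff ?P (?n - 1) \<in> S"
    using Iset nth_mem[of "?n - 1" "rev ?I"] CR_subfieldD(1)[OF S] by (auto simp: nth_default_def)
  ultimately have "- (of_nat (Suc (?n - 1)) * x) \<in> S" by simp
  then have "of_nat (Suc (?n - 1)) * x \<in> S" using CR_subfieldD(5)[OF S, of "- (of_nat (Suc (?n - 1)) * x)"] by simp
  moreover have iS: "inverse (of_nat (Suc (?n - 1))) \<in> S"
    by (rule subsetD[OF CR_subfield_Rats[OF S]]) (intro Rats_inverse Rats_of_nat)
  ultimately have "inverse (of_nat (Suc (?n - 1))) * (of_nat (Suc (?n - 1)) * x) \<in> S"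
    using CR_subfieldD(4)[OF S iS] by simp
  then have "x \<in> S" by (simp add: mult.assoc[symmetric] del: of_nat_Suc)
  then show False using x(2) by simp
qed

text \<open>The identity of \<open>S\<close> extends to the simple extension by \<open>x\<close>,
  sending \<open>x\<close> to another conjugate \<open>z\<close>, and then to a field containing all
  roots of \<open>f\<close>. The restriction to \<open>N\<close> permutes these roots, so it maps
  \<open>N\<close> onto \<open>N\<close>.\<close>

lemma Gal_moves:
  assumes S: "subfield S CR" "S \<subseteq> N" and x: "x \<in> N" "x \<notin> S"
  shows "\<exists>\<sigma>\<in>Gal. (\<forall>y\<in>S. \<sigma> y = y) \<and> \<sigma> x \<noteq> x"
proof -
  have SR: "\<rat> \<subseteq> S" by (rule CR_subfield_Rats[OF S(1)])
  have xa: "(CRf.algebraic over S) x" by (rule CRf.algebraic_mono[OF SR N_algebraic[OF x(1)]])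
  obtain z where z: "z \<noteq> x" "CRf.eval (CRf.Irr S x) z = 0" using exists_conjugate[OF S(1) xa x(2)] by blast
  have e0: "emb CR S id" by (simp add: emb_def)
  obtain j1 where j1: "emb CR (CRf.simple_extension S x) j1" "\<forall>y\<in>S. j1 y = id y" "j1 x = z"
    using field.extend_emb[OF CR_field S(1) _ xa e0, of z] z(2) by auto
  let ?T = "CRf.simple_extension S x"
  have T: "subfield ?T CR" using domain.simple_extension_is_subfield[OF CR_domain S(1), of x] xa by simp
  have ST: "S \<subseteq> ?T" by (rule CRf.simple_extension_incl) auto
  have xT: "x \<in> ?T" by (rule CRf.simple_extension_mem[OF subfieldE(1)[OF S(1)]]) simp
  have alg: "(CRf.algebraic over ?T) y" if "y \<in> set xs" for y
    using root_algebraic[OF that] SR ST by (intro CRf.algebraic_mono[of "\<rat>" ?T]) auto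
  obtain j2 where j2: "emb CR (CRf.finite_extension ?T xs) j2" "\<forall>y\<in>?T. j2 y = j1 y"
    using field.extend_emb_list[OF CR_field T _ alg j1(1), of xs] by auto
  have sub: "subring (CRf.finite_extension ?T xs) CR"
    by (rule domain.finite_extension_is_subring[OF CR_domain subfieldE(1)[OF T]]) auto
  have inc: "?T \<subseteq> CRf.finite_extension ?T xs" by (rule CRf.finite_extension_incl) auto
  have "N \<subseteq> CRf.finite_extension ?T xs"
  proof (rule N_min[OF sub])
    show "\<rat> \<subseteq> CRf.finite_extension ?T xs" using SR ST inc by blast
    show "set xs \<subseteq> CRf.finite_extension ?T xs"
      by (rule domain.finite_extension_mem[OF CR_domain subfieldE(1)[OF T]]) simp
  qed
  then have eN: "emb CR N j2" using emb_mono[OF j2(1)] by blast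
  define \<sigma> where "\<sigma> y = (if y \<in> N then j2 y else y)" for y
  have sN: "emb CR N \<sigma>" unfolding emb_def \<sigma>_def using embD[OF eN] ND by auto
  have root: "\<sigma> z \<in> set xs" if z: "z \<in> set xs" for z
  proof -
    have "\<sigma> (poly f z) = poly f (\<sigma> z)"
      using emb_CR_poly[OF N_subfield sN, of f z] N_Rats f_Rats emb_CR_Rats[OF N_subfield sN] z xs_N by blast
    moreover have "\<sigma> 0 = 0" by (rule emb_CR_Rats[OF N_subfield sN]) simp
    ultimately show ?thesis using z xs by simp
  qed
  have inj: "a = b" if "a \<in> N" "b \<in> N" "\<sigma> a = \<sigma> b" for a b
    using field.emb_inj[OF CR_field N_subfield sN that] .
  have "inj_on \<sigma> (set xs)" by (rule inj_onI) (use inj xs_N in blast)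
  then have sxs: "\<sigma> ` set xs = set xs" using root by (intro endo_inj_surj) auto
  have img: "subring (\<sigma> ` N) CR"
  proof (rule CRf.subringI)
    show "\<one>\<^bsub>CR\<^esub> \<in> \<sigma> ` N" using embD(1)[OF sN] ND(2) by (auto intro!: image_eqI[of _ _ 1])
    fix h assume "h \<in> \<sigma> ` N"
    then obtain a where a: "a \<in> N" "h = \<sigma> a" by auto
    show "\<ominus>\<^bsub>CR\<^esub> h \<in> \<sigma> ` N" using a field.emb_minus[OF CR_field N_subfield sN a(1)] ND(5)[OF a(1)] by (auto intro!: image_eqI[of _ _ "- a"])
    fix k assume "k \<in> \<sigma> ` N"
    then obtain b where b: "b \<in> N" "k = \<sigma> b" by auto
    show "h \<otimes>\<^bsub>CR\<^esub> k \<in> \<sigma> ` N" using a b embD(3)[OF sN a(1) b(1)] ND(4)[OF a(1) b(1)] by (auto intro!: image_eqI[of _ _ "a * b"])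
    show "h \<oplus>\<^bsub>CR\<^esub> k \<in> \<sigma> ` N" using a b embD(2)[OF sN a(1) b(1)] ND(3)[OF a(1) b(1)] by (auto intro!: image_eqI[of _ _ "a + b"])
  qed auto
  have "N \<subseteq> \<sigma> ` N"
  proof (rule N_min[OF img])
    show "\<rat> \<subseteq> \<sigma> ` N"
    proof
      fix r :: complex assume r: "r \<in> \<rat>"
      then have "\<sigma> r = r" "r \<in> N" using emb_CR_Rats[OF N_subfield sN r] N_Rats by auto
      then show "r \<in> \<sigma> ` N" by (metis image_eqI)
    qed
    show "set xs \<subseteq> \<sigma> ` N" using sxs xs_N by blast
  qed
  moreover have "N \<subseteq> {y \<in> N. \<sigma> y \<in> N}"
  proof (rule N_min)
    show "subring {y \<in> N. \<sigma> y \<in> N} CR"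
    proof (rule CRf.subringI)
      show "\<one>\<^bsub>CR\<^esub> \<in> {y \<in> N. \<sigma> y \<in> N}" using embD(1)[OF sN] ND(2) by simp
      fix h assume h: "h \<in> {y \<in> N. \<sigma> y \<in> N}"
      then show "\<ominus>\<^bsub>CR\<^esub> h \<in> {y \<in> N. \<sigma> y \<in> N}" using field.emb_minus[OF CR_field N_subfield sN, of h] ND(5) by auto
      fix k assume "k \<in> {y \<in> N. \<sigma> y \<in> N}"
      then show "h \<otimes>\<^bsub>CR\<^esub> k \<in> {y \<in> N. \<sigma> y \<in> N}" "h \<oplus>\<^bsub>CR\<^esub> k \<in> {y \<in> N. \<sigma> y \<in> N}"
        using h embD(2,3)[OF sN, of h k] ND(3,4) by auto
    qed auto
    show "\<rat> \<subseteq> {y \<in> N. \<sigma> y \<in> N}" using emb_CR_Rats[OF N_subfield sN] N_Rats by auto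
    show "set xs \<subseteq> {y \<in> N. \<sigma> y \<in> N}" using root xs_N by auto
  qed
  ultimately have "\<sigma> \<in> Gal" unfolding Gal_def using sN by (auto simp: \<sigma>_def)
  moreover have "\<forall>y\<in>S. \<sigma> y = y" using S(2) ST j1(2) j2(2) by (auto simp: \<sigma>_def subset_iff)
  moreover have "\<sigma> x \<noteq> x" using x(1) j2(2) xT j1(3) z(1) by (simp add: \<sigma>_def)
  ultimately show ?thesis by blast
qed

lemma Gal_id: "id \<in> Gal" by (simp add: Gal_def emb_def)

lemma Gal_comp: "g \<in> Gal \<Longrightarrow> h \<in> Gal \<Longrightarrow> g \<circ> h \<in> Gal"
proof -
  assume g: "g \<in> Gal" and h: "h \<in> Gal"
  have "emb CR N (g \<circ> h)" unfolding emb_def using GalD[OF g] GalD[OF h] by simp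
  moreover have "(g \<circ> h) ` N = N" using GalD(3)[OF g] GalD(3)[OF h] by (metis image_comp)
  ultimately show ?thesis unfolding Gal_def using GalD(1)[OF g] GalD(1)[OF h] by simp
qed

lemma Gal_inv: assumes g: "g \<in> Gal" shows "\<exists>h\<in>Gal. h \<circ> g = id \<and> g \<circ> h = id"
proof -
  define h where "h y = (if y \<in> N then inv_into N g y else y)" for y
  have inj: "inj_on g N" by (rule inj_onI) (use field.emb_inj[OF CR_field N_subfield GalD(2)[OF g]] in blast)
  have hg: "h (g x) = x" for x
    using GalD(1)[OF g, of x] GalD(4)[OF g, of x] inj by (cases "x \<in> N") (auto simp: h_def)
  have hN: "h y \<in> N" "g (h y) = y" if "y \<in> N" for y
    using that GalD(3)[OF g] inv_into_into[of y g N] f_inv_into_f[of y g N] by (auto simp: h_def)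
  have gh: "g (h y) = y" for y using hN GalD(1)[OF g] by (cases "y \<in> N") (auto simp: h_def)
  have "emb CR N h" unfolding emb_def
  proof (intro conjI ballI)
    show "h \<one>\<^bsub>CR\<^esub> = 1" using hg[of 1] GalD(7)[OF g] by simp
    fix x y assume xy: "x \<in> N" "y \<in> N"
    have "g (h x + h y) = x + y" "g (h x * h y) = x * y" using GalD(5,6)[OF g] hN xy by auto
    then show "h (x \<oplus>\<^bsub>CR\<^esub> y) = h x + h y" "h (x \<otimes>\<^bsub>CR\<^esub> y) = h x * h y" using hg by (metis CR_simps(5), metis CR_simps(2))
  qed
  moreover have "h ` N = N"
  proof
    show "h ` N \<subseteq> N" using hN by auto
    show "N \<subseteq> h ` N"
    proof
      fix x assume "x \<in> N"
      then have "x = h (g x)" "g x \<in> N" using hg GalD(4)[OF g] by auto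
      then show "x \<in> h ` N" by blast
    qed
  qed
  ultimately have "h \<in> Gal" unfolding Gal_def by (simp add: h_def)
  then show ?thesis using hg gh by (intro bexI[of _ h]) auto
qed

definition ON :: "complex set" where "ON = {x \<in> N. algebraic_int x}"

lemma Gal_algebraic_int: assumes "g \<in> Gal" "x \<in> ON" shows "g x \<in> ON"
proof -
  have x: "x \<in> N" "algebraic_int x" using assms by (auto simp: ON_def)
  obtain p where p: "Polynomial.lead_coeff p = 1" "\<forall>i. Polynomial.coeff p i \<in> \<int>" "poly p x = 0"
    using x(2) by (auto simp: algebraic_int.simps)
  have "poly p (g x) = g (poly p x)" using p(2) Ints_subset_Rats by (intro Gal_poly_eq[symmetric] assms x) auto
  also have "\<dots> = 0" using p(3) GalD(9)[OF assms(1), of 0] by simp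
  finally have "algebraic_int (g x)" using p by (intro algebraic_int.intros) auto
  then show ?thesis using GalD(4)[OF assms(1) x(1)] by (simp add: ON_def)
qed

lemma of_int_N: "of_int n \<in> N" using N_Rats by auto

lemma ON_galois_ring: "galois_ring ON Gal"
proof
  show "1 \<in> ON" using ND by (simp add: ON_def)
  show "x - y \<in> ON" if "x \<in> ON" "y \<in> ON" for x y
    using that ND(6) algebraic_int_closed(1)[of x "- y"] by (auto simp: ON_def)
  show "x * y \<in> ON" if "x \<in> ON" "y \<in> ON" for x y
    using that ND(4) algebraic_int_closed(2)[of x y] by (auto simp: ON_def)
  show "finite Gal" by (rule Gal_finite)
  show "id \<in> Gal" by (rule Gal_id)
  show "g \<circ> h \<in> Gal" if "g \<in> Gal" "h \<in> Gal" for g h using Gal_comp that .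
  show "\<exists>h\<in>Gal. h \<circ> g = id \<and> g \<circ> h = id" if "g \<in> Gal" for g using Gal_inv that .
  show "g x \<in> ON" if "g \<in> Gal" "x \<in> ON" for g x using Gal_algebraic_int that .
  show "g (x - y) = g x - g y" if "g \<in> Gal" "x \<in> ON" "y \<in> ON" for g x y using that GalD(8) by (auto simp: ON_def)
  show "g (x * y) = g x * g y" if "g \<in> Gal" "x \<in> ON" "y \<in> ON" for g x y using that GalD(6) by (auto simp: ON_def)
  show "g 1 = 1" if "g \<in> Gal" for g using GalD(7) that .
  show "g = id" if g: "g \<in> Gal" and fx: "\<And>x. x \<in> ON \<Longrightarrow> g x = x" for g
  proof
    fix x
    show "g x = id x"
    proof (cases "x \<in> N")
      case True
      obtain n :: int where n: "n \<noteq> 0" "algebraic_int (of_int n * x)" using N_int_multiple[OF True] by blast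
      have "of_int n * x \<in> ON" using n ND(4)[OF of_int_N True] by (simp add: ON_def)
      then have "g (of_int n * x) = of_int n * x" by (rule fx)
      moreover have "g (of_int n * x) = of_int n * g x" using GalD(6)[OF g of_int_N True] GalD(9)[OF g, of "of_int n"] by simp
      ultimately show ?thesis using n(1) by simp
    next
      case False
      then show ?thesis using GalD(1)[OF g] by simp
    qed
  qed
  show "x \<in> \<int>" if x: "x \<in> ON" and fx: "\<And>g. g \<in> Gal \<Longrightarrow> g x = x" for x
  proof -
    have "x \<in> \<rat>"
    proof (rule ccontr)
      assume "x \<notin> \<rat>"
      then obtain \<sigma> where "\<sigma> \<in> Gal" "\<sigma> x \<noteq> x" using Gal_moves[OF Rats_subfield N_Rats] x by (auto simp: ON_def)
      then show False using fx by blast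
    qed
    then show ?thesis using x by (auto simp: ON_def intro: rational_algebraic_int_is_int)
  qed
qed

end

section \<open>Rings of integers under an embedding\<close>

context field
begin

text \<open>Coefficients in \<open>int_img R\<close> correspond under \<open>j\<close> to rational
  integers, and injectivity of \<open>j\<close> carries a vanishing value back.\<close>

lemma roi_iff:
  assumes M: "subfield M R" and j: "emb R M j" and x: "x \<in> M"
  shows "x \<in> ring_of_integers R M \<longleftrightarrow> algebraic_int (j x)"
proof
  assume "x \<in> ring_of_integers R M"
  then obtain p where p: "p \<noteq> []" "hd p = \<one>" "set p \<subseteq> int_img R" "eval p x = \<zero>"
    unfolding ring_of_integers_def by blast
  have pM: "set p \<subseteq> M" using p(3) emb_ZZ(1)[OF M j] unfolding int_img_def by auto
  let ?q = "map j p"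
  let ?P = "Poly (rev ?q)"
  have "poly ?P (j x) = 0" using emb_eval[OF M j x pM] p(4) emb_zero[OF M j] by (simp add: CR_eval)
  moreover have co: "Polynomial.coeff ?P i \<in> \<int>" for i
  proof -
    have "c \<in> \<int>" if "c \<in> set (rev ?q)" for c using that p(3) emb_ZZ(2)[OF M j] unfolding int_img_def by auto
    then show ?thesis using nth_mem[of i "rev ?q"] by (auto simp: nth_default_def simp del: set_rev set_map)
  qed
  moreover have "Polynomial.lead_coeff ?P = 1"
  proof -
    have "p ! 0 = \<one>" using p(1,2) by (simp add: hd_conv_nth)
    then have h: "?q ! 0 = 1" using p(1) embD(1)[OF j] by simp
    have lc: "Polynomial.coeff ?P (length ?q - 1) = 1" using p(1) h by (simp add: nth_default_def rev_nth)
    have "Polynomial.degree ?P \<le> length ?q - 1" by (rule degree_le) (use p(1) in \<open>auto simp: nth_default_def\<close>)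
    moreover have "length ?q - 1 \<le> Polynomial.degree ?P" by (rule le_degree) (use lc in simp)
    ultimately have "Polynomial.degree ?P = length ?q - 1" by simp
    then show ?thesis using lc by simp
  qed
  ultimately show "algebraic_int (j x)" by (intro algebraic_int.intros) auto
next
  assume "algebraic_int (j x)"
  then obtain P where P: "Polynomial.lead_coeff P = 1" "\<forall>i. Polynomial.coeff P i \<in> \<int>" "poly P (j x) = 0"
    by (auto simp: algebraic_int.simps)
  define p where "p = rev (map (\<lambda>c. ZZ \<lfloor>Re c\<rfloor>) (coeffs P))"
  have P0: "coeffs P \<noteq> []" using P(1) by auto
  have fl: "of_int \<lfloor>Re c\<rfloor> = c" if "c \<in> set (coeffs P)" for c
  proof -
    have "c \<in> \<int>" using that P(2) by (auto simp: coeffs_def split: if_splits)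
    then show ?thesis by (auto elim: Ints_cases)
  qed
  have pM: "set p \<subseteq> M" using emb_ZZ(1)[OF M j] unfolding p_def by auto
  have "map j p = rev (coeffs P)" unfolding p_def using fl emb_ZZ(2)[OF M j] by (simp add: rev_map[symmetric] map_idI)
  then have "j (eval p x) = 0" using emb_eval[OF M j x pM] P(3) by (simp add: CR_eval)
  moreover have "eval p x \<in> M"
    using ring.eval_in_carrier[OF subring_is_ring[OF subfieldE(1)[OF M]], of p x] pM x
      eval_consistent[OF subfieldE(1)[OF M]] by simp
  ultimately have e: "eval p x = \<zero>" using emb_nz[OF M j] by blast
  have "p \<noteq> []" using P0 by (simp add: p_def)
  moreover have "hd p = \<one>"
  proof -
    have "hd p = ZZ \<lfloor>Re (last (coeffs P))\<rfloor>" unfolding p_def using P0 by (simp add: hd_rev last_map)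
    also have "last (coeffs P) = 1" using P(1) P0 by (simp add: last_coeffs_eq_coeff_degree)
    finally show ?thesis by simp
  qed
  moreover have "set p \<subseteq> int_img R" unfolding p_def int_img_def by auto
  ultimately show "x \<in> ring_of_integers R M" unfolding ring_of_integers_def using x e by blast
qed

lemma roi_sub: "ring_of_integers R M \<subseteq> M" by (auto simp: ring_of_integers_def)

lemma roi_subring:
  assumes M: "subfield M R" and j: "emb R M j"
  shows "subring (ring_of_integers R M) R"
proof (rule subringI)
  note s = subringE[OF subfieldE(1)[OF M]]
  note iff = roi_iff[OF M j]
  have oM: "x \<in> M \<and> algebraic_int (j x)" if "x \<in> ring_of_integers R M" for x using that roi_sub iff by blast
  show "ring_of_integers R M \<subseteq> carrier R" using roi_sub s(1) by blast
  show "\<one> \<in> ring_of_integers R M" using iff[OF s(3)] embD(1)[OF j] by simp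
  fix h assume h: "h \<in> ring_of_integers R M"
  then show "\<ominus> h \<in> ring_of_integers R M" using iff[of "\<ominus> h"] s(5)[of h] oM[OF h] emb_minus[OF M j, of h] by auto
  fix k assume k: "k \<in> ring_of_integers R M"
  show "h \<otimes> k \<in> ring_of_integers R M"
    using iff[of "h \<otimes> k"] s(6)[of h k] oM[OF h] oM[OF k] embD(3)[OF j, of h k] algebraic_int_closed(2) by auto
  show "h \<oplus> k \<in> ring_of_integers R M"
    using iff[of "h \<oplus> k"] s(7)[of h k] oM[OF h] oM[OF k] embD(2)[OF j, of h k] algebraic_int_closed(1) by auto
qed

end

section \<open>Finite residue rings\<close>

lemma card_dimension:
  assumes "ring A" "subfield k A" "finite k" "ring.dimension A n k E"
  shows "card E = card k ^ n"
proof -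
  interpret A: ring A by fact
  obtain Us where Us: "set Us \<subseteq> carrier A" "A.independent k Us" "length Us = n" "A.Span k Us = E"
    using A.exists_base[OF assms(2,4)] by blast
  let ?L = "{Ks. set Ks \<subseteq> k \<and> length Ks = n}"
  have "bij_betw (\<lambda>Ks. A.combine Ks Us) ?L E"
  proof (rule bij_betwI')
    show "(A.combine x Us = A.combine y Us) = (x = y)" if xy: "x \<in> ?L" "y \<in> ?L" for x y
    proof
      assume e: "A.combine x Us = A.combine y Us"
      have "A.combine x Us \<in> A.Span k Us"
        using A.Span_eq_combine_set_length_version[OF assms(2) Us(1)] xy Us(3) by auto
      then obtain z where z: "\<forall>Ks. set Ks \<subseteq> k \<and> length Ks = length Us \<and> A.combine x Us = A.combine Ks Us \<longrightarrow> Ks = z"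
        using A.unique_decomposition[OF assms(2) Us(2)] unfolding Ex1_def by meson
      have "x = z" using z xy Us(3) by simp
      moreover have "y = z" using z xy Us(3) e by simp
      ultimately show "x = y" by simp
    qed simp
    show "A.combine x Us \<in> E" if "x \<in> ?L" for x
      using A.Span_eq_combine_set_length_version[OF assms(2) Us(1)] that Us(3,4) by auto
    show "\<exists>x\<in>?L. y = A.combine x Us" if "y \<in> E" for y
      using A.Span_eq_combine_set_length_version[OF assms(2) Us(1)] that Us(3,4) by auto
  qed
  then have "card E = card ?L" by (simp add: bij_betw_same_card)
  then show ?thesis using card_lists_length_eq[OF assms(3)] by simp
qed

lemma finite_domain_field:
  assumes "domain A" "finite (carrier A)" shows "field A"
proof -
  interpret A: domain A by fact
  show ?thesis
  proof (rule A.cring_fieldI2)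
    show "\<zero>\<^bsub>A\<^esub> \<noteq> \<one>\<^bsub>A\<^esub>" using A.one_not_zero by simp
    fix a assume a: "a \<in> carrier A" "a \<noteq> \<zero>\<^bsub>A\<^esub>"
    have "inj_on (\<lambda>b. a \<otimes>\<^bsub>A\<^esub> b) (carrier A)" by (rule inj_onI) (use A.m_lcancel[OF a(2,1)] in blast)
    then have "(\<lambda>b. a \<otimes>\<^bsub>A\<^esub> b) ` carrier A = carrier A" using a by (intro endo_inj_surj assms) auto
    then show "\<exists>b\<in>carrier A. a \<otimes>\<^bsub>A\<^esub> b = \<one>\<^bsub>A\<^esub>" using A.one_closed by (metis imageE)
  qed
qed

lemma finite_subring_subfield:
  assumes "domain A" "subring k A" "finite k" shows "subfield k A"
proof -
  interpret A: domain A by fact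
  have "field (A\<lparr>carrier := k\<rparr>)" by (rule finite_domain_field[OF A.subring_is_domain[OF assms(2)]]) (use assms(3) in simp)
  then show ?thesis using A.subfield_iff(1)[OF _ subringE(1)[OF assms(2)]] by simp
qed

lemma finite_field_pow_card:
  assumes "field A" "finite (carrier A)" "x \<in> carrier A"
  shows "x [^]\<^bsub>A\<^esub> card (carrier A) = x"
proof -
  interpret A: field A by fact
  have c: "card (carrier A) > 0" using assms(2,3) by (auto simp: card_gt_0_iff)
  show ?thesis
  proof (cases "x = \<zero>\<^bsub>A\<^esub>")
    case True
    then show ?thesis using c A.nat_pow_zero by simp
  next
    case False
    interpret G: group "Multiplicative_Group.mult_of A" by (rule A.field_mult_group)
    have x: "x \<in> carrier (Multiplicative_Group.mult_of A)" using False assms(3) by simp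
    have "x [^]\<^bsub>Multiplicative_Group.mult_of A\<^esub> Coset.order (Multiplicative_Group.mult_of A) = \<one>\<^bsub>Multiplicative_Group.mult_of A\<^esub>"
      by (rule G.pow_order_eq_1[OF x])
    then have "x [^]\<^bsub>A\<^esub> (card (carrier A) - 1) = \<one>\<^bsub>A\<^esub>"
      using A.order_mult_of[OF assms(2)] by (simp add: Multiplicative_Group.nat_pow_mult_of Coset.order_def)
    moreover have "x [^]\<^bsub>A\<^esub> card (carrier A) = x [^]\<^bsub>A\<^esub> (card (carrier A) - 1) \<otimes>\<^bsub>A\<^esub> x"
      using c by (metis A.nat_pow_Suc Suc_diff_1)
    ultimately show ?thesis using assms(3) by simp
  qed
qed

section \<open>Splitting types at a Frobenius\<close>

sublocale normal_field \<subseteq> galois_ring ON Gal by (rule ON_galois_ring)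

text \<open>\<open>\<phi>\<close> acts as the Frobenius at the prime \<open>Q\<close> of
  \<open>N\<close> and fixes the embedded \<open>F\<close>. The integers of \<open>F\<close> are
  therefore congruent to rational integers modulo \<open>Q\<close>, so the prime of \<open>F\<close>
  below \<open>Q\<close> has \<open>p\<close> residue classes, and residue degrees over it are
  degrees over the prime field.\<close>

locale frob_data = normal_field f xs + R: field R for f xs and R (structure) +
  fixes F :: "'a set" and iF :: "'a \<Rightarrow> complex" and p :: nat and Q :: "complex set" and \<phi> :: "complex \<Rightarrow> complex"
  assumes F: "subfield F R" "emb R F iF" "iF ` F \<subseteq> N"
    and p: "prime p" "\<not> int p dvd Disc"
    and Q: "primeO Q" "of_nat p \<in> Q"
    and phi: "\<phi> \<in> Gal" "\<And>x. x \<in> ON \<Longrightarrow> x ^ p - \<phi> x \<in> Q" "\<And>x. x \<in> F \<Longrightarrow> \<phi> (iF x) = iF x"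
begin

abbreviation Oi :: "'a set \<Rightarrow> 'a set" where "Oi M \<equiv> ring_of_integers R M"

definition PF :: "'a set" where "PF = {x \<in> Oi F. iF x \<in> Q}"

definition over_F :: "'a set \<Rightarrow> ('a \<Rightarrow> complex) \<Rightarrow> bool" where
  "over_F M j \<longleftrightarrow> subfield M R \<and> F \<subseteq> M \<and> emb R M j \<and> j ` M \<subseteq> N \<and> (\<forall>x\<in>F. j x = iF x)"

lemma over_FD:
  assumes "over_F M j"
  shows "subfield M R" "F \<subseteq> M" "emb R M j" "x \<in> M \<Longrightarrow> j x \<in> N" "x \<in> F \<Longrightarrow> j x = iF x"
  using assms by (auto simp: over_F_def)

lemma over_F_self: "over_F F iF" using F by (simp add: over_F_def)

lemma QI: "idl Q" by (rule primeO_idl[OF Q(1)])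
lemma Q_int: "of_int n \<in> Q \<longleftrightarrow> int p dvd n" by (rule primeO_int_iff[OF Q p(1)])
lemma p0: "p > 0" using p(1) prime_gt_0_nat by blast

lemma Oi_iff: "over_F M j \<Longrightarrow> x \<in> Oi M \<longleftrightarrow> x \<in> M \<and> j x \<in> ON"
  using R.roi_iff[OF over_FD(1,3)] R.roi_sub over_FD(4) unfolding ON_def by blast

lemma Oi_subring: "over_F M j \<Longrightarrow> subring (Oi M) R" by (rule R.roi_subring[OF over_FD(1,3)])

lemma Oi_domain: "over_F M j \<Longrightarrow> domain (OK R M)" by (rule R.subring_is_domain[OF Oi_subring])
lemma Oi_cring: "over_F M j \<Longrightarrow> cring (OK R M)" using Oi_domain by (auto simp: domain_def)

lemma Oi_mem:
  assumes "over_F M j"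
  shows "\<zero> \<in> Oi M" "\<one> \<in> Oi M" "x \<in> Oi M \<Longrightarrow> y \<in> Oi M \<Longrightarrow> x \<oplus> y \<in> Oi M" "x \<in> Oi M \<Longrightarrow> y \<in> Oi M \<Longrightarrow> x \<otimes> y \<in> Oi M"
    "x \<in> Oi M \<Longrightarrow> \<ominus> x \<in> Oi M" "x \<in> Oi M \<Longrightarrow> y \<in> Oi M \<Longrightarrow> x \<ominus> y \<in> Oi M" "x \<in> Oi M \<Longrightarrow> x [^] (n::nat) \<in> Oi M"
    "x \<in> Oi M \<Longrightarrow> x \<in> carrier R" "x \<in> Oi M \<Longrightarrow> x \<in> M"
proof -
  note s = subringE[OF Oi_subring[OF assms]]
  show "\<zero> \<in> Oi M" "\<one> \<in> Oi M" "x \<in> Oi M \<Longrightarrow> y \<in> Oi M \<Longrightarrow> x \<oplus> y \<in> Oi M" "x \<in> Oi M \<Longrightarrow> y \<in> Oi M \<Longrightarrow> x \<otimes> y \<in> Oi M"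
    "x \<in> Oi M \<Longrightarrow> \<ominus> x \<in> Oi M" using s by auto
  show "x \<ominus> y \<in> Oi M" if "x \<in> Oi M" "y \<in> Oi M" using s(5,7) that by (simp add: a_minus_def)
  show "x [^] (n::nat) \<in> Oi M" if "x \<in> Oi M" using that s(3,6) by (induction n) auto
  show "x \<in> carrier R" "x \<in> M" if "x \<in> Oi M" using s(1) that R.roi_sub by blast+
qed

lemma Oi_j:
  assumes "over_F M j"
  shows "x \<in> Oi M \<Longrightarrow> y \<in> Oi M \<Longrightarrow> j (x \<oplus> y) = j x + j y" "x \<in> Oi M \<Longrightarrow> y \<in> Oi M \<Longrightarrow> j (x \<otimes> y) = j x * j y"
    "x \<in> Oi M \<Longrightarrow> y \<in> Oi M \<Longrightarrow> j (x \<ominus> y) = j x - j y" "x \<in> Oi M \<Longrightarrow> j (x [^] (n::nat)) = j x ^ n"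
    "j \<zero> = 0" "j \<one> = 1" "x \<in> Oi M \<Longrightarrow> j (\<ominus> x) = - j x" "x \<in> Oi M \<Longrightarrow> j x \<in> ON"
    "R.ZZ k \<in> Oi M" "j (R.ZZ k) = of_int k" "x \<in> Oi M \<Longrightarrow> y \<in> Oi M \<Longrightarrow> j x = j y \<Longrightarrow> x = y"
proof -
  note M = over_FD[OF assms]
  note m = Oi_mem(9)[OF assms]
  show "x \<in> Oi M \<Longrightarrow> y \<in> Oi M \<Longrightarrow> j (x \<oplus> y) = j x + j y" "x \<in> Oi M \<Longrightarrow> y \<in> Oi M \<Longrightarrow> j (x \<otimes> y) = j x * j y"
    using embD[OF M(3)] m by auto
  show "x \<in> Oi M \<Longrightarrow> y \<in> Oi M \<Longrightarrow> j (x \<ominus> y) = j x - j y" using R.emb_diff[OF M(1,3)] m by auto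
  show "x \<in> Oi M \<Longrightarrow> j (x [^] (n::nat)) = j x ^ n" using R.emb_pow[OF M(1,3)] m by auto
  show "j \<zero> = 0" "j \<one> = 1" using R.emb_zero[OF M(1,3)] embD(1)[OF M(3)] by auto
  show "x \<in> Oi M \<Longrightarrow> j (\<ominus> x) = - j x" using R.emb_minus[OF M(1,3)] m by auto
  show "x \<in> Oi M \<Longrightarrow> j x \<in> ON" using Oi_iff[OF assms] by auto
  show z: "j (R.ZZ k) = of_int k" by (rule R.emb_ZZ(2)[OF M(1,3)])
  show "R.ZZ k \<in> Oi M" using Oi_iff[OF assms, of "R.ZZ k"] R.emb_ZZ(1)[OF M(1,3)] z int_mem by simp
  show "x = y" if "x \<in> Oi M" "y \<in> Oi M" "j x = j y" using R.emb_inj[OF M(1,3)] m that by auto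
qed

lemma Oi_mono: assumes "over_F M j" "x \<in> Oi F" shows "x \<in> Oi M" "j x = iF x"
  using Oi_iff[OF assms(1), of x] Oi_iff[OF over_F_self, of x] over_FD(2,5)[OF assms(1)] assms(2) by auto

lemma Oi_div_p:
  assumes M: "over_F M j" and x: "x \<in> Oi M" and d: "j x \<in> pO p"
  shows "\<exists>w\<in>Oi M. x = R.ZZ (int p) \<otimes> w"
proof -
  let ?z = "R.ZZ (int p)"
  obtain z where z: "z \<in> ON" "j x = of_nat p * z" using d by (auto simp: pO_def)
  have zp: "?z \<in> M" "j ?z = of_nat p" using Oi_j(9,10)[OF M, of "int p"] Oi_mem(9)[OF M] by auto
  have "?z \<noteq> \<zero>" using zp(2) Oi_j(5)[OF M] p0 by auto
  then have i: "inv ?z \<in> M" "?z \<otimes> inv ?z = \<one>" using R.subfield_m_inv[OF over_FD(1)[OF M], of ?z] zp by auto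
  let ?w = "inv ?z \<otimes> x"
  have xM: "x \<in> M" using Oi_mem(9)[OF M x] .
  have wM: "?w \<in> M" using i xM subringE(6)[OF subfieldE(1)[OF over_FD(1)[OF M]]] by blast
  have c: "?z \<in> carrier R" "inv ?z \<in> carrier R" "x \<in> carrier R" using subfieldE(3)[OF over_FD(1)[OF M]] zp i xM by blast+
  have xw: "x = ?z \<otimes> ?w" using c i(2) by (simp add: R.m_assoc[symmetric])
  have "j x = of_nat p * j ?w" using xw embD(3)[OF over_FD(3)[OF M] zp(1) wM] zp(2) by simp
  then have "j ?w = z" using z(2) p0 by simp
  then have "?w \<in> Oi M" using Oi_iff[OF M] wM z(1) by simp
  then show ?thesis using xw by blast
qed

lemma F_residue: assumes "over_F M j" "x \<in> Oi M" "\<phi> (j x) = j x" shows "\<exists>r<p. j (x \<ominus> R.ZZ (int r)) \<in> Q"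
proof -
  have jx: "j x \<in> ON" by (rule Oi_j(8)[OF assms(1,2)])
  have "j x ^ p - j x \<in> Q" using phi(2)[OF jx] assms(3) by simp
  then obtain r where "r < p" "j x - of_nat r \<in> Q" using exists_residue[OF p(1) Q jx] by blast
  then show ?thesis using Oi_j(3)[OF assms(1,2) Oi_j(9)[OF assms(1)]] Oi_j(10)[OF assms(1)] by auto
qed

lemma pull_prime:
  assumes M: "over_F M j" shows "primeideal {x \<in> Oi M. j x \<in> Q} (OK R M)"
proof (rule primeidealI2)
  let ?P = "{x \<in> Oi M. j x \<in> Q}"
  interpret O: domain "OK R M" by (rule Oi_domain[OF M])
  note jm = Oi_j[OF M] and om = Oi_mem[OF M]
  have inv: "inv\<^bsub>add_monoid (OK R M)\<^esub> x = \<ominus> x" if x: "x \<in> Oi M" for x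
  proof -
    have "\<ominus>\<^bsub>OK R M\<^esub> x = \<ominus> x"
      by (rule O.minus_equality) (use x om(5,8) in \<open>auto simp: R.l_neg\<close>)
    then show ?thesis by (simp add: a_inv_def)
  qed
  show "additive_subgroup ?P (OK R M)"
  proof (rule additive_subgroup.intro, rule subgroup.intro)
    show "?P \<subseteq> carrier (add_monoid (OK R M))" by auto
    show "x \<otimes>\<^bsub>add_monoid (OK R M)\<^esub> y \<in> ?P" if "x \<in> ?P" "y \<in> ?P" for x y
      using that jm(1) om(3) idlD(3)[OF QI] by auto
    show "\<one>\<^bsub>add_monoid (OK R M)\<^esub> \<in> ?P" using jm(5) om(1) idlD(2)[OF QI] by simp
    show "inv\<^bsub>add_monoid (OK R M)\<^esub> x \<in> ?P" if "x \<in> ?P" for x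
      using that inv jm(7) om(5) idl_minus[OF QI] by auto
  qed
  show "cring (OK R M)" by (rule Oi_cring[OF M])
  show "x \<otimes>\<^bsub>OK R M\<^esub> a \<in> ?P" if "a \<in> ?P" "x \<in> carrier (OK R M)" for a x
    using that jm(2,8) om(4) idlD(4)[OF QI] by auto
  show "a \<otimes>\<^bsub>OK R M\<^esub> x \<in> ?P" if "a \<in> ?P" "x \<in> carrier (OK R M)" for a x
    using that jm(2,8) om(4) idlD(5)[OF QI] by auto
  have "\<one> \<notin> ?P" using jm(6) Q(1) by (simp add: primeO_def)
  then show "carrier (OK R M) \<noteq> ?P" using om(2) by auto
  show "a \<in> ?P \<or> b \<in> ?P" if "a \<in> carrier (OK R M)" "b \<in> carrier (OK R M)" "a \<otimes>\<^bsub>OK R M\<^esub> b \<in> ?P" for a b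
  proof -
    have "j a * j b \<in> Q" using that jm(2) by auto
    then have "j a \<in> Q \<or> j b \<in> Q" using that jm(8) Q(1) unfolding primeO_def by auto
    then show ?thesis using that by auto
  qed
qed

lemma PF_nz_prime: "nz_prime R F PF"
proof -
  have "R.ZZ (int p) \<in> PF" using Oi_j(9,10)[OF over_F_self] Q(2) by (simp add: PF_def)
  moreover have "R.ZZ (int p) \<noteq> \<zero>" using Oi_j(10)[OF over_F_self, of "int p"] Oi_j(5)[OF over_F_self] p0 by auto
  ultimately show ?thesis unfolding nz_prime_def using pull_prime[OF over_F_self] by (auto simp: PF_def)
qed

lemma PF_int: "R.ZZ k \<in> PF \<longleftrightarrow> int p dvd k"
  using Oi_j(9,10)[OF over_F_self, of k] Q_int by (simp add: PF_def)

lemma above_int: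
  assumes M: "over_F M j" and Q': "Q' \<in> primes_above R F M PF"
  shows "R.ZZ k \<in> Q' \<longleftrightarrow> int p dvd k"
  using PF_int[of k] Q' Oi_j(9)[OF over_F_self, of k] by (auto simp: primes_above_def)

lemma above_pull: "over_F M j \<Longrightarrow> {x \<in> Oi M. j x \<in> Q} \<in> primes_above R F M PF"
  using pull_prime Oi_mono by (auto simp: primes_above_def PF_def)

text \<open>By \<open>local_annihilator\<close> each \<open>x\<close> in \<open>Q'\<close> has a
  multiplier outside \<open>Q'\<close> that makes it divisible by \<open>p\<close>; hence each
  element of the square of \<open>Q'\<close> has one that makes it divisible by
  \<open>p ^ 2\<close>. If \<open>p\<close> itself lay in that square,
  \<open>t * p = p ^ 2 * w\<close> with \<open>t\<close> outside \<open>Q'\<close> would give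
  \<open>t = p * w\<close>, which is in \<open>Q'\<close>. Every prime above \<open>PF\<close> is
  treated, not only the one cut out by \<open>Q\<close>.\<close>

lemma PF_unramified: assumes M: "over_F M j" shows "unramified R F M PF"
  unfolding unramified_def
proof (intro ballI notI)
  fix Q' assume Q': "Q' \<in> primes_above R F M PF" and sub: "ext_ideal R M PF \<subseteq> ideal_prod (OK R M) Q' Q'"
  interpret O: domain "OK R M" by (rule Oi_domain[OF M])
  have pr: "primeideal Q' (OK R M)" using Q' by (simp add: primes_above_def)
  interpret P: primeideal Q' "OK R M" by (rule pr)
  note jm = Oi_j[OF M] and om = Oi_mem[OF M]
  let ?z = "R.ZZ (int p)"
  have Q'O: "Q' \<subseteq> Oi M" using P.a_subset by simp
  have PO: "PF \<subseteq> carrier (OK R M)" using Oi_mono(1)[OF M] by (auto simp: PF_def)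
  have "?z \<in> PF" using PF_int by simp
  then have "?z \<in> ext_ideal R M PF" unfolding ext_ideal_def using O.genideal_self[OF PO] by blast
  then have zin: "?z \<in> ideal_prod (OK R M) Q' Q'" using sub by blast
  have loc: "\<exists>t\<in>Oi M - Q'. \<exists>w\<in>Oi M. t \<otimes> x = ?z \<otimes> w" if x: "x \<in> Q'" for x
  proof -
    have xO: "x \<in> Oi M" using x Q'O by blast
    obtain n where n: "n > 0" "j x * (j x ^ n - 1) \<in> pO p" using local_annihilator[OF p jm(8)[OF xO]] by blast
    let ?t = "x [^] n \<ominus> \<one>"
    have xn: "x [^] n \<in> Oi M" by (rule om(7)[OF xO])
    have tO: "?t \<in> Oi M" by (rule om(6)[OF xn om(2)])
    have "j (?t \<otimes> x) = j x * (j x ^ n - 1)" using jm(2)[OF tO xO] jm(3)[OF xn om(2)] jm(4)[OF xO] jm(6) by (simp add: mult.commute)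
    then obtain w where w: "w \<in> Oi M" "?t \<otimes> x = ?z \<otimes> w" using Oi_div_p[OF M om(4)[OF tO xO]] n by auto
    have "?t \<notin> Q'"
    proof
      assume t: "?t \<in> Q'"
      obtain m where m: "n = Suc m" using n(1) by (cases n) auto
      have "x [^] m \<in> Oi M" by (rule om(7)[OF xO])
      then have xnQ: "x [^] n \<in> Q'" using P.I_l_closed[OF x, of "x [^] m"] m by simp
      have "\<one> = x [^] n \<oplus> \<ominus> ?t" using om(8)[OF xn] by (simp add: a_minus_def R.minus_add R.a_assoc[symmetric] R.r_neg)
      moreover have "\<ominus> ?t = \<ominus>\<^bsub>OK R M\<^esub> ?t"
        by (rule O.minus_equality[symmetric]) (use tO om(5,8) in \<open>auto simp: R.l_neg\<close>)
      moreover have "\<ominus>\<^bsub>OK R M\<^esub> ?t \<in> Q'" using P.a_inv_closed[OF t] .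
      ultimately have "\<one> \<in> Q'" using P.a_closed[OF xnQ, of "\<ominus> ?t"] by simp
      then have "R.ZZ 1 \<in> Q'" by simp
      then show False using above_int[OF M Q', of 1] p(1) by (simp add: prime_nat_iff)
    qed
    then show ?thesis using tO w by blast
  qed
  have key: "\<exists>t\<in>Oi M - Q'. \<exists>w\<in>Oi M. t \<otimes> s = (?z \<otimes> ?z) \<otimes> w" if "s \<in> ideal_prod (OK R M) Q' Q'" for s
    using that
  proof (induction rule: ideal_prod.induct)
    case (prod a b)
    obtain t w where t: "t \<in> Oi M" "t \<notin> Q'" "w \<in> Oi M" "t \<otimes> a = ?z \<otimes> w" using loc[OF prod(1)] by blast
    obtain u v where u: "u \<in> Oi M" "u \<notin> Q'" "v \<in> Oi M" "u \<otimes> b = ?z \<otimes> v" using loc[OF prod(2)] by blast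
    have c: "a \<in> carrier R" "b \<in> carrier R" "t \<in> carrier R" "w \<in> carrier R" "u \<in> carrier R" "v \<in> carrier R" "?z \<in> carrier R"
      using prod Q'O t u om(8) by auto
    have "(t \<otimes> u) \<otimes> (a \<otimes> b) = (t \<otimes> a) \<otimes> (u \<otimes> b)" using c by (simp add: R.m_assoc R.m_lcomm)
    also have "\<dots> = (?z \<otimes> ?z) \<otimes> (w \<otimes> v)" unfolding t(4) u(4) using c by (simp add: R.m_assoc R.m_lcomm)
    finally have e: "(t \<otimes> u) \<otimes> (a \<otimes>\<^bsub>OK R M\<^esub> b) = (?z \<otimes> ?z) \<otimes> (w \<otimes> v)" by simp
    have "t \<otimes> u \<in> Oi M - Q'" using P.I_prime[of t u] t u om(4) by auto
    then show ?case using e om(4)[OF t(3) u(3)] by blast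
  next
    case (sum a b)
    obtain t w where t: "t \<in> Oi M" "t \<notin> Q'" "w \<in> Oi M" "t \<otimes> a = (?z \<otimes> ?z) \<otimes> w" using sum.IH by blast
    obtain u v where u: "u \<in> Oi M" "u \<notin> Q'" "v \<in> Oi M" "u \<otimes> b = (?z \<otimes> ?z) \<otimes> v" using sum.IH by blast
    have "a \<in> Oi M" "b \<in> Oi M" using sum.hyps O.ideal_prod_in_carrier[OF P.ideal_axioms P.ideal_axioms] by auto
    then have c: "a \<in> carrier R" "b \<in> carrier R" "t \<in> carrier R" "w \<in> carrier R" "u \<in> carrier R" "v \<in> carrier R" "?z \<in> carrier R"
      using t u om(8) by auto
    have "(t \<otimes> u) \<otimes> (a \<oplus> b) = u \<otimes> (t \<otimes> a) \<oplus> t \<otimes> (u \<otimes> b)" using c by (simp add: R.r_distr R.m_assoc R.m_lcomm)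
    also have "\<dots> = (?z \<otimes> ?z) \<otimes> (u \<otimes> w \<oplus> t \<otimes> v)" unfolding t(4) u(4) using c by (simp add: R.r_distr R.m_assoc R.m_lcomm)
    finally have e: "(t \<otimes> u) \<otimes> (a \<oplus>\<^bsub>OK R M\<^esub> b) = (?z \<otimes> ?z) \<otimes> (u \<otimes> w \<oplus> t \<otimes> v)" by simp
    have "t \<otimes> u \<in> Oi M - Q'" using P.I_prime[of t u] t u om(4) by auto
    moreover have "u \<otimes> w \<oplus> t \<otimes> v \<in> Oi M" using t u om(3,4) by blast
    ultimately show ?case using e by blast
  qed
  obtain t w where t: "t \<in> Oi M" "t \<notin> Q'" "w \<in> Oi M" "t \<otimes> ?z = (?z \<otimes> ?z) \<otimes> w" using key[OF zin] by blast
  have zO: "?z \<in> Oi M" by (rule jm(9))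
  have "j t * of_nat p = of_nat p * of_nat p * j w"
    using arg_cong[OF t(4), of j] jm(2)[OF t(1) zO] jm(2)[OF om(4)[OF zO zO] t(3)] jm(2)[OF zO zO] jm(10) by simp
  then have "j t = of_nat p * j w" using p0 by simp
  then have "j t = j (?z \<otimes> w)" using jm(2)[OF zO t(3)] jm(10) by simp
  then have "t = ?z \<otimes> w" by (rule jm(11)[OF t(1) om(4)[OF zO t(3)]])
  moreover have "?z \<in> Q'" using above_int[OF M Q'] by simp
  ultimately have "t \<in> Q'" using P.I_r_closed[of ?z w] t(3) by simp
  then show False using t(2) by simp
qed

lemma Oi_a_inv: assumes M: "over_F M j" and x: "x \<in> Oi M" shows "\<ominus>\<^bsub>OK R M\<^esub> x = \<ominus> x"
proof -
  interpret O: domain "OK R M" by (rule Oi_domain[OF M])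
  show ?thesis by (rule O.minus_equality) (use x Oi_mem(5,8)[OF M] in \<open>auto simp: R.l_neg\<close>)
qed

lemma Oi_pow: "x [^]\<^bsub>OK R M\<^esub> (n::nat) = x [^] n"
  by (simp add: nat_pow_def)

lemma above_ideal:
  assumes M: "over_F M j" and Q': "Q' \<in> primes_above R F M PF"
  shows "primeideal Q' (OK R M)" "ideal Q' (OK R M)" "Q' \<subseteq> Oi M"
proof -
  show 1: "primeideal Q' (OK R M)" using Q' by (simp add: primes_above_def)
  show 2: "ideal Q' (OK R M)" by (rule primeideal.axioms(1)[OF 1])
  interpret I: ideal Q' "OK R M" by (rule 2)
  show "Q' \<subseteq> Oi M" using I.a_subset by simp
qed

lemma above_coset_eq:
  assumes M: "over_F M j" and Q': "Q' \<in> primes_above R F M PF" and ab: "a \<in> Oi M" "b \<in> Oi M"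
  shows "Q' +>\<^bsub>OK R M\<^esub> a = Q' +>\<^bsub>OK R M\<^esub> b \<longleftrightarrow> a \<ominus> b \<in> Q'"
proof -
  interpret O: domain "OK R M" by (rule Oi_domain[OF M])
  have "a \<ominus>\<^bsub>OK R M\<^esub> b = a \<ominus> b" using Oi_a_inv[OF M ab(2)] by (simp add: a_minus_def)
  then show ?thesis using O.quotient_eq_iff_same_a_r_cos[OF above_ideal(2)[OF M Q'], of a b] ab by simp
qed

lemma quot_carrier: "carrier (OK R M Quot Q') = (\<lambda>a. Q' +>\<^bsub>OK R M\<^esub> a) ` Oi M"
  by (auto simp: FactRing_def A_RCOSETS_def')

text \<open>The class of \<open>j a\<close> modulo \<open>p\<close> in \<open>ON\<close> determines
  the coset of \<open>a\<close>, because an integer of \<open>M\<close> whose image is divisible by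
  \<open>p\<close> is divisible by \<open>p\<close> already in \<open>M\<close>.\<close>

lemma quot_finite:
  assumes M: "over_F M j" and Q': "Q' \<in> primes_above R F M PF"
  shows "finite (carrier (OK R M Quot Q'))"
proof -
  let ?h = "\<lambda>a. Q' +>\<^bsub>OK R M\<^esub> a"
  define s where "s c = (SOME a. a \<in> Oi M \<and> cls p (j a) = c)" for c
  interpret I: ideal Q' "OK R M" by (rule above_ideal(2)[OF M Q'])
  have "?h a = ?h (s (cls p (j a)))" if a: "a \<in> Oi M" for a
  proof -
    let ?b = "s (cls p (j a))"
    have b: "?b \<in> Oi M" "cls p (j ?b) = cls p (j a)"
      using someI[of "\<lambda>b. b \<in> Oi M \<and> cls p (j b) = cls p (j a)" a] a unfolding s_def by auto
    have "j a - j ?b \<in> pO p" by (rule cls_eq_imp[OF Oi_j(8)[OF M a]]) (simp add: b(2))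
    then have "j (a \<ominus> ?b) \<in> pO p" using Oi_j(3)[OF M a b(1)] by simp
    then obtain w where w: "w \<in> Oi M" "a \<ominus> ?b = R.ZZ (int p) \<otimes> w" using Oi_div_p[OF M Oi_mem(6)[OF M a b(1)]] by blast
    have "R.ZZ (int p) \<in> Q'" using above_int[OF M Q'] by simp
    then have "a \<ominus> ?b \<in> Q'" using I.I_r_closed[of "R.ZZ (int p)" w] w by simp
    then show ?thesis using above_coset_eq[OF M Q' a b(1)] by simp
  qed
  then have "?h ` Oi M \<subseteq> (?h \<circ> s) ` (cls p ` ON)" using Oi_j(8)[OF M] by force
  then show ?thesis unfolding quot_carrier using finite_quotient[OF p] finite_subset by blast
qed

lemma residue_field:
  assumes M: "over_F M j" and Q': "Q' \<in> primes_above R F M PF"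
  shows "(\<lambda>a. Q' +>\<^bsub>OK R M\<^esub> a) ` Oi F = (\<lambda>r. Q' +>\<^bsub>OK R M\<^esub> R.ZZ (int r)) ` {..<p}" (is "?h ` _ = ?k")
    "card ((\<lambda>a. Q' +>\<^bsub>OK R M\<^esub> a) ` Oi F) = p"
    "subfield ((\<lambda>a. Q' +>\<^bsub>OK R M\<^esub> a) ` Oi F) (OK R M Quot Q')"
proof -
  interpret O: domain "OK R M" by (rule Oi_domain[OF M])
  interpret P: primeideal Q' "OK R M" by (rule above_ideal(1)[OF M Q'])
  note zm = Oi_j(9)[OF M] and zF = Oi_j(9)[OF over_F_self]
  show 1: "?h ` Oi F = ?k"
  proof
    show "?k \<subseteq> ?h ` Oi F" using zF by auto
    show "?h ` Oi F \<subseteq> ?k"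
    proof
      fix c assume "c \<in> ?h ` Oi F"
      then obtain x where x: "x \<in> Oi F" "c = ?h x" by blast
      have "\<phi> (iF x) = iF x" using phi(3) Oi_mem(9)[OF over_F_self x(1)] by simp
      then obtain r where r: "r < p" "iF (x \<ominus> R.ZZ (int r)) \<in> Q" using F_residue[OF over_F_self x(1)] by blast
      have "x \<ominus> R.ZZ (int r) \<in> PF" unfolding PF_def using r(2) Oi_mem(6)[OF over_F_self x(1) zF] by simp
      then have "x \<ominus> R.ZZ (int r) \<in> Q'" using Q' by (auto simp: primes_above_def)
      then have "c = ?h (R.ZZ (int r))" using above_coset_eq[OF M Q' Oi_mono(1)[OF M x(1)] zm] x(2) by simp
      then show "c \<in> ?k" using r(1) by blast
    qed
  qed
  have inj: "inj_on (\<lambda>r. Q' +>\<^bsub>OK R M\<^esub> R.ZZ (int r)) {..<p}"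
  proof (rule inj_onI)
    fix r s assume rs: "r \<in> {..<p}" "s \<in> {..<p}" and e: "Q' +>\<^bsub>OK R M\<^esub> R.ZZ (int r) = Q' +>\<^bsub>OK R M\<^esub> R.ZZ (int s)"
    have "R.ZZ (int r) \<ominus> R.ZZ (int s) \<in> Q'" using above_coset_eq[OF M Q' zm zm] e by blast
    moreover have "R.ZZ (int r) \<ominus> R.ZZ (int s) = R.ZZ (int r - int s)"
      by (rule Oi_j(11)[OF M Oi_mem(6)[OF M zm zm] zm]) (simp add: Oi_j(3)[OF M zm zm] Oi_j(10)[OF M])
    ultimately have "int p dvd int r - int s" using above_int[OF M Q'] by simp
    then have "int r mod int p = int s mod int p" by (simp add: mod_eq_dvd_iff)
    then show "r = s" using rs by simp
  qed
  show 2: "card (?h ` Oi F) = p" unfolding 1 using card_image[OF inj] by simp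
  interpret H: ring_hom_ring "OK R M" "OK R M Quot Q'" "(+>\<^bsub>OK R M\<^esub>) Q'" by (rule P.rcos_ring_hom_ring)
  have sub: "subring (Oi F) (OK R M)"
  proof (rule O.subringI)
    note f = Oi_mem[OF over_F_self]
    show "Oi F \<subseteq> carrier (OK R M)" using Oi_mono(1)[OF M] by auto
    show "\<one>\<^bsub>OK R M\<^esub> \<in> Oi F" using f(2) by simp
    show "\<ominus>\<^bsub>OK R M\<^esub> h \<in> Oi F" if "h \<in> Oi F" for h using f(5)[OF that] Oi_a_inv[OF M Oi_mono(1)[OF M that]] by simp
    show "h \<otimes>\<^bsub>OK R M\<^esub> k \<in> Oi F" "h \<oplus>\<^bsub>OK R M\<^esub> k \<in> Oi F" if "h \<in> Oi F" "k \<in> Oi F" for h k using f(3,4) that by auto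
  qed
  have "subring (?h ` Oi F) (OK R M Quot Q')" by (rule H.img_is_subring[OF sub])
  then show "subfield (?h ` Oi F) (OK R M Quot Q')"
    by (rule finite_subring_subfield[OF P.quotient_is_domain]) (simp add: 1)
qed

lemma quot_field:
  assumes M: "over_F M j" and Q': "Q' \<in> primes_above R F M PF"
  shows "field (OK R M Quot Q')"
  by (rule finite_domain_field[OF primeideal.quotient_is_domain[OF above_ideal(1)[OF M Q']] quot_finite[OF M Q']])

lemma inertia:
  assumes M: "over_F M j" and Q': "Q' \<in> primes_above R F M PF"
  shows "card (carrier (OK R M Quot Q')) = p ^ inertia_degree R F M Q'"
    "(\<lambda>a. Q' +>\<^bsub>OK R M\<^esub> a) ` Oi F = carrier (OK R M Quot Q') \<Longrightarrow> inertia_degree R F M Q' = 1"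
proof -
  let ?A = "OK R M Quot Q'" and ?k = "(\<lambda>a. Q' +>\<^bsub>OK R M\<^esub> a) ` Oi F"
  interpret A: field ?A by (rule quot_field[OF M Q'])
  note sf = residue_field(3)[OF M Q']
  obtain Us where Us: "set Us = carrier ?A" using finite_list[OF quot_finite[OF M Q']] by blast
  have "A.Span ?k Us = carrier ?A"
    using A.Span_base_incl[OF sf, of Us] A.Span_in_carrier[OF subfieldE(3)[OF sf], of Us] Us by blast
  then have "A.finite_dimension ?k (carrier ?A)" using A.Span_finite_dimension[OF sf, of Us] Us by simp
  then obtain n where n: "A.dimension n ?k (carrier ?A)" unfolding A.finite_dimension_def by blast
  have uniq: "inertia_degree R F M Q' = m" if "A.dimension m ?k (carrier ?A)" for m
    unfolding inertia_degree_def by (rule the_equality) (use that A.dimension_is_inj[OF sf] in auto)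
  have fk: "finite ?k" by (simp add: residue_field(1)[OF M Q'])
  show "card (carrier ?A) = p ^ inertia_degree R F M Q'"
    using card_dimension[OF A.ring_axioms sf fk n] uniq[OF n] residue_field(2)[OF M Q'] by simp
  show "inertia_degree R F M Q' = 1" if "?k = carrier ?A"
    using uniq[of 1] A.dimension_one[OF sf] that by simp
qed

text \<open>The prime pulled back from \<open>Q\<close> along \<open>j\<close> has degree one:
  \<open>\<phi>\<close> fixes the image of \<open>M\<close>, so every integer of \<open>M\<close> is
  congruent to a residue below \<open>p\<close>. A single inertia degree 1 settles the gcd.\<close>

lemma split_gcd_fixed:
  assumes M: "over_F M j" and fx: "\<And>x. x \<in> M \<Longrightarrow> \<phi> (j x) = j x"
  shows "split_gcd R F M PF = 1"
proof -
  let ?Q = "{x \<in> Oi M. j x \<in> Q}" and ?h = "\<lambda>a. {x \<in> Oi M. j x \<in> Q} +>\<^bsub>OK R M\<^esub> a"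
  note ab = above_pull[OF M]
  have "?h ` Oi M \<subseteq> ?h ` Oi F"
  proof
    fix c assume "c \<in> ?h ` Oi M"
    then obtain x where x: "x \<in> Oi M" "c = ?h x" by blast
    obtain r where r: "r < p" "j (x \<ominus> R.ZZ (int r)) \<in> Q"
      using F_residue[OF M x(1) fx[OF Oi_mem(9)[OF M x(1)]]] by blast
    then have "x \<ominus> R.ZZ (int r) \<in> ?Q" using Oi_mem(6)[OF M x(1) Oi_j(9)[OF M]] by simp
    then have "c = ?h (R.ZZ (int r))" using above_coset_eq[OF M ab x(1) Oi_j(9)[OF M]] x(2) by simp
    then show "c \<in> ?h ` Oi F" using Oi_j(9)[OF over_F_self] by blast
  qed
  moreover have "?h ` Oi F \<subseteq> ?h ` Oi M" using Oi_mono(1)[OF M] by blast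
  ultimately have "inertia_degree R F M ?Q = 1" using inertia(2)[OF M ab] unfolding quot_carrier by blast
  then have "Gcd (inertia_degree R F M ` primes_above R F M PF) dvd 1" using Gcd_dvd[OF imageI[OF ab]] by metis
  then show ?thesis by (simp add: split_gcd_def)
qed

lemma inertia_pow:
  assumes M: "over_F M j" and Q': "Q' \<in> primes_above R F M PF" and x: "x \<in> Oi M"
  shows "x [^] (p ^ inertia_degree R F M Q') \<ominus> x \<in> Q'"
proof -
  let ?A = "OK R M Quot Q'" and ?h = "\<lambda>a. Q' +>\<^bsub>OK R M\<^esub> a" and ?n = "p ^ inertia_degree R F M Q'"
  interpret I: ideal Q' "OK R M" by (rule above_ideal(2)[OF M Q'])
  interpret H: ring_hom_ring "OK R M" ?A "(+>\<^bsub>OK R M\<^esub>) Q'" by (rule I.rcos_ring_hom_ring)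
  have "?h x \<in> carrier ?A" using x by (simp add: quot_carrier)
  then have "?h x [^]\<^bsub>?A\<^esub> card (carrier ?A) = ?h x" by (rule finite_field_pow_card[OF quot_field[OF M Q'] quot_finite[OF M Q']])
  then have "?h x [^]\<^bsub>?A\<^esub> ?n = ?h x" by (simp only: inertia(1)[OF M Q'])
  moreover have "?h (x [^] ?n) = ?h x [^]\<^bsub>?A\<^esub> ?n" using H.hom_nat_pow[of x ?n] x by (simp add: Oi_pow)
  ultimately have "?h (x [^] ?n) = ?h x" by simp
  then show ?thesis using above_coset_eq[OF M Q' Oi_mem(7)[OF M x] x] by simp
qed

end

lemma funpow_coprime_fixed:
  assumes "(g ^^ m) x = x" "(g ^^ n) x = x" "coprime m n"
  shows "g x = x"
proof -
  have it: "(g ^^ (k * i)) x = x" if "(g ^^ k) x = x" for k i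
    using that by (induction i) (auto simp: funpow_add)
  show ?thesis
  proof (cases "m = 0")
    case True
    then show ?thesis using assms by simp
  next
    case False
    then obtain u v where "m * u = n * v + gcd m n" using bezout_nat by blast
    then have "m * u = Suc (n * v)" using assms(3) by simp
    moreover have "(g ^^ Suc (n * v)) x = g x" using it[OF assms(2), of v] by simp
    ultimately show ?thesis using it[OF assms(1), of u] by simp
  qed
qed

lemma (in field) emb_image_subfield:
  assumes "subfield S R" "emb R S j" shows "subfield (j ` S) CR"
proof -
  interpret S: field "R\<lparr>carrier := S\<rparr>" using subfield_iff(2)[OF assms(1)] .
  interpret H: ring_hom_ring "R\<lparr>carrier := S\<rparr>" CR j by (rule emb_hom[OF assms])
  have "subfield (j ` carrier (R\<lparr>carrier := S\<rparr>)) CR"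
    by (rule H.img_is_subfield(2)[OF S.carrier_is_subfield]) simp
  then show ?thesis by simp
qed

section \<open>Fixed fields and divisibility of the gcd\<close>

context normal_field
begin

definition fixing :: "complex set \<Rightarrow> (complex \<Rightarrow> complex) set" where
  "fixing S = {g \<in> Gal. \<forall>z\<in>S. g z = z}"

lemma fixing_Gal: "g \<in> fixing S \<Longrightarrow> g \<in> Gal" by (simp add: fixing_def)

lemma fixing_perm_grp: "perm_grp (fixing S)"
proof -
  have "\<exists>h\<in>fixing S. h \<circ> g = id \<and> g \<circ> h = id" if g: "g \<in> fixing S" for g
  proof -
    obtain h where h: "h \<in> Gal" "h \<circ> g = id" "g \<circ> h = id" using inv_Gal[OF fixing_Gal[OF g]] by blast
    have "h z = z" if "z \<in> S" for z using fun_cong[OF h(2), of z] g that by (simp add: fixing_def)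
    then show ?thesis using h by (auto simp: fixing_def)
  qed
  then show ?thesis
    unfolding perm_grp_def using finite_Gal id_Gal comp_Gal by (auto simp: fixing_def intro: comp_Gal)
qed

lemma fixing_fixed:
  assumes "subfield S CR" "S \<subseteq> N" "y \<in> N" "\<And>g. g \<in> fixing S \<Longrightarrow> g y = y"
  shows "y \<in> S"
proof (rule ccontr)
  assume "y \<notin> S"
  then obtain g where "g \<in> Gal" "\<forall>z\<in>S. g z = z" "g y \<noteq> y" using Gal_moves[OF assms(1-3)] by blast
  then show False using assms(4)[of g] by (simp add: fixing_def)
qed

text \<open>A nonzero \<open>x\<close> divides its norm, a nonzero rational integer, which only
  finitely many primes divide.\<close>

lemma not_in_large_prime:
  assumes "x \<in> ON" "x \<noteq> 0"
  shows "\<exists>B. \<forall>p Q. prime p \<longrightarrow> primeO Q \<longrightarrow> of_nat p \<in> Q \<longrightarrow> B < p \<longrightarrow> x \<notin> Q"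
proof -
  obtain m where m: "(\<Prod>g\<in>Gal. g x) = of_int m" using norm_Ints[OF assms(1)] by (auto elim: Ints_cases)
  have "g x \<noteq> 0" if "g \<in> Gal" for g using Gal_inj[OF that, of x 0] Gal_zero[OF that] assms(2) by auto
  then have "(\<Prod>g\<in>Gal. g x) \<noteq> 0" using finite_Gal by simp
  then have m0: "m \<noteq> 0" using m by auto
  have "x \<notin> Q" if p: "prime p" and Q: "primeO Q" "of_nat p \<in> Q" and B: "nat \<bar>m\<bar> < p" for p Q
  proof
    assume x: "x \<in> Q"
    have "(\<Prod>g\<in>Gal. g x) = x * (\<Prod>g\<in>Gal-{id}. g x)" using prod.remove[OF finite_Gal id_Gal, of "\<lambda>g. g x"] by simp
    moreover have "(\<Prod>g\<in>Gal-{id}. g x) \<in> ON" using assms(1) by (intro prod_mem) (simp add: Gal_mem)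
    ultimately have "of_int m \<in> Q" using m idlD(5)[OF primeO_idl[OF Q(1)] x] by simp
    then have "int p dvd m" using primeO_int_iff[OF Q p] by simp
    then show False using dvd_imp_le_int[OF m0] B by fastforce
  qed
  then show ?thesis by blast
qed

lemma none_in_large_prime:
  assumes "finite T" "T \<subseteq> ON - {0}"
  shows "\<exists>B. \<forall>p Q. prime p \<longrightarrow> primeO Q \<longrightarrow> of_nat p \<in> Q \<longrightarrow> B < p \<longrightarrow> T \<inter> Q = {}"
  using assms
proof (induction T rule: finite_induct)
  case (insert x T)
  obtain B where B: "\<forall>p Q. prime p \<longrightarrow> primeO Q \<longrightarrow> of_nat p \<in> Q \<longrightarrow> B < p \<longrightarrow> T \<inter> Q = {}" using insert by auto
  obtain C where C: "\<forall>p Q. prime p \<longrightarrow> primeO Q \<longrightarrow> of_nat p \<in> Q \<longrightarrow> C < p \<longrightarrow> x \<notin> Q"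
    using not_in_large_prime[of x] insert by auto
  have "insert x T \<inter> Q = {}" if "prime p" "primeO Q" "of_nat p \<in> Q" "max B C < p" for p Q
    using B[rule_format, of p Q] C[rule_format, of p Q] that by simp
  then show ?case by blast
qed auto

end

context frob_data
begin

lemma phi_funpow: "x \<in> ON \<Longrightarrow> x ^ (p ^ n) - (\<phi> ^^ n) x \<in> Q"
proof (induction n)
  case 0
  then show ?case using idlD(2)[OF QI] by simp
next
  case (Suc n)
  let ?y = "(\<phi> ^^ n) x"
  have y: "?y \<in> ON" by (rule Gal_mem[OF Gal_funpow[OF phi(1)] Suc.prems])
  have "(x ^ (p ^ n)) ^ p - ?y ^ p \<in> Q"
    by (rule idl_cong_power[OF QI Suc.IH[OF Suc.prems] power_mem[OF Suc.prems] y])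
  then have "(x ^ (p ^ n)) ^ p - \<phi> ?y \<in> Q" using idl_cong_trans[OF QI _ phi(2)[OF y]] by blast
  then show ?case by (simp add: power_mult[symmetric] mult.commute)
qed

text \<open>Let \<open>n\<close> be the inertia degree of any \<open>Q'\<close> above
  \<open>PF\<close>. The element \<open>h (j \<alpha>)\<close> comes from \<open>Q'\<close>. The
  product \<open>z\<close> of \<open>h\<close> over the conjugates is a multiple of it within
  \<open>M\<close> and comes from \<open>F\<close>, so it lies in \<open>PF\<close> and hence in
  \<open>Q\<close>: this passes from \<open>Q'\<close> to \<open>Q\<close> without choosing a prime
  of \<open>N\<close> above \<open>Q'\<close>. Therefore \<open>h x\<close> lies in \<open>Q\<close>
  for some conjugate \<open>x\<close>, which makes \<open>(\<phi> ^^ n) x\<close> congruent to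
  \<open>x\<close>, and equal to it by \<open>sep\<close>. As \<open>\<phi>\<close> has
  \<open>l\<close>-power order and fixes no conjugate, \<open>l\<close> divides
  \<open>n\<close>.\<close>

lemma dvd_split_gcd:
  assumes M: "over_F M j" and \<alpha>: "\<alpha> \<in> Oi M"
    and l: "prime l" "\<phi> ^^ (l ^ a) = id"
    and nofix: "\<And>x. x \<in> orbt (fixing (iF ` F)) (j \<alpha>) \<Longrightarrow> \<phi> x \<noteq> x"
    and sep: "\<And>x y. x \<in> orbt (fixing (iF ` F)) (j \<alpha>) \<Longrightarrow> y \<in> orbt (fixing (iF ` F)) (j \<alpha>) \<Longrightarrow> x \<noteq> y \<Longrightarrow> x - y \<notin> Q"
  shows "l dvd split_gcd R F M PF"
  unfolding split_gcd_def
proof (rule Gcd_greatest)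
  fix n assume "n \<in> inertia_degree R F M ` primes_above R F M PF"
  then obtain Q' where Q': "Q' \<in> primes_above R F M PF" "n = inertia_degree R F M Q'" by blast
  let ?G = "fixing (iF ` F)" and ?a = "j \<alpha>"
  let ?Y = "orbt ?G ?a"
  define h where "h x = x ^ (p ^ n) - x" for x :: complex
  have G: "perm_grp ?G" by (rule fixing_perm_grp)
  have aO: "?a \<in> ON" by (rule Oi_j(8)[OF M \<alpha>])
  have YO: "x \<in> ON" if "x \<in> ?Y" for x using that Gal_mem[OF fixing_Gal aO] by (auto simp: orbt_def)
  have hO: "h x \<in> ON" if "x \<in> ?Y" for x unfolding h_def by (intro diff_mem power_mem YO that)
  have gh: "g (h x) = h (g x)" if "g \<in> ?G" "x \<in> ?Y" for g x
    unfolding h_def using Gal_diff[OF fixing_Gal[OF that(1)] power_mem[OF YO[OF that(2)]] YO[OF that(2)]]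
      Gal_power[OF fixing_Gal[OF that(1)] YO[OF that(2)]] by simp
  have fY: "finite ?Y" by (rule finite_orbt[OF G])
  have aY: "?a \<in> ?Y" by (rule orbt_self[OF G])
  have inv: "g (prod h T) = prod h T" if g: "g \<in> ?G" and T: "T \<subseteq> ?Y" "\<And>x. x \<in> T \<Longrightarrow> g x \<in> T" for g T
  proof -
    have inj: "inj_on g T" by (rule inj_onI) (rule perm_grp_inj[OF G g])
    have "g ` T = T" by (rule endo_inj_surj[OF finite_subset[OF T(1) fY] _ inj]) (use T(2) in blast)
    then have b: "bij_betw g T T" using inj by (simp add: bij_betw_def)
    have "g (prod h T) = (\<Prod>x\<in>T. g (h x))" by (rule Gal_prod[OF fixing_Gal[OF g]]) (use T(1) hO in blast)
    also have "\<dots> = (\<Prod>x\<in>T. h (g x))" by (rule prod.cong[OF refl]) (use T(1) gh[OF g] in blast)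
    also have "\<dots> = prod h T" by (rule prod.reindex_bij_betw[OF b])
    finally show ?thesis .
  qed
  define z where "z = prod h ?Y"
  \<comment> \<open>The cofactor of the factor at \<open>j \<alpha>\<close> is invariant under all
    automorphisms fixing the image of \<open>M\<close>, so it comes from \<open>M\<close>.\<close>
  define y where "y = prod h (?Y - {?a})"
  have zy: "z = h ?a * y" unfolding z_def y_def by (rule prod.remove[OF fY aY])
  have zO: "z \<in> ON" unfolding z_def by (rule prod_mem) (rule hO)
  have yO: "y \<in> ON" unfolding y_def by (rule prod_mem) (use hO in blast)
  have ONN: "ON \<subseteq> N" by (auto simp: ON_def)
  have "z \<in> iF ` F"
  proof (rule fixing_fixed[OF R.emb_image_subfield[OF F(1,2)] F(3)])
    show "z \<in> N" using zO ONN by blast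
    show "g z = z" if "g \<in> ?G" for g unfolding z_def by (rule inv[OF that]) (auto intro: orbt_closed[OF G that])
  qed
  then obtain z0 where z0: "z0 \<in> F" "z = iF z0" by blast
  have z0O: "z0 \<in> Oi F" using Oi_iff[OF over_F_self] z0 zO by simp
  have jM: "j ` M \<subseteq> N" using over_FD(4)[OF M] by blast
  have "y \<in> j ` M"
  proof (rule fixing_fixed[OF R.emb_image_subfield[OF over_FD(1,3)[OF M]] jM])
    show "y \<in> N" using yO ONN by blast
    fix g assume g: "g \<in> fixing (j ` M)"
    have fx: "g (j x) = j x" if "x \<in> M" for x using g that by (auto simp: fixing_def)
    have "g (iF x) = iF x" if "x \<in> F" for x using fx[of x] over_FD(5)[OF M that] over_FD(2)[OF M] that by auto
    then have gG: "g \<in> ?G" using fixing_Gal[OF g] by (auto simp: fixing_def)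
    have ga: "g ?a = ?a" by (rule fx[OF Oi_mem(9)[OF M \<alpha>]])
    show "g y = y" unfolding y_def
    proof (rule inv[OF gG])
      show "g x \<in> ?Y - {?a}" if "x \<in> ?Y - {?a}" for x
        using that orbt_closed[OF G gG, of x] perm_grp_inj[OF G gG, of x ?a] ga by auto
    qed blast
  qed
  then obtain y0 where y0: "y0 \<in> M" "y = j y0" by blast
  have y0O: "y0 \<in> Oi M" using Oi_iff[OF M] y0 yO by simp
  let ?w = "\<alpha> [^] (p ^ n) \<ominus> \<alpha>"
  have wO: "?w \<in> Oi M" by (intro Oi_mem(6)[OF M] Oi_mem(7)[OF M] \<alpha>)
  have wQ: "?w \<in> Q'" using inertia_pow[OF M Q'(1) \<alpha>] Q'(2) by simp
  interpret I: ideal Q' "OK R M" by (rule above_ideal(2)[OF M Q'(1)])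
  have "?w \<otimes> y0 \<in> Q'" using I.I_r_closed[OF wQ, of y0] y0O by simp
  moreover have "j (?w \<otimes> y0) = j z0"
    using Oi_j(2)[OF M wO y0O] Oi_j(3)[OF M Oi_mem(7)[OF M \<alpha>] \<alpha>] Oi_j(4)[OF M \<alpha>] zy z0 y0(2)
      over_FD(5)[OF M z0(1)] by (simp add: h_def)
  then have "?w \<otimes> y0 = z0" by (rule Oi_j(11)[OF M Oi_mem(4)[OF M wO y0O] Oi_mono(1)[OF M z0O]])
  ultimately have "z0 \<in> PF" using z0O Q'(1) by (auto simp: primes_above_def)
  then have "z \<in> Q" using z0(2) by (simp add: PF_def)
  then obtain x where x: "x \<in> ?Y" "h x \<in> Q" using primeO_prod[OF Q(1), of ?Y h] hO unfolding z_def by blast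
  have phG: "\<phi> \<in> ?G" using phi(1,3) by (auto simp: fixing_def)
  have pY: "(\<phi> ^^ m) x \<in> ?Y" for m by (induction m) (use x(1) orbt_closed[OF G phG] in auto)
  have "(\<phi> ^^ n) x - x ^ (p ^ n) \<in> Q" by (rule idl_cong_sym[OF QI phi_funpow[OF YO[OF x(1)]]])
  then have "(\<phi> ^^ n) x - x \<in> Q" using idl_cong_trans[OF QI] x(2) unfolding h_def by blast
  then have fx: "(\<phi> ^^ n) x = x" using sep[OF pY x(1)] by blast
  show "l dvd n"
  proof (rule ccontr)
    assume "\<not> l dvd n"
    then have "coprime n (l ^ a)" using l(1) by (simp add: prime_imp_coprime coprime_commute)
    moreover have "(\<phi> ^^ (l ^ a)) x = x" by (simp add: l(2))
    ultimately have "\<phi> x = x" using funpow_coprime_fixed[OF fx] by blast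
    then show False using nofix[OF x(1)] by blast
  qed
qed

end

text \<open>If \<open>\<sigma>\<close> fixes the conjugate \<open>g (iL \<beta>)\<close>, it fixes
  the whole image of \<open>L\<close> under \<open>g \<circ> iL\<close>, because
  \<open>\<beta>\<close> is primitive. At a prime with Frobenius \<open>\<sigma> ^^ k\<close> the
  gcd for \<open>L\<close> is then 1, while for \<open>K\<close> it would be divisible by
  \<open>l\<close> if \<open>\<sigma>\<close> fixed no conjugate of \<open>\<alpha>\<close>.\<close>

lemma (in normal_field) fixed_point_transfer:
  fixes R :: "('a, 'b) ring_scheme"
  assumes R: "field R" and F: "subfield F R" "emb R F iF" "iF ` F \<subseteq> N"
    and K: "subfield K R" "F \<subseteq> K" "emb R K iK" "iK ` K \<subseteq> N" "\<And>x. x \<in> F \<Longrightarrow> iK x = iF x"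
    and L: "subfield L R" "F \<subseteq> L" "emb R L iL" "iL ` L \<subseteq> N" "\<And>x. x \<in> F \<Longrightarrow> iL x = iF x"
    and lg: "locally_gcd_equivalent R F K L"
    and \<alpha>: "\<alpha> \<in> K" "algebraic_int (iK \<alpha>)"
    and \<beta>: "\<And>g x. g \<in> fixing (iF ` F) \<Longrightarrow> g (iL \<beta>) = iL \<beta> \<Longrightarrow> x \<in> L \<Longrightarrow> g (iL x) = iL x"
    and l: "prime l" and s: "\<sigma> \<in> fixing (iF ` F)" "\<sigma> ^^ (l ^ a) = id"
    and y: "y \<in> orbt (fixing (iF ` F)) (iL \<beta>)" "\<sigma> y = y"
  shows "\<exists>x\<in>orbt (fixing (iF ` F)) (iK \<alpha>). \<sigma> x = x"
proof (rule ccontr)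
  let ?G = "fixing (iF ` F)" let ?Y = "orbt ?G (iK \<alpha>)"
  assume neg: "\<not> (\<exists>x\<in>?Y. \<sigma> x = x)"
  interpret R: field R by (rule R)
  have G: "perm_grp ?G" by (rule fixing_perm_grp)
  obtain g where g: "g \<in> ?G" "y = g (iL \<beta>)" using y(1) by (auto simp: orbt_def)
  obtain h where h: "h \<in> ?G" "\<And>x. h (g x) = x" "\<And>x. g (h x) = x" using perm_grp_inv[OF G g(1)] by metis
  have hsg: "h \<circ> (\<sigma> \<circ> g) \<in> ?G" by (intro perm_grpD(3)[OF G] h(1) s(1) g(1))
  have sL: "\<sigma> (g (iL x)) = g (iL x)" if "x \<in> L" for x
  proof -
    have "(h \<circ> (\<sigma> \<circ> g)) (iL \<beta>) = iL \<beta>" using y(2) g(2) h(2) by simp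
    then have "h (\<sigma> (g (iL x))) = iL x" using \<beta>[OF hsg _ that] by simp
    then show ?thesis using h(3)[of "\<sigma> (g (iL x))"] by simp
  qed
  have aY: "iK \<alpha> \<in> ?Y" by (rule orbt_self[OF G])
  have aO: "iK \<alpha> \<in> ON" using \<alpha>(1,2) K(4) by (auto simp: ON_def)
  have YO: "x \<in> ON" if "x \<in> ?Y" for x using that Gal_mem[OF fixing_Gal aO] by (auto simp: orbt_def)
  have sid: "\<sigma> \<noteq> id" using neg aY by auto
  \<comment> \<open>A large \<open>p\<close> keeps the differences of distinct conjugates of
    \<open>\<alpha>\<close> out of \<open>Q\<close>, so that congruent conjugates are equal.\<close>
  define T where "T = (\<lambda>(x, y). x - y) ` (?Y \<times> ?Y) - {0}"
  have "finite T" unfolding T_def using finite_orbt[OF G] by simp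
  moreover have "T \<subseteq> ON - {0}" unfolding T_def using YO by (auto intro: diff_mem)
  ultimately obtain B where B: "\<forall>p Q. prime p \<longrightarrow> primeO Q \<longrightarrow> of_nat p \<in> Q \<longrightarrow> B < p \<longrightarrow> T \<inter> Q = {}"
    using none_in_large_prime by blast
  obtain p Q k where P: "max B (nat \<bar>Disc\<bar>) < p" "prime p" "primeO Q" "of_nat p \<in> Q" "\<not> l dvd k"
      and fr: "\<forall>x\<in>ON. x ^ p - (\<sigma> ^^ k) x \<in> Q"
    using Frobenius_generates[OF fixing_Gal[OF s(1)] sid l s(2)] by blast
  \<comment> \<open>Since \<open>l\<close> does not divide \<open>k\<close>, this power has the same
    fixed points as \<open>\<sigma>\<close>, and its order is still a power of
    \<open>l\<close>.\<close>
  define \<phi> where "\<phi> = \<sigma> ^^ k"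
  have sF: "\<sigma> (iF x) = iF x" if "x \<in> F" for x using s(1) that by (simp add: fixing_def)
  have phF: "\<phi> (iF x) = iF x" if "x \<in> F" for x unfolding \<phi>_def by (induction k) (auto simp: sF that)
  interpret frob_data f xs R F iF p Q \<phi>
  proof (intro frob_data.intro frob_data_axioms.intro normal_field_axioms R)
    show "subfield F R" "emb R F iF" "iF ` F \<subseteq> N" by (rule assms(2-4))+
    show "prime p" "primeO Q" "of_nat p \<in> Q" by (rule P)+
    show "\<not> int p dvd Disc" using P(1) by (intro not_dvd_Disc) simp
    show "\<phi> \<in> Gal" unfolding \<phi>_def by (rule Gal_funpow[OF fixing_Gal[OF s(1)]])
    show "x ^ p - \<phi> x \<in> Q" if "x \<in> ON" for x using fr that by (simp add: \<phi>_def)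
    show "\<phi> (iF x) = iF x" if "x \<in> F" for x by (rule phF[OF that])
  qed
  have oK: "over_F K iK" using K by (simp add: over_F_def)
  have oL: "over_F L (g \<circ> iL)"
  proof -
    note gG = GalD[OF fixing_Gal[OF g(1)]]
    have LN: "iL x \<in> N" if "x \<in> L" for x using L(4) that by blast
    have "emb R L (g \<circ> iL)" unfolding emb_def using embD[OF L(3)] gG(5,6,7) LN by simp
    moreover have "g (iL x) = iF x" if "x \<in> F" for x using L(5)[OF that] g(1) that by (simp add: fixing_def)
    ultimately show ?thesis unfolding over_F_def using L(1,2) gG(4) LN by auto
  qed
  have "split_gcd R F L PF = 1"
  proof (rule split_gcd_fixed[OF oL])
    fix x assume x: "x \<in> L"
    show "\<phi> ((g \<circ> iL) x) = (g \<circ> iL) x" unfolding \<phi>_def by (induction k) (auto simp: sL x)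
  qed
  moreover have "l dvd split_gcd R F K PF"
  proof (rule dvd_split_gcd[OF oK _ l])
    show "\<alpha> \<in> Oi K" using Oi_iff[OF oK] \<alpha>(1) aO by simp
    show "\<phi> ^^ (l ^ a) = id" unfolding \<phi>_def by (simp add: funpow_mult mult.commute[of k] funpow_mult[symmetric] s(2))
    show "\<phi> x \<noteq> x" if x: "x \<in> ?Y" for x
    proof
      assume "\<phi> x = x"
      moreover have "coprime k (l ^ a)" using prime_imp_coprime[OF l P(5)] by (simp add: coprime_commute)
      moreover have "(\<sigma> ^^ (l ^ a)) x = x" by (simp add: s(2))
      ultimately have "\<sigma> x = x" using funpow_coprime_fixed[of k \<sigma> x] unfolding \<phi>_def by blast
      then show False using neg x by blast
    qed
    show "x - y \<notin> Q" if "x \<in> ?Y" "y \<in> ?Y" "x \<noteq> y" for x y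
    proof -
      have "x - y \<in> T" using that by (auto simp: T_def)
      then show ?thesis using B P by auto
    qed
  qed
  moreover have "split_gcd R F K PF = split_gcd R F L PF"
    using lg PF_nz_prime PF_unramified[OF oK] PF_unramified[OF oL] by (simp add: locally_gcd_equivalent_def)
  ultimately show False using l by simp
qed

lemma Poly_rev_nz:
  assumes "q \<noteq> []" "hd q \<noteq> (0::complex)"
  shows "Poly (rev q) \<noteq> 0" "Polynomial.degree (Poly (rev q)) \<le> length q - 1"
proof -
  have "Polynomial.coeff (Poly (rev q)) (length q - 1) = hd q" using assms(1) by (simp add: nth_default_def rev_nth hd_conv_nth)
  then show "Poly (rev q) \<noteq> 0" using assms(2) by (metis coeff_0)
  show "Polynomial.degree (Poly (rev q)) \<le> length q - 1" by (rule degree_le) (use assms(1) in \<open>auto simp: nth_default_def\<close>)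
qed

lemma exists_rational_poly_vanishing:
  assumes "finite Z" "\<And>z. z \<in> Z \<Longrightarrow> \<exists>P. P \<noteq> 0 \<and> (\<forall>i. Polynomial.coeff P i \<in> \<rat>) \<and> poly P z = (0::complex)"
  shows "\<exists>P. P \<noteq> 0 \<and> (\<forall>i. Polynomial.coeff P i \<in> \<rat>) \<and> (\<forall>z\<in>Z. poly P z = 0)"
  using assms
proof (induction Z rule: finite_induct)
  case empty
  show ?case by (rule exI[of _ 1]) (auto simp: coeff_1)
next
  case (insert z Z)
  obtain P where P: "P \<noteq> 0" "\<forall>i. Polynomial.coeff P i \<in> \<rat>" "\<forall>z\<in>Z. poly P z = 0" using insert by auto
  obtain P' where P': "P' \<noteq> 0" "\<forall>i. Polynomial.coeff P' i \<in> \<rat>" "poly P' z = 0" using insert.prems[of z] by auto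
  have "Polynomial.coeff (P * P') i \<in> \<rat>" for i unfolding coeff_mult by (intro Rats_sum Rats_mult) (use P P' in auto)
  then show ?case using P P' by (intro exI[of _ "P * P'"]) auto
qed

context field
begin

lemma emb_rational_poly:
  assumes Q: "subfield (rat_img R) R" and K: "subfield K R" "rat_img R \<subseteq> K" "emb R K j"
    and x: "x \<in> K" "(algebraic over (rat_img R)) x"
  shows "\<exists>P. P \<noteq> 0 \<and> (\<forall>i. Polynomial.coeff P i \<in> \<rat>) \<and> poly P (j x) = 0"
proof -
  have xc: "x \<in> carrier R" using subfieldE(3)[OF K(1)] x(1) by blast
  obtain p where p: "p \<in> carrier (univ_poly R (rat_img R))" "p \<noteq> []" "eval p x = \<zero>"
    using algebraicE[OF subfieldE(1)[OF Q] xc x(2)] by blast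
  have pp: "set p \<subseteq> rat_img R" "hd p \<noteq> \<zero>" using p(1,2) by (auto simp: univ_poly_carrier[symmetric] polynomial_def)
  have pK: "set p \<subseteq> K" using pp(1) K(2) by blast
  let ?q = "map j p"
  have "hd p \<in> K" using p(2) pK by (cases p) auto
  then have "hd ?q \<noteq> 0" using emb_nz[OF K(1,3)] pp(2) p(2) by (simp add: hd_map)
  then have "Poly (rev ?q) \<noteq> 0" using p(2) by (intro Poly_rev_nz) auto
  moreover have "c \<in> \<rat>" if "c \<in> set ?q" for c
    using that pp(1) emb_rat_img[OF K(1) K(3)] pK by auto
  then have "Polynomial.coeff (Poly (rev ?q)) i \<in> \<rat>" for i
    using nth_mem[of i "rev ?q"] by (auto simp: nth_default_def simp del: set_map)
  moreover have "poly (Poly (rev ?q)) (j x) = 0"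
    using emb_eval[OF K(1,3) x(1) pK] p(3) emb_zero[OF K(1,3)] by (simp add: CR_eval)
  ultimately show ?thesis by blast
qed

lemma F_isomorphic_if_images_eq:
  assumes K: "subfield K R" "F \<subseteq> K" "emb R K j" and L: "subfield L R" "F \<subseteq> L" "emb R L i"
    and im: "j ` K = i ` L" and F: "\<And>x. x \<in> F \<Longrightarrow> j x = i x"
  shows "F_isomorphic R F K L"
proof -
  define \<psi> where "\<psi> x = inv_into L i (j x)" for x
  have ii: "inj_on i L" by (rule inj_onI) (rule emb_inj[OF L(1,3)])
  have ij: "inj_on j K" by (rule inj_onI) (rule emb_inj[OF K(1,3)])
  have psi: "\<psi> x \<in> L" "i (\<psi> x) = j x" if "x \<in> K" for x
  proof -
    have "j x \<in> i ` L" using im that by blast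
    then show "\<psi> x \<in> L" "i (\<psi> x) = j x" unfolding \<psi>_def by (rule inv_into_into, rule f_inv_into_f)
  qed
  have uni: "\<psi> x = y" if "x \<in> K" "y \<in> L" "j x = i y" for x y
    unfolding \<psi>_def using that ii by simp
  note sK = subringE[OF subfieldE(1)[OF K(1)]] and sL = subringE[OF subfieldE(1)[OF L(1)]]
  have hom: "\<psi> \<in> ring_hom (R\<lparr>carrier := K\<rparr>) (R\<lparr>carrier := L\<rparr>)"
  proof (rule ring_hom_memI)
    show "\<psi> x \<in> carrier (R\<lparr>carrier := L\<rparr>)" if "x \<in> carrier (R\<lparr>carrier := K\<rparr>)" for x using that psi by simp
    show "\<psi> (x \<otimes>\<^bsub>R\<lparr>carrier := K\<rparr>\<^esub> y) = \<psi> x \<otimes>\<^bsub>R\<lparr>carrier := L\<rparr>\<^esub> \<psi> y"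
      if "x \<in> carrier (R\<lparr>carrier := K\<rparr>)" "y \<in> carrier (R\<lparr>carrier := K\<rparr>)" for x y
      using that psi sK(6) sL(6) embD(3)[OF K(3)] embD(3)[OF L(3)] by (simp add: uni)
    show "\<psi> (x \<oplus>\<^bsub>R\<lparr>carrier := K\<rparr>\<^esub> y) = \<psi> x \<oplus>\<^bsub>R\<lparr>carrier := L\<rparr>\<^esub> \<psi> y"
      if "x \<in> carrier (R\<lparr>carrier := K\<rparr>)" "y \<in> carrier (R\<lparr>carrier := K\<rparr>)" for x y
      using that psi sK(7) sL(7) embD(2)[OF K(3)] embD(2)[OF L(3)] by (simp add: uni)
    show "\<psi> \<one>\<^bsub>R\<lparr>carrier := K\<rparr>\<^esub> = \<one>\<^bsub>R\<lparr>carrier := L\<rparr>\<^esub>"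
      using sK(3) sL(3) embD(1)[OF K(3)] embD(1)[OF L(3)] by (simp add: uni)
  qed
  have "bij_betw \<psi> K L"
  proof (rule bij_betwI')
    show "(\<psi> x = \<psi> y) = (x = y)" if "x \<in> K" "y \<in> K" for x y
      using psi(2)[OF that(1)] psi(2)[OF that(2)] inj_onD[OF ij _ that] by auto
    show "\<psi> x \<in> L" if "x \<in> K" for x using psi that by simp
    fix y assume y: "y \<in> L"
    then have "i y \<in> j ` K" using im by blast
    then obtain x where "x \<in> K" "i y = j x" by blast
    then show "\<exists>x\<in>K. y = \<psi> x" using uni[of x y] y by auto
  qed
  then have "\<psi> \<in> ring_iso (R\<lparr>carrier := K\<rparr>) (R\<lparr>carrier := L\<rparr>)" using hom by (simp add: ring_iso_def)
  moreover have "\<psi> x = x" if "x \<in> F" for x using uni[of x x] F[OF that] K(2) L(2) that by blast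
  ultimately show ?thesis unfolding F_isomorphic_def by blast
qed

end

context normal_field
begin

text \<open>Only finitely many automorphisms move something in \<open>S\<close>, so one element of
  \<open>S\<close> is moved by all of them. A nonzero integer multiple of it is integral and has the
  same stabilizer.\<close>

lemma exists_primitive:
  assumes S: "subfield S CR" "S \<subseteq> N"
  shows "\<exists>a\<in>S. algebraic_int a \<and> (\<forall>g\<in>Gal. g a = a \<longrightarrow> (\<forall>x\<in>S. g x = x))"
proof -
  define T where "T = {g \<in> Gal. \<exists>x\<in>S. g x \<noteq> x}"
  note SD = CR_subfieldD[OF S(1)]
  have nS: "of_nat n \<in> S" for n using CR_subfield_Rats[OF S(1)] by auto
  have iS: "of_int n \<in> S" for n using CR_subfield_Rats[OF S(1)] by auto
  have SN: "x \<in> N" if "x \<in> S" for x using S(2) that by blast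
  have scal: "g (of_int n * y) = of_int n * g y" if "g \<in> Gal" "y \<in> S" for g n y
    using GalD(6)[OF that(1) SN[OF iS] SN[OF that(2)], of n] GalD(9)[OF that(1), of "of_int n"] by simp
  have "\<exists>v\<in>S. \<forall>\<tau>\<in>T. \<tau> v \<noteq> v"
  proof (rule exists_moved_by_all)
    show "finite T" unfolding T_def using Gal_finite by simp
    show "S \<noteq> {}" using SD(1) by blast
    show "x + of_nat n * y \<in> S" if "x \<in> S" "y \<in> S" for x y n by (intro SD(3,4) that nS)
    show "\<tau> (x + of_nat n * y) = \<tau> x + of_nat n * \<tau> y" if "\<tau> \<in> T" "x \<in> S" "y \<in> S" for \<tau> x y n
    proof -
      have t: "\<tau> \<in> Gal" using that(1) by (simp add: T_def)
      have "\<tau> (x + of_nat n * y) = \<tau> x + \<tau> (of_nat n * y)" by (intro GalD(5)[OF t] SN SD(4) that nS)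
      then show ?thesis using scal[OF t that(3), of "int n"] by simp
    qed
    show "\<exists>v\<in>S. \<tau> v \<noteq> v" if "\<tau> \<in> T" for \<tau> using that by (simp add: T_def)
  qed
  then obtain v where v: "v \<in> S" "\<And>\<tau>. \<tau> \<in> T \<Longrightarrow> \<tau> v \<noteq> v" by blast
  obtain n :: int where n: "n \<noteq> 0" "algebraic_int (of_int n * v)" using N_int_multiple[OF SN[OF v(1)]] by blast
  show ?thesis
  proof (intro bexI[of _ "of_int n * v"] conjI ballI impI)
    fix g x assume g: "g \<in> Gal" "g (of_int n * v) = of_int n * v" and x: "x \<in> S"
    have "g v = v" using g(2) scal[OF g(1) v(1)] n(1) by simp
    then have "g \<notin> T" using v(2) by blast
    then show "g x = x" using g(1) x by (auto simp: T_def)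
  qed (use n v SD(4) iS in auto)
qed

text \<open>The conjugates are roots of the image of \<open>Irr F \<alpha>\<close>, whose degree is
  the dimension of a simple extension inside \<open>K\<close>.\<close>

lemma card_orbit_le_ext_degree:
  fixes R (structure)
  assumes R: "field R" and F: "subfield F R" and K: "subfield K R" "F \<subseteq> K" "emb R K j" "j ` K \<subseteq> N"
    and d: "ring.dimension R n F K" and \<alpha>: "\<alpha> \<in> K"
  shows "card (orbt (fixing (j ` F)) (j \<alpha>)) \<le> ext_degree R F K"
proof -
  interpret R: field R by (rule R)
  have dn: "ext_degree R F K = n"
    unfolding ext_degree_def by (rule the_equality) (use d R.dimension_is_inj[OF F] in auto)
  have ac: "\<alpha> \<in> carrier R" using subfieldE(3)[OF K(1)] \<alpha> by blast
  have al: "(R.algebraic over F) \<alpha>"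
    using R.finite_dimension_imp_algebraic[OF F subfieldE(1)[OF K(1)] R.finite_dimensionI[OF d] \<alpha>] .
  let ?I = "R.Irr F \<alpha>"
  note I = R.IrrE[OF F ac al]
  have len: "length ?I \<ge> 2" by (rule R.Irr_length[OF F ac al])
  have Iset: "set ?I \<subseteq> F" using I(1) by (auto simp: univ_poly_carrier[symmetric] polynomial_def)
  have "R.dimension (length ?I - 1) F (R.simple_extension F \<alpha>)" by (rule R.dimension_simple_extension[OF F ac al])
  then obtain Us where Us: "set Us \<subseteq> carrier R" "R.independent F Us" "length Us = length ?I - 1" "R.Span F Us = R.simple_extension F \<alpha>"
    using R.exists_base[OF F] by blast
  have "set Us \<subseteq> K" using R.Span_base_incl[OF F Us(1)] Us(4)
      R.simple_extension_subring_incl[OF subfieldE(1)[OF K(1)] K(2) \<alpha>] by blast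
  then have dl: "length ?I - 1 \<le> n" using R.independent_length_le_dimension[OF F d Us(2)] Us(3) by simp
  let ?P = "Poly (rev (map j ?I))"
  have ne: "?I \<noteq> []" using len by auto
  have "hd (map j ?I) = 1" using I(3) ne embD(1)[OF K(3)] by (simp add: hd_map)
  then have P: "?P \<noteq> 0" "Polynomial.degree ?P \<le> length ?I - 1" using Poly_rev_nz[of "map j ?I"] ne by auto
  have "orbt (fixing (j ` F)) (j \<alpha>) \<subseteq> {z. poly ?P z = 0}"
  proof
    fix z assume "z \<in> orbt (fixing (j ` F)) (j \<alpha>)"
    then obtain g where g: "g \<in> fixing (j ` F)" "z = g (j \<alpha>)" by (auto simp: orbt_def)
    note gG = GalD[OF fixing_Gal[OF g(1)]]
    have KN: "j x \<in> N" if "x \<in> K" for x using K(4) that by blast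
    have e: "emb R K (g \<circ> j)" unfolding emb_def using embD[OF K(3)] gG(5,6,7) KN by simp
    have mp: "map (g \<circ> j) ?I = map j ?I" using Iset g(1) by (auto simp: fixing_def)
    have IK: "set ?I \<subseteq> K" using Iset K(2) by blast
    have "poly ?P z = (g \<circ> j) (R.eval ?I \<alpha>)"
      using R.emb_eval[OF K(1) e \<alpha> IK, unfolded mp CR_eval] g(2) by simp
    also have "\<dots> = 0" using I(4) R.emb_zero[OF K(1) e] by simp
    finally show "z \<in> {z. poly ?P z = 0}" by simp
  qed
  then have "card (orbt (fixing (j ` F)) (j \<alpha>)) \<le> card {z. poly ?P z = 0}"
    by (rule card_mono[OF poly_roots_finite[OF P(1)]])
  also have "\<dots> \<le> Polynomial.degree ?P" by (rule card_poly_roots_bound[OF P(1)])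
  finally show ?thesis using P(2) dl dn by linarith
qed

end

section \<open>Locally gcd equivalent extensions\<close>

text \<open>One embedding of \<open>F\<close> is extended to \<open>K\<close> and to
  \<open>L\<close> separately, which makes the two agree on \<open>F\<close>. Generators of
  \<open>K\<close> and \<open>L\<close> are taken over the prime field as well, because
  \<open>N\<close> is generated over the rationals: \<open>f\<close> is a rational polynomial
  vanishing at the images of all these generators, so the images of both fields fall into
  \<open>N\<close>.\<close>

lemma (in field) exists_compatible_normal_field:
  assumes ch: "\<forall>n::nat. n > 0 \<longrightarrow> [n] \<cdot> \<one> \<noteq> \<zero>"
    and F: "finite_ext R (rat_img R) F" and K: "finite_ext R F K" and L: "finite_ext R F L"
  shows "\<exists>f xs iK iL. normal_field f xs \<and> emb R K iK \<and> iK ` K \<subseteq> normal_field.N xs \<and>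
    emb R L iL \<and> iL ` L \<subseteq> normal_field.N xs \<and> (\<forall>x\<in>F. iK x = iL x)"
proof -
  let ?Q = "rat_img R"
  have Q: "subfield ?Q R" and Fs: "subfield F R" "?Q \<subseteq> F" "finite_dimension ?Q F"
    using F by (auto simp: finite_ext_def finite_dimension_def)
  have eQ: "emb R ?Q (ratc R)" by (rule emb_ratc[OF ch])
  obtain us where us: "set us \<subseteq> F" "finite_extension ?Q us = F" "\<And>x. x \<in> F \<Longrightarrow> (algebraic over ?Q) x"
    using finite_dim_eq_finite_extension[OF Q Fs] by blast
  have "set us \<subseteq> carrier R" using us(1) subfieldE(3)[OF Fs(1)] by blast
  then obtain iF where iF: "emb R F iF" using extend_emb_list[OF Q _ _ eQ, of us] us by blast
  have step: "\<exists>j ws. emb R M j \<and> (\<forall>x\<in>F. j x = iF x) \<and> set ws \<subseteq> M \<and> finite_extension ?Q ws = M \<and>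
      (\<forall>x\<in>M. \<exists>P. P \<noteq> 0 \<and> (\<forall>i. Polynomial.coeff P i \<in> \<rat>) \<and> poly P (j x) = 0)"
    if M: "finite_ext R F M" for M
  proof -
    have Ms: "subfield M R" "F \<subseteq> M" "finite_dimension F M" using M by (auto simp: finite_ext_def finite_dimension_def)
    obtain vs where vs: "set vs \<subseteq> M" "finite_extension F vs = M" "\<And>x. x \<in> M \<Longrightarrow> (algebraic over F) x"
      using finite_dim_eq_finite_extension[OF Fs(1) Ms] by blast
    have "set vs \<subseteq> carrier R" using vs(1) subfieldE(3)[OF Ms(1)] by blast
    then obtain j where j: "emb R M j" "\<forall>x\<in>F. j x = iF x" using extend_emb_list[OF Fs(1) _ _ iF, of vs] vs by blast
    have QM: "?Q \<subseteq> M" using Fs(2) Ms(2) by blast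
    have "finite_dimension ?Q M" by (rule telescopic_base_dim(1)[OF Q Fs(1) Fs(3) Ms(3)])
    then obtain ws where ws: "set ws \<subseteq> M" "finite_extension ?Q ws = M" "\<And>x. x \<in> M \<Longrightarrow> (algebraic over ?Q) x"
      using finite_dim_eq_finite_extension[OF Q Ms(1) QM] by blast
    have "\<exists>P. P \<noteq> 0 \<and> (\<forall>i. Polynomial.coeff P i \<in> \<rat>) \<and> poly P (j x) = 0" if "x \<in> M" for x
      by (rule emb_rational_poly[OF Q Ms(1) QM j(1) that ws(3)[OF that]])
    then show ?thesis using j ws by blast
  qed
  obtain iK vs where iK: "emb R K iK" "\<forall>x\<in>F. iK x = iF x" "set vs \<subseteq> K" "finite_extension ?Q vs = K"
      "\<forall>x\<in>K. \<exists>P. P \<noteq> 0 \<and> (\<forall>i. Polynomial.coeff P i \<in> \<rat>) \<and> poly P (iK x) = 0" using step[OF K] by blast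
  obtain iL ws where iL: "emb R L iL" "\<forall>x\<in>F. iL x = iF x" "set ws \<subseteq> L" "finite_extension ?Q ws = L"
      "\<forall>x\<in>L. \<exists>P. P \<noteq> 0 \<and> (\<forall>i. Polynomial.coeff P i \<in> \<rat>) \<and> poly P (iL x) = 0" using step[OF L] by blast
  have "\<exists>P. P \<noteq> 0 \<and> (\<forall>i. Polynomial.coeff P i \<in> \<rat>) \<and> poly P z = 0" if "z \<in> iK ` set vs \<union> iL ` set ws" for z
    using that iK(3,5) iL(3,5) by blast
  then obtain f where f: "f \<noteq> 0" "\<forall>i. Polynomial.coeff f i \<in> \<rat>" "\<forall>z\<in>iK ` set vs \<union> iL ` set ws. poly f z = 0"
    using exists_rational_poly_vanishing[of "iK ` set vs \<union> iL ` set ws"] by blast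
  obtain xs where xs: "set xs = {z. poly f z = 0}" using finite_list[OF poly_roots_finite[OF f(1)]] by blast
  interpret normal_field f xs using f xs by unfold_locales auto
  have img: "j ` M \<subseteq> N"
    if M: "subfield M R" and j: "emb R M j" and us: "set us \<subseteq> M" "finite_extension ?Q us = M" "\<forall>u\<in>set us. poly f (j u) = 0" for M j us
  proof -
    let ?T = "{x \<in> M. j x \<in> N}"
    note s = subringE[OF subfieldE(1)[OF M]]
    have QM: "?Q \<subseteq> M" using finite_extension_incl[OF subfieldE(3)[OF Q], of us] us(1,2) s(1) by blast
    have "subring ?T R"
    proof (rule subringI)
      show "?T \<subseteq> carrier R" using s(1) by blast
      show "\<one> \<in> ?T" using s(3) embD(1)[OF j] ND(2) by simp
      show "\<ominus> h \<in> ?T" if "h \<in> ?T" for h using that s(5)[of h] emb_minus[OF M j, of h] ND(5)[of "j h"] by simp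
      show "h \<otimes> k \<in> ?T" if "h \<in> ?T" "k \<in> ?T" for h k using that s(6)[of h k] embD(3)[OF j, of h k] ND(4)[of "j h" "j k"] by simp
      show "h \<oplus> k \<in> ?T" if "h \<in> ?T" "k \<in> ?T" for h k using that s(7)[of h k] embD(2)[OF j, of h k] ND(3)[of "j h" "j k"] by simp
    qed
    moreover have "?Q \<subseteq> ?T" using QM emb_rat_img[OF M j] N_Rats by blast
    moreover have "set us \<subseteq> ?T" using us(1,3) xs xs_N by auto
    ultimately have "finite_extension ?Q us \<subseteq> ?T" by (rule finite_extension_subring_incl)
    then show ?thesis using us(2) by blast
  qed
  have "subfield K R" "subfield L R" using K L by (auto simp: finite_ext_def)
  then have "iK ` K \<subseteq> N" "iL ` L \<subseteq> N" using img[OF _ iK(1,3,4)] img[OF _ iL(1,3,4)] f(3) by auto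
  then show ?thesis using normal_field_axioms iK(1,2) iL(1,2) by (intro exI[of _ f] exI[of _ xs] exI[of _ iK] exI[of _ iL]) auto
qed

text \<open>Replacing \<open>iK\<close> by \<open>j = g \<circ> iK\<close> sends
  \<open>\<alpha>\<close> to \<open>x\<close>. The automorphisms that fix the image of
  \<open>K\<close> are then the stabilizer of \<open>x\<close>, and those that fix the image of
  \<open>L\<close> the stabilizer of \<open>iL \<beta>\<close>. Equal groups have equal fixed fields
  by \<open>fixing_fixed\<close>, so the two images coincide.\<close>

lemma (in normal_field) F_isomorphic_if_equal_stabilizers:
  fixes R :: "('a, 'b) ring_scheme"
  assumes R: "field R"
    and K: "subfield K R" "F \<subseteq> K" "emb R K iK" "iK ` K \<subseteq> N" "\<And>x. x \<in> F \<Longrightarrow> iK x = iF x"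
    and L: "subfield L R" "F \<subseteq> L" "emb R L iL" "iL ` L \<subseteq> N" "\<And>x. x \<in> F \<Longrightarrow> iL x = iF x"
    and a: "\<alpha> \<in> K" "\<And>g x. g \<in> fixing (iF ` F) \<Longrightarrow> g (iK \<alpha>) = iK \<alpha> \<Longrightarrow> x \<in> K \<Longrightarrow> g (iK x) = iK x"
    and b: "\<beta> \<in> L" "\<And>g x. g \<in> fixing (iF ` F) \<Longrightarrow> g (iL \<beta>) = iL \<beta> \<Longrightarrow> x \<in> L \<Longrightarrow> g (iL x) = iL x"
    and x: "x \<in> orbt (fixing (iF ` F)) (iK \<alpha>)" "stb (fixing (iF ` F)) x = stb (fixing (iF ` F)) (iL \<beta>)"
  shows "F_isomorphic R F K L"
proof -
  interpret R: field R by (rule R)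
  let ?G = "fixing (iF ` F)"
  have G: "perm_grp ?G" by (rule fixing_perm_grp)
  obtain g where g: "g \<in> ?G" "x = g (iK \<alpha>)" using x(1) by (auto simp: orbt_def)
  obtain h where h: "h \<in> ?G" "\<And>x. h (g x) = x" "\<And>x. g (h x) = x" using perm_grp_inv[OF G g(1)] by metis
  note gG = GalD[OF fixing_Gal[OF g(1)]]
  have KN: "iK y \<in> N" if "y \<in> K" for y using K(4) that by blast
  define j where "j = g \<circ> iK"
  have ej: "emb R K j" unfolding emb_def j_def using embD[OF K(3)] gG(5,6,7) KN by simp
  have jN: "j ` K \<subseteq> N" using gG(4) KN by (auto simp: j_def)
  have jF: "j y = iF y" if "y \<in> F" for y using K(5)[OF that] g(1) that by (simp add: fixing_def j_def)
  have subG: "k \<in> ?G" if k: "k \<in> fixing (i ` M)" and F: "F \<subseteq> M" "\<And>y. y \<in> F \<Longrightarrow> i y = iF y" for k M i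
  proof -
    have "k (iF y) = iF y" if "y \<in> F" for y
    proof -
      have "k (i y) = i y" using k F(1) that by (auto simp: fixing_def)
      then show ?thesis using F(2)[OF that] by simp
    qed
    then show ?thesis using fixing_Gal[OF k] by (auto simp: fixing_def)
  qed
  have 1: "k \<in> stb ?G x" if k: "k \<in> fixing (j ` K)" for k
    using subG[OF k K(2) jF] k a(1) g(2) by (auto simp: stb_def fixing_def j_def)
  have 2: "k (j y) = j y" if k: "k \<in> stb ?G x" and y: "y \<in> K" for k y
  proof -
    have kG: "k \<in> ?G" "k x = x" using k by (auto simp: stb_def)
    have hkg: "h \<circ> (k \<circ> g) \<in> ?G" by (intro perm_grpD(3)[OF G] h(1) kG(1) g(1))
    have "(h \<circ> (k \<circ> g)) (iK \<alpha>) = iK \<alpha>" using kG(2) g(2) h(2) by simp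
    then have "h (k (g (iK y))) = iK y" using a(2)[OF hkg _ y] by simp
    then show ?thesis using h(3)[of "k (g (iK y))"] by (simp add: j_def)
  qed
  have 3: "k \<in> stb ?G (iL \<beta>)" if k: "k \<in> fixing (iL ` L)" for k
    using subG[OF k L(2,5)] k b(1) by (auto simp: stb_def fixing_def)
  have 4: "k (iL y) = iL y" if k: "k \<in> stb ?G (iL \<beta>)" and y: "y \<in> L" for k y
    using b(2)[of k y] k y by (auto simp: stb_def)
  have "j ` K = iL ` L"
  proof
    show "j ` K \<subseteq> iL ` L"
    proof (rule image_subsetI)
      fix y assume y: "y \<in> K"
      show "j y \<in> iL ` L"
        by (rule fixing_fixed[OF R.emb_image_subfield[OF L(1,3)] L(4)]) (use jN y 2 3 x(2) in auto)
    qed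
    show "iL ` L \<subseteq> j ` K"
    proof (rule image_subsetI)
      fix y assume y: "y \<in> L"
      show "iL y \<in> j ` K"
        by (rule fixing_fixed[OF R.emb_image_subfield[OF K(1) ej] jN]) (use L(4) y 1 4 x(2) in auto)
    qed
  qed
  then show ?thesis using R.F_isomorphic_if_images_eq[OF K(1,2) ej L(1-3)] jF L(5) by simp
qed

theorem theorem1:
  fixes R :: "('a, 'b) ring_scheme" and F K L :: "'a set"
  assumes "char_zero_field R"
    and "number_field R F"
    and "finite_ext R F K" and "finite_ext R F L"
    and "ext_degree R F K \<le> 5" and "ext_degree R F L \<le> 5"
    and "locally_gcd_equivalent R F K L"
  shows "F_isomorphic R F K L"
proof -
  have R: "field R" and ch: "\<forall>n::nat. n > 0 \<longrightarrow> [n] \<cdot>\<^bsub>R\<^esub> \<one>\<^bsub>R\<^esub> \<noteq> \<zero>\<^bsub>R\<^esub>" using assms(1) by (auto simp: char_zero_field_def)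
  interpret R: field R by (rule R)
  obtain f xs iK iL where nf: "normal_field f xs" and iK: "emb R K iK" "iK ` K \<subseteq> normal_field.N xs"
      and iL: "emb R L iL" "iL ` L \<subseteq> normal_field.N xs" and iF: "\<forall>x\<in>F. iK x = iL x"
    using R.exists_compatible_normal_field[OF ch assms(2)[unfolded number_field_def] assms(3,4)] by blast
  interpret normal_field f xs by (rule nf)
  have F: "subfield F R" using assms(3) by (simp add: finite_ext_def)
  obtain m where Ks: "subfield K R" "F \<subseteq> K" "R.dimension m F K" using assms(3) by (auto simp: finite_ext_def)
  obtain n where Ls: "subfield L R" "F \<subseteq> L" "R.dimension n F L" using assms(4) by (auto simp: finite_ext_def)
  have eF: "emb R F iK" "iK ` F \<subseteq> N" using emb_mono[OF iK(1) Ks(2)] iK(2) Ks(2) by auto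
  have iF': "iL x = iK x" if "x \<in> F" for x using iF that by simp
  have imF: "iL ` F = iK ` F" using iF' by simp
  let ?G = "fixing (iK ` F)"
  obtain \<alpha> where \<alpha>: "\<alpha> \<in> K" "algebraic_int (iK \<alpha>)"
      "\<And>g x. g \<in> ?G \<Longrightarrow> g (iK \<alpha>) = iK \<alpha> \<Longrightarrow> x \<in> K \<Longrightarrow> g (iK x) = iK x"
    using exists_primitive[OF R.emb_image_subfield[OF Ks(1) iK(1)] iK(2)] fixing_Gal by blast
  obtain \<beta> where \<beta>: "\<beta> \<in> L" "algebraic_int (iL \<beta>)"
      "\<And>g x. g \<in> ?G \<Longrightarrow> g (iL \<beta>) = iL \<beta> \<Longrightarrow> x \<in> L \<Longrightarrow> g (iL x) = iL x"
    using exists_primitive[OF R.emb_image_subfield[OF Ls(1) iL(1)] iL(2)] fixing_Gal by blast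
  have lg': "locally_gcd_equivalent R F L K" using assms(7) unfolding locally_gcd_equivalent_def by metis
  have "\<exists>x\<in>orbt ?G (iK \<alpha>). stb ?G x = stb ?G (iL \<beta>)"
  proof (rule exists_equal_stabilizers[OF fixing_perm_grp])
    show "card (orbt ?G (iK \<alpha>)) \<le> 5"
      using card_orbit_le_ext_degree[OF R F Ks(1,2) iK Ks(3) \<alpha>(1)] assms(5) by linarith
    show "card (orbt ?G (iL \<beta>)) \<le> 5"
      using card_orbit_le_ext_degree[OF R F Ls(1,2) iL Ls(3) \<beta>(1)] assms(6) unfolding imF by linarith
    fix l a \<sigma> assume l: "prime l" and s: "\<sigma> \<in> ?G" "\<sigma> ^^ (l ^ a) = id"
    show "(\<exists>x\<in>orbt ?G (iK \<alpha>). \<sigma> x = x) \<longleftrightarrow> (\<exists>y\<in>orbt ?G (iL \<beta>). \<sigma> y = y)"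
    proof
      assume "\<exists>y\<in>orbt ?G (iL \<beta>). \<sigma> y = y"
      then obtain y where y: "y \<in> orbt ?G (iL \<beta>)" "\<sigma> y = y" by blast
      show "\<exists>x\<in>orbt ?G (iK \<alpha>). \<sigma> x = x"
        \<comment> \<open>Both implications are the same transfer with \<open>K\<close> and
          \<open>L\<close> exchanged; \<open>F\<close> is embedded by \<open>iK\<close> each time,
          and \<open>iL\<close> agrees with it there.\<close>
        by (rule fixed_point_transfer[where iF = iK and iK = iK and iL = iL and \<alpha> = \<alpha> and \<beta> = \<beta>,
          OF R F eF Ks(1,2) iK _ Ls(1,2) iL iF' assms(7) \<alpha>(1,2) _ l s y])
          (rule refl | assumption | erule (2) \<beta>(3))+
    next
      assume "\<exists>y\<in>orbt ?G (iK \<alpha>). \<sigma> y = y"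
      then obtain y where y: "y \<in> orbt ?G (iK \<alpha>)" "\<sigma> y = y" by blast
      show "\<exists>x\<in>orbt ?G (iL \<beta>). \<sigma> x = x"
        by (rule fixed_point_transfer[where iF = iK and iK = iL and iL = iK and \<alpha> = \<beta> and \<beta> = \<alpha>,
          OF R F eF Ls(1,2) iL iF' Ks(1,2) iK _ lg' \<beta>(1,2) _ l s y])
          (rule refl | assumption | erule (2) \<alpha>(3))+
    qed
  qed
  then obtain x where x: "x \<in> orbt ?G (iK \<alpha>)" "stb ?G x = stb ?G (iL \<beta>)" by blast
  show ?thesis
    by (rule F_isomorphic_if_equal_stabilizers[where iF = iK and iK = iK and iL = iL and \<alpha> = \<alpha> and \<beta> = \<beta>,
        OF R Ks(1,2) iK _ Ls(1,2) iL iF' \<alpha>(1) _ \<beta>(1) _ x])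
      (rule refl | assumption | erule (2) \<alpha>(3) | erule (2) \<beta>(3))+
qed

end
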